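(* Let $\mathcal D_H$ be a left $H$-category, $M$ a right-left SAYD module over $H$ and $r\ge1$. (1) Applying the functor $Hom_H(-,k)$ to the inclusion maps $(inc_1,M)$, one obtains a morphism of Hochschild complexes $$C^{\bullet}_H(inc_1,M)^{hoc}:C^{\bullet}_H(\mathcal{D}_H \otimes M_r(k),M)^{hoc} \longrightarrow C^{\bullet}_H(\mathcal{D}_H,M)^{hoc}$$ as well as a morphism of double complexes computing cyclic cohomology $$C^{\bullet\bullet}_H(inc_1,M)^{cy}:C^{\bullet\bullet}_H(\mathcal{D}_H\otimes M_r(k),M)^{cy} \longrightarrow C_H^{\bullet\bullet}(\mathcal{D}_H ,M)^{cy}.$$ (2) Applying the functor $Hom_H(-,k)$ to the trace maps $tr^M$, one obtains a morphism of cocyclic modules $$C^\bullet_H(tr^M): C^\bullet_H(\mathcal{D}_H,M) \longrightarrow C^\bullet_H(\mathcal{D}_H \otimes M_r(k),M).$$ (3) The morphisms on Hochschild cohomology $$HC^{\bullet}_H(inc_1,M)^{hoc}:HC^{\bullet}_H(\mathcal{D}_H \otimes M_r(k),M)^{hoc} \longrightarrow HC^{\bullet}_H(\mathcal{D}_H,M)^{hoc},\qquad HC^{\bullet}_H(tr^M)^{hoc}:HC^{\bullet}_H(\mathcal{D}_H,M)^{hoc} \longrightarrow HC^{\bullet}_H(\mathcal{D}_H \otimes M_r(k),M)^{hoc}$$ induced by $C^{\bullet}_H(inc_1,M)^{hoc}$ and $C^{\bullet}_H(tr^M)^{hoc}$ are mutually inverse isomorphisms. (4) The induced maps on Hopf-cyclic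 cohomology $$HC^{\bullet}_H(tr^M):HC^\bullet_H(\mathcal{D}_H,M)\longrightarrow HC^\bullet_H(\mathcal{D}_H \otimes M_r(k),M),\qquad HC^{\bullet}_H(inc_1,M):HC^\bullet_H(\mathcal{D}_H \otimes M_r(k),M)\longrightarrow HC^\bullet_H(\mathcal{D}_H,M)$$ are mutually inverse isomorphisms.
   Context: $k$ is a field of characteristic zero; $H$ is a Hopf algebra over $k$ with coproduct $\Delta(h)=h_1\otimes h_2$, counit $\varepsilon$, bijective antipode $S$. A left $H$-category is a small $k$-linear category $\mathcal D_H$ with each $Hom_{\mathcal D_H}(X,Y)$ a left $H$-module, $h(id_X)=\varepsilon(h)id_X$, $h(gf)=(h_1g)(h_2f)$. A right-left SAYD module is a right $H$-module and left $H$-comodule $M$, $m\mapsto m_{(-1)}\otimes m_{(0)}$, with $(mh)_{(-1)}\otimes(mh)_{(0)}=S(h_3)m_{(-1)}h_1\otimes m_{(0)}h_2$ and $m_{(0)}m_{(-1)}=m$. $\mathcal D_H\otimes M_r(k)$ is the left $H$-category with the objects of $\mathcal D_H$, $Hom(X,Y)=Hom_{\mathcal D_H}(X,Y)\otimes M_r(k)$, componentwise composition, $h(f\otimes B)=hf\otimes B$. $CN_n(\mathcal D_H)=\bigoplus_{(X_0,\ldots,X_n)}Hom_{\mathcal D_H}(X_1,X_0)\otimes\ldots\otimes Hom_{\mathcal D_H}(X_0,X_n)$ with diagonal left $H$-action; $M\otimes CN_n(\mathcal D_H)$ is a right $H$-module by $(m\otimes f^0\otimes\ldots\otimes f^n)h=mh_1\otimes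 S(h_2)(f^0\otimes\ldots\otimes f^n)$, and $C^n_H(\mathcal D_H,M)=Hom_H(M\otimes CN_n(\mathcal D_H),k)$ with $k$ an $H$-module via $\varepsilon$. It is a cocyclic module with $(\delta_i\phi)(m\otimes f^0\otimes\ldots\otimes f^n)=\phi(m\otimes\ldots\otimes f^if^{i+1}\otimes\ldots\otimes f^n)$ for $0\le i\le n-1$, $(\delta_n\phi)(m\otimes f^0\otimes\ldots\otimes f^n)=\phi(m_{(0)}\otimes(S^{-1}(m_{(-1)})f^n)f^0\otimes f^1\otimes\ldots\otimes f^{n-1})$, $(\sigma_i\phi)$ = $\phi$ evaluated after inserting the identity ($id_{X_{i+1}}$ for $i<n$, $id_{X_0}$ for $i=n$) after $f^i$, $(\tau_n\phi)(m\otimes f^0\otimes\ldots\otimes f^n)=\phi(m_{(0)}\otimes S^{-1}(m_{(-1)})f^n\otimes f^0\otimes\ldots\otimes f^{n-1})$. $C^\bullet_H(\cdot,M)^{hoc}$ is the complex with differential $b=\sum_{i=0}^{n+1}(-1)^i\delta_i$; its cohomology is denoted $HC^\bullet_H(\cdot,M)^{hoc}$. $C^{\bullet\bullet}_H(\cdot,M)^{cy}$ is the standard cyclic bicomplex, with columns alternately $(C^\bullet_H,b)$ and $(C^\bullet_H,-b')$, $b'=\sum_{i=0}^{n}(-1)^i\delta_i$, and horizontal maps alternately $1-\lambda$ and $N=\sum_{j=0}^n\lambda^j$, $\lambda=(-1)^n\tau_n$; its total cohomology is the Hopf-cyclic cohomology $HC^\bullet_H(\cdot,M)$. $(inc_1,M):M\otimes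 CN_n(\mathcal D_H)\to M\otimes CN_n(\mathcal D_H\otimes M_r(k))$ is $m\otimes f^0\otimes\ldots\otimes f^n\mapsto m\otimes(f^0\otimes E_{11})\otimes\ldots\otimes(f^n\otimes E_{11})$, $E_{11}$ the elementary matrix; $tr^M:M\otimes CN_n(\mathcal D_H\otimes M_r(k))\to M\otimes CN_n(\mathcal D_H)$ is $m\otimes(f^0\otimes B^0)\otimes\ldots\otimes(f^n\otimes B^n)\mapsto(m\otimes f^0\otimes\ldots\otimes f^n)\,\mathrm{trace}(B^0\cdots B^n)$. The maps on cochains are $\phi\mapsto\phi\circ(inc_1,M)$ and $\phi\mapsto\phi\circ tr^M$. *)

theory Defs
  imports "HOL-Analysis.Determinants" "HOL-Library.Function_Algebras"
begin

section \<open>Linear algebra and tensor products over a field\<close>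

text \<open>A vector space is a subspace of a type carrying a scalar multiplication that satisfies
  \<^const>\<open>vector_space\<close>; addition is the one of the type. Types of functions are added
  pointwise (\<^theory>\<open>HOL-Library.Function_Algebras\<close>) and scaled pointwise by \<open>fscale\<close>.\<close>

definition fscale :: "'k::field \<Rightarrow> ('x \<Rightarrow> 'k) \<Rightarrow> 'x \<Rightarrow> 'k" where
  "fscale c f = (\<lambda>x. c * f x)"

definition lin_on ::
  "('k::field \<Rightarrow> 'v::ab_group_add \<Rightarrow> 'v) \<Rightarrow> 'v set \<Rightarrow> ('k \<Rightarrow> 'w::ab_group_add \<Rightarrow> 'w) \<Rightarrow> 'w set \<Rightarrow> ('v \<Rightarrow> 'w) \<Rightarrow> bool" where
  "lin_on s1 V s2 W f \<longleftrightarrow>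
     (\<forall>x\<in>V. f x \<in> W) \<and>
     (\<forall>x\<in>V. \<forall>y\<in>V. f (x + y) = f x + f y) \<and>
     (\<forall>c. \<forall>x\<in>V. f (s1 c x) = s2 c (f x))"

definition bilin_on ::
  "('k::field \<Rightarrow> 'v::ab_group_add \<Rightarrow> 'v) \<Rightarrow> 'v set \<Rightarrow> ('k \<Rightarrow> 'w::ab_group_add \<Rightarrow> 'w) \<Rightarrow> 'w set \<Rightarrow>
   ('k \<Rightarrow> 'u::ab_group_add \<Rightarrow> 'u) \<Rightarrow> 'u set \<Rightarrow> ('v \<Rightarrow> 'w \<Rightarrow> 'u) \<Rightarrow> bool" where
  "bilin_on s1 V s2 W s3 U f \<longleftrightarrow>
     (\<forall>v\<in>V. lin_on s2 W s3 U (f v)) \<and> (\<forall>w\<in>W. lin_on s1 V s3 U (\<lambda>v. f v w))"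

text \<open>
  Tensor products are realised as spaces of functionals. The data are a pair \<open>P\<close> consisting of
  the set of admissible tuples (such as \<open>V \<times> W\<close>) and the set of multilinear forms on these tuples.
  The pure tensor of a tuple is the functional evaluating a multilinear form at that tuple, and
  the tensor product consists of the finite sums of pure tensors. As the ground ring is a field,
  multilinear forms separate tensors, so this is the usual tensor product; the universal
  properties are the theorems \<open>tensor_lift_pure_bi\<close>, \<open>tensor_lift_lin_bi\<close>, \<open>tensor_lift_pure_CN\<close>
  and \<open>tensor_lift_lin_CN\<close> below.
\<close>

type_synonym ('x, 'k) multi = "'x set \<times> ('x \<Rightarrow> 'k) set"
type_synonym ('x, 'k) tensor = "('x \<Rightarrow> 'k) \<Rightarrow> 'k"

definition pure :: "('x, 'k::field) multi \<Rightarrow> 'x \<Rightarrow> ('x, 'k) tensor" where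
  "pure P x = (\<lambda>\<beta>. if \<beta> \<in> snd P then \<beta> x else 0)"

definition tensor_space :: "('x, 'k::field) multi \<Rightarrow> ('x, 'k) tensor set" where
  "tensor_space P = {\<Sum>x\<leftarrow>ps. pure P x | ps. set ps \<subseteq> fst P}"

text \<open>\<open>tensor_lift P f t = \<Sum>\<^sub>i f x\<^sub>i\<close> where \<open>t = \<Sum>\<^sub>i pure P x\<^sub>i\<close>: the linear extension of
  \<open>f\<close> from pure tensors. For multilinear \<open>f\<close> it does not depend on the chosen representation.\<close>

definition tensor_lift :: "('x, 'k::field) multi \<Rightarrow> ('x \<Rightarrow> 'u::ab_group_add) \<Rightarrow> ('x, 'k) tensor \<Rightarrow> 'u" where
  "tensor_lift P f t = (\<Sum>x\<leftarrow>(SOME ps. set ps \<subseteq> fst P \<and> t = (\<Sum>x\<leftarrow>ps. pure P x)). f x)"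

text \<open>Simultaneous linear extension in several tensors \<open>t\<^sub>0, t\<^sub>1, \<dots>\<close>.\<close>

fun tensor_lifts ::
  "('x, 'k::field) multi list \<Rightarrow> ('x list \<Rightarrow> 'u::ab_group_add) \<Rightarrow> ('x, 'k) tensor list \<Rightarrow> 'u" where
  "tensor_lifts (P # Ps) F (t # ts) = tensor_lift P (\<lambda>x. tensor_lifts Ps (\<lambda>xs. F (x # xs)) ts) t"
| "tensor_lifts _ F _ = F []"

definition bi ::
  "('k::field \<Rightarrow> 'v::ab_group_add \<Rightarrow> 'v) \<Rightarrow> 'v set \<Rightarrow> ('k \<Rightarrow> 'w::ab_group_add \<Rightarrow> 'w) \<Rightarrow> 'w set \<Rightarrow> ('v \<times> 'w, 'k) multi" where
  "bi s1 V s2 W = (V \<times> W, {\<beta>. bilin_on s1 V s2 W (*) UNIV (\<lambda>v w. \<beta> (v, w))})"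


section \<open>Hopf algebras and stable anti-Yetter-Drinfeld modules\<close>

record ('k, 'h) hopf =
  hscale :: "'k \<Rightarrow> 'h \<Rightarrow> 'h"
  coprod :: "'h \<Rightarrow> ('h \<times> 'h, 'k) tensor"
  counit :: "'h \<Rightarrow> 'k"
  antip  :: "'h \<Rightarrow> 'h"

definition HH :: "('k::field, 'h::ring_1) hopf \<Rightarrow> ('h \<times> 'h, 'k) multi" where
  "HH H = bi (hscale H) UNIV (hscale H) UNIV"

definition HHH :: "('k::field, 'h::ring_1) hopf \<Rightarrow> ('h \<times> ('h \<times> 'h, 'k) tensor, 'k) multi" where
  "HHH H = bi (hscale H) UNIV fscale (tensor_space (HH H))"

text \<open>\<open>sweedler H n h F\<close> is Sweedler's \<open>F [h\<^sub>1, \<dots>, h\<^sub>n\<^sub>+\<^sub>1]\<close>, extended linearly.\<close>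

fun sweedler :: "('k::field, 'h::ring_1) hopf \<Rightarrow> nat \<Rightarrow> 'h \<Rightarrow> ('h list \<Rightarrow> 'u::ab_group_add) \<Rightarrow> 'u" where
  "sweedler H 0 h F = F [h]"
| "sweedler H (Suc n) h F =
     tensor_lift (HH H) (\<lambda>(a, b). sweedler H n b (\<lambda>hs. F (a # hs))) (coprod H h)"

definition hopf_algebra :: "('k::field, 'h::ring_1) hopf \<Rightarrow> bool" where
  "hopf_algebra H \<longleftrightarrow>
     vector_space (hscale H) \<and>
     bilin_on (hscale H) UNIV (hscale H) UNIV (hscale H) UNIV (*) \<and>
     lin_on (hscale H) UNIV fscale (tensor_space (HH H)) (coprod H) \<and>
     lin_on (hscale H) UNIV (*) UNIV (counit H) \<and>
     lin_on (hscale H) UNIV (hscale H) UNIV (antip H) \<and>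
     (\<forall>h. tensor_lift (HH H) (\<lambda>(a, b). tensor_lift (HH H) (\<lambda>(a1, a2).
             pure (HHH H) (a1, pure (HH H) (a2, b))) (coprod H a)) (coprod H h) =
          tensor_lift (HH H) (\<lambda>(a, b). pure (HHH H) (a, coprod H b)) (coprod H h)) \<and>
     (\<forall>h. sweedler H 1 h (\<lambda>hs. hscale H (counit H (hs ! 0)) (hs ! 1)) = h) \<and>
     (\<forall>h. sweedler H 1 h (\<lambda>hs. hscale H (counit H (hs ! 1)) (hs ! 0)) = h) \<and>
     coprod H 1 = pure (HH H) (1, 1) \<and>
     (\<forall>g h. coprod H (g * h) =
        sweedler H 1 g (\<lambda>gs. sweedler H 1 h (\<lambda>hs. pure (HH H) (gs ! 0 * hs ! 0, gs ! 1 * hs ! 1)))) \<and>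
     counit H 1 = 1 \<and>
     (\<forall>g h. counit H (g * h) = counit H g * counit H h) \<and>
     (\<forall>h. sweedler H 1 h (\<lambda>hs. antip H (hs ! 0) * hs ! 1) = hscale H (counit H h) 1) \<and>
     (\<forall>h. sweedler H 1 h (\<lambda>hs. hs ! 0 * antip H (hs ! 1)) = hscale H (counit H h) 1) \<and>
     bij (antip H)"

record ('k, 'h, 'm) hmodcomod =
  mscale :: "'k \<Rightarrow> 'm \<Rightarrow> 'm"
  ract   :: "'m \<Rightarrow> 'h \<Rightarrow> 'm"
  coact  :: "'m \<Rightarrow> ('h \<times> 'm, 'k) tensor"

definition HM :: "('k::field, 'h::ring_1) hopf \<Rightarrow> ('k, 'h, 'm::ab_group_add) hmodcomod \<Rightarrow> ('h \<times> 'm, 'k) multi" where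
  "HM H M = bi (hscale H) UNIV (mscale M) UNIV"

definition HHM :: "('k::field, 'h::ring_1) hopf \<Rightarrow> ('k, 'h, 'm::ab_group_add) hmodcomod \<Rightarrow>
    ('h \<times> ('h \<times> 'm, 'k) tensor, 'k) multi" where
  "HHM H M = bi (hscale H) UNIV fscale (tensor_space (HM H M))"

definition SAYD_module :: "('k::field, 'h::ring_1) hopf \<Rightarrow> ('k, 'h, 'm::ab_group_add) hmodcomod \<Rightarrow> bool" where
  "SAYD_module H M \<longleftrightarrow>
     vector_space (mscale M) \<and>
     bilin_on (mscale M) UNIV (hscale H) UNIV (mscale M) UNIV (ract M) \<and>
     (\<forall>m. ract M m 1 = m) \<and>
     (\<forall>m g h. ract M m (g * h) = ract M (ract M m g) h) \<and>
     lin_on (mscale M) UNIV fscale (tensor_space (HM H M)) (coact M) \<and>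
     (\<forall>m. tensor_lift (HM H M) (\<lambda>(a, x). sweedler H 1 a (\<lambda>hs.
             pure (HHM H M) (hs ! 0, pure (HM H M) (hs ! 1, x)))) (coact M m) =
          tensor_lift (HM H M) (\<lambda>(a, x). pure (HHM H M) (a, coact M x)) (coact M m)) \<and>
     (\<forall>m. tensor_lift (HM H M) (\<lambda>(a, x). mscale M (counit H a) x) (coact M m) = m) \<and>
     (\<forall>m h. coact M (ract M m h) =
        sweedler H 2 h (\<lambda>hs. tensor_lift (HM H M)
          (\<lambda>(a, x). pure (HM H M) (antip H (hs ! 2) * a * hs ! 0, ract M x (hs ! 1))) (coact M m))) \<and>
     (\<forall>m. tensor_lift (HM H M) (\<lambda>(a, x). ract M x a) (coact M m) = m)"


section \<open>Left $H$-categories and matrices over them\<close>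

text \<open>The hom-spaces are subspaces of one ambient vector space, which is no restriction: embed
  them into their product. They need not be disjoint, so composition \<open>cmp D X Y Z g f\<close> (with
  \<open>f : X \<rightarrow> Y\<close> and \<open>g : Y \<rightarrow> Z\<close>) and the action \<open>lact D X Y h f\<close> depend on the objects.\<close>

record ('k, 'h, 'o, 'a) hcat =
  Obj    :: "'o set"
  Hom    :: "'o \<Rightarrow> 'o \<Rightarrow> 'a set"
  cscale :: "'k \<Rightarrow> 'a \<Rightarrow> 'a"
  cmp   :: "'o \<Rightarrow> 'o \<Rightarrow> 'o \<Rightarrow> 'a \<Rightarrow> 'a \<Rightarrow> 'a"
  ident  :: "'o \<Rightarrow> 'a"
  lact   :: "'o \<Rightarrow> 'o \<Rightarrow> 'h \<Rightarrow> 'a \<Rightarrow> 'a"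

definition H_category :: "('k::field, 'h::ring_1) hopf \<Rightarrow> ('k, 'h, 'o, 'a::ab_group_add) hcat \<Rightarrow> bool" where
  "H_category H D \<longleftrightarrow>
     vector_space (cscale D) \<and>
     (\<forall>X\<in>Obj D. \<forall>Y\<in>Obj D. module.subspace (cscale D) (Hom D X Y)) \<and>
     (\<forall>X\<in>Obj D. \<forall>Y\<in>Obj D. \<forall>Z\<in>Obj D.
        bilin_on (cscale D) (Hom D Y Z) (cscale D) (Hom D X Y) (cscale D) (Hom D X Z) (cmp D X Y Z)) \<and>
     (\<forall>W\<in>Obj D. \<forall>X\<in>Obj D. \<forall>Y\<in>Obj D. \<forall>Z\<in>Obj D.
        \<forall>f\<in>Hom D W X. \<forall>g\<in>Hom D X Y. \<forall>k\<in>Hom D Y Z.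
          cmp D W X Z (cmp D X Y Z k g) f = cmp D W Y Z k (cmp D W X Y g f)) \<and>
     (\<forall>X\<in>Obj D. ident D X \<in> Hom D X X) \<and>
     (\<forall>X\<in>Obj D. \<forall>Y\<in>Obj D. \<forall>f\<in>Hom D X Y.
        cmp D X X Y f (ident D X) = f \<and> cmp D X Y Y (ident D Y) f = f) \<and>
     (\<forall>X\<in>Obj D. \<forall>Y\<in>Obj D.
        bilin_on (hscale H) UNIV (cscale D) (Hom D X Y) (cscale D) (Hom D X Y) (lact D X Y) \<and>
        (\<forall>f\<in>Hom D X Y. lact D X Y 1 f = f \<and>
           (\<forall>g h. lact D X Y (g * h) f = lact D X Y g (lact D X Y h f)))) \<and>
     (\<forall>X\<in>Obj D. \<forall>h. lact D X X h (ident D X) = cscale D (counit H h) (ident D X)) \<and>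
     (\<forall>X\<in>Obj D. \<forall>Y\<in>Obj D. \<forall>Z\<in>Obj D. \<forall>f\<in>Hom D X Y. \<forall>g\<in>Hom D Y Z. \<forall>h.
        lact D X Z h (cmp D X Y Z g f) =
        sweedler H 1 h (\<lambda>hs. cmp D X Y Z (lact D Y Z (hs ! 0) g) (lact D X Y (hs ! 1) f)))"

definition mat_scale :: "'k::field \<Rightarrow> 'k ^ 'r ^ 'r \<Rightarrow> 'k ^ 'r ^ 'r" where
  "mat_scale c B = (\<chi> i j. c * B $ i $ j)"

definition elem_mat :: "'r::finite \<Rightarrow> 'r \<Rightarrow> 'k::field ^ 'r ^ 'r" where
  "elem_mat p q = (\<chi> i j. if i = p \<and> j = q then 1 else 0)"

text \<open>\<open>Hom D X Y \<otimes> M\<^sub>r(k)\<close>, where \<open>r\<close> is the cardinality of the finite index type \<open>'r\<close>.\<close>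

definition HomMat ::
  "('k::field, 'h, 'o, 'a::ab_group_add) hcat \<Rightarrow> 'o \<Rightarrow> 'o \<Rightarrow> ('a \<times> ('k ^ 'r::finite ^ 'r), 'k) multi" where
  "HomMat D X Y = bi (cscale D) (Hom D X Y) mat_scale UNIV"

definition mat_cat ::
  "'r::finite itself \<Rightarrow> ('k::field, 'h, 'o, 'a::ab_group_add) hcat \<Rightarrow> ('k, 'h, 'o, ('a \<times> ('k ^ 'r ^ 'r), 'k) tensor) hcat" where
  "mat_cat _ D =
    \<lparr> Obj = Obj D,
      Hom = (\<lambda>X Y. tensor_space (HomMat D X Y)),
      cscale = fscale,
      cmp = (\<lambda>X Y Z s t. tensor_lift (HomMat D Y Z) (\<lambda>(g, B). tensor_lift (HomMat D X Y) (\<lambda>(f, C).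
                pure (HomMat D X Z) (cmp D X Y Z g f, B ** C)) t) s),
      ident = (\<lambda>X. pure (HomMat D X X) (ident D X, mat 1)),
      lact = (\<lambda>X Y h. tensor_lift (HomMat D X Y) (\<lambda>(f, B). pure (HomMat D X Y) (lact D X Y h f, B))) \<rparr>"


section \<open>The modules $M \otimes CN_n$ and their chains\<close>

text \<open>A generator of \<open>CN\<^sub>n\<close> is a pair of lists \<open>[X\<^sub>0,\<dots>,X\<^sub>n]\<close>, \<open>[f\<^sup>0,\<dots>,f\<^sup>n]\<close> with
  \<open>f\<^sup>i : X\<^sub>i\<^sub>+\<^sub>1 \<rightarrow> X\<^sub>i\<close>, indices of objects being taken modulo \<open>n + 1\<close>. A form on \<open>CN\<^sub>n\<close> is a family,
  indexed by \<open>(X\<^sub>0,\<dots>,X\<^sub>n)\<close>, of multilinear forms, so that distinct lists of objects give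
  distinct direct summands.\<close>

definition src :: "'o list \<Rightarrow> nat \<Rightarrow> 'o" where "src xs i = xs ! (Suc i mod length xs)"
definition tgt :: "'o list \<Rightarrow> nat \<Rightarrow> 'o" where "tgt xs i = xs ! (i mod length xs)"

definition cyclic_words :: "('k, 'h, 'o, 'a) hcat \<Rightarrow> nat \<Rightarrow> ('o list \<times> 'a list) set" where
  "cyclic_words D n = {(xs, fs). length xs = Suc n \<and> length fs = Suc n \<and> set xs \<subseteq> Obj D \<and>
     (\<forall>i\<le>n. fs ! i \<in> Hom D (src xs i) (tgt xs i))}"

definition CN :: "('k::field, 'h, 'o, 'a::ab_group_add) hcat \<Rightarrow> nat \<Rightarrow> ('o list \<times> 'a list, 'k) multi" where
  "CN D n = (cyclic_words D n,
     {\<beta>. \<forall>(xs, fs)\<in>cyclic_words D n. \<forall>i\<le>n.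
        lin_on (cscale D) (Hom D (src xs i) (tgt xs i)) (*) UNIV (\<lambda>g. \<beta> (xs, fs[i := g]))})"

text \<open>The diagonal left action \<open>h(f\<^sup>0\<otimes>\<dots>\<otimes>f\<^sup>n) = h\<^sub>1f\<^sup>0\<otimes>\<dots>\<otimes>h\<^sub>n\<^sub>+\<^sub>1f\<^sup>n\<close>.\<close>

definition CN_act :: "('k::field, 'h::ring_1) hopf \<Rightarrow> ('k, 'h, 'o, 'a::ab_group_add) hcat \<Rightarrow> nat \<Rightarrow>
    'h \<Rightarrow> ('o list \<times> 'a list, 'k) tensor \<Rightarrow> ('o list \<times> 'a list, 'k) tensor" where
  "CN_act H D n h = tensor_lift (CN D n) (\<lambda>(xs, fs). sweedler H n h (\<lambda>hs.
     pure (CN D n) (xs, map (\<lambda>i. lact D (src xs i) (tgt xs i) (hs ! i) (fs ! i)) [0..<Suc n])))"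

definition MCN :: "('k::field, 'h, 'm::ab_group_add) hmodcomod \<Rightarrow> ('k, 'h, 'o, 'a::ab_group_add) hcat \<Rightarrow> nat \<Rightarrow>
    ('m \<times> ('o list \<times> 'a list, 'k) tensor, 'k) multi" where
  "MCN M D n = bi (mscale M) UNIV fscale (tensor_space (CN D n))"

type_synonym ('k, 'm, 'o, 'a) chain = "('m \<times> ('o list \<times> 'a list, 'k) tensor, 'k) tensor"

definition mword :: "('k::field, 'h, 'm::ab_group_add) hmodcomod \<Rightarrow> ('k, 'h, 'o, 'a::ab_group_add) hcat \<Rightarrow> nat \<Rightarrow>
    'm \<Rightarrow> 'o list \<Rightarrow> 'a list \<Rightarrow> ('k, 'm, 'o, 'a) chain" where
  "mword M D n m xs fs = pure (MCN M D n) (m, pure (CN D n) (xs, fs))"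

text \<open>\<open>chain_lift M D n F\<close> is the linear map on \<open>M \<otimes> CN\<^sub>n\<close> with
  \<open>m \<otimes> f\<^sup>0 \<otimes> \<dots> \<otimes> f\<^sup>n \<mapsto> F m [X\<^sub>0,\<dots>,X\<^sub>n] [f\<^sup>0,\<dots>,f\<^sup>n]\<close>.\<close>

definition chain_lift :: "('k::field, 'h, 'm::ab_group_add) hmodcomod \<Rightarrow> ('k, 'h, 'o, 'a::ab_group_add) hcat \<Rightarrow> nat \<Rightarrow>
    ('m \<Rightarrow> 'o list \<Rightarrow> 'a list \<Rightarrow> 'u::ab_group_add) \<Rightarrow> ('k, 'm, 'o, 'a) chain \<Rightarrow> 'u" where
  "chain_lift M D n F = tensor_lift (MCN M D n) (\<lambda>(m, c). tensor_lift (CN D n) (\<lambda>(xs, fs). F m xs fs) c)"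

definition MCN_act :: "('k::field, 'h::ring_1) hopf \<Rightarrow> ('k, 'h, 'm::ab_group_add) hmodcomod \<Rightarrow>
    ('k, 'h, 'o, 'a::ab_group_add) hcat \<Rightarrow> nat \<Rightarrow> ('k, 'm, 'o, 'a) chain \<Rightarrow> 'h \<Rightarrow> ('k, 'm, 'o, 'a) chain" where
  "MCN_act H M D n t h = tensor_lift (MCN M D n) (\<lambda>(m, c). sweedler H 1 h (\<lambda>hs.
     pure (MCN M D n) (ract M m (hs ! 0), CN_act H D n (antip H (hs ! 1)) c))) t"

definition inc_chain :: "('k::field, 'h, 'm::ab_group_add) hmodcomod \<Rightarrow> ('k, 'h, 'o, 'a::ab_group_add) hcat \<Rightarrow>
    'r::finite \<Rightarrow> nat \<Rightarrow> ('k, 'm, 'o, 'a) chain \<Rightarrow> ('k, 'm, 'o, ('a \<times> ('k ^ 'r ^ 'r), 'k) tensor) chain" where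
  "inc_chain M D e n = chain_lift M D n (\<lambda>m xs fs. mword M (mat_cat TYPE('r) D) n m xs
     (map (\<lambda>i. pure (HomMat D (src xs i) (tgt xs i)) (fs ! i, elem_mat e e)) [0..<Suc n]))"

definition tr_chain :: "('k::field, 'h, 'm::ab_group_add) hmodcomod \<Rightarrow> ('k, 'h, 'o, 'a::ab_group_add) hcat \<Rightarrow>
    nat \<Rightarrow> ('k, 'm, 'o, ('a \<times> ('k ^ 'r::finite ^ 'r), 'k) tensor) chain \<Rightarrow> ('k, 'm, 'o, 'a) chain" where
  "tr_chain M D n = chain_lift M (mat_cat TYPE('r) D) n (\<lambda>m xs ts.
     tensor_lifts (map (\<lambda>i. HomMat D (src xs i) (tgt xs i)) [0..<Suc n])
       (\<lambda>ps. fscale (trace (foldr (**) (map snd ps) (mat 1))) (mword M D n m xs (map fst ps))) ts)"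

definition right_H_hom :: "('k::field, 'h::ring_1) hopf \<Rightarrow> ('k, 'h, 'm::ab_group_add) hmodcomod \<Rightarrow>
    ('k, 'h, 'o, 'a::ab_group_add) hcat \<Rightarrow> ('k, 'h, 'p, 'b::ab_group_add) hcat \<Rightarrow> nat \<Rightarrow>
    (('k, 'm, 'o, 'a) chain \<Rightarrow> ('k, 'm, 'p, 'b) chain) \<Rightarrow> bool" where
  "right_H_hom H M D D' n f \<longleftrightarrow>
     lin_on fscale (tensor_space (MCN M D n)) fscale (tensor_space (MCN M D' n)) f \<and>
     (\<forall>t\<in>tensor_space (MCN M D n). \<forall>h. f (MCN_act H M D n t h) = MCN_act H M D' n (f t) h)"


section \<open>The cocyclic module\<close>

text \<open>Functionals on \<open>M \<otimes> CN\<^sub>n\<close> are extended by 0 to the whole type, so that equality of cochains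
  is equality of functions.\<close>

definition off_zero :: "'t set \<Rightarrow> ('t \<Rightarrow> 'k::zero) \<Rightarrow> 't \<Rightarrow> 'k" where
  "off_zero T \<phi> = (\<lambda>t. if t \<in> T then \<phi> t else 0)"

definition cochains :: "('k::field, 'h::ring_1) hopf \<Rightarrow> ('k, 'h, 'm::ab_group_add) hmodcomod \<Rightarrow>
    ('k, 'h, 'o, 'a::ab_group_add) hcat \<Rightarrow> nat \<Rightarrow> (('k, 'm, 'o, 'a) chain \<Rightarrow> 'k) set" where
  "cochains H M D n = {\<phi>.
     lin_on fscale (tensor_space (MCN M D n)) (*) UNIV \<phi> \<and>
     (\<forall>t. t \<notin> tensor_space (MCN M D n) \<longrightarrow> \<phi> t = 0) \<and>
     (\<forall>t\<in>tensor_space (MCN M D n). \<forall>h. \<phi> (MCN_act H M D n t h) = counit H h * \<phi> t)}"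

definition HomH :: "('k::field, 'h, 'm::ab_group_add) hmodcomod \<Rightarrow> ('k, 'h, 'o, 'a::ab_group_add) hcat \<Rightarrow> nat \<Rightarrow>
    (('k, 'm, 'o, 'a) chain \<Rightarrow> 't) \<Rightarrow> ('t \<Rightarrow> 'k) \<Rightarrow> ('k, 'm, 'o, 'a) chain \<Rightarrow> 'k" where
  "HomH M D n g \<phi> = off_zero (tensor_space (MCN M D n)) (\<lambda>t. \<phi> (g t))"

definition inc_cochain :: "('k::field, 'h, 'm::ab_group_add) hmodcomod \<Rightarrow> ('k, 'h, 'o, 'a::ab_group_add) hcat \<Rightarrow>
    'r::finite \<Rightarrow> nat \<Rightarrow> (('k, 'm, 'o, ('a \<times> ('k ^ 'r ^ 'r), 'k) tensor) chain \<Rightarrow> 'k) \<Rightarrow>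
    ('k, 'm, 'o, 'a) chain \<Rightarrow> 'k" where
  "inc_cochain M D e n = HomH M D n (inc_chain M D e n)"

definition tr_cochain :: "('k::field, 'h, 'm::ab_group_add) hmodcomod \<Rightarrow> ('k, 'h, 'o, 'a::ab_group_add) hcat \<Rightarrow>
    nat \<Rightarrow> (('k, 'm, 'o, 'a) chain \<Rightarrow> 'k) \<Rightarrow>
    ('k, 'm, 'o, ('a \<times> ('k ^ 'r::finite ^ 'r), 'k) tensor) chain \<Rightarrow> 'k" where
  "tr_cochain M D n = HomH M (mat_cat TYPE('r) D) n (tr_chain M D n)"

definition coface :: "('k::field, 'h::ring_1) hopf \<Rightarrow> ('k, 'h, 'm::ab_group_add) hmodcomod \<Rightarrow>
    ('k, 'h, 'o, 'a::ab_group_add) hcat \<Rightarrow> nat \<Rightarrow> nat \<Rightarrow> (('k, 'm, 'o, 'a) chain \<Rightarrow> 'k) \<Rightarrow> ('k, 'm, 'o, 'a) chain \<Rightarrow> 'k" where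
  "coface H M D n i \<phi> = off_zero (tensor_space (MCN M D (Suc n))) (chain_lift M D (Suc n) (\<lambda>m xs fs.
     if i \<le> n then
       \<phi> (mword M D n m (take (Suc i) xs @ drop (i + 2) xs)
            (take i fs @ [cmp D (src xs (Suc i)) (src xs i) (tgt xs i) (fs ! i) (fs ! Suc i)] @ drop (i + 2) fs))
     else
       tensor_lift (HM H M) (\<lambda>(a, x). \<phi> (mword M D n x (xs ! Suc n # take n (tl xs))
          (cmp D (src xs 0) (xs ! 0) (xs ! Suc n)
             (lact D (xs ! 0) (xs ! Suc n) (inv (antip H) a) (fs ! Suc n)) (fs ! 0) # take n (tl fs)))) (coact M m)))"

definition codegen :: "('k::field, 'h, 'm::ab_group_add) hmodcomod \<Rightarrow> ('k, 'h, 'o, 'a::ab_group_add) hcat \<Rightarrow>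
    nat \<Rightarrow> nat \<Rightarrow> (('k, 'm, 'o, 'a) chain \<Rightarrow> 'k) \<Rightarrow> ('k, 'm, 'o, 'a) chain \<Rightarrow> 'k" where
  "codegen M D n i \<phi> = off_zero (tensor_space (MCN M D n)) (chain_lift M D n (\<lambda>m xs fs.
     \<phi> (mword M D (Suc n) m (take (Suc i) xs @ [src xs i] @ drop (Suc i) xs)
          (take (Suc i) fs @ [ident D (src xs i)] @ drop (Suc i) fs))))"

definition cocyc :: "('k::field, 'h::ring_1) hopf \<Rightarrow> ('k, 'h, 'm::ab_group_add) hmodcomod \<Rightarrow>
    ('k, 'h, 'o, 'a::ab_group_add) hcat \<Rightarrow> nat \<Rightarrow> (('k, 'm, 'o, 'a) chain \<Rightarrow> 'k) \<Rightarrow> ('k, 'm, 'o, 'a) chain \<Rightarrow> 'k" where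
  "cocyc H M D n \<phi> = off_zero (tensor_space (MCN M D n)) (chain_lift M D n (\<lambda>m xs fs.
     tensor_lift (HM H M) (\<lambda>(a, x). \<phi> (mword M D n x (xs ! n # take n xs)
        (lact D (xs ! 0) (xs ! n) (inv (antip H) a) (fs ! n) # take n fs))) (coact M m)))"

text \<open>\<open>cface C n i : C\<^sup>n \<rightarrow> C\<^sup>n\<^sup>+\<^sup>1\<close>, \<open>cdegen C n i : C\<^sup>n\<^sup>+\<^sup>1 \<rightarrow> C\<^sup>n\<close> and \<open>ccyc C n : C\<^sup>n \<rightarrow> C\<^sup>n\<close>.\<close>

record ('k, 'c) cocyclic =
  Cob :: "nat \<Rightarrow> 'c set"
  scl :: "'k \<Rightarrow> 'c \<Rightarrow> 'c"
  cface :: "nat \<Rightarrow> nat \<Rightarrow> 'c \<Rightarrow> 'c"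
  cdegen :: "nat \<Rightarrow> nat \<Rightarrow> 'c \<Rightarrow> 'c"
  ccyc :: "nat \<Rightarrow> 'c \<Rightarrow> 'c"

definition C_H :: "('k::field, 'h::ring_1) hopf \<Rightarrow> ('k, 'h, 'm::ab_group_add) hmodcomod \<Rightarrow>
    ('k, 'h, 'o, 'a::ab_group_add) hcat \<Rightarrow> ('k, ('k, 'm, 'o, 'a) chain \<Rightarrow> 'k) cocyclic" where
  "C_H H M D = \<lparr> Cob = cochains H M D, scl = fscale,
     cface = coface H M D, cdegen = codegen M D, ccyc = cocyc H M D \<rparr>"

definition cocyclic_module :: "('k::field, 'c::ab_group_add) cocyclic \<Rightarrow> bool" where
  "cocyclic_module C \<longleftrightarrow>
     vector_space (scl C) \<and>
     (\<forall>n. module.subspace (scl C) (Cob C n)) \<and>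
     (\<forall>n. \<forall>i\<le>Suc n. lin_on (scl C) (Cob C n) (scl C) (Cob C (Suc n)) (cface C n i)) \<and>
     (\<forall>n. \<forall>i\<le>n. lin_on (scl C) (Cob C (Suc n)) (scl C) (Cob C n) (cdegen C n i)) \<and>
     (\<forall>n. lin_on (scl C) (Cob C n) (scl C) (Cob C n) (ccyc C n)) \<and>
     (\<forall>n. \<forall>x\<in>Cob C n. \<forall>j\<le>n + 2. \<forall>i<j. cface C (Suc n) j (cface C n i x) = cface C (Suc n) i (cface C n (j - 1) x)) \<and>
     (\<forall>n. \<forall>x\<in>Cob C (n + 2). \<forall>j\<le>n. \<forall>i\<le>j. cdegen C n j (cdegen C (Suc n) i x) = cdegen C n i (cdegen C (Suc n) (Suc j) x)) \<and>
     (\<forall>n. \<forall>x\<in>Cob C n. \<forall>j\<le>n. cdegen C n j (cface C n j x) = x \<and> cdegen C n j (cface C n (Suc j) x) = x) \<and>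
     (\<forall>n. \<forall>x\<in>Cob C (Suc n). \<forall>j\<le>Suc n. \<forall>i\<le>n + 2.
        (i < j \<longrightarrow> cdegen C (Suc n) j (cface C (Suc n) i x) = cface C n i (cdegen C n (j - 1) x)) \<and>
        (Suc j < i \<longrightarrow> cdegen C (Suc n) j (cface C (Suc n) i x) = cface C n (i - 1) (cdegen C n j x))) \<and>
     (\<forall>n. \<forall>x\<in>Cob C n. \<forall>i\<in>{1..Suc n}. ccyc C (Suc n) (cface C n i x) = cface C n (i - 1) (ccyc C n x)) \<and>
     (\<forall>n. \<forall>x\<in>Cob C n. ccyc C (Suc n) (cface C n 0 x) = cface C n (Suc n) x) \<and>
     (\<forall>n. \<forall>x\<in>Cob C (Suc n). \<forall>i\<in>{1..n}. ccyc C n (cdegen C n i x) = cdegen C n (i - 1) (ccyc C (Suc n) x)) \<and>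
     (\<forall>n. \<forall>x\<in>Cob C (Suc n). ccyc C n (cdegen C n 0 x) = cdegen C n n (ccyc C (Suc n) (ccyc C (Suc n) x))) \<and>
     (\<forall>n. \<forall>x\<in>Cob C n. (ccyc C n ^^ Suc n) x = x)"

definition cocyclic_morphism ::
  "('k::field, 'c::ab_group_add) cocyclic \<Rightarrow> ('k, 'd::ab_group_add) cocyclic \<Rightarrow> (nat \<Rightarrow> 'c \<Rightarrow> 'd) \<Rightarrow> bool" where
  "cocyclic_morphism C C' f \<longleftrightarrow>
     cocyclic_module C \<and> cocyclic_module C' \<and>
     (\<forall>n. lin_on (scl C) (Cob C n) (scl C') (Cob C' n) (f n)) \<and>
     (\<forall>n. \<forall>x\<in>Cob C n. \<forall>i\<le>Suc n. f (Suc n) (cface C n i x) = cface C' n i (f n x)) \<and>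
     (\<forall>n. \<forall>x\<in>Cob C (Suc n). \<forall>i\<le>n. f n (cdegen C n i x) = cdegen C' n i (f (Suc n) x)) \<and>
     (\<forall>n. \<forall>x\<in>Cob C n. f n (ccyc C n x) = ccyc C' n (f n x))"


section \<open>Complexes, bicomplexes and cohomology\<close>

record ('k, 'c) cpx =
  cob   :: "nat \<Rightarrow> 'c set"
  cpscl :: "'k \<Rightarrow> 'c \<Rightarrow> 'c"
  cd    :: "nat \<Rightarrow> 'c \<Rightarrow> 'c"

definition cochain_complex :: "('k::field, 'c::ab_group_add) cpx \<Rightarrow> bool" where
  "cochain_complex K \<longleftrightarrow>
     vector_space (cpscl K) \<and>
     (\<forall>n. module.subspace (cpscl K) (cob K n)) \<and>
     (\<forall>n. lin_on (cpscl K) (cob K n) (cpscl K) (cob K (Suc n)) (cd K n)) \<and>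
     (\<forall>n. \<forall>x\<in>cob K n. cd K (Suc n) (cd K n x) = 0)"

definition complex_morphism ::
  "('k::field, 'c::ab_group_add) cpx \<Rightarrow> ('k, 'd::ab_group_add) cpx \<Rightarrow> (nat \<Rightarrow> 'c \<Rightarrow> 'd) \<Rightarrow> bool" where
  "complex_morphism K L f \<longleftrightarrow>
     cochain_complex K \<and> cochain_complex L \<and>
     (\<forall>n. lin_on (cpscl K) (cob K n) (cpscl L) (cob L n) (f n)) \<and>
     (\<forall>n. \<forall>x\<in>cob K n. f (Suc n) (cd K n x) = cd L n (f n x))"

definition cocycles :: "('k, 'c::ab_group_add) cpx \<Rightarrow> nat \<Rightarrow> 'c set" where
  "cocycles K n = {z \<in> cob K n. cd K n z = 0}"

definition coboundaries :: "('k, 'c::ab_group_add) cpx \<Rightarrow> nat \<Rightarrow> 'c set" where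
  "coboundaries K n = (case n of 0 \<Rightarrow> {0} | Suc m \<Rightarrow> cd K m ` cob K m)"

text \<open>The cohomology is the set of cosets of the coboundaries in the cocycles, with the induced
  addition and scalar multiplication.\<close>

definition coh_class :: "('k, 'c::ab_group_add) cpx \<Rightarrow> nat \<Rightarrow> 'c \<Rightarrow> 'c set" where
  "coh_class K n z = {z + b | b. b \<in> coboundaries K n}"

definition cohomology :: "('k, 'c::ab_group_add) cpx \<Rightarrow> nat \<Rightarrow> 'c set set" where
  "cohomology K n = coh_class K n ` cocycles K n"

definition coh_add :: "('k, 'c::ab_group_add) cpx \<Rightarrow> nat \<Rightarrow> 'c set \<Rightarrow> 'c set \<Rightarrow> 'c set" where
  "coh_add K n A B = (\<Union>a\<in>A. \<Union>b\<in>B. coh_class K n (a + b))"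

definition coh_scale :: "('k, 'c::ab_group_add) cpx \<Rightarrow> nat \<Rightarrow> 'k \<Rightarrow> 'c set \<Rightarrow> 'c set" where
  "coh_scale K n c A = (\<Union>a\<in>A. coh_class K n (cpscl K c a))"

definition coh_map :: "('k, 'd::ab_group_add) cpx \<Rightarrow> (nat \<Rightarrow> 'c \<Rightarrow> 'd) \<Rightarrow> nat \<Rightarrow> 'c set \<Rightarrow> 'd set" where
  "coh_map L f n A = (\<Union>a\<in>A. coh_class L n (f n a))"

definition coh_linear ::
  "('k, 'c::ab_group_add) cpx \<Rightarrow> ('k, 'd::ab_group_add) cpx \<Rightarrow> nat \<Rightarrow> ('c set \<Rightarrow> 'd set) \<Rightarrow> bool" where
  "coh_linear K L n F \<longleftrightarrow>
     (\<forall>A\<in>cohomology K n. F A \<in> cohomology L n) \<and>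
     (\<forall>A\<in>cohomology K n. \<forall>B\<in>cohomology K n. F (coh_add K n A B) = coh_add L n (F A) (F B)) \<and>
     (\<forall>c. \<forall>A\<in>cohomology K n. F (coh_scale K n c A) = coh_scale L n c (F A))"

definition inverse_coh_isos ::
  "('k, 'c::ab_group_add) cpx \<Rightarrow> ('k, 'd::ab_group_add) cpx \<Rightarrow> nat \<Rightarrow> ('c set \<Rightarrow> 'd set) \<Rightarrow> ('d set \<Rightarrow> 'c set) \<Rightarrow> bool" where
  "inverse_coh_isos K L n F G \<longleftrightarrow>
     coh_linear K L n F \<and> coh_linear L K n G \<and>
     (\<forall>A\<in>cohomology K n. G (F A) = A) \<and> (\<forall>B\<in>cohomology L n. F (G B) = B)"

text \<open>Bicomplexes have vertical differential \<open>dv p q : C\<^sup>p\<^sup>,\<^sup>q \<rightarrow> C\<^sup>p\<^sup>,\<^sup>q\<^sup>+\<^sup>1\<close> and horizontal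
  differential \<open>dh p q : C\<^sup>p\<^sup>,\<^sup>q \<rightarrow> C\<^sup>p\<^sup>+\<^sup>1\<^sup>,\<^sup>q\<close>, which anticommute.\<close>

record ('k, 'c) bicpx =
  bob   :: "nat \<Rightarrow> nat \<Rightarrow> 'c set"
  bpscl :: "'k \<Rightarrow> 'c \<Rightarrow> 'c"
  dv    :: "nat \<Rightarrow> nat \<Rightarrow> 'c \<Rightarrow> 'c"
  dh    :: "nat \<Rightarrow> nat \<Rightarrow> 'c \<Rightarrow> 'c"

definition bicomplex :: "('k::field, 'c::ab_group_add) bicpx \<Rightarrow> bool" where
  "bicomplex K \<longleftrightarrow>
     vector_space (bpscl K) \<and>
     (\<forall>p q. module.subspace (bpscl K) (bob K p q)) \<and>
     (\<forall>p q. lin_on (bpscl K) (bob K p q) (bpscl K) (bob K p (Suc q)) (dv K p q)) \<and>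
     (\<forall>p q. lin_on (bpscl K) (bob K p q) (bpscl K) (bob K (Suc p) q) (dh K p q)) \<and>
     (\<forall>p q. \<forall>x\<in>bob K p q. dv K p (Suc q) (dv K p q x) = 0) \<and>
     (\<forall>p q. \<forall>x\<in>bob K p q. dh K (Suc p) q (dh K p q x) = 0) \<and>
     (\<forall>p q. \<forall>x\<in>bob K p q. dv K (Suc p) q (dh K p q x) + dh K p (Suc q) (dv K p q x) = 0)"

definition bicomplex_morphism ::
  "('k::field, 'c::ab_group_add) bicpx \<Rightarrow> ('k, 'd::ab_group_add) bicpx \<Rightarrow> (nat \<Rightarrow> nat \<Rightarrow> 'c \<Rightarrow> 'd) \<Rightarrow> bool" where
  "bicomplex_morphism K L f \<longleftrightarrow>
     bicomplex K \<and> bicomplex L \<and>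
     (\<forall>p q. lin_on (bpscl K) (bob K p q) (bpscl L) (bob L p q) (f p q)) \<and>
     (\<forall>p q. \<forall>x\<in>bob K p q. f p (Suc q) (dv K p q x) = dv L p q (f p q x)) \<and>
     (\<forall>p q. \<forall>x\<in>bob K p q. f (Suc p) q (dh K p q x) = dh L p q (f p q x))"

text \<open>An element of total degree \<open>n\<close> is the function taking \<open>p \<le> n\<close> to its component in
  \<open>C\<^sup>p\<^sup>,\<^sup>n\<^sup>-\<^sup>p\<close>, and \<open>p > n\<close> to 0.\<close>

definition tot :: "('k, 'c::ab_group_add) bicpx \<Rightarrow> ('k, nat \<Rightarrow> 'c) cpx" where
  "tot K =
    \<lparr> cob = (\<lambda>n. {x. (\<forall>p\<le>n. x p \<in> bob K p (n - p)) \<and> (\<forall>p>n. x p = 0)}),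
      cpscl = (\<lambda>c x p. bpscl K c (x p)),
      cd = (\<lambda>n x p. (if p \<le> n then dv K p (n - p) (x p) else 0) +
                    (if 1 \<le> p \<and> p \<le> Suc n then dh K (p - 1) (Suc n - p) (x (p - 1)) else 0)) \<rparr>"

definition tot_map :: "(nat \<Rightarrow> nat \<Rightarrow> 'c \<Rightarrow> 'd) \<Rightarrow> nat \<Rightarrow> (nat \<Rightarrow> 'c) \<Rightarrow> nat \<Rightarrow> 'd::zero" where
  "tot_map f n x = (\<lambda>p. if p \<le> n then f p (n - p) (x p) else 0)"

definition b_op :: "('k::field, 'c::ab_group_add) cocyclic \<Rightarrow> nat \<Rightarrow> 'c \<Rightarrow> 'c" where
  "b_op C n x = (\<Sum>i\<le>Suc n. scl C ((-1) ^ i) (cface C n i x))"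

definition b'_op :: "('k::field, 'c::ab_group_add) cocyclic \<Rightarrow> nat \<Rightarrow> 'c \<Rightarrow> 'c" where
  "b'_op C n x = (\<Sum>i\<le>n. scl C ((-1) ^ i) (cface C n i x))"

definition lambda_op :: "('k::field, 'c::ab_group_add) cocyclic \<Rightarrow> nat \<Rightarrow> 'c \<Rightarrow> 'c" where
  "lambda_op C n x = scl C ((-1) ^ n) (ccyc C n x)"

definition N_op :: "('k::field, 'c::ab_group_add) cocyclic \<Rightarrow> nat \<Rightarrow> 'c \<Rightarrow> 'c" where
  "N_op C n x = (\<Sum>j\<le>n. (lambda_op C n ^^ j) x)"

definition hoc :: "('k::field, 'c::ab_group_add) cocyclic \<Rightarrow> ('k, 'c) cpx" where
  "hoc C = \<lparr> cob = Cob C, cpscl = scl C, cd = b_op C \<rparr>"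

definition cy :: "('k::field, 'c::ab_group_add) cocyclic \<Rightarrow> ('k, 'c) bicpx" where
  "cy C =
    \<lparr> bob = (\<lambda>p q. Cob C q), bpscl = scl C,
      dv = (\<lambda>p q x. if even p then b_op C q x else - b'_op C q x),
      dh = (\<lambda>p q x. if even p then x - lambda_op C q x else N_op C q x) \<rparr>"


section \<open>Universal properties of the tensor products\<close>

lemma separating_functional:
  assumes "vector_space (s :: 'k::field \<Rightarrow> 'u::ab_group_add \<Rightarrow> 'u)" and "u \<noteq> 0"
  shows "\<exists>l. lin_on s UNIV (*) UNIV l \<and> l u \<noteq> 0"
proof -
  interpret vector_space s by fact
  interpret k: vector_space "(*) :: 'k \<Rightarrow> 'k \<Rightarrow> 'k"
    by unfold_locales (auto simp: algebra_simps)
  interpret p: vector_space_pair s "(*) :: 'k \<Rightarrow> 'k \<Rightarrow> 'k" ..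
  have "\<not> dependent {u}" using assms(2) by simp
  from p.linear_independent_extend[OF this, of "\<lambda>_. 1"]
  obtain g where g: "Vector_Spaces.linear s (*) g" "g u = 1" by auto
  then interpret g: Vector_Spaces.linear s "(*)" g by simp
  have "lin_on s UNIV (*) UNIV g" by (simp add: lin_on_def g.add g.scale)
  with g(2) show ?thesis by (intro exI[of _ g]) simp
qed

lemma sum_list_fun_apply: "(\<Sum>x\<leftarrow>ps. f x) y = (\<Sum>x\<leftarrow>ps. f x y)"
  for f :: "'x \<Rightarrow> 'y \<Rightarrow> 'k::comm_monoid_add"
  by (induction ps) simp_all

lemma lin_on_sum_list:
  assumes "lin_on s UNIV (*) UNIV (l :: 'u::ab_group_add \<Rightarrow> 'k::field)"
  shows "l (\<Sum>x\<leftarrow>ps. f x) = (\<Sum>x\<leftarrow>ps. l (f x))"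
proof (induction ps)
  case Nil
  have "l (0 + 0) = l 0 + l 0" using assms unfolding lin_on_def by blast
  then have "l 0 = 0" by (metis add_0_left add_cancel_left_left)
  then show ?case by simp
next
  case (Cons a ps)
  then show ?case using assms unfolding lin_on_def by simp
qed

lemma tensor_lift_sum:
  fixes f :: "'x \<Rightarrow> 'u::ab_group_add" and s :: "'k::field \<Rightarrow> 'u \<Rightarrow> 'u"
  assumes s: "vector_space s"
    and f: "\<And>l. lin_on s UNIV (*) UNIV l \<Longrightarrow> (\<lambda>x. l (f x)) \<in> snd P"
    and ps: "set ps \<subseteq> fst P"
  shows "tensor_lift P f (\<Sum>x\<leftarrow>ps. pure P x) = (\<Sum>x\<leftarrow>ps. f x)"
proof -
  define t where "t = (\<Sum>x\<leftarrow>ps. pure P x)"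
  define qs where "qs = (SOME qs. set qs \<subseteq> fst P \<and> t = (\<Sum>x\<leftarrow>qs. pure P x))"
  have qs: "set qs \<subseteq> fst P \<and> t = (\<Sum>x\<leftarrow>qs. pure P x)"
    unfolding qs_def by (rule someI[of _ ps]) (simp add: t_def ps)
  have "(\<Sum>x\<leftarrow>qs. f x) - (\<Sum>x\<leftarrow>ps. f x) = 0"
  proof (rule ccontr)
    assume "\<not> ?thesis"
    from separating_functional[OF s this] obtain l where
      l: "lin_on s UNIV (*) UNIV l" and ne: "l ((\<Sum>x\<leftarrow>qs. f x) - (\<Sum>x\<leftarrow>ps. f x)) \<noteq> 0" by blast
    have ev: "(\<Sum>x\<leftarrow>rs. pure P x) (\<lambda>x. l (f x)) = l (\<Sum>x\<leftarrow>rs. f x)" for rs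
      using f[OF l] by (simp add: sum_list_fun_apply lin_on_sum_list[OF l] pure_def)
    have "l (\<Sum>x\<leftarrow>qs. f x) = l (\<Sum>x\<leftarrow>ps. f x)"
      using ev[of qs] ev[of ps] qs t_def by simp
    moreover have "l ((\<Sum>x\<leftarrow>qs. f x) - (\<Sum>x\<leftarrow>ps. f x) + (\<Sum>x\<leftarrow>ps. f x)) =
        l ((\<Sum>x\<leftarrow>qs. f x) - (\<Sum>x\<leftarrow>ps. f x)) + l (\<Sum>x\<leftarrow>ps. f x)"
      using l unfolding lin_on_def by blast
    ultimately show False using ne by simp
  qed
  then show ?thesis by (simp add: tensor_lift_def flip: t_def qs_def)
qed

lemma tensor_lift_lin:
  fixes f :: "'x \<Rightarrow> 'u::ab_group_add" and s :: "'k::field \<Rightarrow> 'u \<Rightarrow> 'u"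
  assumes s: "vector_space s"
    and f: "\<And>l. lin_on s UNIV (*) UNIV l \<Longrightarrow> (\<lambda>x. l (f x)) \<in> snd P"
    and U: "module.subspace s U" and fU: "\<And>x. x \<in> fst P \<Longrightarrow> f x \<in> U"
    and sc: "\<And>c x. x \<in> fst P \<Longrightarrow> \<exists>y\<in>fst P. fscale c (pure P x) = pure P y \<and> f y = s c (f x)"
  shows "lin_on fscale (tensor_space P) s U (tensor_lift P f)"
proof -
  interpret vector_space s by fact
  have L: "tensor_lift P f (\<Sum>x\<leftarrow>ps. pure P x) = (\<Sum>x\<leftarrow>ps. f x)" if "set ps \<subseteq> fst P" for ps
    by (rule tensor_lift_sum[OF s f that])
  have memU: "(\<Sum>x\<leftarrow>ps. f x) \<in> U" if "set ps \<subseteq> fst P" for ps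
    using that by (induction ps) (auto simp: fU subspace_0[OF U] subspace_add[OF U])
  have scal: "\<exists>qs. set qs \<subseteq> fst P \<and> fscale c (\<Sum>x\<leftarrow>ps. pure P x) = (\<Sum>x\<leftarrow>qs. pure P x) \<and>
      (\<Sum>x\<leftarrow>qs. f x) = s c (\<Sum>x\<leftarrow>ps. f x)" if "set ps \<subseteq> fst P" for ps c
    using that
  proof (induction ps)
    case Nil
    show ?case by (intro exI[of _ "[]"]) (simp add: fscale_def zero_fun_def)
  next
    case (Cons x ps)
    then obtain qs where qs: "set qs \<subseteq> fst P"
      "fscale c (\<Sum>x\<leftarrow>ps. pure P x) = (\<Sum>x\<leftarrow>qs. pure P x)" "(\<Sum>x\<leftarrow>qs. f x) = s c (\<Sum>x\<leftarrow>ps. f x)"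
      by auto
    from Cons.prems sc[of x c] obtain y where y: "y \<in> fst P" "fscale c (pure P x) = pure P y" "f y = s c (f x)"
      by auto
    have add: "fscale c (a + b) = fscale c a + fscale c b" for a b :: "('x, 'k) tensor"
      by (simp add: fscale_def fun_eq_iff algebra_simps)
    show ?case using qs y by (intro exI[of _ "y # qs"])
        (simp only: add scale_right_distrib list.map sum_list.Cons list.set insert_subset simp_thms)
  qed
  show ?thesis unfolding lin_on_def
  proof (intro conjI ballI allI)
    fix t assume "t \<in> tensor_space P"
    then obtain ps where ps: "set ps \<subseteq> fst P" "t = (\<Sum>x\<leftarrow>ps. pure P x)"
      unfolding tensor_space_def by blast
    show "tensor_lift P f t \<in> U" using L[OF ps(1)] memU[OF ps(1)] ps(2) by simp
    show "tensor_lift P f (fscale c t) = s c (tensor_lift P f t)" for c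
    proof -
      obtain qs where qs: "set qs \<subseteq> fst P" "fscale c t = (\<Sum>x\<leftarrow>qs. pure P x)"
        "(\<Sum>x\<leftarrow>qs. f x) = s c (\<Sum>x\<leftarrow>ps. f x)" using scal[OF ps(1)] ps(2) by blast
      show ?thesis using L[OF qs(1)] L[OF ps(1)] qs ps by simp
    qed
    fix t' assume "t' \<in> tensor_space P"
    then obtain ps' where ps': "set ps' \<subseteq> fst P" "t' = (\<Sum>x\<leftarrow>ps'. pure P x)"
      unfolding tensor_space_def by blast
    show "tensor_lift P f (t + t') = tensor_lift P f t + tensor_lift P f t'"
      using L[of "ps @ ps'"] L[of ps] L[of ps'] ps ps' by simp
  qed
qed

lemma lin_on_comp_functional:
  assumes "lin_on s1 V s2 U f" "lin_on s2 UNIV (*) UNIV l"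
  shows "lin_on s1 V (*) UNIV (\<lambda>x. l (f x))"
  using assms unfolding lin_on_def by simp

lemma pure_bi_bilin: "bilin_on s1 V s2 W fscale UNIV (\<lambda>v w. pure (bi s1 V s2 W) (v, w))"
  by (auto simp: bilin_on_def lin_on_def bi_def pure_def fscale_def fun_eq_iff)

lemma bi_functional:
  assumes "bilin_on s1 V s2 W s U f" "lin_on s UNIV (*) UNIV l"
  shows "(\<lambda>x. l (case x of (v, w) \<Rightarrow> f v w)) \<in> snd (bi s1 V s2 W)"
  using assms(1) unfolding bi_def bilin_on_def snd_conv mem_Collect_eq prod.case
  by (auto intro: lin_on_comp_functional[OF _ assms(2)])

theorem tensor_lift_pure_bi:
  assumes "vector_space s" "bilin_on s1 V s2 W s U f" "v \<in> V" "w \<in> W"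
  shows "tensor_lift (bi s1 V s2 W) (\<lambda>(v, w). f v w) (pure (bi s1 V s2 W) (v, w)) = f v w"
  using tensor_lift_sum[of s "\<lambda>(v, w). f v w" "bi s1 V s2 W" "[(v, w)]"] assms
    bi_functional[OF assms(2)]
  by (simp add: bi_def)

theorem tensor_lift_lin_bi:
  assumes "vector_space s" "module.subspace s U" "bilin_on s1 V s2 W s U f"
    and "vector_space s1" "module.subspace s1 V"
  shows "lin_on fscale (tensor_space (bi s1 V s2 W)) s U (tensor_lift (bi s1 V s2 W) (\<lambda>(v, w). f v w))"
proof (rule tensor_lift_lin[OF assms(1) _ assms(2)])
  interpret v: vector_space s1 by fact
  fix c x
  assume x: "x \<in> fst (bi s1 V s2 W)"
  then obtain v w where vw: "x = (v, w)" "v \<in> V" "w \<in> W" by (auto simp: bi_def)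
  then have V: "s1 c v \<in> V" using v.subspace_scale[OF assms(5)] by simp
  have "f (s1 c v) w = s c (f v w)" using assms(3) vw by (simp add: bilin_on_def lin_on_def)
  moreover have "fscale c (pure (bi s1 V s2 W) (v, w)) = pure (bi s1 V s2 W) (s1 c v, w)"
    using pure_bi_bilin[of s1 V s2 W] vw by (simp add: bilin_on_def lin_on_def)
  ultimately show "\<exists>y\<in>fst (bi s1 V s2 W). fscale c (pure (bi s1 V s2 W) x) = pure (bi s1 V s2 W) y \<and>
      (case y of (v, w) \<Rightarrow> f v w) = s c (case x of (v, w) \<Rightarrow> f v w)"
    using V vw by (intro bexI[of _ "(s1 c v, w)"]) (auto simp: bi_def)
next
  fix x assume "x \<in> fst (bi s1 V s2 W)"
  then show "(case x of (v, w) \<Rightarrow> f v w) \<in> U"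
    using assms(3) by (auto simp: bi_def bilin_on_def lin_on_def)
qed (rule bi_functional[OF assms(3)])

definition multilin_CN :: "('k::field, 'h, 'o, 'a::ab_group_add) hcat \<Rightarrow> nat \<Rightarrow>
    ('k \<Rightarrow> 'u::ab_group_add \<Rightarrow> 'u) \<Rightarrow> 'u set \<Rightarrow> ('o list \<times> 'a list \<Rightarrow> 'u) \<Rightarrow> bool" where
  "multilin_CN D n s U F \<longleftrightarrow> (\<forall>(xs, fs)\<in>cyclic_words D n. \<forall>i\<le>n.
     lin_on (cscale D) (Hom D (src xs i) (tgt xs i)) s U (\<lambda>g. F (xs, fs[i := g])))"

lemma cyclic_words_update:
  assumes "(xs, fs) \<in> cyclic_words D n" "i \<le> n" "g \<in> Hom D (src xs i) (tgt xs i)"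
  shows "(xs, fs[i := g]) \<in> cyclic_words D n"
  using assms by (auto simp: cyclic_words_def nth_list_update)

lemma pure_CN_multilin: "multilin_CN D n fscale UNIV (pure (CN D n))"
proof (unfold multilin_CN_def, clarify)
  fix xs fs i
  assume w: "(xs, fs) \<in> cyclic_words D n" and i: "i \<le> n"
  have "lin_on (cscale D) (Hom D (src xs i) (tgt xs i)) (*) UNIV (\<lambda>g. \<beta> (xs, fs[i := g]))"
    if "\<beta> \<in> snd (CN D n)" for \<beta>
    using that bspec[of "cyclic_words D n" _ "(xs, fs)"] w i unfolding CN_def snd_conv mem_Collect_eq by blast
  then show "lin_on (cscale D) (Hom D (src xs i) (tgt xs i)) fscale UNIV (\<lambda>g. pure (CN D n) (xs, fs[i := g]))"
    unfolding lin_on_def pure_def fscale_def fun_eq_iff by simp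
qed

lemma CN_functional:
  assumes "multilin_CN D n s U F" "lin_on s UNIV (*) UNIV l"
  shows "(\<lambda>x. l (F x)) \<in> snd (CN D n)"
proof (unfold CN_def snd_conv mem_Collect_eq, clarify)
  fix xs fs i
  assume "(xs, fs) \<in> cyclic_words D n" "i \<le> n"
  then have "lin_on (cscale D) (Hom D (src xs i) (tgt xs i)) s U (\<lambda>g. F (xs, fs[i := g]))"
    using assms(1) unfolding multilin_CN_def by blast
  then show "lin_on (cscale D) (Hom D (src xs i) (tgt xs i)) (*) UNIV (\<lambda>g. l (F (xs, fs[i := g])))"
    by (rule lin_on_comp_functional[OF _ assms(2)])
qed

theorem tensor_lift_pure_CN:
  assumes "vector_space s" "multilin_CN D n s U F" "x \<in> cyclic_words D n"
  shows "tensor_lift (CN D n) F (pure (CN D n) x) = F x"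
  using tensor_lift_sum[of s F "CN D n" "[x]"] assms CN_functional[OF assms(2)]
  by (simp add: CN_def)

theorem tensor_lift_lin_CN:
  assumes "vector_space s" "module.subspace s U" "multilin_CN D n s U F" "vector_space (cscale D)"
    and "\<And>X Y. X \<in> Obj D \<Longrightarrow> Y \<in> Obj D \<Longrightarrow> module.subspace (cscale D) (Hom D X Y)"
  shows "lin_on fscale (tensor_space (CN D n)) s U (tensor_lift (CN D n) F)"
proof (rule tensor_lift_lin[OF assms(1) CN_functional[OF assms(3)] assms(2)])
  interpret v: vector_space "cscale D" by fact
  fix x assume "x \<in> fst (CN D n)"
  then obtain xs fs where x: "x = (xs, fs)" "(xs, fs) \<in> cyclic_words D n"
    by (cases x) (auto simp: CN_def)
  have len: "length xs = Suc n" "length fs = Suc n" "set xs \<subseteq> Obj D"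
    using x(2) by (auto simp: cyclic_words_def)
  have f0: "fs ! 0 \<in> Hom D (src xs 0) (tgt xs 0)" using x(2) by (simp add: cyclic_words_def)
  have lin: "lin_on (cscale D) (Hom D (src xs 0) (tgt xs 0)) s U (\<lambda>g. F (xs, fs[0 := g]))"
    using assms(3) x(2) unfolding multilin_CN_def by blast
  have plin: "lin_on (cscale D) (Hom D (src xs 0) (tgt xs 0)) fscale UNIV (\<lambda>g. pure (CN D n) (xs, fs[0 := g]))"
    using pure_CN_multilin[of D n] x(2) unfolding multilin_CN_def by blast
  have upd: "fs[0 := fs ! 0] = fs" by simp
  show "F x \<in> U" using lin f0 upd x(1) unfolding lin_on_def by metis
  fix c
  let ?y = "(xs, fs[0 := cscale D c (fs ! 0)])"
  have "src xs 0 \<in> Obj D" "tgt xs 0 \<in> Obj D"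
    using len by (auto simp: src_def tgt_def intro!: subsetD[OF len(3)] nth_mem)
  then have "cscale D c (fs ! 0) \<in> Hom D (src xs 0) (tgt xs 0)"
    using v.subspace_scale[OF assms(5)] f0 by blast
  then have "?y \<in> cyclic_words D n" by (intro cyclic_words_update[OF x(2)]) auto
  moreover have "F ?y = s c (F x)" "fscale c (pure (CN D n) x) = pure (CN D n) ?y"
    using lin plin f0 upd x(1) unfolding lin_on_def by metis+
  ultimately show "\<exists>y\<in>fst (CN D n). fscale c (pure (CN D n) x) = pure (CN D n) y \<and> F y = s c (F x)"
    by (intro bexI[of _ ?y]) (auto simp: CN_def)
qed

end

(* With u_p = id (x) E_pe and v_p = id (x) E_ep one has sum_p u_p v_p = id, and the cochain map
   tr o inc inserts this splitting of the identity at every junction f^(j-1), f^j of a cyclic word,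
   while inc o tr = id. Let Q_j be the insertion at junction j alone. It commutes with the cofaces
   away from junction j and is absorbed by the coface that composes there, so that
   sum_j (-1)^j sigma_j Q_(j+1) ... Q_1 is a Hochschild homotopy from the identity to
   Q_0 Q_n ... Q_1 = tr o inc. For cyclic cohomology, tr o inc is a projector of the bicomplex whose
   kernel has exact columns: the b-columns by this homotopy, the b'-columns because b' is
   contractible. Hence the kernel has an acyclic total complex. *)

theory Submission
  imports Defs
begin

section \<open>Cohomology of complexes and bicomplexes\<close>

text \<open>The obstacle is that the inclusion at \<open>elem_mat e e\<close> does not preserve
  identities: id \<otimes> E_ee is not the identity of the matrix category. The inclusion therefore
  yields a map compatible with cofaces and rotations only, and the kernel of the projector tr o inc
  need not be closed under codegeneracies. Its b'-columns are still exact, because a primitive found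
  with the last codegeneracy can be pushed back into the kernel by 1 - tr o inc. The Hopf structure
  enters the homotopy in two places. Insertions commute with the diagonal action, since h acts on id
  \<otimes> E_pe through the counit. The last coface twists the arrow that it moves by S^-1(m_(-1));
  on an inserted arrow this twist is again a counit, which the coaction absorbs, and so the chain of
  insertions closes up at junction 0. All identities are checked on pure words: cochains correspond
  to scalar functions of (m, objects, arrows) that are multilinear and satisfy F (m h, c) = F (m, h
  c).\<close>

lemma vs_module: "vector_space s \<Longrightarrow> module s"
  by (simp add: module_iff_vector_space)

lemma lin_onD:
  assumes "lin_on s1 V s2 W f" "x \<in> V"
  shows lin_on_mem: "f x \<in> W"
    and lin_on_add: "y \<in> V \<Longrightarrow> f (x + y) = f x + f y"
    and lin_on_scale: "f (s1 c x) = s2 c (f x)"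
  using assms unfolding lin_on_def by blast+

lemma lin_on_neg:
  assumes "vector_space s1" "vector_space s2" "lin_on s1 V s2 W f" "x \<in> V"
  shows "f (- x) = - f x"
proof -
  interpret a: vector_space s1 by fact
  interpret b: vector_space s2 by fact
  show ?thesis using lin_on_scale[OF assms(3,4), of "-1"]
    by (simp only: a.scale_minus_left a.scale_one b.scale_minus_left b.scale_one)
qed

lemma lin_on_zero:
  assumes "vector_space s1" "module.subspace s1 V" "lin_on s1 V s2 W f"
  shows "f 0 = 0"
proof -
  interpret a: vector_space s1 by fact
  have "0 \<in> V" using assms(2) by (rule a.subspace_0)
  then show ?thesis using lin_on_add[OF assms(3), of 0 0] by simp
qed

lemma lin_on_diff:
  assumes "vector_space s1" "vector_space s2" "module.subspace s1 V" "lin_on s1 V s2 W f" "x \<in> V" "y \<in> V"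
  shows "f (x - y) = f x - f y"
proof -
  interpret a: vector_space s1 by fact
  have "- y \<in> V" using assms(3,6) by (rule a.subspace_neg)
  then show ?thesis
    using lin_on_add[OF assms(4,5), of "- y"] lin_on_neg[OF assms(1,2,4,6)] by simp
qed

lemma lin_on_comp:
  assumes "lin_on s1 V s2 W f" "lin_on s2 W s3 U g"
  shows "lin_on s1 V s3 U (\<lambda>x. g (f x))"
  using assms by (simp add: lin_on_def)

section \<open>Cosets of coboundaries and the maps induced on them\<close>

lemma cochain_complexD:
  assumes "cochain_complex K"
  shows cochain_complex_vs: "vector_space (cpscl K)"
    and cochain_complex_subspace: "module.subspace (cpscl K) (cob K n)"
    and cochain_complex_lin: "lin_on (cpscl K) (cob K n) (cpscl K) (cob K (Suc n)) (cd K n)"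
    and cochain_complex_dd: "x \<in> cob K n \<Longrightarrow> cd K (Suc n) (cd K n x) = 0"
  using assms unfolding cochain_complex_def by blast+

lemma subspace_coboundaries:
  assumes "cochain_complex K"
  shows "module.subspace (cpscl K) (coboundaries K n)"
proof -
  interpret vector_space "cpscl K" using assms by (rule cochain_complex_vs)
  show ?thesis
  proof (cases n)
    case 0
    then show ?thesis by (simp add: coboundaries_def)
  next
    case (Suc m)
    note sub = cochain_complex_subspace[OF assms, of m] and lin = cochain_complex_lin[OF assms, of m]
    show ?thesis unfolding Suc coboundaries_def nat.case
    proof (rule subspaceI)
      have "cd K m 0 = 0" by (rule lin_on_zero[OF vector_space_axioms sub lin])
      then show "0 \<in> cd K m ` cob K m" using subspace_0[OF sub] by (metis imageI)
    next
      fix x y assume "x \<in> cd K m ` cob K m" "y \<in> cd K m ` cob K m"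
      then obtain x' y' where "x = cd K m x'" "y = cd K m y'" "x' \<in> cob K m" "y' \<in> cob K m" by blast
      then show "x + y \<in> cd K m ` cob K m"
        by (intro image_eqI[of _ _ "x' + y'"]) (simp_all add: lin_on_add[OF lin] subspace_add[OF sub])
    next
      fix c x assume "x \<in> cd K m ` cob K m"
      then obtain x' where "x = cd K m x'" "x' \<in> cob K m" by blast
      then show "cpscl K c x \<in> cd K m ` cob K m"
        by (intro image_eqI[of _ _ "cpscl K c x'"]) (simp_all add: lin_on_scale[OF lin] subspace_scale[OF sub])
    qed
  qed
qed

lemma subspace_cocycles:
  assumes "cochain_complex K"
  shows "module.subspace (cpscl K) (cocycles K n)"
proof -
  interpret vector_space "cpscl K" using assms by (rule cochain_complex_vs)
  note sub = cochain_complex_subspace[OF assms, of n] and lin = cochain_complex_lin[OF assms, of n]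
  show ?thesis
    unfolding cocycles_def
    by (rule subspaceI)
      (auto simp: subspace_0[OF sub] subspace_add[OF sub] subspace_scale[OF sub]
        lin_on_zero[OF vector_space_axioms sub lin] lin_on_add[OF lin] lin_on_scale[OF lin])
qed

lemma coboundaries_le_cocycles:
  assumes "cochain_complex K"
  shows "coboundaries K n \<subseteq> cocycles K n"
proof (cases n)
  case 0
  interpret vector_space "cpscl K" using assms by (rule cochain_complex_vs)
  show ?thesis using subspace_0[OF subspace_cocycles[OF assms]] 0 by (simp add: coboundaries_def)
next
  case (Suc m)
  then show ?thesis
    using lin_on_mem[OF cochain_complex_lin[OF assms]] cochain_complex_dd[OF assms]
    by (auto simp: coboundaries_def cocycles_def)
qed

lemma coh_class_mem: "z \<in> coh_class K n y \<longleftrightarrow> z - y \<in> coboundaries K n"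
proof
  assume "z - y \<in> coboundaries K n"
  then show "z \<in> coh_class K n y" unfolding coh_class_def by (intro CollectI exI[of _ "z - y"]) simp
qed (auto simp: coh_class_def)

lemma coh_class_eq_iff:
  assumes "cochain_complex K"
  shows "coh_class K n x = coh_class K n y \<longleftrightarrow> x - y \<in> coboundaries K n"
proof -
  interpret vector_space "cpscl K" using assms by (rule cochain_complex_vs)
  note sub = subspace_coboundaries[OF assms, of n]
  show ?thesis
  proof
    assume "coh_class K n x = coh_class K n y"
    moreover have "x \<in> coh_class K n x" by (simp add: coh_class_mem subspace_0[OF sub])
    ultimately show "x - y \<in> coboundaries K n" by (simp add: coh_class_mem)
  next
    assume xy: "x - y \<in> coboundaries K n"
    have "z - x \<in> coboundaries K n \<longleftrightarrow> z - y \<in> coboundaries K n" for z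
      using subspace_add[OF sub xy, of "z - x"] subspace_diff[OF sub _ xy, of "z - y"] by simp (metis diff_diff_eq2 diff_add_cancel)
    then show "coh_class K n x = coh_class K n y" by (intro set_eqI) (simp add: coh_class_mem)
  qed
qed

lemma coh_class_self:
  assumes "cochain_complex K"
  shows "x \<in> coh_class K n x"
proof -
  interpret vector_space "cpscl K" using assms by (rule cochain_complex_vs)
  show ?thesis using subspace_0[OF subspace_coboundaries[OF assms]] by (simp add: coh_class_mem)
qed

text \<open>Sums, scalar multiples and images of classes are all defined as unions over every
  representative. If \<open>g\<close> sends cohomologous elements to cohomologous elements, all
  members of such a union coincide, so it can be computed from a single representative.\<close>

lemma coh_class_UN:
  assumes K: "cochain_complex K" and L: "cochain_complex L"
    and g: "\<And>a. a - x \<in> coboundaries K n \<Longrightarrow> g a - g x \<in> coboundaries L n"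
  shows "(\<Union>a\<in>coh_class K n x. coh_class L n (g a)) = coh_class L n (g x)"
proof -
  have "coh_class L n (g a) = coh_class L n (g x)" if "a \<in> coh_class K n x" for a
    using that g by (simp add: coh_class_eq_iff[OF L] coh_class_mem)
  moreover have "coh_class K n x \<noteq> {}" using coh_class_self[OF K, of x n] by blast
  ultimately show ?thesis by (intro SUP_eq_const)
qed

lemma complex_morphismD:
  assumes "complex_morphism K L f"
  shows "cochain_complex K" "cochain_complex L"
    and "lin_on (cpscl K) (cob K n) (cpscl L) (cob L n) (f n)"
    and "x \<in> cob K n \<Longrightarrow> f (Suc n) (cd K n x) = cd L n (f n x)"
  using assms unfolding complex_morphism_def by blast+

lemma complex_morphism_zero:
  assumes "complex_morphism K L f"
  shows "f n 0 = 0"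
  by (rule lin_on_zero[OF cochain_complex_vs cochain_complex_subspace complex_morphismD(3)[OF assms]])
    (rule complex_morphismD(1)[OF assms])+

lemma complex_morphism_coboundaries:
  assumes f: "complex_morphism K L f" and x: "x \<in> coboundaries K n"
  shows "f n x \<in> coboundaries L n"
proof (cases n)
  case 0
  then show ?thesis using x complex_morphism_zero[OF f, of 0] by (simp add: coboundaries_def)
next
  case (Suc m)
  with x obtain y where y: "y \<in> cob K m" "x = cd K m y" by (auto simp: coboundaries_def)
  have "f n x = cd L m (f m y)" using complex_morphismD(4)[OF f y(1)] y(2) Suc by simp
  then show ?thesis
    using lin_on_mem[OF complex_morphismD(3)[OF f] y(1)] Suc by (simp add: coboundaries_def)
qed

lemma complex_morphism_cocycles:
  assumes f: "complex_morphism K L f" and x: "x \<in> cocycles K n"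
  shows "f n x \<in> cocycles L n"
proof -
  note fD = complex_morphismD[OF f]
  have x': "x \<in> cob K n" "cd K n x = 0" using x by (auto simp: cocycles_def)
  have "cd L n (f n x) = f (Suc n) 0" using fD(4)[OF x'(1)] x'(2) by simp
  also have "\<dots> = 0" by (rule complex_morphism_zero[OF f])
  finally show ?thesis using lin_on_mem[OF fD(3) x'(1)] by (simp add: cocycles_def)
qed

lemma coh_map_class:
  assumes f: "complex_morphism K L f" and x: "x \<in> cocycles K n"
  shows "coh_map L f n (coh_class K n x) = coh_class L n (f n x)"
  unfolding coh_map_def
proof (rule coh_class_UN)
  note fD = complex_morphismD[OF f]
  show K: "cochain_complex K" and L: "cochain_complex L" by fact+
  interpret k: vector_space "cpscl K" using K by (rule cochain_complex_vs)
  note Zsub = subspace_cocycles[OF K, of n]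
  fix a assume a: "a - x \<in> coboundaries K n"
  \<comment> \<open>Coboundaries are cocycles, so every representative \<open>a\<close> of the class
    lies where \<open>f n\<close> is linear.\<close>
  then have "a - x \<in> cocycles K n" using coboundaries_le_cocycles[OF K] by blast
  from k.subspace_add[OF Zsub this x] have "a \<in> cocycles K n" by simp
  with x have "f n (a - x) = f n a - f n x"
    by (intro lin_on_diff[OF cochain_complex_vs[OF K] cochain_complex_vs[OF L] cochain_complex_subspace[OF K] fD(3)])
      (auto simp: cocycles_def)
  then show "f n a - f n x \<in> coboundaries L n"
    using complex_morphism_coboundaries[OF f a] by simp
qed

lemma coh_add_class:
  assumes "cochain_complex K"
  shows "coh_add K n (coh_class K n x) (coh_class K n y) = coh_class K n (x + y)"
proof -
  interpret vector_space "cpscl K" using assms by (rule cochain_complex_vs)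
  have "(\<Union>b\<in>coh_class K n y. coh_class K n (a + b)) = coh_class K n (a + y)" for a
    by (rule coh_class_UN[OF assms assms]) simp
  moreover have "(\<Union>a\<in>coh_class K n x. coh_class K n (a + y)) = coh_class K n (x + y)"
    by (rule coh_class_UN[OF assms assms]) simp
  ultimately show ?thesis by (simp add: coh_add_def)
qed

lemma coh_scale_class:
  assumes "cochain_complex K"
  shows "coh_scale K n c (coh_class K n x) = coh_class K n (cpscl K c x)"
proof -
  interpret vector_space "cpscl K" using assms by (rule cochain_complex_vs)
  show ?thesis unfolding coh_scale_def
    by (rule coh_class_UN[OF assms assms])
      (simp add: subspace_scale[OF subspace_coboundaries[OF assms]] flip: scale_right_diff_distrib)
qed

lemma coh_linear_coh_map:
  assumes f: "complex_morphism K L f"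
  shows "coh_linear K L n (coh_map L f n)"
proof -
  note fD = complex_morphismD[OF f]
  interpret k: vector_space "cpscl K" using fD(1) by (rule cochain_complex_vs)
  note Zsub = subspace_cocycles[OF fD(1), of n]
  have ob: "x \<in> cob K n" if "x \<in> cocycles K n" for x using that by (simp add: cocycles_def)
  show ?thesis unfolding coh_linear_def cohomology_def
  proof (intro conjI ballI allI; elim imageE; hypsubst)
    fix x assume x: "x \<in> cocycles K n"
    show "coh_map L f n (coh_class K n x) \<in> coh_class L n ` cocycles L n"
      unfolding coh_map_class[OF f x] by (rule imageI[OF complex_morphism_cocycles[OF f x]])
    show "coh_map L f n (coh_scale K n c (coh_class K n x)) = coh_scale L n c (coh_map L f n (coh_class K n x))" for c
      unfolding coh_scale_class[OF fD(1)] coh_map_class[OF f x] coh_map_class[OF f k.subspace_scale[OF Zsub x]]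
        coh_scale_class[OF fD(2)] lin_on_scale[OF fD(3) ob[OF x]] ..
    fix y assume y: "y \<in> cocycles K n"
    show "coh_map L f n (coh_add K n (coh_class K n x) (coh_class K n y)) =
        coh_add L n (coh_map L f n (coh_class K n x)) (coh_map L f n (coh_class K n y))"
      unfolding coh_add_class[OF fD(1)] coh_map_class[OF f x] coh_map_class[OF f y]
        coh_map_class[OF f k.subspace_add[OF Zsub x y]] coh_add_class[OF fD(2)]
        lin_on_add[OF fD(3) ob[OF x] ob[OF y]] ..
  qed
qed

lemma inverse_coh_isosI:
  assumes f: "complex_morphism K L f" and g: "complex_morphism L K g"
    and gf: "\<And>z. z \<in> cocycles K n \<Longrightarrow> g n (f n z) - z \<in> coboundaries K n"
    and fg: "\<And>z. z \<in> cocycles L n \<Longrightarrow> f n (g n z) - z \<in> coboundaries L n"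
  shows "inverse_coh_isos K L n (coh_map L f n) (coh_map K g n)"
  unfolding inverse_coh_isos_def
proof (intro conjI ballI coh_linear_coh_map f g)
  fix A assume "A \<in> cohomology K n"
  then obtain z where z: "z \<in> cocycles K n" "A = coh_class K n z" by (auto simp: cohomology_def)
  show "coh_map K g n (coh_map L f n A) = A"
    unfolding z(2) coh_map_class[OF f z(1)] coh_map_class[OF g complex_morphism_cocycles[OF f z(1)]]
      coh_class_eq_iff[OF complex_morphismD(1)[OF f]] by (rule gf[OF z(1)])
next
  fix A assume "A \<in> cohomology L n"
  then obtain z where z: "z \<in> cocycles L n" "A = coh_class L n z" by (auto simp: cohomology_def)
  show "coh_map L f n (coh_map K g n A) = A"
    unfolding z(2) coh_map_class[OF g z(1)] coh_map_class[OF f complex_morphism_cocycles[OF g z(1)]]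
      coh_class_eq_iff[OF complex_morphismD(2)[OF f]] by (rule fg[OF z(1)])
qed

section \<open>Total complexes of bicomplexes\<close>

lemma bicomplexD:
  assumes "bicomplex K"
  shows "vector_space (bpscl K)"
    and "module.subspace (bpscl K) (bob K p q)"
    and "lin_on (bpscl K) (bob K p q) (bpscl K) (bob K p (Suc q)) (dv K p q)"
    and "lin_on (bpscl K) (bob K p q) (bpscl K) (bob K (Suc p) q) (dh K p q)"
    and "x \<in> bob K p q \<Longrightarrow> dv K p (Suc q) (dv K p q x) = 0"
    and "x \<in> bob K p q \<Longrightarrow> dh K (Suc p) q (dh K p q x) = 0"
    and "x \<in> bob K p q \<Longrightarrow> dv K (Suc p) q (dh K p q x) + dh K p (Suc q) (dv K p q x) = 0"
  using assms unfolding bicomplex_def by blast+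

text \<open>Separates the ends of the total complex, where only one of the two differentials
  contributes, from the interior, where both do and the truncated subtractions of the definition are
  genuine.\<close>

lemma cd_tot:
  "cd (tot K) n x 0 = dv K 0 n (x 0)"
  "p < n \<Longrightarrow> cd (tot K) n x (Suc p) = dv K (Suc p) (n - Suc p) (x (Suc p)) + dh K p (n - p) (x p)"
  "cd (tot K) n x (Suc n) = dh K n 0 (x n)"
  "Suc n < p \<Longrightarrow> cd (tot K) n x p = 0"
  by (auto simp: tot_def)

lemma mem_cob_tot: "x \<in> cob (tot K) n \<longleftrightarrow> (\<forall>p\<le>n. x p \<in> bob K p (n - p)) \<and> (\<forall>p>n. x p = 0)"
  by (simp add: tot_def)

lemma cochain_complex_tot:
  assumes K: "bicomplex K"
  shows "cochain_complex (tot K)"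
proof -
  note D = bicomplexD[OF K]
  interpret k: vector_space "bpscl K" by (rule D(1))
  have scl: "cpscl (tot K) c x p = bpscl K c (x p)" for c x p by (simp add: tot_def)
  have vs: "vector_space (cpscl (tot K))"
    by unfold_locales (auto simp: scl fun_eq_iff k.scale_right_distrib k.scale_left_distrib)
  interpret t: vector_space "cpscl (tot K)" by (rule vs)
  note sub = k.subspace_0[OF D(2)] k.subspace_add[OF D(2)] k.subspace_scale[OF D(2)]
  have dv_add: "dv K p q (x + y) = dv K p q x + dv K p q y"
    if "x \<in> bob K p q" "y \<in> bob K p q" for p q x y using lin_on_add[OF D(3)] that by blast
  have dh_add: "dh K p q (x + y) = dh K p q x + dh K p q y"
    if "x \<in> bob K p q" "y \<in> bob K p q" for p q x y using lin_on_add[OF D(4)] that by blast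
  have cases: "p = 0 \<or> (\<exists>p'. p = Suc p' \<and> p' < n) \<or> p = Suc n \<or> Suc n < p" for p n :: nat
    by (cases p) auto
  have lin: "lin_on (cpscl (tot K)) (cob (tot K) n) (cpscl (tot K)) (cob (tot K) (Suc n)) (cd (tot K) n)" for n
  proof (unfold lin_on_def, intro conjI ballI allI)
    fix x assume x: "x \<in> cob (tot K) n"
    have xb: "x p \<in> bob K p (n - p)" if "p \<le> n" for p using x that by (simp add: mem_cob_tot)
    show "cd (tot K) n x \<in> cob (tot K) (Suc n)"
      unfolding mem_cob_tot
    proof (intro conjI allI impI)
      fix p assume "p \<le> Suc n"
      then consider "p = 0" | p' where "p = Suc p'" "p' < n" | "p = Suc n" using cases[of p n] by auto
      then show "cd (tot K) n x p \<in> bob K p (Suc n - p)"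
      proof cases
        case 1 then show ?thesis using lin_on_mem[OF D(3) xb[of 0]] by (simp add: cd_tot)
      next
        case 2
        then have "Suc (n - Suc p') = n - p'" by simp
        then have "dv K p (n - Suc p') (x p) \<in> bob K p (n - p')"
          using lin_on_mem[OF D(3) xb[of "Suc p'"]] 2 by simp
        then show ?thesis using lin_on_mem[OF D(4) xb[of p']] 2 sub by (simp add: cd_tot)
      next
        case 3 then show ?thesis using lin_on_mem[OF D(4) xb[of n]] by (simp add: cd_tot)
      qed
    qed (simp add: cd_tot)
    show "cd (tot K) n (cpscl (tot K) c x) = cpscl (tot K) c (cd (tot K) n x)" for c
    proof
      fix p show "cd (tot K) n (cpscl (tot K) c x) p = cpscl (tot K) c (cd (tot K) n x) p"
        using cases[of p n] lin_on_scale[OF D(3) xb] lin_on_scale[OF D(4) xb]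
          lin_on_scale[OF D(3) xb[of 0, simplified]] lin_on_scale[OF D(4) xb[of n, simplified]]
        by (auto simp: cd_tot scl k.scale_right_distrib)
    qed
    fix y assume y: "y \<in> cob (tot K) n"
    have yb: "y p \<in> bob K p (n - p)" if "p \<le> n" for p using y that by (simp add: mem_cob_tot)
    show "cd (tot K) n (x + y) = cd (tot K) n x + cd (tot K) n y"
    proof
      fix p show "cd (tot K) n (x + y) p = (cd (tot K) n x + cd (tot K) n y) p"
        using cases[of p n] dv_add[OF xb yb] dh_add[OF xb yb]
          dv_add[OF xb[of 0, simplified] yb[of 0, simplified]]
          dh_add[OF xb[of n, simplified] yb[of n, simplified]] by (auto simp: cd_tot)
    qed
  qed
  have subsp: "module.subspace (cpscl (tot K)) (cob (tot K) n)" for n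
    by (rule t.subspaceI) (auto simp: mem_cob_tot scl sub)
  have dd: "cd (tot K) (Suc n) (cd (tot K) n x) = 0" if x: "x \<in> cob (tot K) n" for n x
  proof
    fix p
    have xb: "x p \<in> bob K p (n - p)" if "p \<le> n" for p using x that by (simp add: mem_cob_tot)
    have dv0: "dv K p q 0 = 0" and dh0: "dh K p q 0 = 0" for p q
      using lin_on_zero[OF D(1,2,3)] lin_on_zero[OF D(1,2,4)] by blast+
    \<comment> \<open>Component p of the double differential has up to four terms. The two squares
      vanish and the two mixed terms cancel by anticommutativity; near the ends some of the four are
      absent, hence the cases.\<close>
    consider "p = 0" | "p = 1" "n = 0" | "p = 1" "0 < n" | p' where "p = Suc (Suc p')" "Suc p' < n" 
      | p' where "p = Suc (Suc p')" "Suc p' = n" | "p = Suc (Suc n)" | "Suc (Suc n) < p"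
    proof -
      have "p = 0 \<or> p = 1 \<or> (\<exists>p'. p = Suc (Suc p'))" by (metis One_nat_def not0_implies_Suc)
      moreover have "Suc p' < n \<or> Suc p' = n \<or> p' = n \<or> n < p'" for p' by linarith
      ultimately show thesis using that by blast
    qed
    then show "cd (tot K) (Suc n) (cd (tot K) n x) p = 0 p"
    proof cases
      case 1 then show ?thesis using D(5)[OF xb[of 0]] by (simp add: cd_tot)
    next
      case 2 then show ?thesis using D(7)[OF xb[of 0]] cd_tot(3)[of K 0 x] by (simp add: cd_tot)
    next
      case 3
      then have q: "Suc (n - Suc 0) = n" by simp
      have "dv K 1 n (dv K 1 (n - 1) (x 1)) = 0" using D(5)[OF xb[of 1]] 3 q by simp
      moreover have "dv K 1 n (dv K 1 (n - 1) (x 1) + dh K 0 n (x 0)) =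
        dv K 1 n (dv K 1 (n - 1) (x 1)) + dv K 1 n (dh K 0 n (x 0))"
        using lin_on_mem[OF D(3) xb[of 1]] lin_on_mem[OF D(4) xb[of 0]] 3 q by (intro dv_add) auto
      ultimately show ?thesis using D(7)[OF xb[of 0]] 3 by (simp add: cd_tot)
    next
      case 4
      define q where "q = n - Suc (Suc p')"
      have q: "n - Suc p' = Suc q" "n - p' = Suc (Suc q)" "Suc n - Suc (Suc p') = Suc q" "Suc n - Suc p' = Suc (Suc q)"
        using 4 by (auto simp: q_def)
      have m: "x (Suc (Suc p')) \<in> bob K (Suc (Suc p')) q" "x (Suc p') \<in> bob K (Suc p') (Suc q)"
        "x p' \<in> bob K p' (Suc (Suc q))"
        using xb[of "Suc (Suc p')"] xb[of "Suc p'"] xb[of p'] 4 q by (auto simp: q_def)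
      note mm = lin_on_mem[OF D(3) m(1)] lin_on_mem[OF D(4) m(2)] lin_on_mem[OF D(3) m(2)] lin_on_mem[OF D(4) m(3)]
      show ?thesis
        using 4 D(5)[OF m(1)] D(6)[OF m(3)] D(7)[OF m(2)]
        by (simp add: cd_tot q dv_add[OF mm(1,2)] dh_add[OF mm(3,4)] flip: q_def)
    next
      case 5
      have m: "x (Suc p') \<in> bob K (Suc p') 0" "x p' \<in> bob K p' (Suc 0)"
        using xb[of "Suc p'"] xb[of p'] 5 by auto
      note mm = lin_on_mem[OF D(3) m(1)] lin_on_mem[OF D(4) m(2)]
      have "n - p' = Suc 0" "Suc n - Suc p' = Suc 0" using 5 by auto
      then show ?thesis
        using 5 D(6)[OF m(2)] D(7)[OF m(1)] cd_tot(2)[of p' n K x] cd_tot(3)[of K n x] dh_add[OF mm(1,2)]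
        by (simp add: cd_tot flip: add.assoc)
    next
      case 6 then show ?thesis using D(6)[OF xb[of n]] by (simp add: cd_tot)
    next
      case 7 then show ?thesis by (simp add: cd_tot)
    qed
  qed
  show ?thesis unfolding cochain_complex_def using vs lin subsp dd by blast
qed

lemma complex_morphism_tot:
  assumes f: "bicomplex_morphism K L f"
  shows "complex_morphism (tot K) (tot L) (tot_map f)"
proof -
  have K: "bicomplex K" and L: "bicomplex L"
    and lin: "\<And>p q. lin_on (bpscl K) (bob K p q) (bpscl L) (bob L p q) (f p q)"
    and v: "\<And>p q x. x \<in> bob K p q \<Longrightarrow> f p (Suc q) (dv K p q x) = dv L p q (f p q x)"
    and h: "\<And>p q x. x \<in> bob K p q \<Longrightarrow> f (Suc p) q (dh K p q x) = dh L p q (f p q x)"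
    using f unfolding bicomplex_morphism_def by blast+
  note D = bicomplexD[OF K]
  have "lin_on (cpscl (tot K)) (cob (tot K) n) (cpscl (tot L)) (cob (tot L) n) (tot_map f n)" for n
  proof -
    interpret l: vector_space "bpscl L" using bicomplexD(1)[OF L] .
    show ?thesis
      unfolding lin_on_def tot_map_def
      by (auto simp: mem_cob_tot fun_eq_iff tot_def lin_on_mem[OF lin] lin_on_add[OF lin] lin_on_scale[OF lin])
  qed
  moreover have "tot_map f (Suc n) (cd (tot K) n x) = cd (tot L) n (tot_map f n x)"
    if x: "x \<in> cob (tot K) n" for n x
  proof
    fix p
    have xb: "x p \<in> bob K p (n - p)" if "p \<le> n" for p using x that by (simp add: mem_cob_tot)
    consider "p = 0" | p' where "p = Suc p'" "p' < n" | "p = Suc n" | "Suc n < p" by (cases p) force+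
    then show "tot_map f (Suc n) (cd (tot K) n x) p = cd (tot L) n (tot_map f n x) p"
    proof cases
      case 1 then show ?thesis using v[OF xb[of 0]] by (simp add: cd_tot tot_map_def)
    next
      case 2
      define q where "q = n - Suc p'"
      have q: "n - p' = Suc q" using 2 by (auto simp: q_def)
      have m: "x (Suc p') \<in> bob K (Suc p') q" "x p' \<in> bob K p' (Suc q)"
        using xb[of "Suc p'"] xb[of p'] 2 q by (auto simp: q_def)
      have "dv K (Suc p') q (x (Suc p')) \<in> bob K (Suc p') (Suc q)" "dh K p' (Suc q) (x p') \<in> bob K (Suc p') (Suc q)"
        using lin_on_mem[OF D(3) m(1)] lin_on_mem[OF D(4) m(2)] .
      then show ?thesis using 2 v[OF m(1)] h[OF m(2)]
        by (simp add: cd_tot tot_map_def q lin_on_add[OF lin] flip: q_def)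
    next
      case 3 then show ?thesis using h[OF xb[of n]] by (simp add: cd_tot tot_map_def)
    next
      case 4 then show ?thesis by (simp add: cd_tot tot_map_def)
    qed
  qed
  ultimately show ?thesis
    unfolding complex_morphism_def using cochain_complex_tot[OF K] cochain_complex_tot[OF L] by blast
qed

text \<open>A bicomplex with exact columns has an acyclic total complex: a primitive is built column by
  column, starting from column 0.\<close>

lemma tot_exact:
  assumes K: "bicomplex K"
    and ex: "\<And>p q z. z \<in> bob K p (Suc q) \<Longrightarrow> dv K p (Suc q) z = 0 \<Longrightarrow> \<exists>y\<in>bob K p q. dv K p q y = z"
    and ex0: "\<And>p z. z \<in> bob K p 0 \<Longrightarrow> dv K p 0 z = 0 \<Longrightarrow> z = 0"
    and x: "x \<in> cocycles (tot K) n"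
  shows "x \<in> coboundaries (tot K) n"
proof -
  note D = bicomplexD[OF K]
  interpret k: vector_space "bpscl K" by (rule D(1))
  have xb: "x p \<in> bob K p (n - p)" if "p \<le> n" for p using x that by (simp add: mem_cob_tot cocycles_def)
  have x0: "x p = 0" if "p > n" for p using x that by (simp add: mem_cob_tot cocycles_def)
  have dx: "cd (tot K) n x p = 0" for p using x by (simp add: cocycles_def)
  show ?thesis
  proof (cases n)
    case 0
    then have "x 0 = 0" using ex0[of "x 0" 0] xb[of 0] dx[of 0] by (simp add: cd_tot)
    then have "x = 0" using x0 0 by (simp add: fun_eq_iff) (metis gr0I)
    then show ?thesis using 0 by (simp add: coboundaries_def)
  next
    case (Suc m)
    \<comment> \<open>\<open>corr y p\<close> is what column p - 1 of a candidate primitive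
      \<open>y\<close> already contributes to component p of its total differential. Column p has to
      supply the rest vertically.\<close>
    define corr where "corr y p = (if p = 0 then 0 else dh K (p - 1) (Suc m - p) (y (p - 1)))" for y :: "nat \<Rightarrow> 'b" and p
    have corr_mem: "corr y k \<in> bob K k (Suc m - k)" 
      if "k \<le> Suc m" "\<And>p. p < k \<Longrightarrow> y p \<in> bob K p (m - p)" for y k
      using that(1) lin_on_mem[OF D(4) that(2)[of "k - 1"]] k.subspace_0[OF D(2)] by (cases k) (auto simp: corr_def)
    \<comment> \<open>The remainder in column k is vertically closed. Since x is a cocycle, dv of
      column k is minus dh of column k - 1; that column is dv of \<open>y (k - 1)\<close> plus a
      horizontal boundary, and dh dv = - dv dh.\<close>
    have closed: "dv K k (Suc m - k) (x k - corr y k) = 0"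
      if k: "k \<le> Suc m" and y: "\<And>p. p < k \<Longrightarrow> y p \<in> bob K p (m - p)"
        and yx: "\<And>p. p < k \<Longrightarrow> x p = dv K p (m - p) (y p) + corr y p" for k y
    proof (cases k)
      case 0
      then show ?thesis using dx[of 0] Suc by (simp add: cd_tot corr_def)
    next
      case (Suc j)
      define q where "q = m - j"
      have q: "Suc m - k = q" "m - j = q" "n - j = Suc q" "n - Suc j = q" using Suc \<open>n = Suc m\<close> k by (auto simp: q_def)
      have yj: "y j \<in> bob K j q" using y[of j] Suc q by simp
      have xk: "x k \<in> bob K k q" using xb[of k] Suc \<open>n = Suc m\<close> k q by simp
      have cj: "corr y j \<in> bob K j (Suc q)" using corr_mem[of j y] y Suc k q \<open>n = Suc m\<close> by simp
      have "dh K j (Suc q) (corr y j) = 0"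
      proof (cases j)
        case 0 then show ?thesis using lin_on_zero[OF D(1,2,4)] by (simp add: corr_def)
      next
        case (Suc i)
        have "y i \<in> bob K i (Suc q)" using y[of i] Suc \<open>k = Suc j\<close> q k by (simp add: q_def Suc_diff_Suc)
        moreover have "Suc m - j = Suc q" using q \<open>k = Suc j\<close> k by simp
        ultimately show ?thesis using D(6)[of "y i" i "Suc q"] Suc by (simp add: corr_def)
      qed
      then have "dh K j (Suc q) (x j) = dh K j (Suc q) (dv K j q (y j))"
        using lin_on_add[OF D(4) lin_on_mem[OF D(3) yj] cj] yx[of j] Suc q by simp
      moreover have "dv K k q (x k) + dh K j (Suc q) (x j) = 0"
        using dx[of k] cd_tot(2)[of j n K x] Suc q k \<open>n = Suc m\<close> by simp
      moreover have "dv K k q (dh K j q (y j)) + dh K j (Suc q) (dv K j q (y j)) = 0"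
        using D(7)[OF yj] Suc by simp
      moreover have "dv K k q (x k - dh K j q (y j)) = dv K k q (x k) - dv K k q (dh K j q (y j))"
        using lin_on_mem[OF D(4) yj] Suc by (intro lin_on_diff[OF D(1,1,2,3) xk]) simp
      ultimately have "dv K k q (x k - dh K j q (y j)) = 0"
        by (metis add_right_cancel diff_self)
      then show ?thesis using Suc q by (simp add: corr_def)
    qed
    have "\<exists>y. (\<forall>p<k. y p \<in> bob K p (m - p) \<and> x p = dv K p (m - p) (y p) + corr y p) \<and> (\<forall>p\<ge>k. y p = 0)"
      if "k \<le> n" for k using that
    proof (induction k)
      case 0 show ?case by (intro exI[of _ 0]) simp
    next
      case (Suc k)
      then obtain y where y: "\<And>p. p < k \<Longrightarrow> y p \<in> bob K p (m - p)"
        "\<And>p. p < k \<Longrightarrow> x p = dv K p (m - p) (y p) + corr y p" "\<And>p. p \<ge> k \<Longrightarrow> y p = 0" by auto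
      have k: "k \<le> m" using Suc \<open>n = Suc m\<close> by simp
      then have q: "Suc m - k = Suc (m - k)" by simp
      have "x k - corr y k \<in> bob K k (Suc (m - k))"
        using k.subspace_diff[OF D(2) xb[of k] ] corr_mem[of k y] y(1) k q \<open>n = Suc m\<close> by simp
      moreover have "dv K k (Suc (m - k)) (x k - corr y k) = 0" using closed[of k y] y k q by simp
      ultimately obtain v where v: "v \<in> bob K k (m - k)" "dv K k (m - k) v = x k - corr y k" using ex by blast
      define w where "w p = (if p = k then v else y p)" for p
      have "corr w p = corr y p" if "p \<le> k" for p using that by (auto simp: corr_def w_def)
      moreover have "w k = v" "\<And>p. p \<noteq> k \<Longrightarrow> w p = y p" by (simp_all add: w_def)
      ultimately show ?case
        by (intro exI[of _ w]) (use y v in \<open>auto simp: less_Suc_eq\<close>)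
    qed
    from this[of n] obtain y where y: "\<And>p. p < n \<Longrightarrow> y p \<in> bob K p (m - p)"
      "\<And>p. p < n \<Longrightarrow> x p = dv K p (m - p) (y p) + corr y p" "\<And>p. p \<ge> n \<Longrightarrow> y p = 0" by auto
    \<comment> \<open>Column n sits in vertical degree 0, where no primitive can be chosen. The
      remainder is closed there, so \<open>ex0\<close> forces it to vanish.\<close>
    have "x n - corr y n \<in> bob K n 0"
      using k.subspace_diff[OF D(2) xb[of n]] corr_mem[of n y] y(1) \<open>n = Suc m\<close> by simp
    from ex0[OF this] closed[of n y] y Suc have last: "x n = corr y n" by simp
    have "y \<in> cob (tot K) m" using y Suc by (auto simp: mem_cob_tot)
    moreover have "cd (tot K) m y = x"
    proof
      fix p
      consider "p = 0" | p' where "p = Suc p'" "p' < m" | "p = Suc m" | "Suc m < p" by (cases p) force+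
      then show "cd (tot K) m y p = x p"
        by cases (use y(2)[of p] last Suc x0[of p] in \<open>auto simp: cd_tot corr_def\<close>)
    qed
    ultimately show ?thesis using Suc by (auto simp: coboundaries_def)
  qed
qed

section \<open>Cocyclic modules\<close>

lemma funpow_compose_Suc: "(f ^^ Suc k) x = (f ^^ k) (f x)"
  by (simp add: funpow_swap1)

text \<open>The terms with i < j cancel against those with j \<le> i under the bijection (j, i)
  \<mapsto> (i, j - 1), which lowers the total index by one and so flips the sign. The bound
  \<open>N\<close> is free because b sums over one coface more than b'.\<close>

lemma (in vector_space) alternating_double_sum:
  assumes a: "\<And>i j. i < j \<Longrightarrow> j \<le> Suc N \<Longrightarrow> a j i = a i (j - 1)"
  shows "(\<Sum>j\<le>Suc N. \<Sum>i\<le>N. scale ((-1) ^ (i + j)) (a j i)) = 0"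
proof -
  let ?f = "\<lambda>(j, i). scale ((-1) ^ (i + j)) (a j i)"
  let ?A = "{(j, i). i < j \<and> j \<le> Suc N}" and ?B = "{(j, i). j \<le> i \<and> i \<le> N}"
  have fin: "finite ?A" "finite ?B"
    by (rule finite_subset[of _ "{..Suc N} \<times> {..Suc N}"], auto)+
  have "(\<Sum>j\<le>Suc N. \<Sum>i\<le>N. scale ((-1) ^ (i + j)) (a j i)) = sum ?f ({..Suc N} \<times> {..N})"
    by (simp add: sum.cartesian_product)
  also have "{..Suc N} \<times> {..N} = ?A \<union> ?B" by auto
  also have "sum ?f (?A \<union> ?B) = sum ?f ?A + sum ?f ?B"
    by (rule sum.union_disjoint[OF fin]) auto
  also have "sum ?f ?A = (\<Sum>x\<in>?B. - ?f x)"
  proof (rule sum.reindex_bij_witness[of _ "\<lambda>(j, i). (Suc i, j)" "\<lambda>(j, i). (i, j - 1)"])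
    fix x assume "x \<in> ?A"
    then obtain j i where x: "x = (Suc j, i)" "i \<le> j" "j \<le> N" by (cases x, cases "fst x") auto
    then show "- ?f (case x of (j, i) \<Rightarrow> (i, j - 1)) = ?f x"
      using a[of i "Suc j"] by (simp add: add.commute)
  qed auto
  finally show ?thesis by (simp add: sum_negf)
qed

section \<open>The operators b, b', lambda and N of a cocyclic module\<close>

locale cocyclic_loc =
  fixes C :: "('k::field, 'c::ab_group_add) cocyclic"
  assumes cocyclic: "cocyclic_module C"
begin

lemmas cocyclicD = cocyclic[unfolded cocyclic_module_def]

lemmas vs = cocyclicD[THEN conjunct1, rule_format]
lemmas sub = cocyclicD[THEN conjunct2, THEN conjunct1, rule_format]
lemmas face_lin = cocyclicD[THEN conjunct2, THEN conjunct2, THEN conjunct1, rule_format]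
lemmas degen_lin = cocyclicD[THEN conjunct2, THEN conjunct2, THEN conjunct2, THEN conjunct1, rule_format]
lemmas cyc_lin = cocyclicD[THEN conjunct2, THEN conjunct2, THEN conjunct2, THEN conjunct2, THEN conjunct1, rule_format]
lemmas face_face = cocyclicD[THEN conjunct2, THEN conjunct2, THEN conjunct2, THEN conjunct2, THEN conjunct2, THEN conjunct1, rule_format]
lemmas degen_face = cocyclicD[THEN conjunct2, THEN conjunct2, THEN conjunct2, THEN conjunct2, THEN conjunct2, THEN conjunct2, THEN conjunct2, THEN conjunct1, rule_format]
lemmas degen_face_ne = cocyclicD[THEN conjunct2, THEN conjunct2, THEN conjunct2, THEN conjunct2, THEN conjunct2, THEN conjunct2, THEN conjunct2, THEN conjunct2, THEN conjunct1, rule_format]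
lemmas cyc_face_all = cocyclicD[THEN conjunct2, THEN conjunct2, THEN conjunct2, THEN conjunct2, THEN conjunct2, THEN conjunct2, THEN conjunct2, THEN conjunct2, THEN conjunct2, THEN conjunct1, rule_format]
lemmas cyc_face_0 = cocyclicD[THEN conjunct2, THEN conjunct2, THEN conjunct2, THEN conjunct2, THEN conjunct2, THEN conjunct2, THEN conjunct2, THEN conjunct2, THEN conjunct2, THEN conjunct2, THEN conjunct1, rule_format]
lemmas cyc_power = cocyclicD[THEN conjunct2, THEN conjunct2, THEN conjunct2, THEN conjunct2, THEN conjunct2, THEN conjunct2, THEN conjunct2, THEN conjunct2, THEN conjunct2, THEN conjunct2, THEN conjunct2, THEN conjunct2, THEN conjunct2, rule_format]

lemma degen_face_id: "x \<in> Cob C n \<Longrightarrow> j \<le> n \<Longrightarrow> cdegen C n j (cface C n j x) = x"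
  by (rule degen_face[THEN conjunct1])

lemma degen_face_less: "x \<in> Cob C (Suc n) \<Longrightarrow> j \<le> Suc n \<Longrightarrow> i < j \<Longrightarrow>
    cdegen C (Suc n) j (cface C (Suc n) i x) = cface C n i (cdegen C n (j - 1) x)"
  by (rule degen_face_ne[THEN conjunct1, rule_format]) simp_all

lemma cyc_face: "x \<in> Cob C n \<Longrightarrow> 1 \<le> i \<Longrightarrow> i \<le> Suc n \<Longrightarrow>
    ccyc C (Suc n) (cface C n i x) = cface C n (i - 1) (ccyc C n x)"
  by (rule cyc_face_all) simp_all

sublocale v: vector_space "scl C" by (rule vs)

lemmas sub_intros = v.subspace_0[OF sub] v.subspace_add[OF sub] v.subspace_diff[OF sub]
  v.subspace_scale[OF sub] v.subspace_sum[OF sub] v.subspace_neg[OF sub]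

lemma lin_on_sum:
  assumes f: "lin_on (scl C) (Cob C n) (scl C) W f" and x: "\<And>i. i \<in> I \<Longrightarrow> x i \<in> Cob C n"
  shows "f (\<Sum>i\<in>I. x i) = (\<Sum>i\<in>I. f (x i))"
  using x
proof (induction I rule: infinite_finite_induct)
  case (insert i I)
  then show ?case using lin_on_add[OF f, of "x i" "sum x I"] by (simp add: sub_intros)
qed (simp_all add: lin_on_zero[OF vs sub f])

lemma lin_on_combination:
  assumes f: "lin_on (scl C) (Cob C n) (scl C) W f" and x: "\<And>i. i \<in> I \<Longrightarrow> x i \<in> Cob C n"
  shows "f (\<Sum>i\<in>I. scl C (c i) (x i)) = (\<Sum>i\<in>I. scl C (c i) (f (x i)))"
proof -
  have "f (\<Sum>i\<in>I. scl C (c i) (x i)) = (\<Sum>i\<in>I. f (scl C (c i) (x i)))"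
    by (rule lin_on_sum[OF f]) (simp add: x sub_intros)
  then show ?thesis by (simp add: lin_on_scale[OF f x])
qed

lemma lin_on_lincomb:
  assumes "\<And>i. i \<in> I \<Longrightarrow> lin_on (scl C) (Cob C n) (scl C) (Cob C m) (f i)"
  shows "lin_on (scl C) (Cob C n) (scl C) (Cob C m) (\<lambda>x. \<Sum>i\<in>I. scl C (c i) (f i x))"
  unfolding lin_on_def
proof (intro conjI ballI allI)
  fix x assume x: "x \<in> Cob C n"
  show "(\<Sum>i\<in>I. scl C (c i) (f i x)) \<in> Cob C m"
    by (intro sub_intros) (use assms x lin_on_mem in blast)
  show "(\<Sum>i\<in>I. scl C (c i) (f i (scl C d x))) = scl C d (\<Sum>i\<in>I. scl C (c i) (f i x))" for d
    by (simp add: lin_on_scale[OF assms x] v.scale_sum_right mult.commute)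
  fix y assume y: "y \<in> Cob C n"
  show "(\<Sum>i\<in>I. scl C (c i) (f i (x + y))) = (\<Sum>i\<in>I. scl C (c i) (f i x)) + (\<Sum>i\<in>I. scl C (c i) (f i y))"
    by (simp add: lin_on_add[OF assms x y] v.scale_right_distrib sum.distrib)
qed

lemma b_lin: "lin_on (scl C) (Cob C n) (scl C) (Cob C (Suc n)) (b_op C n)"
  unfolding b_op_def[abs_def] by (rule lin_on_lincomb) (simp add: face_lin)

lemma b'_lin: "lin_on (scl C) (Cob C n) (scl C) (Cob C (Suc n)) (b'_op C n)"
  unfolding b'_op_def[abs_def] by (rule lin_on_lincomb) (simp add: face_lin)

lemma lambda_lin: "lin_on (scl C) (Cob C n) (scl C) (Cob C n) (lambda_op C n)"
  using lin_on_lincomb[of "{0::nat}" n n "\<lambda>_. ccyc C n" "\<lambda>_. (-1) ^ n"] cyc_lin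
  by (simp add: lambda_op_def[abs_def])

lemma funpow_lin:
  assumes "lin_on (scl C) (Cob C n) (scl C) (Cob C n) f"
  shows "lin_on (scl C) (Cob C n) (scl C) (Cob C n) (f ^^ k)"
proof (induction k)
  case 0 then show ?case by (simp add: lin_on_def)
next
  case (Suc k)
  then show ?case using lin_on_comp[OF Suc assms] by (simp add: o_def)
qed

lemma N_lin: "lin_on (scl C) (Cob C n) (scl C) (Cob C n) (N_op C n)"
  using lin_on_lincomb[of "{..n}" n n "\<lambda>j. lambda_op C n ^^ j" "\<lambda>_. 1"] funpow_lin[OF lambda_lin]
  by (simp add: N_op_def[abs_def])

lemmas op_mem = lin_on_mem[OF b_lin] lin_on_mem[OF b'_lin] lin_on_mem[OF lambda_lin] lin_on_mem[OF N_lin]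
  lin_on_mem[OF funpow_lin[OF lambda_lin]] lin_on_mem[OF face_lin] lin_on_mem[OF degen_lin] lin_on_mem[OF cyc_lin]

lemma b_b:
  assumes x: "x \<in> Cob C n"
  shows "b_op C (Suc n) (b_op C n x) = 0"
proof -
  have "b_op C (Suc n) (b_op C n x) =
      (\<Sum>j\<le>Suc (Suc n). \<Sum>i\<le>Suc n. scl C ((-1) ^ (i + j)) (cface C (Suc n) j (cface C n i x)))"
    unfolding b_op_def
    by (intro sum.cong refl, subst lin_on_combination[OF face_lin[of _ "Suc n"]])
      (simp_all add: op_mem x v.scale_sum_right power_add mult.commute del: sum.atMost_Suc power_Suc)
  also have "\<dots> = 0" by (rule v.alternating_double_sum) (simp add: face_face[OF x])
  finally show ?thesis .
qed

lemma b'_b':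
  assumes x: "x \<in> Cob C n"
  shows "b'_op C (Suc n) (b'_op C n x) = 0"
proof -
  have "b'_op C (Suc n) (b'_op C n x) =
      (\<Sum>j\<le>Suc n. \<Sum>i\<le>n. scl C ((-1) ^ (i + j)) (cface C (Suc n) j (cface C n i x)))"
    unfolding b'_op_def
    by (intro sum.cong refl, subst lin_on_combination[OF face_lin[of _ "Suc n"]])
      (simp_all add: op_mem x v.scale_sum_right power_add mult.commute del: sum.atMost_Suc power_Suc)
  also have "\<dots> = 0" by (rule v.alternating_double_sum) (simp add: face_face[OF x])
  finally show ?thesis .
qed

text \<open>With its sign built in, a coface is shifted by lambda without any further sign: the
  coface i + 1 becomes the coface i, and the coface 0 becomes the last one.\<close>

definition sface :: "nat \<Rightarrow> nat \<Rightarrow> 'c \<Rightarrow> 'c" where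
  "sface n i x = scl C ((-1) ^ i) (cface C n i x)"

lemma sface_lin: "i \<le> Suc n \<Longrightarrow> lin_on (scl C) (Cob C n) (scl C) (Cob C (Suc n)) (sface n i)"
  using lin_on_lincomb[of "{0::nat}" n "Suc n" "\<lambda>_. cface C n i" "\<lambda>_. (-1) ^ i"] face_lin
  by (simp add: sface_def[abs_def])

lemma b_sface: "b_op C n x = (\<Sum>i\<le>Suc n. sface n i x)"
  by (simp add: b_op_def sface_def)

lemma b'_sface: "b'_op C n x = (\<Sum>i\<le>n. sface n i x)"
  by (simp add: b'_op_def sface_def)

lemma lambda_sface:
  assumes "x \<in> Cob C n" "i \<le> n"
  shows "lambda_op C (Suc n) (sface n (Suc i) x) = sface n i (lambda_op C n x)"
proof -
  have "lambda_op C (Suc n) (sface n (Suc i) x) =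
      scl C ((-1) ^ Suc n * (-1) ^ Suc i) (cface C n i (ccyc C n x))"
    using assms cyc_face[of x n "Suc i"]
    by (simp add: lambda_op_def sface_def lin_on_scale[OF cyc_lin] op_mem del: power_Suc)
  also have "\<dots> = scl C ((-1) ^ i * (-1) ^ n) (cface C n i (ccyc C n x))" by (simp add: mult.commute)
  also have "\<dots> = sface n i (lambda_op C n x)"
    using assms by (simp add: lambda_op_def sface_def lin_on_scale[OF face_lin] op_mem)
  finally show ?thesis .
qed

lemma lambda_sface_0:
  assumes "x \<in> Cob C n"
  shows "lambda_op C (Suc n) (sface n 0 x) = sface n (Suc n) x"
  using assms by (simp add: lambda_op_def sface_def cyc_face_0)

text \<open>The sign collected along a full rotation is (-1)^(n (n + 1)) = 1.\<close>

lemma lambda_power: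
  assumes x: "x \<in> Cob C n"
  shows "(lambda_op C n ^^ Suc n) x = x"
proof -
  have "(lambda_op C n ^^ k) x = scl C ((-1) ^ (n * k)) ((ccyc C n ^^ k) x)" for k
    by (induction k)
      (simp_all add: lambda_op_def lin_on_scale[OF cyc_lin] lin_on_mem[OF funpow_lin[OF cyc_lin]] x power_add)
  from this[of "Suc n"] show ?thesis using cyc_power[OF x] by simp
qed

lemma N_lambda:
  assumes x: "x \<in> Cob C n"
  shows "N_op C n (lambda_op C n x) = N_op C n x" "lambda_op C n (N_op C n x) = N_op C n x"
proof -
  \<comment> \<open>Shifting the summation index trades the first term x for the term of the full
    rotation, which is x again.\<close>
  have shift: "(\<Sum>j\<le>n. (lambda_op C n ^^ Suc j) x) = N_op C n x"
  proof -
    have "(\<Sum>j\<le>Suc n. (lambda_op C n ^^ j) x) = x + (\<Sum>j\<le>n. (lambda_op C n ^^ Suc j) x)"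
      by (subst sum.atMost_Suc_shift) simp
    moreover have "(\<Sum>j\<le>Suc n. (lambda_op C n ^^ j) x) = N_op C n x + x"
      unfolding sum.atMost_Suc lambda_power[OF x] N_op_def ..
    ultimately show ?thesis by (simp add: add.commute)
  qed
  have "N_op C n (lambda_op C n x) = (\<Sum>j\<le>n. (lambda_op C n ^^ Suc j) x)"
    by (simp add: N_op_def funpow_swap1)
  then show "N_op C n (lambda_op C n x) = N_op C n x" unfolding shift .
  have "lambda_op C n (N_op C n x) = (\<Sum>j\<le>n. (lambda_op C n ^^ Suc j) x)"
    unfolding N_op_def by (subst lin_on_sum[OF lambda_lin]) (simp_all add: op_mem x)
  then show "lambda_op C n (N_op C n x) = N_op C n x" unfolding shift .
qed

text \<open>lambda moves the signed coface 0 to the last place and lowers the index of each other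
  one. Hence the last coface cancels from b - lambda b, and what remains involves only the cofaces
  of b'.\<close>

lemma b_lambda:
  assumes x: "x \<in> Cob C n"
  shows "b_op C n x - lambda_op C (Suc n) (b_op C n x) = b'_op C n x - b'_op C n (lambda_op C n x)"
proof -
  have "lambda_op C (Suc n) (b_op C n x) = (\<Sum>i\<le>Suc n. lambda_op C (Suc n) (sface n i x))"
    unfolding b_sface by (rule lin_on_sum[OF lambda_lin]) (simp add: lin_on_mem[OF sface_lin x])
  also have "\<dots> = sface n (Suc n) x + (\<Sum>i\<le>n. sface n i (lambda_op C n x))"
    by (subst sum.atMost_Suc_shift) (simp add: lambda_sface_0 lambda_sface x)
  finally show ?thesis by (simp add: b_sface b'_sface)
qed

text \<open>lambda fixes N x, so every signed coface of N x is a rotation of the coface 0, and b N x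
  runs through a full orbit: it is the norm of coface 0 of N x. Expanding this inner norm, coface 0
  of lambda^i x is the i-th rotation of coface i of x, and the outer norm does not see
  rotations.\<close>

lemma b_N:
  assumes x: "x \<in> Cob C n"
  shows "b_op C n (N_op C n x) = N_op C (Suc n) (b'_op C n x)"
proof -
  let ?L = "lambda_op C (Suc n)" and ?l = "lambda_op C n"
  have rot: "(?L ^^ i) (sface n i y) = sface n 0 ((?l ^^ i) y)" if "i \<le> Suc n" "y \<in> Cob C n" for i y
    using that
  proof (induction i arbitrary: y)
    case (Suc i)
    then show ?case
      using Suc.IH[of "?l y"] lambda_sface[of y n i] by (simp add: op_mem funpow_compose_Suc del: funpow.simps)
  qed simp
  have NL: "N_op C (Suc n) ((?L ^^ i) z) = N_op C (Suc n) z" if "z \<in> Cob C (Suc n)" for i z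
  proof (induction i)
    case (Suc i)
    then show ?case using N_lambda(1)[OF op_mem(5)[OF that, of i]] by simp
  qed simp
  \<comment> \<open>The rotation in degree n + 1 has order n + 2, so its i-th power is inverted by
    the power n + 2 - i. As i runs through 0, ..., n + 1, these exponents run through 1, ..., n +
    2.\<close>
  have E: "sface n i (N_op C n x) = (?L ^^ (Suc n - i + 1)) (sface n 0 (N_op C n x))" if i: "i \<le> Suc n" for i
  proof -
    have "(?l ^^ i) (N_op C n x) = N_op C n x" for i
      by (induction i) (simp_all add: N_lambda(2)[OF x])
    then have "(?L ^^ i) (sface n i (N_op C n x)) = sface n 0 (N_op C n x)"
      using rot[OF i op_mem(4)[OF x]] by simp
    then have "(?L ^^ (Suc (Suc n) - i)) (sface n 0 (N_op C n x)) =
        (?L ^^ (Suc (Suc n) - i)) ((?L ^^ i) (sface n i (N_op C n x)))" by simp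
    also have "\<dots> = (?L ^^ (Suc (Suc n) - i + i)) (sface n i (N_op C n x))"
      by (simp only: funpow_add o_apply)
    also have "Suc (Suc n) - i + i = Suc (Suc n)" using i by simp
    finally have "(?L ^^ (Suc (Suc n) - i)) (sface n 0 (N_op C n x)) = sface n i (N_op C n x)"
      using lambda_power[OF lin_on_mem[OF sface_lin[OF i] op_mem(4)[OF x]]] by simp
    moreover have "Suc n - i + 1 = Suc (Suc n) - i" using i by simp
    ultimately show ?thesis by (simp only:)
  qed
  have "b_op C n (N_op C n x) = (\<Sum>i\<le>Suc n. (?L ^^ (Suc n - i + 1)) (sface n 0 (N_op C n x)))"
    unfolding b_sface by (intro sum.cong refl E) simp
  also have "\<dots> = (\<Sum>i\<le>Suc n. (?L ^^ (i + 1)) (sface n 0 (N_op C n x)))"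
    by (rule sum.reindex_bij_witness[of _ "\<lambda>i. Suc n - i" "\<lambda>i. Suc n - i"]) auto
  also have "\<dots> = N_op C (Suc n) (?L (sface n 0 (N_op C n x)))"
    by (simp add: N_op_def funpow_swap1)
  also have "\<dots> = N_op C (Suc n) (sface n 0 (N_op C n x))"
    by (rule N_lambda(1)) (simp add: lin_on_mem[OF sface_lin] op_mem x)
  also have "sface n 0 (N_op C n x) = (\<Sum>i\<le>n. sface n 0 ((?l ^^ i) x))"
    unfolding N_op_def by (rule lin_on_sum[OF sface_lin]) (simp_all add: op_mem x)
  also have "\<dots> = (\<Sum>i\<le>n. (?L ^^ i) (sface n i x))" by (rule sum.cong) (simp_all add: rot x)
  also have "N_op C (Suc n) \<dots> = (\<Sum>i\<le>n. N_op C (Suc n) ((?L ^^ i) (sface n i x)))"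
    by (rule lin_on_sum[OF N_lin]) (simp add: op_mem lin_on_mem[OF sface_lin] x)
  also have "\<dots> = (\<Sum>i\<le>n. N_op C (Suc n) (sface n i x))"
    by (rule sum.cong) (simp_all add: NL lin_on_mem[OF sface_lin] x)
  also have "\<dots> = N_op C (Suc n) (b'_op C n x)"
    unfolding b'_sface by (rule lin_on_sum[OF N_lin, symmetric]) (simp add: lin_on_mem[OF sface_lin] x)
  finally show ?thesis .
qed

lemma cochain_complex_hoc: "cochain_complex (hoc C)"
  unfolding cochain_complex_def hoc_def by (simp add: vs sub b_lin b_b)

lemma neg_lin:
  assumes "lin_on (scl C) (Cob C n) (scl C) (Cob C m) f"
  shows "lin_on (scl C) (Cob C n) (scl C) (Cob C m) (\<lambda>x. - f x)"
  using lin_on_lincomb[of "{0::nat}" n m "\<lambda>_. f" "\<lambda>_. -1"] assms by simp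

lemma one_minus_lambda_lin: "lin_on (scl C) (Cob C n) (scl C) (Cob C n) (\<lambda>x. x - lambda_op C n x)"
  using lin_on_lincomb[of "{0, 1::nat}" n n "\<lambda>i x. if i = 0 then x else lambda_op C n x" "\<lambda>i. if i = 0 then 1 else -1"]
    lambda_lin by (simp add: lin_on_def)

lemma bicomplex_cy: "bicomplex (cy C)"
proof -
  have "b'_op C n (- x) = - b'_op C n x" if "x \<in> Cob C n" for x n
    by (rule lin_on_neg[OF vs vs b'_lin that])
  moreover have "N_op C n (- x) = - N_op C n x" if "x \<in> Cob C n" for x n
    by (rule lin_on_neg[OF vs vs N_lin that])
  moreover have "N_op C n (x - lambda_op C n x) = 0" if "x \<in> Cob C n" for x n
    using lin_on_diff[OF vs vs sub N_lin that op_mem(3)[OF that]] N_lambda(1)[OF that] by simp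
  moreover have "b'_op C n (x - lambda_op C n x) = b'_op C n x - b'_op C n (lambda_op C n x)" if "x \<in> Cob C n" for x n
    using lin_on_diff[OF vs vs sub b'_lin that op_mem(3)[OF that]] .
  moreover have "lin_on (scl C) (Cob C q) (scl C) (Cob C (Suc q)) (\<lambda>x. if even p then b_op C q x else - b'_op C q x)" for p q :: nat
    using b_lin[of q] neg_lin[OF b'_lin[of q]] by (cases "even p") simp_all
  moreover have "lin_on (scl C) (Cob C q) (scl C) (Cob C q) (\<lambda>x. if even p then x - lambda_op C q x else N_op C q x)" for p q :: nat
    using N_lin[of q] one_minus_lambda_lin[of q] by (cases "even p") simp_all
  ultimately show ?thesis
    unfolding bicomplex_def cy_def bicpx.simps
    by (intro conjI allI ballI vs sub)
      (simp_all add: b_b b'_b' op_mem N_lambda(2) b_N b_lambda)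
qed

text \<open>The last codegeneracy contracts b': it undoes the highest coface of b' and passes
  through the lower ones to the last codegeneracy one degree below. In degree 0, b' is the coface 0,
  which the codegeneracy shows to be injective.\<close>

lemma b'_exact:
  assumes z: "z \<in> Cob C n" "b'_op C n z = 0"
  shows "case n of 0 \<Rightarrow> z = 0 | Suc m \<Rightarrow> z = b'_op C m (scl C ((-1) ^ m) (cdegen C m m z))"
proof (cases n)
  case 0
  have "cdegen C 0 0 (cface C 0 0 z) = z" using degen_face_id[of z 0 0] z 0 by simp
  moreover have "cface C 0 0 z = 0" using z 0 by (simp add: b'_op_def)
  ultimately show ?thesis using lin_on_zero[OF vs sub degen_lin[of 0 0]] 0 by simp
next
  case (Suc m)
  let ?s = "\<lambda>i. scl C ((-1) ^ i) (cdegen C n n (cface C n i z))"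
  have "0 = cdegen C n n (b'_op C n z)" using lin_on_zero[OF vs sub degen_lin[of n n]] z by simp
  also have "\<dots> = (\<Sum>i\<le>n. ?s i)"
    unfolding b'_op_def by (rule lin_on_combination[OF degen_lin]) (auto simp: op_mem z)
  also have "\<dots> = (\<Sum>i\<le>m. ?s i) + scl C ((-1) ^ n) z"
    using degen_face_id[of z n n] z Suc by simp
  also have "(\<Sum>i\<le>m. ?s i) = (\<Sum>i\<le>m. scl C ((-1) ^ i) (cface C m i (cdegen C m m z)))"
    using Suc degen_face_less[of z m "Suc m"] z by (intro sum.cong) auto
  also have "\<dots> = b'_op C m (cdegen C m m z)" by (simp add: b'_op_def)
  finally have "b'_op C m (cdegen C m m z) = - scl C ((-1) ^ n) z" by (simp add: eq_neg_iff_add_eq_0)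
  moreover have "b'_op C m (scl C ((-1) ^ m) (cdegen C m m z)) = scl C ((-1) ^ m) (b'_op C m (cdegen C m m z))"
    using z Suc by (intro lin_on_scale[OF b'_lin]) (simp add: op_mem)
  ultimately show ?thesis using Suc by (simp flip: power_add)
qed

end

text \<open>Only the inner cofaces need separate treatment, as the last one is \<open>\<tau> \<delta>\<^sub>0\<close>.\<close>

lemma cocyclic_moduleI:
  assumes vs: "vector_space (scl C)" and sub: "\<And>n. module.subspace (scl C) (Cob C n)"
    and fl: "\<And>n i. i \<le> n \<Longrightarrow> lin_on (scl C) (Cob C n) (scl C) (Cob C (Suc n)) (cface C n i)"
    and dl: "\<And>n i. i \<le> n \<Longrightarrow> lin_on (scl C) (Cob C (Suc n)) (scl C) (Cob C n) (cdegen C n i)"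
    and cl: "\<And>n. lin_on (scl C) (Cob C n) (scl C) (Cob C n) (ccyc C n)"
    and fs: "\<And>n x. x \<in> Cob C n \<Longrightarrow> cface C n (Suc n) x = ccyc C (Suc n) (cface C n 0 x)"
    and ff: "\<And>n x i j. x \<in> Cob C n \<Longrightarrow> j \<le> Suc n \<Longrightarrow> i < j \<Longrightarrow>
      cface C (Suc n) j (cface C n i x) = cface C (Suc n) i (cface C n (j - 1) x)"
    and dd: "\<And>n x i j. x \<in> Cob C (n + 2) \<Longrightarrow> j \<le> n \<Longrightarrow> i \<le> j \<Longrightarrow>
      cdegen C n j (cdegen C (Suc n) i x) = cdegen C n i (cdegen C (Suc n) (Suc j) x)"
    and df: "\<And>n x j. x \<in> Cob C n \<Longrightarrow> j \<le> n \<Longrightarrow> cdegen C n j (cface C n j x) = x"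
    and dfS: "\<And>n x j. x \<in> Cob C n \<Longrightarrow> j \<le> n \<Longrightarrow> cdegen C n j (cface C n (Suc j) x) = x"
    and df1: "\<And>n x i j. x \<in> Cob C (Suc n) \<Longrightarrow> j \<le> Suc n \<Longrightarrow> i < j \<Longrightarrow>
      cdegen C (Suc n) j (cface C (Suc n) i x) = cface C n i (cdegen C n (j - 1) x)"
    and df2: "\<And>n x i j. x \<in> Cob C (Suc n) \<Longrightarrow> i \<le> Suc n \<Longrightarrow> Suc j < i \<Longrightarrow>
      cdegen C (Suc n) j (cface C (Suc n) i x) = cface C n (i - 1) (cdegen C n j x)"
    and cf: "\<And>n x i. x \<in> Cob C n \<Longrightarrow> 1 \<le> i \<Longrightarrow> i \<le> n \<Longrightarrow> ccyc C (Suc n) (cface C n i x) = cface C n (i - 1) (ccyc C n x)"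
    and cd: "\<And>n x i. x \<in> Cob C (Suc n) \<Longrightarrow> 1 \<le> i \<Longrightarrow> i \<le> n \<Longrightarrow> ccyc C n (cdegen C n i x) = cdegen C n (i - 1) (ccyc C (Suc n) x)"
    and cd0: "\<And>n x. x \<in> Cob C (Suc n) \<Longrightarrow> ccyc C n (cdegen C n 0 x) = cdegen C n n (ccyc C (Suc n) (ccyc C (Suc n) x))"
    and cp: "\<And>n x. x \<in> Cob C n \<Longrightarrow> (ccyc C n ^^ Suc n) x = x"
  shows "cocyclic_module C"
proof -
  interpret v: vector_space "scl C" by (rule vs)
  note mem = lin_on_mem[OF cl] lin_on_mem[OF fl] lin_on_mem[OF dl]
  have fl': "lin_on (scl C) (Cob C n) (scl C) (Cob C (Suc n)) (cface C n i)" if "i \<le> Suc n" for n i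
  proof (cases "i = Suc n")
    case True
    have "lin_on (scl C) (Cob C n) (scl C) (Cob C (Suc n)) (\<lambda>x. ccyc C (Suc n) (cface C n 0 x))"
      by (rule lin_on_comp[OF fl cl]) simp
    then show ?thesis unfolding True lin_on_def
      by (simp add: fs v.subspace_add[OF sub] v.subspace_scale[OF sub])
  qed (use that fl in simp)
  \<comment> \<open>The rotation relation for the last coface is a consequence of the order. By the
    inner relations, n rotations turn coface n into coface 0, one more makes it the last coface, and
    n + 2 rotations are the identity.\<close>
  have cyc_face: "ccyc C (Suc n) (cface C n (Suc n) x) = cface C n n (ccyc C n x)" if x: "x \<in> Cob C n" for n x
  proof -
    let ?t = "ccyc C (Suc n)"
    have rot: "(?t ^^ k) (cface C n k y) = cface C n 0 ((ccyc C n ^^ k) y)" if "k \<le> n" "y \<in> Cob C n" for k y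
      using that
    proof (induction k arbitrary: y)
      case (Suc k)
      then show ?case using Suc.IH[of "ccyc C n y"] cf[of y n "Suc k"] mem(1) by (simp add: funpow_compose_Suc del: funpow.simps)
    qed simp
    have "(?t ^^ n) (cface C n n (ccyc C n x)) = cface C n 0 ((ccyc C n ^^ n) (ccyc C n x))"
      using rot[of n "ccyc C n x"] mem(1)[OF x] by simp
    also have "\<dots> = cface C n 0 x" using cp[OF x] by (simp only: funpow_compose_Suc)
    finally have "?t (?t ((?t ^^ n) (cface C n n (ccyc C n x)))) = ?t (cface C n (Suc n) x)"
      using fs[OF x] by simp
    moreover have "?t (?t ((?t ^^ n) (cface C n n (ccyc C n x)))) = (?t ^^ Suc (Suc n)) (cface C n n (ccyc C n x))"
      by simp
    ultimately show ?thesis using cp[OF mem(2)[of n n, OF order_refl mem(1)[OF x]]] by (simp only:)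
  qed
  have cf': "ccyc C (Suc n) (cface C n i x) = cface C n (i - 1) (ccyc C n x)" if "x \<in> Cob C n" "1 \<le> i" "i \<le> Suc n" for n i x
    using cyc_face[OF that(1)] cf[OF that(1,2)] that(3) by (cases "i = Suc n") auto
  have ff': "cface C (Suc n) j (cface C n i x) = cface C (Suc n) i (cface C n (j - 1) x)"
    if x: "x \<in> Cob C n" and ij: "j \<le> n + 2" "i < j" for n i j x
  proof (cases "j = n + 2")
    case True
    have last: "cface C (Suc n) (n + 2) y = ccyc C (Suc (Suc n)) (cface C (Suc n) 0 y)" if "y \<in> Cob C (Suc n)" for y
      using fs[OF that] by simp
    \<comment> \<open>The outer coface is the last one, hence a rotated coface 0. Exchanging coface
      0 with the inner one and moving the rotation inward turns the inner coface 0 into the last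
      coface.\<close>
    have step: "cface C (Suc n) (n + 2) (cface C n i x) = cface C (Suc n) i (cface C n (Suc n) x)" if "i \<le> n" for i
    proof -
      have "cface C (Suc n) (n + 2) (cface C n i x) = ccyc C (Suc (Suc n)) (cface C (Suc n) 0 (cface C n i x))"
        using that x by (intro last mem(2))
      also have "cface C (Suc n) 0 (cface C n i x) = cface C (Suc n) (Suc i) (cface C n 0 x)"
        using ff[of x n "Suc i" 0] that x by simp
      also have "ccyc C (Suc (Suc n)) \<dots> = cface C (Suc n) i (ccyc C (Suc n) (cface C n 0 x))"
        using cf'[of "cface C n 0 x" "Suc n" "Suc i"] that x by (simp add: mem)
      finally show ?thesis by (simp add: fs x)
    qed
    show ?thesis
    proof (cases "i = Suc n")
      case False
      then show ?thesis using step[of i] True ij by simp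
    next
      \<comment> \<open>Here both cofaces are last ones, so two rotations appear. They are carried
        past coface 0, one at a time, until the outer coface has become coface n + 1.\<close>
      case i: True
      have m0: "cface C n 0 x \<in> Cob C (Suc n)" using x by (simp add: mem)
      have "cface C (Suc n) (n + 2) (cface C n (Suc n) x) =
          ccyc C (Suc (Suc n)) (cface C (Suc n) 0 (ccyc C (Suc n) (cface C n 0 x)))"
        using last[OF mem(1)[OF m0]] fs[OF x] by simp
      also have "cface C (Suc n) 0 (ccyc C (Suc n) (cface C n 0 x)) = ccyc C (Suc (Suc n)) (cface C (Suc n) 1 (cface C n 0 x))"
        using cf'[OF m0, of 1] by simp
      also have "cface C (Suc n) 1 (cface C n 0 x) = cface C (Suc n) 0 (cface C n 0 x)"
        using ff[of x n 1 0] x by simp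
      also have "ccyc C (Suc (Suc n)) \<dots> = cface C (Suc n) (n + 2) (cface C n 0 x)" using last[OF m0] by simp
      also have "ccyc C (Suc (Suc n)) \<dots> = cface C (Suc n) (Suc n) (ccyc C (Suc n) (cface C n 0 x))"
        using cyc_face[OF m0] by simp
      finally show ?thesis using True i fs[OF x] by simp
    qed
  qed (use ff[OF x] ij in simp)
  have df2': "cdegen C (Suc n) j (cface C (Suc n) i x) = cface C n (i - 1) (cdegen C n j x)"
    if x: "x \<in> Cob C (Suc n)" and ij: "i \<le> n + 2" "Suc j < i" for n i j x
  proof (cases "i = n + 2")
    case True
    then have j: "j \<le> n" using ij by simp
    have m0: "cface C (Suc n) 0 x \<in> Cob C (Suc (Suc n))" using x by (simp add: mem)
    have "cdegen C (Suc n) j (cface C (Suc n) i x) = cdegen C (Suc n) j (ccyc C (Suc (Suc n)) (cface C (Suc n) 0 x))"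
      using fs[OF x] True by simp
    also have "\<dots> = ccyc C (Suc n) (cdegen C (Suc n) (Suc j) (cface C (Suc n) 0 x))"
      using cd[OF m0, of "Suc j"] j by simp
    also have "cdegen C (Suc n) (Suc j) (cface C (Suc n) 0 x) = cface C n 0 (cdegen C n j x)"
      using df1[OF x, of "Suc j" 0] j by simp
    also have "ccyc C (Suc n) \<dots> = cface C n (Suc n) (cdegen C n j x)"
      using fs[of "cdegen C n j x" n] x j by (simp add: mem)
    finally show ?thesis using True by simp
  qed (use df2[OF x, of i j] ij in simp)
  show ?thesis
    unfolding cocyclic_module_def
    by (intro conjI allI ballI impI vs sub fl' dl cl dd df dfS df1 df2' cf' fs[symmetric] cd cd0 ff')
      (simp_all add: cp del: funpow.simps)
qed

section \<open>Morphisms of cocyclic modules that need not preserve degeneracies\<close>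

text \<open>Codegeneracies are left out because the inclusion does not preserve identities. The last
  coface is covered, being the rotation of coface 0.\<close>

definition precocyclic_morphism ::
  "('k::field, 'c::ab_group_add) cocyclic \<Rightarrow> ('k, 'd::ab_group_add) cocyclic \<Rightarrow> (nat \<Rightarrow> 'c \<Rightarrow> 'd) \<Rightarrow> bool" where
  "precocyclic_morphism C C' f \<longleftrightarrow>
     cocyclic_module C \<and> cocyclic_module C' \<and>
     (\<forall>n. lin_on (scl C) (Cob C n) (scl C') (Cob C' n) (f n)) \<and>
     (\<forall>n. \<forall>x\<in>Cob C n. \<forall>i\<le>n. f (Suc n) (cface C n i x) = cface C' n i (f n x)) \<and>
     (\<forall>n. \<forall>x\<in>Cob C n. f n (ccyc C n x) = ccyc C' n (f n x))"

locale precocyclic_morphism_loc =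
  fixes C :: "('k::field, 'c::ab_group_add) cocyclic" and C' :: "('k, 'd::ab_group_add) cocyclic"
    and f :: "nat \<Rightarrow> 'c \<Rightarrow> 'd"
  assumes precocyclic: "precocyclic_morphism C C' f"
begin

lemma source: "cocyclic_module C" and target: "cocyclic_module C'"
  and mor_lin: "lin_on (scl C) (Cob C n) (scl C') (Cob C' n) (f n)"
  and mor_inner: "x \<in> Cob C n \<Longrightarrow> i \<le> n \<Longrightarrow> f (Suc n) (cface C n i x) = cface C' n i (f n x)"
  and mor_cyc: "x \<in> Cob C n \<Longrightarrow> f n (ccyc C n x) = ccyc C' n (f n x)"
  using precocyclic unfolding precocyclic_morphism_def by blast+

sublocale src: cocyclic_loc C by unfold_locales (rule source)
sublocale tgt: cocyclic_loc C' by unfold_locales (rule target)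

lemma mor_face:
  assumes x: "x \<in> Cob C n" and i: "i \<le> Suc n"
  shows "f (Suc n) (cface C n i x) = cface C' n i (f n x)"
proof (cases "i = Suc n")
  case True
  have "f (Suc n) (ccyc C (Suc n) (cface C n 0 x)) = ccyc C' (Suc n) (cface C' n 0 (f n x))"
    using mor_cyc[of "cface C n 0 x" "Suc n"] mor_inner[OF x, of 0] lin_on_mem[OF src.face_lin x, of 0] by simp
  then show ?thesis using src.cyc_face_0[OF x] tgt.cyc_face_0[OF lin_on_mem[OF mor_lin x]] True by simp
next
  case False
  then show ?thesis using i mor_inner[OF x, of i] by simp
qed

lemma mor_sum:
  assumes "\<And>i. i \<in> I \<Longrightarrow> y i \<in> Cob C n"
  shows "f n (\<Sum>i\<in>I. y i) = (\<Sum>i\<in>I. f n (y i))"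
  using assms
proof (induction I rule: infinite_finite_induct)
  case (insert i I)
  then show ?case using lin_on_add[OF mor_lin, of "y i" n "sum y I"] by (simp add: src.sub_intros)
qed (simp_all add: lin_on_zero[OF src.vs src.sub mor_lin])

lemma mor_b:
  assumes x: "x \<in> Cob C n"
  shows "f (Suc n) (b_op C n x) = b_op C' n (f n x)"
proof -
  have "f (Suc n) (b_op C n x) = (\<Sum>i\<le>Suc n. f (Suc n) (scl C ((-1) ^ i) (cface C n i x)))"
    unfolding b_op_def by (rule mor_sum) (simp add: src.sub_intros src.op_mem x)
  also have "\<dots> = b_op C' n (f n x)"
    unfolding b_op_def
    by (rule sum.cong) (simp_all add: lin_on_scale[OF mor_lin] src.op_mem x mor_face)
  finally show ?thesis .
qed

lemma mor_b':
  assumes x: "x \<in> Cob C n"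
  shows "f (Suc n) (b'_op C n x) = b'_op C' n (f n x)"
proof -
  have "f (Suc n) (b'_op C n x) = (\<Sum>i\<le>n. f (Suc n) (scl C ((-1) ^ i) (cface C n i x)))"
    unfolding b'_op_def by (rule mor_sum) (simp add: src.sub_intros src.op_mem x)
  also have "\<dots> = b'_op C' n (f n x)"
    unfolding b'_op_def
    by (rule sum.cong) (simp_all add: lin_on_scale[OF mor_lin] src.op_mem x mor_face)
  finally show ?thesis .
qed

lemma mor_lambda:
  assumes x: "x \<in> Cob C n"
  shows "f n (lambda_op C n x) = lambda_op C' n (f n x)"
  by (simp add: lambda_op_def lin_on_scale[OF mor_lin] src.op_mem x mor_cyc)

lemma mor_N:
  assumes x: "x \<in> Cob C n"
  shows "f n (N_op C n x) = N_op C' n (f n x)"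
proof -
  have "f n ((lambda_op C n ^^ k) x) = (lambda_op C' n ^^ k) (f n x)" for k
    by (induction k) (simp_all add: mor_lambda src.op_mem x)
  then show ?thesis unfolding N_op_def by (subst mor_sum) (simp_all add: src.op_mem x)
qed

lemma complex_morphism_hoc: "complex_morphism (hoc C) (hoc C') f"
  unfolding complex_morphism_def
  using src.cochain_complex_hoc tgt.cochain_complex_hoc mor_lin mor_b by (simp add: hoc_def)

lemma mor_diff: "x \<in> Cob C n \<Longrightarrow> y \<in> Cob C n \<Longrightarrow> f n (x - y) = f n x - f n y"
  by (rule lin_on_diff[OF src.vs tgt.vs src.sub mor_lin])

lemma mor_neg: "x \<in> Cob C n \<Longrightarrow> f n (- x) = - f n x"
  by (rule lin_on_neg[OF src.vs tgt.vs mor_lin])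

lemma bicomplex_morphism_cy: "bicomplex_morphism (cy C) (cy C') (\<lambda>p q. f q)"
  unfolding bicomplex_morphism_def
  using src.bicomplex_cy tgt.bicomplex_cy mor_lin
  by (simp add: cy_def mor_b mor_b' mor_N mor_lambda mor_diff mor_neg src.op_mem)

end

lemma precocyclic_morphism_comp:
  assumes "precocyclic_morphism C C' f" "precocyclic_morphism C' C'' g"
  shows "precocyclic_morphism C C'' (\<lambda>n x. g n (f n x))"
proof -
  interpret f: precocyclic_morphism_loc C C' f by unfold_locales fact
  interpret g: precocyclic_morphism_loc C' C'' g by unfold_locales fact
  show ?thesis
    unfolding precocyclic_morphism_def
    using f.source g.target lin_on_comp[OF f.mor_lin g.mor_lin]
    by (simp add: f.mor_inner g.mor_inner f.mor_cyc g.mor_cyc lin_on_mem[OF f.mor_lin])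
qed

text \<open>A projector that induces the identity on Hochschild cohomology has a kernel with exact
  columns: the even ones by hypothesis, the odd ones because \<open>b'\<close> is contractible.\<close>

lemma cyclic_of_hochschild:
  assumes f: "precocyclic_morphism C C f"
    and idem: "\<And>n x. x \<in> Cob C n \<Longrightarrow> f n (f n x) = f n x"
    and hh: "\<And>n z. z \<in> cocycles (hoc C) n \<Longrightarrow> z - f n z \<in> coboundaries (hoc C) n"
    and z: "z \<in> cocycles (tot (cy C)) n"
  shows "z - tot_map (\<lambda>p q. f q) n z \<in> coboundaries (tot (cy C)) n"
proof -
  interpret f: precocyclic_morphism_loc C C f by unfold_locales fact
  \<comment> \<open>\<open>K\<close> is the kernel of the projector, with the differentials of the
    cyclic bicomplex.\<close>
  define K where "K = (cy C)\<lparr>bob := \<lambda>p q. {x \<in> Cob C q. f q x = 0}\<rparr>"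
  have K: "bob K p q = {x \<in> Cob C q. f q x = 0}" "bpscl K = scl C" "dv K = dv (cy C)" "dh K = dh (cy C)" for p q
    by (simp_all add: K_def cy_def)
  have cdK: "cd (tot K) = cd (tot (cy C))" by (simp add: tot_def K cong: if_cong)
  have B: "bob (cy C) p q = Cob C q" "bpscl (cy C) = scl C" for p q by (simp_all add: cy_def)
  note bD = bicomplexD[OF f.src.bicomplex_cy, unfolded B]
  have f0: "f q 0 = 0" for q by (rule lin_on_zero[OF f.src.vs f.src.sub f.mor_lin])
  have fv: "f (Suc q) (dv (cy C) p q x) = dv (cy C) p q (f q x)"
    and fh: "f q (dh (cy C) p q x) = dh (cy C) p q (f q x)" if "x \<in> Cob C q" for p q x
    using f.bicomplex_morphism_cy that unfolding bicomplex_morphism_def B by blast+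
  have v0: "dv (cy C) p q 0 = 0" and h0: "dh (cy C) p q 0 = 0" for p q
    using lin_on_zero[OF bD(1,2,3)] lin_on_zero[OF bD(1,2,4)] by blast+
  have "module.subspace (scl C) (bob K p q)" for p q
    unfolding K
    by (rule f.src.v.subspaceI)
      (auto simp: f0 f.src.sub_intros lin_on_add[OF f.mor_lin] lin_on_scale[OF f.mor_lin])
  moreover have "lin_on (scl C) (bob K p q) (scl C) (bob K p (Suc q)) (dv (cy C) p q)" for p q
    using bD(3)[of q p] fv v0 unfolding lin_on_def K by auto
  moreover have "lin_on (scl C) (bob K p q) (scl C) (bob K (Suc p) q) (dh (cy C) p q)" for p q
    using bD(4)[of q p] fh h0 unfolding lin_on_def K by auto
  ultimately have bK: "bicomplex K"
    unfolding bicomplex_def K(2-4) using bD(1,5,6,7) by (simp add: K(1))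
  \<comment> \<open>Primitives are found in the whole bicomplex and then corrected by 1 - f. This
    does not change their differential, because f of the differential is f z = 0, and by idempotence
    it lands in the kernel. The correction is needed as the contraction of b' uses a codegeneracy,
    which f need not respect.\<close>
  have corr: "\<exists>y\<in>bob K p q. dv (cy C) p q y = z"
    if z: "z \<in> bob K p (Suc q)" and y: "y \<in> Cob C q" "dv (cy C) p q y = z" for p q y z
  proof
    have fy: "f q y \<in> Cob C q" by (rule lin_on_mem[OF f.mor_lin y(1)])
    show "y - f q y \<in> bob K p q"
      using y fy by (simp add: K f.src.sub_intros f.mor_diff idem)
    have "dv (cy C) p q (y - f q y) = dv (cy C) p q y - dv (cy C) p q (f q y)"
      by (rule lin_on_diff[OF bD(1,1,2,3) y(1) fy])
    also have "dv (cy C) p q (f q y) = 0" using fv[OF y(1), of p] y(2) z by (simp add: K)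
    finally show "dv (cy C) p q (y - f q y) = z" using y by simp
  qed
  \<comment> \<open>On the kernel z - f z is z itself, so the hypothesis on Hochschild cohomology
    says that closed elements are coboundaries.\<close>
  have even0: "z \<in> coboundaries (hoc C) q" if "z \<in> bob K p q" "dv (cy C) p q z = 0" "even p" for p q z
    using hh[of z q] that by (simp add: K cocycles_def hoc_def cy_def)
  have odd0: "case q of 0 \<Rightarrow> z = 0 | Suc m \<Rightarrow> z = b'_op C m (scl C ((-1) ^ m) (cdegen C m m z))"
    if "z \<in> bob K p q" "dv (cy C) p q z = 0" "odd p" for p q z
    using f.src.b'_exact[of z q] that by (simp add: K cy_def)
  show ?thesis
  proof -
    have T: "complex_morphism (tot (cy C)) (tot (cy C)) (tot_map (\<lambda>p q. f q))"
      by (rule complex_morphism_tot[OF f.bicomplex_morphism_cy])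
    let ?w = "z - tot_map (\<lambda>p q. f q) n z"
    interpret t: vector_space "cpscl (tot (cy C))" by (rule cochain_complex_vs[OF complex_morphismD(1)[OF T]])
    have w: "?w \<in> cocycles (tot (cy C)) n"
      using t.subspace_diff[OF subspace_cocycles[OF complex_morphismD(1)[OF T]] z complex_morphism_cocycles[OF T z]] .
    have zq: "z p \<in> Cob C (n - p)" if "p \<le> n" for p
      using z that by (simp add: cocycles_def mem_cob_tot B)
    have "f (n - p) (z p - f (n - p) (z p)) = 0" if "p \<le> n" for p
      using zq[OF that] lin_on_mem[OF f.mor_lin zq[OF that]] by (simp add: f.mor_diff idem)
    then have "?w p \<in> bob K p (n - p)" if "p \<le> n" for p
      using w that by (simp add: cocycles_def mem_cob_tot B K tot_map_def)
    then have wK: "?w \<in> cocycles (tot K) n"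
      using w by (simp add: cocycles_def mem_cob_tot cdK)
    have "?w \<in> coboundaries (tot K) n"
    proof (rule tot_exact[OF bK _ _ wK])
      fix p z assume z: "z \<in> bob K p 0" "dv K p 0 z = 0"
      show "z = 0"
        using even0[of z p 0] odd0[of z p 0] z by (cases "even p") (simp_all add: K coboundaries_def)
    next
      fix p q z assume z: "z \<in> bob K p (Suc q)" "dv K p (Suc q) z = 0"
      obtain y where "y \<in> Cob C q" "dv (cy C) p q y = z"
      proof (cases "even p")
        case True
        then show thesis
          using even0[of z p "Suc q"] z that by (auto simp: K coboundaries_def hoc_def cy_def)
      next
        case False
        let ?s = "scl C ((-1) ^ q) (cdegen C q q z)"
        have s: "?s \<in> Cob C q" using z by (simp add: K f.src.sub_intros f.src.op_mem)
        \<comment> \<open>Odd columns carry -b', which accounts for the sign in front of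
          \<open>?s\<close>.\<close>
        moreover have "dv (cy C) p q (- ?s) = z"
          using odd0[of z p "Suc q"] False z lin_on_neg[OF bD(1,1,3) s]
          by (simp add: K) (simp add: cy_def)
        ultimately show thesis using that[of "- ?s"] f.src.sub_intros(6) by simp
      qed
      from corr[OF z(1) this] show "\<exists>y\<in>bob K p q. dv K p q y = z" by (simp add: K)
    qed
    then show ?thesis
      by (auto simp: coboundaries_def cdK mem_cob_tot K(1) B image_iff split: nat.splits)
  qed
qed

section \<open>The Hochschild homotopy built from junction operators\<close>

context cocyclic_loc
begin

text \<open>Coface i composes across junction i + 1. Hence junctions up to i keep their number,
  those from i + 2 on lose one, and an insertion at i + 1 is absorbed. \<open>Q_wrap\<close> is how
  junction 0 enters: the last codegeneracy after the last coface is the identity, but an insertion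
  at junction n + 1 made between them survives as an insertion at junction 0.\<close>

context
  fixes Q :: "nat \<Rightarrow> nat \<Rightarrow> 'c \<Rightarrow> 'c"
  assumes Q_lin: "\<And>n j. j \<le> n \<Longrightarrow> lin_on (scl C) (Cob C n) (scl C) (Cob C n) (Q n j)"
    and Q_le: "\<And>n i j x. x \<in> Cob C n \<Longrightarrow> 1 \<le> j \<Longrightarrow> j \<le> i \<Longrightarrow> i \<le> n \<Longrightarrow>
      Q (Suc n) j (cface C n i x) = cface C n i (Q n j x)"
    and Q_greater: "\<And>n i j x. x \<in> Cob C n \<Longrightarrow> i + 2 \<le> j \<Longrightarrow> j \<le> Suc n \<Longrightarrow>
      Q (Suc n) j (cface C n i x) = cface C n i (Q n (j - 1) x)"
    and Q_Suc: "\<And>n i x. x \<in> Cob C n \<Longrightarrow> i \<le> n \<Longrightarrow> Q (Suc n) (Suc i) (cface C n i x) = cface C n i x"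
    and Q_last: "\<And>n j x. x \<in> Cob C n \<Longrightarrow> 1 \<le> j \<Longrightarrow> j \<le> n \<Longrightarrow>
      Q (Suc n) j (cface C n (Suc n) x) = cface C n (Suc n) (Q n j x)"
    and Q_wrap: "\<And>n x. x \<in> Cob C n \<Longrightarrow> cdegen C n n (Q (Suc n) (Suc n) (cface C n (Suc n) x)) = Q n 0 x"
begin

text \<open>The product Q_j ... Q_1, with Q_1 applied first.\<close>

definition jfold :: "nat \<Rightarrow> nat \<Rightarrow> 'c \<Rightarrow> 'c" where
  "jfold n j x = rec_nat x (\<lambda>k. Q n (Suc k)) j"

lemma jfold_simps: "jfold n 0 x = x" "jfold n (Suc j) x = Q n (Suc j) (jfold n j x)"
  by (simp_all add: jfold_def)

lemma jfold_lin: "j \<le> n \<Longrightarrow> lin_on (scl C) (Cob C n) (scl C) (Cob C n) (jfold n j)"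
proof (induction j)
  case 0 then show ?case by (simp add: lin_on_def jfold_simps)
next
  case (Suc j)
  then show ?case using lin_on_comp[of "scl C" "Cob C n" "scl C" "Cob C n" "jfold n j"] Q_lin[of "Suc j" n]
    by (simp add: jfold_simps)
qed

lemma jfold_face_le:
  assumes x: "x \<in> Cob C n" and j: "j \<le> i" "i \<le> Suc n" "j \<le> n"
  shows "jfold (Suc n) j (cface C n i x) = cface C n i (jfold n j x)"
  using j(1,3)
proof (induction j)
  case (Suc j)
  have "jfold n j x \<in> Cob C n" using Suc.prems by (intro lin_on_mem[OF jfold_lin x]) simp
  then show ?case
    using Suc Q_le[of "jfold n j x" n "Suc j" i] Q_last[of "jfold n j x" n "Suc j"] j(2)
    by (cases "i = Suc n") (simp_all add: jfold_simps)
qed (simp add: jfold_simps)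

text \<open>Among the factors Q_(j+1) ... Q_1 the one at i + 1 is absorbed by coface i, the lower
  ones commute with it, and the higher ones pass it with their index lowered by one. So one factor
  is lost, and the induction starts at j = i.\<close>

lemma jfold_face_greater:
  assumes x: "x \<in> Cob C n" and i: "i \<le> j" "j \<le> n"
  shows "jfold (Suc n) (Suc j) (cface C n i x) = cface C n i (jfold n j x)"
  using i
proof (induction j rule: dec_induct)
  case base
  have "jfold n i x \<in> Cob C n" using i by (intro lin_on_mem[OF jfold_lin x]) simp
  then show ?case using i Q_Suc jfold_face_le[OF x, of i i] by (simp add: jfold_simps(2)[of "Suc n" i])
next
  case (step j)
  have "jfold n j x \<in> Cob C n" using step by (intro lin_on_mem[OF jfold_lin x]) simp
  then show ?case
    using step Q_greater[of "jfold n j x" n i "Suc (Suc j)"]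
    by (simp add: jfold_simps(2)[of "Suc n" "Suc j"] jfold_simps(2)[of n j])
qed

definition jhom :: "nat \<Rightarrow> 'c \<Rightarrow> 'c" where
  "jhom n x = (\<Sum>j\<le>n. scl C ((-1) ^ j) (cdegen C n j (jfold (Suc n) (Suc j) x)))"

lemma jhom_lin: "lin_on (scl C) (Cob C (Suc n)) (scl C) (Cob C n) (jhom n)"
  unfolding jhom_def[abs_def]
  by (rule lin_on_lincomb, rule lin_on_comp[OF jfold_lin degen_lin]) simp_all

text \<open>Expand over pairs of a codegeneracy j and a coface i. For i = j and i = j + 1 the two
  cancel and leave consecutive members of the sequence of partial products, which telescopes. The
  remaining pairs can be exchanged and reassemble into b after the homotopy, with the opposite
  sign.\<close>

lemma jhom_homotopy:
  assumes x: "x \<in> Cob C n"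
  shows "jhom n (b_op C n x) = x - Q n 0 (jfold n n x) - (case n of 0 \<Rightarrow> 0 | Suc m \<Rightarrow> b_op C m (jhom m x))"
proof -
  define G where "G = (\<lambda>(j, i). scl C ((-1) ^ (i + j)) (cdegen C n j (jfold (Suc n) (Suc j) (cface C n i x))))"
  \<comment> \<open>The telescoping sequence. Its member n + 1 is the product closed up at junction
    0, which is what \<open>Q_wrap\<close> delivers for j = n, i = n + 1.\<close>
  define P where "P k = (if k \<le> n then jfold n k x else Q n 0 (jfold n n x))" for k
  let ?D = "(\<lambda>j. (j, j)) ` {..n}" and ?S = "(\<lambda>j. (j, Suc j)) ` {..n}"
    and ?A = "{(j, i). i < j \<and> j \<le> n}" and ?B = "{(j, i). Suc j < i \<and> i \<le> Suc n}"
  have Rx: "jfold n j x \<in> Cob C n" if "j \<le> n" for j by (rule lin_on_mem[OF jfold_lin[OF that] x])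
  have fin: "finite ?A" "finite ?B"
    by (rule finite_subset[of _ "{..Suc n} \<times> {..Suc n}"]; force)+
  have "jhom n (b_op C n x) = (\<Sum>j\<le>n. \<Sum>i\<le>Suc n. G (j, i))"
    unfolding jhom_def
  proof (rule sum.cong[OF refl])
    fix j assume j: "j \<in> {..n}"
    then have "lin_on (scl C) (Cob C (Suc n)) (scl C) (Cob C n) (\<lambda>x. cdegen C n j (jfold (Suc n) (Suc j) x))"
      by (intro lin_on_comp[OF jfold_lin degen_lin]) simp_all
    from lin_on_combination[OF this, of "{..Suc n}" "\<lambda>i. cface C n i x" "\<lambda>i. (-1) ^ i"]
    show "scl C ((-1) ^ j) (cdegen C n j (jfold (Suc n) (Suc j) (b_op C n x))) = (\<Sum>i\<le>Suc n. G (j, i))"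
      by (simp add: op_mem x b_op_def G_def v.scale_sum_right power_add mult.commute del: sum.atMost_Suc power_Suc)
  qed
  also have "\<dots> = sum G ({..n} \<times> {..Suc n})" by (simp only: sum.cartesian_product case_prod_eta)
  \<comment> \<open>\<open>?D\<close> and \<open>?S\<close> hold the two cofaces that codegeneracy j
    cancels, \<open>?A\<close> and \<open>?B\<close> those below and above them.\<close>
  also have "{..n} \<times> {..Suc n} = (?D \<union> ?S) \<union> (?A \<union> ?B)" by (auto simp: image_iff)
  also have "sum G \<dots> = (sum G ?D + sum G ?S) + (sum G ?A + sum G ?B)"
    using fin by (subst sum.union_disjoint; (subst sum.union_disjoint)?; (subst sum.union_disjoint)?) auto
  also have "sum G ?D = (\<Sum>j\<le>n. P j)"
  proof (subst sum.reindex)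
    show "sum (G \<circ> (\<lambda>j. (j, j))) {..n} = (\<Sum>j\<le>n. P j)"
    proof (rule sum.cong[OF refl])
      fix j assume "j \<in> {..n}"
      then have j: "j \<le> n" by simp
      have "cdegen C n j (jfold (Suc n) (Suc j) (cface C n j x)) = jfold n j x"
        using jfold_face_greater[OF x order_refl j] degen_face_id[OF Rx[OF j] j] by simp
      then show "(G \<circ> (\<lambda>j. (j, j))) j = P j" using j by (simp add: G_def P_def flip: mult_2)
    qed
  qed (simp add: inj_on_def)
  also have "sum G ?S = (\<Sum>j\<le>n. - P (Suc j))"
  proof (subst sum.reindex)
    show "sum (G \<circ> (\<lambda>j. (j, Suc j))) {..n} = (\<Sum>j\<le>n. - P (Suc j))"
    proof (rule sum.cong[OF refl])
      fix j assume "j \<in> {..n}"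
      then have j: "j \<le> n" by simp
      have "cdegen C n j (jfold (Suc n) (Suc j) (cface C n (Suc j) x)) = P (Suc j)"
      proof (cases "j = n")
        case True
        have "jfold (Suc n) (Suc n) (cface C n (Suc n) x) = Q (Suc n) (Suc n) (cface C n (Suc n) (jfold n n x))"
          using jfold_face_le[OF x, of n "Suc n"] by (simp add: jfold_simps(2)[of "Suc n"])
        then show ?thesis using Q_wrap[OF Rx[of n]] True by (simp add: P_def)
      next
        case False
        then have j': "Suc j \<le> n" using j by simp
        then show ?thesis
          using jfold_face_le[OF x, of "Suc j" "Suc j"] degen_face[THEN conjunct2, OF Rx[OF j'] j] by (simp add: P_def)
      qed
      then show "(G \<circ> (\<lambda>j. (j, Suc j))) j = - P (Suc j)" by (simp add: G_def flip: mult_2)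
    qed
  qed (simp add: inj_on_def)
  also have "(\<Sum>j\<le>n. P j) + (\<Sum>j\<le>n. - P (Suc j)) = P 0 - P (Suc n)"
    by (simp flip: sum.distrib add: sum_telescope)
  also have "P 0 - P (Suc n) = x - Q n 0 (jfold n n x)" by (simp add: P_def jfold_simps(1))
  also have "sum G ?A + sum G ?B = - (case n of 0 \<Rightarrow> 0 | Suc m \<Rightarrow> b_op C m (jhom m x))"
  proof (cases n)
    case 0
    have e: "?A = {}" "?B = {}" using 0 by auto
    show ?thesis unfolding e by (simp add: 0)
  next
    case (Suc m)
    define B where "B = (\<lambda>(j, i). scl C ((-1) ^ (i + j)) (cface C m i (cdegen C m j (jfold n (Suc j) x))))"
    let ?A' = "{(j, i). i \<le> j \<and> j \<le> m}" and ?B' = "{(j, i). j < i \<and> i \<le> n}"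
    have fin': "finite ?A'" "finite ?B'"
      by (rule finite_subset[of _ "{..n} \<times> {..n}"]; force simp: Suc)+
    \<comment> \<open>Exchanging codegeneracy and coface lowers one index by one and so changes the
      sign. The shifted regions \<open>?A'\<close> and \<open>?B'\<close> tile the rectangle that
      indexes b composed with \<open>jhom\<close>.\<close>
    have "sum G ?A = (\<Sum>p\<in>?A'. - B p)"
    proof (rule sum.reindex_bij_witness[of _ "\<lambda>(j, i). (Suc j, i)" "\<lambda>(j, i). (j - 1, i)"])
      fix p assume "p \<in> ?A"
      then obtain j i where p: "p = (Suc j, i)" "i \<le> j" "Suc j \<le> n" by (cases p, cases "fst p") auto
      have "cdegen C n (Suc j) (cface C n i (jfold n (Suc j) x)) = cface C m i (cdegen C m j (jfold n (Suc j) x))"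
        using degen_face_less[of "jfold n (Suc j) x" m "Suc j" i] Rx[OF p(3)] p Suc by simp
      then show "- B (case p of (j, i) \<Rightarrow> (j - 1, i)) = G p"
        using p jfold_face_greater[OF x, of i "Suc j"] by (simp add: G_def B_def)
    qed (auto simp: Suc)
    moreover have "sum G ?B = (\<Sum>p\<in>?B'. - B p)"
    proof (rule sum.reindex_bij_witness[of _ "\<lambda>(j, i). (j, Suc i)" "\<lambda>(j, i). (j, i - 1)"])
      fix p assume "p \<in> ?B"
      then obtain j i where p: "p = (j, Suc i)" "j < i" "i \<le> n" by (cases p, cases "snd p") auto
      have j: "Suc j \<le> n" using p by simp
      have "cdegen C n j (cface C n (Suc i) (jfold n (Suc j) x)) = cface C m i (cdegen C m j (jfold n (Suc j) x))"
        using degen_face_ne[THEN conjunct2, rule_format, of "jfold n (Suc j) x" m j "Suc i"] Rx[OF j] p Suc by simp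
      then show "- B (case p of (j, i) \<Rightarrow> (j, i - 1)) = G p"
        using p j jfold_face_le[OF x, of "Suc j" "Suc i"] by (simp add: G_def B_def)
    qed auto
    ultimately have "sum G ?A + sum G ?B = (\<Sum>p\<in>?A' \<union> ?B'. - B p)"
      using fin' by (subst sum.union_disjoint) auto
    also have "?A' \<union> ?B' = {..m} \<times> {..Suc m}" using Suc by auto
    also have "(\<Sum>p\<in>{..m} \<times> {..Suc m}. - B p) = - (\<Sum>j\<le>m. \<Sum>i\<le>Suc m. B (j, i))"
      by (simp only: sum_negf sum.cartesian_product case_prod_eta)
    also have "(\<Sum>j\<le>m. \<Sum>i\<le>Suc m. B (j, i)) = (\<Sum>i\<le>Suc m. \<Sum>j\<le>m. B (j, i))" by (rule sum.swap)
    also have "\<dots> = b_op C m (jhom m x)"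
      unfolding b_op_def
    proof (rule sum.cong[OF refl])
      fix i assume "i \<in> {..Suc m}"
      then have i: "i \<le> Suc m" by simp
      have "cdegen C m j (jfold n (Suc j) x) \<in> Cob C m" if "j \<le> m" for j
        using that Rx[of "Suc j"] Suc by (simp add: op_mem)
      then show "(\<Sum>j\<le>m. B (j, i)) = scl C ((-1) ^ i) (cface C m i (jhom m x))"
        unfolding jhom_def B_def
        by (subst lin_on_combination[OF face_lin[OF i]]) (simp_all add: Suc v.scale_sum_right power_add)
    qed
    finally show ?thesis by (simp add: Suc)
  qed
  finally show ?thesis by simp
qed

lemma junction_homotopy:
  assumes z: "z \<in> cocycles (hoc C) n"
  shows "z - Q n 0 (jfold n n z) \<in> coboundaries (hoc C) n"
proof -
  have z': "z \<in> Cob C n" "b_op C n z = 0" using z by (simp_all add: cocycles_def hoc_def)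
  have "z - Q n 0 (jfold n n z) = (case n of 0 \<Rightarrow> 0 | Suc m \<Rightarrow> b_op C m (jhom m z))"
    using jhom_homotopy[OF z'(1)] lin_on_zero[OF vs sub jhom_lin] z'(2) by simp
  then show ?thesis
    using lin_on_mem[OF jhom_lin] z' by (auto simp: coboundaries_def hoc_def split: nat.splits)
qed

end

end

section \<open>Sweedler calculus\<close>

lemma sum_list_swap:
  fixes f :: "'x \<Rightarrow> 'y \<Rightarrow> 'u::ab_group_add"
  shows "(\<Sum>x\<leftarrow>xs. \<Sum>y\<leftarrow>ys. f x y) = (\<Sum>y\<leftarrow>ys. \<Sum>x\<leftarrow>xs. f x y)"
  by (induction xs) (simp_all add: sum_list_addf)

lemma lin_on_sum_list_gen:
  assumes "vector_space s1" "module.subspace s1 V" "lin_on s1 V s2 W f" "\<And>x. x \<in> set xs \<Longrightarrow> g x \<in> V"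
  shows "f (\<Sum>x\<leftarrow>xs. g x) = (\<Sum>x\<leftarrow>xs. f (g x))"
proof -
  interpret vector_space s1 by fact
  have "(\<Sum>x\<leftarrow>xs. g x) \<in> V \<and> f (\<Sum>x\<leftarrow>xs. g x) = (\<Sum>x\<leftarrow>xs. f (g x))"
    using assms(4)
  proof (induction xs)
    case Nil
    then show ?case using lin_on_zero[OF assms(1-3)] subspace_0[OF assms(2)] by simp
  next
    case (Cons x xs)
    then show ?case using lin_on_add[OF assms(3), of "g x"] subspace_add[OF assms(2)] by simp
  qed
  then show ?thesis ..
qed

lemma lin_on_sum_list_fun:
  assumes "vector_space s2" "module.subspace s2 W" "\<And>y. y \<in> set ys \<Longrightarrow> lin_on s1 V s2 W (f y)"
  shows "lin_on s1 V s2 W (\<lambda>x. \<Sum>y\<leftarrow>ys. f y x)"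
proof -
  interpret vector_space s2 by fact
  show ?thesis
    using assms(3)
  proof (induction ys)
    case Nil
    then show ?case by (simp add: lin_on_def subspace_0[OF assms(2)])
  next
    case (Cons y ys)
    then have "lin_on s1 V s2 W (\<lambda>x. \<Sum>y\<leftarrow>ys. f y x)" "lin_on s1 V s2 W (f y)" by simp_all
    then show ?case
      by (simp add: lin_on_def subspace_add[OF assms(2)] scale_right_distrib)
  qed
qed

lemma vector_space_field: "vector_space ((*) :: 'k::field \<Rightarrow> 'k \<Rightarrow> 'k)"
  by unfold_locales (auto simp: algebra_simps)

lemma vector_space_fscale: "vector_space (fscale :: 'k::field \<Rightarrow> ('x \<Rightarrow> 'k) \<Rightarrow> _)"
  by unfold_locales (auto simp: fscale_def fun_eq_iff algebra_simps)

lemma subspace_UNIV: "vector_space s \<Longrightarrow> module.subspace s UNIV"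
  by (simp add: module.subspace_def vs_module)

definition rep :: "('x, 'k::field) multi \<Rightarrow> ('x, 'k) tensor \<Rightarrow> 'x list" where
  "rep P t = (SOME ps. set ps \<subseteq> fst P \<and> t = (\<Sum>x\<leftarrow>ps. pure P x))"

text \<open>The representation of \<open>t\<close> chosen by \<^const>\<open>tensor_lift\<close> does not depend on the map to be
  extended, so that \<open>tensor_lift P\<close> is a finite sum even for maps that are not multilinear.\<close>

lemma tensor_lift_rep: "tensor_lift P f t = (\<Sum>x\<leftarrow>rep P t. f x)"
  by (simp add: tensor_lift_def rep_def)

lemma rep:
  assumes "t \<in> tensor_space P"
  shows "set (rep P t) \<subseteq> fst P" "t = (\<Sum>x\<leftarrow>rep P t. pure P x)"
proof -
  have "\<exists>ps. set ps \<subseteq> fst P \<and> t = (\<Sum>x\<leftarrow>ps. pure P x)"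
    using assms unfolding tensor_space_def by blast
  from someI_ex[OF this] show "set (rep P t) \<subseteq> fst P" "t = (\<Sum>x\<leftarrow>rep P t. pure P x)"
    unfolding rep_def by blast+
qed

lemma pure_mem_tensor_space: "x \<in> fst P \<Longrightarrow> pure P x \<in> tensor_space P"
  unfolding tensor_space_def by (intro CollectI exI[of _ "[x]"]) simp

lemma tensor_space_add:
  assumes "t \<in> tensor_space P" "t' \<in> tensor_space P"
  shows "t + t' \<in> tensor_space P"
proof -
  obtain ps qs where "set ps \<subseteq> fst P" "t = (\<Sum>x\<leftarrow>ps. pure P x)" "set qs \<subseteq> fst P" "t' = (\<Sum>x\<leftarrow>qs. pure P x)"
    using assms unfolding tensor_space_def by blast
  then show ?thesis unfolding tensor_space_def by (intro CollectI exI[of _ "ps @ qs"]) simp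
qed

lemma tensor_space_zero: "0 \<in> tensor_space P"
  unfolding tensor_space_def by (intro CollectI exI[of _ "[]"]) simp

lemma subspace_tensor_space:
  assumes sc: "\<And>c x. x \<in> fst P \<Longrightarrow> \<exists>y\<in>fst P. fscale c (pure P x) = pure P y"
  shows "module.subspace fscale (tensor_space P)"
proof -
  interpret f: vector_space "fscale :: 'a \<Rightarrow> ('b, 'a) tensor \<Rightarrow> _" by (rule vector_space_fscale)
  show ?thesis
  proof (rule f.subspaceI)
    fix c and t assume "t \<in> tensor_space P"
    then obtain ps where "set ps \<subseteq> fst P" "t = (\<Sum>x\<leftarrow>ps. pure P x)"
      unfolding tensor_space_def by blast
    then show "fscale c t \<in> tensor_space P"
    proof (induction ps arbitrary: t)
      case Nil
      show ?case unfolding Nil(2) by (simp only: list.map sum_list.Nil f.scale_zero_right tensor_space_zero)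
    next
      case (Cons x ps)
      then obtain y where y: "y \<in> fst P" "fscale c (pure P x) = pure P y" using sc[of x c] by auto
      have "fscale c (\<Sum>x\<leftarrow>ps. pure P x) \<in> tensor_space P" using Cons by simp
      from tensor_space_add[OF pure_mem_tensor_space[OF y(1)] this] show ?case
        unfolding Cons.prems(2) by (simp only: list.map sum_list.Cons f.scale_right_distrib y(2))
    qed
  qed (simp_all add: tensor_space_zero tensor_space_add)
qed

lemma bi_scale_pure:
  assumes "vector_space s1" "module.subspace s1 V" "x \<in> fst (bi s1 V s2 W)"
  shows "\<exists>y\<in>fst (bi s1 V s2 W). fscale c (pure (bi s1 V s2 W) x) = pure (bi s1 V s2 W) y"
proof -
  interpret vector_space s1 by fact
  obtain v w where vw: "x = (v, w)" "v \<in> V" "w \<in> W" using assms(3) by (auto simp: bi_def)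
  have "fscale c (pure (bi s1 V s2 W) (v, w)) = pure (bi s1 V s2 W) (s1 c v, w)"
    using pure_bi_bilin[of s1 V s2 W] vw by (simp add: bilin_on_def lin_on_def)
  then show ?thesis using vw subspace_scale[OF assms(2) vw(2)] by (intro bexI[of _ "(s1 c v, w)"]) (auto simp: bi_def)
qed

lemma subspace_tensor_space_bi:
  assumes "vector_space s1" "module.subspace s1 V"
  shows "module.subspace fscale (tensor_space (bi s1 V s2 W))"
  by (rule subspace_tensor_space) (rule bi_scale_pure[OF assms])

lemma fst_bi: "fst (bi s1 V s2 W) = V \<times> W"
  by (simp add: bi_def)

text \<open>Sweedler's f h_1 h_2 for a single coproduct. Iterated coproducts are written as nested
  \<open>cs\<close>, and coassociativity says that the nesting may be moved.\<close>

definition cs :: "('k::field, 'h::ring_1) hopf \<Rightarrow> 'h \<Rightarrow> ('h \<Rightarrow> 'h \<Rightarrow> 'u::ab_group_add) \<Rightarrow> 'u" where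
  "cs H h f = tensor_lift (HH H) (\<lambda>(a, b). f a b) (coprod H h)"

lemma cs_sum: "cs H h f = (\<Sum>x\<leftarrow>rep (HH H) (coprod H h). f (fst x) (snd x))"
  by (simp add: cs_def tensor_lift_rep split_def)

lemma cs_swap: "cs H h (\<lambda>a b. cs H g (\<lambda>c d. f a b c d)) = cs H g (\<lambda>c d. cs H h (\<lambda>a b. f a b c d))"
  unfolding cs_sum by (rule sum_list_swap)

lemma sweedler_0: "sweedler H 0 h F = F [h]"
  and sweedler_Suc: "sweedler H (Suc n) h F = cs H h (\<lambda>a b. sweedler H n b (\<lambda>hs. F (a # hs)))"
  by (simp_all add: cs_def)

lemma sweedler_1: "sweedler H 1 h F = cs H h (\<lambda>a b. F [a, b])"
  by (simp add: cs_def)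

text \<open>The list of tuples that occur in the iterated coproduct, in the representations that the
  lifts choose. It makes \<open>sweedler\<close> a finite sum, so that exchanging two coproducts, or
  a coproduct and a coaction, is exchanging two sums.\<close>

primrec swl :: "('k::field, 'h::ring_1) hopf \<Rightarrow> nat \<Rightarrow> 'h \<Rightarrow> 'h list list" where
  "swl H 0 h = [[h]]"
| "swl H (Suc n) h = concat (map (\<lambda>x. map ((#) (fst x)) (swl H n (snd x))) (rep (HH H) (coprod H h)))"

lemma sweedler_sum: "sweedler H n h F = (\<Sum>hs\<leftarrow>swl H n h. F hs)"
proof (induction n arbitrary: h F)
  case (Suc n)
  have "(\<Sum>x\<leftarrow>xs. \<Sum>hs\<leftarrow>swl H n (snd x). F (fst x # hs)) =
      sum_list (map F (concat (map (\<lambda>x. map ((#) (fst x)) (swl H n (snd x))) xs)))" for xs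
    by (induction xs) (simp_all add: o_def)
  then show ?case unfolding sweedler_Suc cs_sum Suc.IH swl.simps .
qed simp

lemma length_swl: "hs \<in> set (swl H n h) \<Longrightarrow> length hs = Suc n"
  by (induction n arbitrary: h hs) auto

lemma sweedler_cong: "(\<And>hs. length hs = Suc n \<Longrightarrow> F hs = G hs) \<Longrightarrow> sweedler H n h F = sweedler H n h G"
  unfolding sweedler_sum by (rule arg_cong[where f = sum_list], rule map_cong[OF refl]) (simp add: length_swl)

lemma sweedler_cs_swap: "sweedler H n h (\<lambda>hs. cs H g (\<lambda>a b. f hs a b)) = cs H g (\<lambda>a b. sweedler H n h (\<lambda>hs. f hs a b))"
  unfolding sweedler_sum cs_sum by (rule sum_list_swap)

locale hopf_loc =
  fixes H :: "('k::field, 'h::ring_1) hopf"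
  assumes hopf: "hopf_algebra H"
begin

abbreviation lin :: "('k \<Rightarrow> 'u::ab_group_add \<Rightarrow> 'u) \<Rightarrow> ('h \<Rightarrow> 'u) \<Rightarrow> bool" where
  "lin s f \<equiv> lin_on (hscale H) UNIV s UNIV f"

lemmas hopf_axioms' = hopf[unfolded hopf_algebra_def]

lemmas hvs = hopf_axioms'[THEN conjunct1]
lemmas mult_bilin = hopf_axioms'[THEN conjunct2, THEN conjunct1]
lemmas coprod_lin = hopf_axioms'[THEN conjunct2, THEN conjunct2, THEN conjunct1]
lemmas counit_lin = hopf_axioms'[THEN conjunct2, THEN conjunct2, THEN conjunct2, THEN conjunct1]
lemmas antip_lin = hopf_axioms'[THEN conjunct2, THEN conjunct2, THEN conjunct2, THEN conjunct2, THEN conjunct1]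
lemmas coassoc_axiom = hopf_axioms'[THEN conjunct2, THEN conjunct2, THEN conjunct2, THEN conjunct2, THEN conjunct2, THEN conjunct1, rule_format]
lemmas counit_axiom1 = hopf_axioms'[THEN conjunct2, THEN conjunct2, THEN conjunct2, THEN conjunct2, THEN conjunct2, THEN conjunct2, THEN conjunct1, rule_format, unfolded sweedler_1]
lemmas counit_axiom2 = hopf_axioms'[THEN conjunct2, THEN conjunct2, THEN conjunct2, THEN conjunct2, THEN conjunct2, THEN conjunct2, THEN conjunct2, THEN conjunct1, rule_format, unfolded sweedler_1]
lemmas coprod_one = hopf_axioms'[THEN conjunct2, THEN conjunct2, THEN conjunct2, THEN conjunct2, THEN conjunct2, THEN conjunct2, THEN conjunct2, THEN conjunct2, THEN conjunct1]
lemmas coprod_mult = hopf_axioms'[THEN conjunct2, THEN conjunct2, THEN conjunct2, THEN conjunct2, THEN conjunct2, THEN conjunct2, THEN conjunct2, THEN conjunct2, THEN conjunct2, THEN conjunct1, rule_format, unfolded sweedler_1]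
lemmas counit_one = hopf_axioms'[THEN conjunct2, THEN conjunct2, THEN conjunct2, THEN conjunct2, THEN conjunct2, THEN conjunct2, THEN conjunct2, THEN conjunct2, THEN conjunct2, THEN conjunct2, THEN conjunct1]
lemmas counit_mult = hopf_axioms'[THEN conjunct2, THEN conjunct2, THEN conjunct2, THEN conjunct2, THEN conjunct2, THEN conjunct2, THEN conjunct2, THEN conjunct2, THEN conjunct2, THEN conjunct2, THEN conjunct2, THEN conjunct1, rule_format]
lemmas antip_axiom1 = hopf_axioms'[THEN conjunct2, THEN conjunct2, THEN conjunct2, THEN conjunct2, THEN conjunct2, THEN conjunct2, THEN conjunct2, THEN conjunct2, THEN conjunct2, THEN conjunct2, THEN conjunct2, THEN conjunct2, THEN conjunct1, rule_format, unfolded sweedler_1]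
lemmas antip_axiom2 = hopf_axioms'[THEN conjunct2, THEN conjunct2, THEN conjunct2, THEN conjunct2, THEN conjunct2, THEN conjunct2, THEN conjunct2, THEN conjunct2, THEN conjunct2, THEN conjunct2, THEN conjunct2, THEN conjunct2, THEN conjunct2, THEN conjunct1, rule_format, unfolded sweedler_1]
lemmas bij_antip = hopf_axioms'[THEN conjunct2, THEN conjunct2, THEN conjunct2, THEN conjunct2, THEN conjunct2, THEN conjunct2, THEN conjunct2, THEN conjunct2, THEN conjunct2, THEN conjunct2, THEN conjunct2, THEN conjunct2, THEN conjunct2, THEN conjunct2]

sublocale h: vector_space "hscale H" by (rule hvs)

lemma mult_lin: "lin (hscale H) (\<lambda>x. x * y)" "lin (hscale H) (\<lambda>x. y * x)"
  using mult_bilin by (simp_all add: bilin_on_def)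

lemma lin_comp: "lin s f \<Longrightarrow> lin (hscale H) g \<Longrightarrow> lin s (\<lambda>x. f (g x))"
  by (rule lin_on_comp)

lemma lin_id: "lin (hscale H) (\<lambda>x. x)"
  by (simp add: lin_on_def)

lemma lin_scaled: "lin s f \<Longrightarrow> f (hscale H c x) = s c (f x)"
  by (rule lin_on_scale) auto

lemma lin_sum_list: "lin s f \<Longrightarrow> f (\<Sum>x\<leftarrow>xs. g x) = (\<Sum>x\<leftarrow>xs. f (g x))"
  by (rule lin_on_sum_list_gen[OF hvs h.subspace_UNIV]) auto

lemma lin_cs_out: "lin s f \<Longrightarrow> f (cs H h g) = cs H h (\<lambda>a b. f (g a b))"
  unfolding cs_sum by (rule lin_sum_list)

lemma scale_cs_out:
  assumes "vector_space s" shows "s c (cs H h g) = cs H h (\<lambda>a b. s c (g a b))"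
proof -
  interpret vector_space s by fact
  have "s c (\<Sum>x\<leftarrow>xs. f x) = (\<Sum>x\<leftarrow>xs. s c (f x))" for xs :: "('h \<times> 'h) list" and f
    by (induction xs) (simp_all add: scale_right_distrib)
  then show ?thesis unfolding cs_sum .
qed

lemma HH_vs: "vector_space s \<Longrightarrow> (\<And>b. lin s (\<lambda>a. f a b)) \<Longrightarrow> (\<And>a. lin s (f a)) \<Longrightarrow>
    lin_on fscale (tensor_space (HH H)) s UNIV (tensor_lift (HH H) (\<lambda>(a, b). f a b))"
  unfolding HH_def
  by (rule tensor_lift_lin_bi) (auto simp: bilin_on_def subspace_UNIV hvs)

lemma lin_cs:
  assumes "vector_space s" "\<And>b. lin s (\<lambda>a. f a b)" "\<And>a. lin s (f a)"
  shows "lin s (\<lambda>h. cs H h f)"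
  unfolding cs_def by (rule lin_on_comp[OF coprod_lin HH_vs]) (rule assms)+

lemma lin_cs_fun:
  assumes "vector_space s" "\<And>a b. lin s (\<lambda>x. f x a b)"
  shows "lin s (\<lambda>x. cs H h (f x))"
  unfolding cs_sum by (rule lin_on_sum_list_fun[OF assms(1) subspace_UNIV[OF assms(1)] assms(2)])

text \<open>The axiom is an identity of tensors in \<open>HHH H\<close>. A trilinear
  \<open>f\<close> extends to a linear map \<open>L\<close> on that space, in two stages because the
  space is H \<otimes> (H \<otimes> H), and applying \<open>L\<close> to both sides gives the
  identity for \<open>f\<close>.\<close>

lemma coassoc:
  assumes s: "vector_space s" and "\<And>b c. lin s (\<lambda>a. f a b c)" "\<And>a c. lin s (\<lambda>b. f a b c)" "\<And>a b. lin s (f a b)"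
  shows "cs H h (\<lambda>a b. cs H a (\<lambda>a1 a2. f a1 a2 b)) = cs H h (\<lambda>a b. cs H b (\<lambda>b1 b2. f a b1 b2))"
proof -
  let ?T = "tensor_space (HH H)"
  define g where "g a t = tensor_lift (HH H) (\<lambda>(b, c). f a b c) t" for a t
  have sub: "module.subspace fscale ?T"
    unfolding HH_def by (rule subspace_tensor_space_bi[OF hvs h.subspace_UNIV])
  have g1: "lin_on fscale ?T s UNIV (g a)" for a
    unfolding g_def by (rule HH_vs[OF s assms(3,4)])
  have g2: "lin s (\<lambda>a. g a t)" for t
    unfolding g_def tensor_lift_rep
    by (rule lin_on_sum_list_fun[OF s subspace_UNIV[OF s]]) (simp add: split_def assms(2))
  have bil: "bilin_on (hscale H) UNIV fscale ?T s UNIV g"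
    unfolding bilin_on_def using g1 g2 by simp
  define L where "L = tensor_lift (HHH H) (\<lambda>(a, t). g a t)"
  have L: "lin_on fscale (tensor_space (HHH H)) s UNIV L"
    unfolding L_def HHH_def by (rule tensor_lift_lin_bi[OF s subspace_UNIV[OF s] bil hvs h.subspace_UNIV])
  have Lp: "L (pure (HHH H) (a, t)) = g a t" if "t \<in> ?T" for a t
    unfolding L_def HHH_def by (rule tensor_lift_pure_bi[OF s bil UNIV_I that])
  have subL: "module.subspace fscale (tensor_space (HHH H))"
    unfolding HHH_def by (rule subspace_tensor_space_bi[OF hvs h.subspace_UNIV])
  have pT: "pure (HH H) (a, b) \<in> ?T" for a b by (rule pure_mem_tensor_space) (simp add: HH_def fst_bi)
  have cT: "coprod H a \<in> ?T" for a by (rule lin_on_mem[OF coprod_lin]) simp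
  have pTT: "pure (HHH H) (a, t) \<in> tensor_space (HHH H)" if "t \<in> ?T" for a t
    by (rule pure_mem_tensor_space) (simp add: HHH_def fst_bi that)
  interpret F: vector_space "fscale :: 'k \<Rightarrow> ('h \<times> ('h \<times> 'h, 'k) tensor, 'k) tensor \<Rightarrow> _" by (rule vector_space_fscale)
  have sumT: "(\<Sum>x\<leftarrow>xs. q x) \<in> tensor_space (HHH H)" if "\<And>x. x \<in> set xs \<Longrightarrow> q x \<in> tensor_space (HHH H)"
    for xs :: "('h \<times> 'h) list" and q
    using that by (induction xs) (auto simp: tensor_space_zero tensor_space_add)
  have Lsum: "L (\<Sum>x\<leftarrow>xs. q x) = (\<Sum>x\<leftarrow>xs. L (q x))" if "\<And>x. x \<in> set xs \<Longrightarrow> q x \<in> tensor_space (HHH H)"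
    for xs :: "('h \<times> 'h) list" and q
    by (rule lin_on_sum_list_gen[OF vector_space_fscale subL L that])
  have gp: "g a (pure (HH H) (b, c)) = f a b c" for a b c
    unfolding g_def HH_def
    by (rule tensor_lift_pure_bi[OF s]) (use assms in \<open>auto simp: bilin_on_def\<close>)
  have "L (cs H h (\<lambda>a b. cs H a (\<lambda>a1 a2. pure (HHH H) (a1, pure (HH H) (a2, b))))) =
      L (cs H h (\<lambda>a b. pure (HHH H) (a, coprod H b)))"
    using coassoc_axiom[of h] by (simp add: cs_def)
  moreover have "L (cs H h (\<lambda>a b. cs H a (\<lambda>a1 a2. pure (HHH H) (a1, pure (HH H) (a2, b))))) =
      cs H h (\<lambda>a b. cs H a (\<lambda>a1 a2. f a1 a2 b))"
    unfolding cs_sum by (subst Lsum, simp add: sumT pTT pT, subst Lsum) (simp_all add: pTT pT Lp gp)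
  moreover have "L (cs H h (\<lambda>a b. pure (HHH H) (a, coprod H b))) = cs H h (\<lambda>a b. cs H b (\<lambda>b1 b2. f a b1 b2))"
    unfolding cs_sum[of H h] by (subst Lsum) (simp_all add: pTT cT Lp g_def cs_def)
  ultimately show ?thesis by simp
qed

lemma cs_one: "cs H 1 f = f 1 1" if "vector_space s" "\<And>b. lin s (\<lambda>a. f a b)" "\<And>a. lin s (f a)"
proof -
  have "tensor_lift (HH H) (\<lambda>(a, b). f a b) (pure (HH H) (1, 1)) = f 1 1"
    unfolding HH_def by (intro tensor_lift_pure_bi[OF that(1)]) (use that in \<open>auto simp: bilin_on_def\<close>)
  then show ?thesis by (simp add: cs_def coprod_one)
qed

lemma cs_mult:
  assumes s: "vector_space s" and f: "\<And>b. lin s (\<lambda>a. f a b)" "\<And>a. lin s (f a)"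
  shows "cs H (g * h) f = cs H g (\<lambda>a b. cs H h (\<lambda>c d. f (a * c) (b * d)))"
proof -
  let ?T = "tensor_space (HH H)" and ?L = "tensor_lift (HH H) (\<lambda>(a, b). f a b)"
  have sub: "module.subspace fscale ?T"
    unfolding HH_def by (rule subspace_tensor_space_bi[OF hvs h.subspace_UNIV])
  have pT: "pure (HH H) (a, b) \<in> ?T" for a b by (rule pure_mem_tensor_space) (simp add: HH_def fst_bi)
  have sumT: "(\<Sum>x\<leftarrow>xs. q x) \<in> ?T" if "\<And>x. x \<in> set xs \<Longrightarrow> q x \<in> ?T" for xs :: "('h \<times> 'h) list" and q
    using that by (induction xs) (auto simp: tensor_space_zero tensor_space_add)
  have Lsum: "?L (\<Sum>x\<leftarrow>xs. q x) = (\<Sum>x\<leftarrow>xs. ?L (q x))" if "\<And>x. x \<in> set xs \<Longrightarrow> q x \<in> ?T" for xs :: "('h \<times> 'h) list" and q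
    by (rule lin_on_sum_list_gen[OF vector_space_fscale sub HH_vs[OF s f] that])
  have Lp: "?L (pure (HH H) (a, b)) = f a b" for a b
    unfolding HH_def by (rule tensor_lift_pure_bi[OF s]) (use f in \<open>auto simp: bilin_on_def\<close>)
  have "coprod H (g * h) = cs H g (\<lambda>a b. cs H h (\<lambda>c d. pure (HH H) (a * c, b * d)))"
    using coprod_mult[of g h] by simp
  then have "cs H (g * h) f = ?L (cs H g (\<lambda>a b. cs H h (\<lambda>c d. pure (HH H) (a * c, b * d))))"
    unfolding cs_def[of H "g * h"] by simp
  also have "\<dots> = cs H g (\<lambda>a b. cs H h (\<lambda>c d. f (a * c) (b * d)))"
    unfolding cs_sum by (subst Lsum, simp add: sumT pT, subst Lsum) (simp_all add: pT Lp)
  finally show ?thesis .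
qed

text \<open>The axioms in the shape used for rewriting: a factor eps(h_i) under a coproduct deletes
  its leg, inside any expression that is linear in the other one.\<close>

lemma cs_counit:
  assumes "lin s f"
  shows "cs H h (\<lambda>a b. s (counit H a) (f b)) = f h" "cs H h (\<lambda>a b. s (counit H b) (f a)) = f h"
proof -
  have "cs H h (\<lambda>a b. hscale H (counit H a) b) = h" "cs H h (\<lambda>a b. hscale H (counit H b) a) = h"
    using counit_axiom1[of h] counit_axiom2[of h] by simp_all
  then show "cs H h (\<lambda>a b. s (counit H a) (f b)) = f h" "cs H h (\<lambda>a b. s (counit H b) (f a)) = f h"
    using lin_cs_out[OF assms, of h "\<lambda>a b. hscale H (counit H a) b"]
      lin_cs_out[OF assms, of h "\<lambda>a b. hscale H (counit H b) a"] by (simp_all add: lin_scaled[OF assms])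
qed

lemma cs_antip:
  assumes "lin s f"
  shows "cs H h (\<lambda>a b. f (antip H a * b)) = s (counit H h) (f 1)"
    "cs H h (\<lambda>a b. f (a * antip H b)) = s (counit H h) (f 1)"
proof -
  have "cs H h (\<lambda>a b. antip H a * b) = hscale H (counit H h) 1" "cs H h (\<lambda>a b. a * antip H b) = hscale H (counit H h) 1"
    using antip_axiom1[of h] antip_axiom2[of h] by simp_all
  then show "cs H h (\<lambda>a b. f (antip H a * b)) = s (counit H h) (f 1)"
    "cs H h (\<lambda>a b. f (a * antip H b)) = s (counit H h) (f 1)"
    by (simp_all add: lin_scaled[OF assms] flip: lin_cs_out[OF assms])
qed

end

section \<open>The antipode and its inverse\<close>

context hopf_loc
begin

abbreviation S' :: "'h \<Rightarrow> 'h" where "S' \<equiv> inv (antip H)"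

lemma lin_mult1: "lin (hscale H) A \<Longrightarrow> lin (hscale H) (\<lambda>x. A x * c)"
  by (rule lin_comp[OF mult_lin(1)])

lemma lin_mult2: "lin (hscale H) A \<Longrightarrow> lin (hscale H) (\<lambda>x. c * A x)"
  by (rule lin_comp[OF mult_lin(2)])

lemma lin_antip: "lin (hscale H) A \<Longrightarrow> lin (hscale H) (\<lambda>x. antip H (A x))"
  by (rule lin_comp[OF antip_lin])

lemmas lin_intros = lin_mult1 lin_mult2 lin_antip lin_id

lemma antip_one: "antip H 1 = 1"
proof -
  have "cs H 1 (\<lambda>a b. antip H a * b) = antip H 1 * 1"
    by (rule cs_one[OF hvs]) (intro lin_intros)+
  then show ?thesis using cs_antip(1)[OF lin_id, of 1] by (simp add: counit_one)
qed

lemma counit_antip: "counit H (antip H h) = counit H h"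
proof -
  have "cs H h (\<lambda>a b. counit H (antip H a * b)) = counit H h"
    using cs_antip(1)[OF counit_lin, of h] by (simp add: counit_one)
  moreover have "cs H h (\<lambda>a b. counit H (antip H a * b)) = counit H (antip H h)"
    using cs_counit(2)[OF lin_comp[OF counit_lin antip_lin], of h] by (simp add: counit_mult mult.commute)
  ultimately show ?thesis by simp
qed

text \<open>Both sides are convolution inverse to the multiplication.\<close>

lemma antip_mult: "antip H (g * h) = antip H h * antip H g"
proof -
  \<comment> \<open>The triple product S(g_1 h_1) (g_2 h_2) S(h_3) S(g_3). Collapsing the second and
    third factors leaves S(g h), collapsing the first and second leaves S(h) S(g).\<close>
  define G where "G g1 g2 g3 h1 h2 h3 = antip H (g1 * h1) * (g2 * h2) * (antip H h3 * antip H g3)"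
    for g1 g2 g3 h1 h2 h3
  have lG: "lin (hscale H) (\<lambda>x. G x g2 g3 h1 h2 h3)" "lin (hscale H) (\<lambda>x. G g1 x g3 h1 h2 h3)"
    "lin (hscale H) (\<lambda>x. G g1 g2 x h1 h2 h3)" "lin (hscale H) (\<lambda>x. G g1 g2 g3 x h2 h3)"
    "lin (hscale H) (\<lambda>x. G g1 g2 g3 h1 x h3)" "lin (hscale H) (\<lambda>x. G g1 g2 g3 h1 h2 x)" for g1 g2 g3 h1 h2 h3
    unfolding G_def by (intro lin_intros)+
  define X where "X = cs H g (\<lambda>g1 g'. cs H g' (\<lambda>g2 g3. cs H h (\<lambda>h1 h'. cs H h' (\<lambda>h2 h3. G g1 g2 g3 h1 h2 h3))))"
  have "cs H h' (\<lambda>h2 h3. G g1 g2 g3 h1 h2 h3) = hscale H (counit H h') (antip H (g1 * h1) * g2 * antip H g3)" for g1 g2 g3 h1 h'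
    using cs_antip(2)[of "hscale H" "\<lambda>y. antip H (g1 * h1) * g2 * (y * antip H g3)" h']
    by (simp add: G_def mult.assoc lin_intros)
  moreover have "cs H h (\<lambda>h1 h'. hscale H (counit H h') (antip H (g1 * h1) * g2 * antip H g3)) =
      antip H (g1 * h) * g2 * antip H g3" for g1 g2 g3
    by (rule cs_counit(2)) (intro lin_intros)
  moreover have "cs H g' (\<lambda>g2 g3. antip H (g1 * h) * g2 * antip H g3) = hscale H (counit H g') (antip H (g1 * h))" for g1 g'
    using cs_antip(2)[of "hscale H" "\<lambda>y. antip H (g1 * h) * y" g'] by (simp add: mult.assoc lin_intros)
  moreover have "cs H g (\<lambda>g1 g'. hscale H (counit H g') (antip H (g1 * h))) = antip H (g * h)"
    by (rule cs_counit(2)) (intro lin_intros)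
  ultimately have A: "X = antip H (g * h)" unfolding X_def by simp
  have "X = cs H g (\<lambda>g' g3. cs H g' (\<lambda>g1 g2. cs H h (\<lambda>h1 h'. cs H h' (\<lambda>h2 h3. G g1 g2 g3 h1 h2 h3))))"
    unfolding X_def by (rule coassoc[OF hvs, symmetric]) (intro lin_cs_fun hvs lG)+
  also have "\<dots> = cs H g (\<lambda>g' g3. cs H g' (\<lambda>g1 g2. cs H h (\<lambda>h' h3. cs H h' (\<lambda>h1 h2. G g1 g2 g3 h1 h2 h3))))"
    by (subst coassoc[OF hvs, of "\<lambda>h1 h2 h3. G _ _ _ h1 h2 h3", OF lG(4-6)]) (rule refl)
  also have "\<dots> = cs H g (\<lambda>g' g3. cs H h (\<lambda>h' h3. cs H g' (\<lambda>g1 g2. cs H h' (\<lambda>h1 h2. G g1 g2 g3 h1 h2 h3))))"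
    by (subst cs_swap) (rule refl)
  finally have X: "X = cs H g (\<lambda>g' g3. cs H h (\<lambda>h' h3. cs H g' (\<lambda>g1 g2. cs H h' (\<lambda>h1 h2. G g1 g2 g3 h1 h2 h3))))" .
  have B1: "cs H g' (\<lambda>g1 g2. cs H h' (\<lambda>h1 h2. G g1 g2 g3 h1 h2 h3)) =
      hscale H (counit H g') (hscale H (counit H h') (antip H h3 * antip H g3))" for g' g3 h' h3
  proof -
    have "cs H g' (\<lambda>g1 g2. cs H h' (\<lambda>h1 h2. G g1 g2 g3 h1 h2 h3)) =
        cs H (g' * h') (\<lambda>a b. antip H a * b * (antip H h3 * antip H g3))"
      unfolding G_def by (rule cs_mult[OF hvs, symmetric]) (intro lin_intros)+
    also have "\<dots> = hscale H (counit H (g' * h')) (1 * (antip H h3 * antip H g3))"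
      by (rule cs_antip(1)) (intro lin_intros)
    finally show ?thesis by (simp add: counit_mult)
  qed
  have B2: "cs H h (\<lambda>h' h3. hscale H (counit H g') (hscale H (counit H h') (antip H h3 * antip H g3))) =
      hscale H (counit H g') (antip H h * antip H g3)" for g' g3
    by (subst scale_cs_out[OF hvs, symmetric], subst cs_counit(1)) (intro lin_intros refl)+
  have "cs H g (\<lambda>g' g3. hscale H (counit H g') (antip H h * antip H g3)) = antip H h * antip H g"
    by (rule cs_counit(1)) (intro lin_intros)
  then have "X = antip H h * antip H g" unfolding X B1 B2 .
  then show ?thesis using A by simp
qed

text \<open>Both sides are convolution inverse to the comultiplication.\<close>

lemma cs_antip_arg:
  assumes s: "vector_space s" and B1: "\<And>b. lin s (\<lambda>a. B a b)" and B2: "\<And>a. lin s (B a)"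
  shows "cs H (antip H h) B = cs H h (\<lambda>a b. B (antip H b) (antip H a))"
proof -
  note Bi = lin_comp[OF B1] lin_comp[OF B2] lin_cs_fun[OF s] lin_intros
  \<comment> \<open>B applied to Delta(S(h_1)) (h_2 \<otimes> h_3) (S(h_5) \<otimes> S(h_4)). From
    the right, h_3 S(h_4) and then h_2 S(h_5) collapse and leave Delta(S(h)). From the left, the
    first two factors are Delta(S(h_1) h_2) and collapse to 1.\<close>
  define F where "F h1 h2 h3 h4 h5 = cs H (antip H h1) (\<lambda>x y. B (x * (h2 * antip H h5)) (y * (h3 * antip H h4)))"
    for h1 h2 h3 h4 h5
  have lF: "lin s (\<lambda>x. F x h2 h3 h4 h5)" "lin s (\<lambda>x. F h1 x h3 h4 h5)" "lin s (\<lambda>x. F h1 h2 x h4 h5)"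
    "lin s (\<lambda>x. F h1 h2 h3 x h5)" "lin s (\<lambda>x. F h1 h2 h3 h4 x)" for h1 h2 h3 h4 h5
    unfolding F_def by (rule lin_comp[OF lin_cs antip_lin], rule s, (intro Bi)+)
  define X where "X = cs H h (\<lambda>h1 r. cs H r (\<lambda>h2 r. cs H r (\<lambda>h3 r. cs H r (\<lambda>h4 h5. F h1 h2 h3 h4 h5))))"
  have A1: "cs H r (\<lambda>h3 r. cs H r (\<lambda>h4 h5. F h1 h2 h3 h4 h5)) = cs H (antip H h1) (\<lambda>x y. B (x * (h2 * antip H r)) y)" for h1 h2 r
  proof -
    have e: "cs H k (\<lambda>h3 h4. F h1 h2 h3 h4 h5) = s (counit H k) (cs H (antip H h1) (\<lambda>x y. B (x * (h2 * antip H h5)) y))" for k h5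
    proof -
      have "cs H k (\<lambda>h3 h4. F h1 h2 h3 h4 h5) = cs H (antip H h1) (\<lambda>x y. cs H k (\<lambda>h3 h4. B (x * (h2 * antip H h5)) (y * (h3 * antip H h4))))"
        unfolding F_def by (rule cs_swap)
      also have "\<dots> = cs H (antip H h1) (\<lambda>x y. s (counit H k) (B (x * (h2 * antip H h5)) (y * 1)))"
        by (subst cs_antip(2)[where s = s and f = "\<lambda>z. B (_ * (h2 * antip H h5)) (_ * z)"]) (intro Bi refl)+
      finally show ?thesis by (simp add: scale_cs_out[OF s])
    qed
    have "cs H r (\<lambda>h3 r. cs H r (\<lambda>h4 h5. F h1 h2 h3 h4 h5)) = cs H r (\<lambda>k h5. cs H k (\<lambda>h3 h4. F h1 h2 h3 h4 h5))"
      by (rule coassoc[OF s, symmetric]) (rule lF)+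
    also have "\<dots> = cs H (antip H h1) (\<lambda>x y. B (x * (h2 * antip H r)) y)"
      unfolding e by (rule cs_counit(1)) (intro Bi)
    finally show ?thesis .
  qed
  have A2: "cs H r (\<lambda>h2 r. cs H (antip H h1) (\<lambda>x y. B (x * (h2 * antip H r)) y)) = s (counit H r) (cs H (antip H h1) B)" for h1 r
  proof -
    have "cs H r (\<lambda>h2 r. cs H (antip H h1) (\<lambda>x y. B (x * (h2 * antip H r)) y)) =
        s (counit H r) (cs H (antip H h1) (\<lambda>x y. B (x * 1) y))"
      by (rule cs_antip(2)) (intro Bi)
    then show ?thesis by simp
  qed
  have "cs H h (\<lambda>h1 r. s (counit H r) (cs H (antip H h1) B)) = cs H (antip H h) B"
    by (rule cs_counit(2)) (rule lin_comp[OF lin_cs antip_lin], rule s, rule B1, rule B2)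
  then have A: "X = cs H (antip H h) B" unfolding X_def A1 A2 .
  have "X = cs H h (\<lambda>h1 r. cs H r (\<lambda>k r. cs H k (\<lambda>h2 h3. cs H r (\<lambda>h4 h5. F h1 h2 h3 h4 h5))))"
    unfolding X_def
    by (subst coassoc[OF s, of "\<lambda>h2 h3 r. cs H r (\<lambda>h4 h5. F _ h2 h3 h4 h5)"])
      (intro lin_cs_fun lin_cs s lF refl)+
  also have "\<dots> = cs H h (\<lambda>j r. cs H j (\<lambda>h1 k. cs H k (\<lambda>h2 h3. cs H r (\<lambda>h4 h5. F h1 h2 h3 h4 h5))))"
    by (rule coassoc[OF s, symmetric]) (intro lin_cs_fun lin_cs s lF)+
  finally have X: "X = cs H h (\<lambda>j r. cs H j (\<lambda>h1 k. cs H k (\<lambda>h2 h3. cs H r (\<lambda>h4 h5. F h1 h2 h3 h4 h5))))" .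
  have B': "cs H j (\<lambda>h1 k. cs H k (\<lambda>h2 h3. cs H r (\<lambda>h4 h5. F h1 h2 h3 h4 h5))) =
      s (counit H j) (cs H r (\<lambda>h4 h5. B (antip H h5) (antip H h4)))" for j r
  proof -
    have e: "cs H k (\<lambda>h2 h3. F h1 h2 h3 h4 h5) = cs H (antip H h1 * k) (\<lambda>u v. B (u * antip H h5) (v * antip H h4))"
      for h1 k h4 h5
      unfolding F_def by (subst cs_swap, subst cs_mult[OF s]) ((intro Bi)+, simp add: mult.assoc)
    have one: "cs H 1 (\<lambda>u v. B (u * antip H h5) (v * antip H h4)) = B (1 * antip H h5) (1 * antip H h4)" for h4 h5
      by (rule cs_one[OF s]) (intro Bi)+
    have "cs H j (\<lambda>h1 k. cs H k (\<lambda>h2 h3. cs H r (\<lambda>h4 h5. F h1 h2 h3 h4 h5))) =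
        cs H j (\<lambda>h1 k. cs H r (\<lambda>h4 h5. cs H (antip H h1 * k) (\<lambda>u v. B (u * antip H h5) (v * antip H h4))))"
      unfolding e[symmetric] by (subst cs_swap) (rule refl)
    also have "\<dots> = s (counit H j) (cs H r (\<lambda>h4 h5. cs H 1 (\<lambda>u v. B (u * antip H h5) (v * antip H h4))))"
      by (rule cs_antip(1)) (intro Bi lin_cs s)+
    finally show ?thesis unfolding one by simp
  qed
  have "cs H h (\<lambda>j r. s (counit H j) (cs H r (\<lambda>h4 h5. B (antip H h5) (antip H h4)))) =
      cs H h (\<lambda>h4 h5. B (antip H h5) (antip H h4))"
    by (rule cs_counit(1)) (intro lin_cs s Bi)+
  then have "X = cs H h (\<lambda>h4 h5. B (antip H h5) (antip H h4))" unfolding X B' .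
  then show ?thesis using A by simp
qed

lemma S'_antip: "S' (antip H x) = x" and antip_S': "antip H (S' x) = x"
  using bij_antip by (simp_all add: bij_is_inj bij_is_surj surj_f_inv_f)

lemma S'_lin: "lin (hscale H) S'"
proof -
  have "S' (x + y) = S' x + S' y" for x y
    using lin_on_add[OF antip_lin, of "S' x" "S' y"] S'_antip[of "S' x + S' y"] by (simp add: antip_S')
  moreover have "S' (hscale H c x) = hscale H c (S' x)" for c x
    using lin_scaled[OF antip_lin, of c "S' x"] S'_antip[of "hscale H c (S' x)"] by (simp add: antip_S')
  ultimately show ?thesis by (simp add: lin_on_def)
qed

lemma S'_one: "S' 1 = 1"
  using S'_antip[of 1] by (simp add: antip_one)

lemma S'_mult: "S' (g * h) = S' h * S' g"
  using S'_antip[of "S' h * S' g"] by (simp add: antip_mult antip_S')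

lemma counit_S': "counit H (S' h) = counit H h"
  using counit_antip[of "S' h"] by (simp add: antip_S')

lemma cs_S'_arg:
  assumes "vector_space s" "\<And>b. lin s (\<lambda>a. B a b)" "\<And>a. lin s (B a)"
  shows "cs H (S' h) B = cs H h (\<lambda>a b. B (S' b) (S' a))"
  using cs_antip_arg[OF assms(1), of "\<lambda>a b. B (S' b) (S' a)" "S' h",
      OF lin_comp[OF assms(3) S'_lin] lin_comp[OF assms(2) S'_lin]]
  by (simp add: antip_S' S'_antip)

text \<open>The legs occur in the opposite order because S^-1 reverses products: applied to h_1
  S(h_2) = eps(h) it gives h_2 S^-1(h_1) = eps(h).\<close>

lemma cs_S':
  assumes "lin s f"
  shows "cs H h (\<lambda>a b. f (b * S' a)) = s (counit H h) (f 1)"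
proof -
  have "S' (a * antip H b) = b * S' a" for a b by (simp add: S'_mult S'_antip)
  then show ?thesis using cs_antip(2)[OF lin_comp[OF assms S'_lin], of h] by (simp add: S'_one)
qed

section \<open>Iterated coproducts of multilinear functions\<close>

definition mlin :: "('k \<Rightarrow> 'u::ab_group_add \<Rightarrow> 'u) \<Rightarrow> nat \<Rightarrow> ('h list \<Rightarrow> 'u) \<Rightarrow> bool" where
  "mlin s n F \<longleftrightarrow> (\<forall>hs i. length hs = n \<longrightarrow> i < n \<longrightarrow> lin s (\<lambda>a. F (hs[i := a])))"

lemma mlinD: "mlin s n F \<Longrightarrow> length hs = n \<Longrightarrow> i < n \<Longrightarrow> lin s (\<lambda>a. F (hs[i := a]))"
  by (simp add: mlin_def)

lemma mlin_mid:
  assumes "mlin s n F" "Suc (length us + length vs) = n"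
  shows "lin s (\<lambda>a. F (us @ a # vs))"
  using mlinD[OF assms(1), of "us @ 0 # vs" "length us"] assms(2) by simp

lemma mlin_hd: "mlin s (Suc n) F \<Longrightarrow> length hs = n \<Longrightarrow> lin s (\<lambda>a. F (a # hs))"
  using mlin_mid[of s "Suc n" F "[]" hs] by simp

lemma mlin_Cons: "mlin s (Suc n) F \<Longrightarrow> mlin s n (\<lambda>hs. F (a # hs))"
  unfolding mlin_def
proof (intro allI impI)
  fix hs :: "'h list" and i
  assume F: "\<forall>hs i. length hs = Suc n \<longrightarrow> i < Suc n \<longrightarrow> lin s (\<lambda>a. F (hs[i := a]))"
    and "length hs = n" "i < n"
  then show "lin s (\<lambda>b. F (a # hs[i := b]))"
    using F[rule_format, of "a # hs" "Suc i"] by simp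
qed

lemma mlin_snoc: "mlin s (Suc n) F \<Longrightarrow> mlin s n (\<lambda>hs. F (hs @ [a]))"
  unfolding mlin_def
proof (intro allI impI)
  fix hs :: "'h list" and i
  assume F: "\<forall>hs i. length hs = Suc n \<longrightarrow> i < Suc n \<longrightarrow> lin s (\<lambda>a. F (hs[i := a]))"
    and "length hs = n" "i < n"
  then show "lin s (\<lambda>b. F (hs[i := b] @ [a]))"
    using F[rule_format, of "hs @ [a]" i] by (simp add: list_update_append)
qed

lemma mlin_comp:
  assumes "mlin s n F" and g: "\<And>i. i < n \<Longrightarrow> lin (hscale H) (g i)" and len: "\<And>hs. length hs = n \<Longrightarrow> length (f hs) = n"
    and f: "\<And>hs i a. length hs = n \<Longrightarrow> i < n \<Longrightarrow> f (hs[i := a]) = (f hs)[p i := g i a]" "\<And>i. i < n \<Longrightarrow> p i < n"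
  shows "mlin s n (\<lambda>hs. F (f hs))"
  unfolding mlin_def
proof (intro allI impI)
  fix hs :: "'h list" and i assume "length hs = n" "i < n"
  then show "lin s (\<lambda>a. F (f (hs[i := a])))"
    using lin_comp[OF mlinD[OF assms(1) len f(2)] g[of i]] f(1) by simp
qed

lemma mlin_sum_list:
  assumes "vector_space s" "\<And>x. x \<in> set xs \<Longrightarrow> mlin s n (F x)"
  shows "mlin s n (\<lambda>hs. \<Sum>x\<leftarrow>xs. F x hs)"
  unfolding mlin_def
  by (intro allI impI lin_on_sum_list_fun[OF assms(1) subspace_UNIV[OF assms(1)]] mlinD[OF assms(2)])

lemma sweedler_lin_fun:
  assumes "vector_space s" "\<And>hs. length hs = Suc n \<Longrightarrow> lin s (\<lambda>x. F x hs)"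
  shows "lin s (\<lambda>x. sweedler H n h (F x))"
  unfolding sweedler_sum
  by (rule lin_on_sum_list_fun[OF assms(1) subspace_UNIV[OF assms(1)]]) (simp add: length_swl assms(2))

lemma sweedler_lin:
  assumes "vector_space s"
  shows "mlin s (Suc n) F \<Longrightarrow> lin s (\<lambda>h. sweedler H n h F)"
proof (induction n arbitrary: F)
  case 0
  then show ?case using mlin_hd[of s 0 F "[]"] by (simp add: sweedler_0)
next
  case (Suc n)
  show ?case unfolding sweedler_Suc
    by (intro lin_cs assms sweedler_lin_fun Suc.IH mlin_Cons[OF Suc.prems] mlin_hd[OF Suc.prems])
qed

lemma sweedler_scale:
  assumes "vector_space s" shows "sweedler H n h (\<lambda>hs. s c (F hs)) = s c (sweedler H n h F)"
proof -
  interpret vector_space s by fact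
  have "(\<Sum>x\<leftarrow>xs. s c (F x)) = s c (\<Sum>x\<leftarrow>xs. F x)" for xs :: "'h list list"
    by (induction xs) (simp_all add: scale_right_distrib)
  then show ?thesis unfolding sweedler_sum .
qed

text \<open>Coassociativity in general position: the next iterated coproduct arises by comultiplying
  any one leg. Cofaces need it, as the leg acting on a composite is split over its two
  factors.\<close>

lemma sweedler_split:
  assumes s: "vector_space s"
  shows "mlin s (n + 2) F \<Longrightarrow> i \<le> n \<Longrightarrow>
    sweedler H (Suc n) h F = sweedler H n h (\<lambda>hs. cs H (hs ! i) (\<lambda>a b. F (take i hs @ a # b # drop (Suc i) hs)))"
proof (induction i arbitrary: n h F)
  case 0
  show ?case
  proof (cases n)
    case 0
    then show ?thesis by (simp add: sweedler_0 sweedler_Suc del: sweedler.simps)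
  next
    case (Suc m)
    have F: "mlin s (Suc (Suc (Suc m))) F" using 0 Suc by simp
    have "cs H h (\<lambda>a b. cs H b (\<lambda>b1 b2. sweedler H m b2 (\<lambda>hs. F (a # b1 # hs)))) =
        cs H h (\<lambda>a b. cs H a (\<lambda>a1 a2. sweedler H m b (\<lambda>hs. F (a1 # a2 # hs))))"
      by (rule coassoc[OF s, symmetric])
        (intro sweedler_lin_fun sweedler_lin s mlin_Cons[OF mlin_Cons[OF F]] mlin_hd[OF F] mlin_hd[OF mlin_Cons[OF F]]; simp)+
    then show ?thesis
      by (simp add: Suc sweedler_Suc sweedler_cs_swap del: sweedler.simps)
  qed
next
  case (Suc i)
  then obtain m where m: "n = Suc m" "i \<le> m" by (cases n) auto
  have F: "mlin s (Suc (m + 2)) F" using Suc.prems m by simp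
  show ?case
    unfolding m sweedler_Suc[of H "Suc m"] sweedler_Suc[of H m h] Suc.IH[OF mlin_Cons[OF F] m(2)] by simp
qed

text \<open>The counit on any one leg deletes that leg. Codegeneracies need it, since h acts on the
  inserted identity through the counit.\<close>

lemma sweedler_counit:
  assumes s: "vector_space s"
  shows "mlin s (Suc n) F \<Longrightarrow> i \<le> Suc n \<Longrightarrow>
    sweedler H (Suc n) h (\<lambda>hs. s (counit H (hs ! i)) (F (take i hs @ drop (Suc i) hs))) = sweedler H n h F"
proof (induction i arbitrary: n h F)
  case 0
  have "cs H h (\<lambda>a b. s (counit H a) (sweedler H n b F)) = sweedler H n h F"
    by (rule cs_counit(1)[OF sweedler_lin[OF s 0(1)]])
  then show ?case by (simp add: sweedler_Suc sweedler_scale[OF s] del: sweedler.simps)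
next
  case (Suc i)
  show ?case
  proof (cases n)
    case 0
    then have "i = 0" "lin s (\<lambda>a. F [a])" using Suc.prems mlin_hd[of s 0 F "[]"] by simp_all
    then show ?thesis using cs_counit(2)[of s "\<lambda>a. F [a]" h] 0 by (simp add: sweedler_Suc sweedler_0 del: sweedler.simps)
  next
    case (Suc m)
    have F: "mlin s (Suc (Suc m)) F" and i: "i \<le> Suc m" using Suc.prems Suc by simp_all
    show ?thesis
      unfolding Suc sweedler_Suc[of H "Suc m" h] sweedler_Suc[of H m h]
      using Suc.IH[OF mlin_Cons[OF F] i] by (simp del: sweedler.simps)
  qed
qed

text \<open>The recursion of \<open>sweedler\<close> peels legs off the front. The rotation moves
  the last arrow, so its leg has to be separated from the other end.\<close>

lemma sweedler_snoc:
  assumes s: "vector_space s"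
  shows "mlin s (n + 2) F \<Longrightarrow> sweedler H (Suc n) h F = cs H h (\<lambda>a b. sweedler H n a (\<lambda>hs. F (hs @ [b])))"
proof (induction n arbitrary: h F)
  case 0
  then show ?case by (simp add: sweedler_0 sweedler_Suc del: sweedler.simps)
next
  case (Suc n)
  have F: "mlin s (Suc (n + 2)) F" and F': "mlin s (Suc (Suc (Suc n))) F" using Suc.prems by simp_all
  have l3: "lin s (\<lambda>b. F (a # hs @ [b]))" if "length hs = Suc n" for a hs
    using mlin_mid[OF F', of "a # hs" "[]"] that by simp
  have "sweedler H (Suc (Suc n)) h F = cs H h (\<lambda>a b. cs H b (\<lambda>b1 b2. sweedler H n b1 (\<lambda>hs. F (a # hs @ [b2]))))"
    unfolding sweedler_Suc[of H "Suc n"] Suc.IH[OF mlin_Cons[OF F]] by simp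
  also have "\<dots> = cs H h (\<lambda>a b. cs H a (\<lambda>a1 a2. sweedler H n a2 (\<lambda>hs. F (a1 # hs @ [b]))))"
    by (rule coassoc[OF s, symmetric])
      (intro sweedler_lin_fun sweedler_lin s mlin_snoc[OF mlin_Cons[OF F']] mlin_hd[OF F'] l3; simp)+
  finally show ?case by (simp add: sweedler_Suc del: sweedler.simps)
qed

lemma sweedler_mult:
  assumes s: "vector_space s"
  shows "mlin s (Suc n) F \<Longrightarrow>
    sweedler H n (g * h) F = sweedler H n g (\<lambda>gs. sweedler H n h (\<lambda>hs. F (map2 (*) gs hs)))"
proof (induction n arbitrary: g h F)
  case 0
  then show ?case by (simp add: sweedler_0)
next
  case (Suc n)
  have "sweedler H (Suc n) (g * h) F =
      cs H g (\<lambda>a b. cs H h (\<lambda>c d. sweedler H n (b * d) (\<lambda>hs. F (a * c # hs))))"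
    unfolding sweedler_Suc
    by (rule cs_mult[OF s]) (intro sweedler_lin_fun s mlin_hd[OF Suc.prems] sweedler_lin mlin_Cons[OF Suc.prems]; simp)+
  also have "\<dots> = sweedler H (Suc n) g (\<lambda>gs. sweedler H (Suc n) h (\<lambda>hs. F (map2 (*) gs hs)))"
    unfolding sweedler_Suc[of H n g] sweedler_Suc[of H n h] sweedler_cs_swap
      Suc.IH[OF mlin_Cons[OF Suc.prems]] by (simp, rule cs_swap)
  finally show ?case .
qed

lemma sweedler_one:
  assumes s: "vector_space s"
  shows "mlin s (Suc n) F \<Longrightarrow> sweedler H n 1 F = F (replicate (Suc n) 1)"
proof (induction n arbitrary: F)
  case 0
  then show ?case by (simp add: sweedler_0)
next
  case (Suc n)
  have "sweedler H (Suc n) 1 F = sweedler H n 1 (\<lambda>hs. F (1 # hs))"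
    unfolding sweedler_Suc
    by (rule cs_one[OF s]) (intro sweedler_lin_fun s mlin_hd[OF Suc.prems] sweedler_lin mlin_Cons[OF Suc.prems]; simp)+
  then show ?case using Suc.IH[OF mlin_Cons[OF Suc.prems]] by simp
qed

lemma mlin_map_rev:
  assumes "mlin s n F" "lin (hscale H) g"
  shows "mlin s n (\<lambda>hs. F (map g (rev hs)))"
  by (rule mlin_comp[OF assms(1), of "\<lambda>_. g" _ "\<lambda>i. n - Suc i"])
    (auto simp: assms(2) rev_update map_update)

text \<open>S^-1 reverses coproducts as well as products, so the legs of S^-1(h) are the legs of h
  in reversed order, each under S^-1.\<close>

lemma sweedler_S':
  assumes s: "vector_space s"
  shows "mlin s (Suc n) F \<Longrightarrow> sweedler H n (S' h) F = sweedler H n h (\<lambda>hs. F (map S' (rev hs)))"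
proof (induction n arbitrary: h F)
  case 0
  then show ?case by (simp add: sweedler_0)
next
  case (Suc n)
  have "sweedler H (Suc n) (S' h) F = cs H h (\<lambda>a b. sweedler H n (S' a) (\<lambda>hs. F (S' b # hs)))"
    unfolding sweedler_Suc
    by (rule cs_S'_arg[OF s]) (intro sweedler_lin_fun s mlin_hd[OF Suc.prems] sweedler_lin mlin_Cons[OF Suc.prems]; simp)+
  also have "\<dots> = cs H h (\<lambda>a b. sweedler H n a (\<lambda>hs. F (map S' (rev (hs @ [b])))))"
    by (simp add: Suc.IH[OF mlin_Cons[OF Suc.prems]] del: sweedler.simps)
  also have "\<dots> = sweedler H (Suc n) h (\<lambda>hs. F (map S' (rev hs)))"
    by (rule sweedler_snoc[OF s, symmetric]) (use mlin_map_rev[OF Suc.prems S'_lin] in simp)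
  finally show ?case .
qed

end

section \<open>Forms on words\<close>

lemma pure_apply: "\<beta> \<in> snd P \<Longrightarrow> pure P x \<beta> = \<beta> x"
  by (simp add: pure_def)

lemma bi_formI:
  assumes "\<And>w. w \<in> W \<Longrightarrow> lin_on s1 V (*) UNIV (\<lambda>v. f v w)" "\<And>v. v \<in> V \<Longrightarrow> lin_on s2 W (*) UNIV (f v)"
  shows "(\<lambda>(v, w). f v w) \<in> snd (bi s1 V s2 W)"
  using assms by (simp add: bi_def bilin_on_def)

text \<open>A tensor is itself a functional on forms, so lifting a form is evaluating the tensor at
  it. Identities between coactions can thus be tested by evaluating both sides at one form.\<close>

lemma tensor_lift_eval:
  assumes "t \<in> tensor_space P" "\<beta> \<in> snd P"
  shows "tensor_lift P \<beta> t = t \<beta>"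
proof -
  have "t \<beta> = (\<Sum>x\<leftarrow>rep P t. pure P x) \<beta>" using rep(2)[OF assms(1)] by simp
  then show ?thesis by (simp add: tensor_lift_rep sum_list_fun_apply pure_apply[OF assms(2)])
qed

locale sayd_loc = hopf_loc H
  for H :: "('k::field, 'h::ring_1) hopf" +
  fixes M :: "('k, 'h, 'm::ab_group_add) hmodcomod"
  assumes sayd: "SAYD_module H M"
begin

lemmas saydD = sayd[unfolded SAYD_module_def]

lemmas mvs = saydD[THEN conjunct1]
lemmas ract_bilin = saydD[THEN conjunct2, THEN conjunct1]
lemmas ract_one = saydD[THEN conjunct2, THEN conjunct2, THEN conjunct1, rule_format]
lemmas ract_mult = saydD[THEN conjunct2, THEN conjunct2, THEN conjunct2, THEN conjunct1, rule_format]
lemmas coact_lin = saydD[THEN conjunct2, THEN conjunct2, THEN conjunct2, THEN conjunct2, THEN conjunct1]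
lemmas coact_axioms = saydD[THEN conjunct2, THEN conjunct2, THEN conjunct2, THEN conjunct2, THEN conjunct2]
lemmas coact_coassoc_axiom = coact_axioms[THEN conjunct1, rule_format]
lemmas coact_counit_axiom = coact_axioms[THEN conjunct2, THEN conjunct1, rule_format]
lemmas coact_ract_axiom = coact_axioms[THEN conjunct2, THEN conjunct2, THEN conjunct1, rule_format]
lemmas coact_stable_axiom = coact_axioms[THEN conjunct2, THEN conjunct2, THEN conjunct2, rule_format]

sublocale m: vector_space "mscale M" by (rule mvs)

abbreviation mlinear :: "('k \<Rightarrow> 'u::ab_group_add \<Rightarrow> 'u) \<Rightarrow> ('m \<Rightarrow> 'u) \<Rightarrow> bool" where
  "mlinear s f \<equiv> lin_on (mscale M) UNIV s UNIV f"

lemma ract_lin: "mlinear (mscale M) (\<lambda>m. ract M m h)" "lin (mscale M) (ract M m)"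
  using ract_bilin by (simp_all add: bilin_on_def)

text \<open>Sweedler's f m_(-1) m_(0) for the coaction, with values in k, where cochains take
  theirs.\<close>

definition ca :: "'m \<Rightarrow> ('h \<Rightarrow> 'm \<Rightarrow> 'k) \<Rightarrow> 'k" where
  "ca m f = tensor_lift (HM H M) (\<lambda>(a, x). f a x) (coact M m)"

lemma ca_sum: "ca m f = (\<Sum>x\<leftarrow>rep (HM H M) (coact M m). f (fst x) (snd x))"
  by (simp add: ca_def tensor_lift_rep split_def)

lemma coact_mem: "coact M m \<in> tensor_space (HM H M)"
  by (rule lin_on_mem[OF coact_lin]) simp

lemma ca_eval:
  assumes "\<And>x. lin (*) (\<lambda>a. f a x)" "\<And>a. mlinear (*) (f a)"
  shows "(\<lambda>(a, x). f a x) \<in> snd (HM H M)" "ca m f = coact M m (\<lambda>(a, x). f a x)"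
proof -
  show *: "(\<lambda>(a, x). f a x) \<in> snd (HM H M)" unfolding HM_def using assms by (intro bi_formI)
  show "ca m f = coact M m (\<lambda>(a, x). f a x)" unfolding ca_def by (rule tensor_lift_eval[OF coact_mem *])
qed

lemma ca_lin:
  assumes "\<And>x. lin (*) (\<lambda>a. f a x)" "\<And>a. mlinear (*) (f a)"
  shows "mlinear (*) (\<lambda>m. ca m f)"
  unfolding ca_eval(2)[OF assms] lin_on_def
  by (simp add: lin_on_add[OF coact_lin] lin_on_scale[OF coact_lin]) (simp add: fscale_def)

lemma ca_lin_fun:
  assumes "\<And>a y. lin_on s V (*) UNIV (\<lambda>x. f x a y)"
  shows "lin_on s V (*) UNIV (\<lambda>x. ca m (f x))"
  unfolding ca_sum by (rule lin_on_sum_list_fun[OF vector_space_field subspace_UNIV[OF vector_space_field] assms])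

lemma mlinear_comp: "mlinear s f \<Longrightarrow> lin_on s1 V (mscale M) UNIV g \<Longrightarrow> lin_on s1 V s UNIV (\<lambda>x. f (g x))"
  by (rule lin_on_comp)

text \<open>Both sides are values at one bilinear form \<open>\<beta>\<close> on H \<otimes> (H
  \<otimes> M), of the two tensors that the coassociativity axiom identifies.\<close>

lemma ca_coassoc:
  assumes f: "\<And>b x. lin (*) (\<lambda>a. f a b x)" "\<And>a x. lin (*) (\<lambda>b. f a b x)" "\<And>a b. mlinear (*) (f a b)"
  shows "ca m (\<lambda>a x. cs H a (\<lambda>a1 a2. f a1 a2 x)) = ca m (\<lambda>a x. ca x (\<lambda>b y. f a b y))"
proof -
  define \<beta> :: "'h \<times> ('h \<times> 'm, 'k) tensor \<Rightarrow> 'k" where "\<beta> = (\<lambda>(a, t). t (\<lambda>(b, x). f a b x))"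
  have \<beta>: "\<beta> \<in> snd (HHM H M)"
    unfolding HHM_def \<beta>_def
  proof (rule bi_formI)
    fix t assume t: "t \<in> tensor_space (HM H M)"
    have "t (\<lambda>(b, x). f a b x) = tensor_lift (HM H M) (\<lambda>(b, x). f a b x) t" for a
      by (rule tensor_lift_eval[OF t ca_eval(1), symmetric]) (rule f)+
    then show "lin (*) (\<lambda>a. t (\<lambda>(b, x). f a b x))"
      unfolding tensor_lift_rep
      by (simp add: lin_on_sum_list_fun[OF vector_space_field subspace_UNIV[OF vector_space_field]] f(1) split_def)
  qed (simp add: lin_on_def fscale_def)
  have "ca m (\<lambda>a x. cs H a (\<lambda>a1 a2. f a1 a2 x)) =
      tensor_lift (HM H M) (\<lambda>(a, x). sweedler H 1 a (\<lambda>hs. pure (HHM H M) (hs ! 0, pure (HM H M) (hs ! 1, x)))) (coact M m) \<beta>"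
    unfolding tensor_lift_rep ca_sum sweedler_1 cs_sum
    by (simp add: split_def sum_list_fun_apply pure_apply[OF \<beta>])
      (simp add: \<beta>_def pure_apply[OF ca_eval(1)] f)
  also have "\<dots> = tensor_lift (HM H M) (\<lambda>(a, x). pure (HHM H M) (a, coact M x)) (coact M m) \<beta>"
    unfolding coact_coassoc_axiom ..
  also have "\<dots> = ca m (\<lambda>a x. ca x (\<lambda>b y. f a b y))"
    unfolding tensor_lift_rep ca_sum[of m]
    by (simp add: split_def sum_list_fun_apply pure_apply[OF \<beta>]) (simp add: \<beta>_def ca_eval(2) f)
  finally show ?thesis .
qed

lemma mlinear_sum_list: "mlinear (*) f \<Longrightarrow> f (\<Sum>x\<leftarrow>xs. g x) = (\<Sum>x\<leftarrow>xs. f (g x))"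
  by (rule lin_on_sum_list_gen[OF mvs m.subspace_UNIV]) auto

lemma ca_counit:
  assumes f: "mlinear (*) f"
  shows "ca m (\<lambda>a x. counit H a * f x) = f m"
proof -
  have "f m = f (tensor_lift (HM H M) (\<lambda>(a, x). mscale M (counit H a) x) (coact M m))"
    unfolding coact_counit_axiom ..
  also have "\<dots> = ca m (\<lambda>a x. counit H a * f x)"
    unfolding tensor_lift_rep ca_sum
    by (simp add: split_def mlinear_sum_list[OF f] lin_on_scale[OF f])
  finally show ?thesis by simp
qed

lemma ca_stable:
  assumes f: "mlinear (*) f"
  shows "ca m (\<lambda>a x. f (ract M x a)) = f m"
proof -
  have "f m = f (tensor_lift (HM H M) (\<lambda>(a, x). ract M x a) (coact M m))"
    unfolding coact_stable_axiom ..
  also have "\<dots> = ca m (\<lambda>a x. f (ract M x a))"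
    unfolding tensor_lift_rep ca_sum by (simp add: split_def mlinear_sum_list[OF f])
  finally show ?thesis by simp
qed

lemma ca_ract:
  assumes f: "\<And>x. lin (*) (\<lambda>a. f a x)" "\<And>a. mlinear (*) (f a)"
  shows "ca (ract M m h) f =
    cs H h (\<lambda>h1 r. cs H r (\<lambda>h2 h3. ca m (\<lambda>a x. f (antip H h3 * a * h1) (ract M x h2))))"
proof -
  have "ca (ract M m h) f = sweedler H 2 h (\<lambda>hs. tensor_lift (HM H M)
      (\<lambda>(a, x). pure (HM H M) (antip H (hs ! 2) * a * hs ! 0, ract M x (hs ! 1))) (coact M m)) (\<lambda>(a, x). f a x)"
    unfolding ca_eval(2)[OF f] coact_ract_axiom ..
  also have "\<dots> = sweedler H (Suc (Suc 0)) h (\<lambda>hs. ca m (\<lambda>a x. f (antip H (hs ! 2) * a * hs ! 0) (ract M x (hs ! 1))))"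
    unfolding sweedler_sum tensor_lift_rep ca_sum numeral_2_eq_2
    by (simp add: split_def sum_list_fun_apply pure_apply[OF ca_eval(1)[OF f, unfolded split_def]] del: swl.simps)
  finally show ?thesis by (simp add: sweedler_Suc sweedler_0 numeral_2_eq_2 del: sweedler.simps)
qed

lemma ca_sweedler_swap: "ca m (\<lambda>a x. sweedler H n h (\<lambda>hs. f a x hs)) = sweedler H n h (\<lambda>hs. ca m (\<lambda>a x. f a x hs))"
  unfolding ca_sum sweedler_sum by (rule sum_list_swap)

text \<open>Stability in the form m_(0) S^-1(m_(-1)) = m, which gives the rotation its finite order.
  By stability m_(0) may be replaced by its own m_(0) m_(-1); after coassociativity the product a_2
  S^-1(a_1) of the two legs of the coacting element is a counit.\<close>

lemma ca_stable_S':
  assumes f: "mlinear (*) f"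
  shows "ca m (\<lambda>a x. f (ract M x (S' a))) = f m"
proof -
  have fr: "mlinear (*) (\<lambda>x. f (ract M x h))" for h by (rule mlinear_comp[OF f ract_lin(1)])
  have fl: "lin (*) (\<lambda>h. f (ract M x h))" for x by (rule mlinear_comp[OF f ract_lin(2)])
  have "ca m (\<lambda>a x. f (ract M x (S' a))) = ca m (\<lambda>a x. ca x (\<lambda>b y. f (ract M y (b * S' a))))"
    by (simp add: ract_mult ca_stable[OF fr])
  also have "\<dots> = ca m (\<lambda>a x. cs H a (\<lambda>a1 a2. f (ract M x (a2 * S' a1))))"
    by (rule ca_coassoc[symmetric]) (rule lin_comp[OF fl] fr, (intro lin_mult2 lin_mult1 S'_lin lin_id)?)+
  also have "\<dots> = ca m (\<lambda>a x. counit H a * f (ract M x 1))"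
    by (simp add: cs_S'[OF fl])
  also have "\<dots> = f m" by (simp add: ract_one ca_counit[OF f])
  finally show ?thesis .
qed

end

section \<open>Words, balanced forms and the cochains that they define\<close>

locale hcat_loc = sayd_loc H M
  for H :: "('k::field, 'h::ring_1) hopf" and M :: "('k, 'h, 'm::ab_group_add) hmodcomod" +
  fixes D :: "('k, 'h, 'o, 'a::ab_group_add) hcat"
  assumes hcat: "H_category H D"
begin

lemmas hcatD = hcat[unfolded H_category_def]

lemmas cvs = hcatD[THEN conjunct1]
lemmas Hom_sub = hcatD[THEN conjunct2, THEN conjunct1, rule_format]
lemmas cmp_bilin = hcatD[THEN conjunct2, THEN conjunct2, THEN conjunct1, rule_format]
lemmas cmp_assoc = hcatD[THEN conjunct2, THEN conjunct2, THEN conjunct2, THEN conjunct1, rule_format]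
lemmas ident_mem = hcatD[THEN conjunct2, THEN conjunct2, THEN conjunct2, THEN conjunct2, THEN conjunct1, rule_format]
lemmas hcatD' = hcatD[THEN conjunct2, THEN conjunct2, THEN conjunct2, THEN conjunct2, THEN conjunct2]
lemmas cmp_ident = hcatD'[THEN conjunct1, rule_format]
lemmas lact_axiom = hcatD'[THEN conjunct2, THEN conjunct1, rule_format]
lemmas lact_ident = hcatD'[THEN conjunct2, THEN conjunct2, THEN conjunct1, rule_format]
lemmas lact_cmp_axiom = hcatD'[THEN conjunct2, THEN conjunct2, THEN conjunct2, rule_format]

sublocale c: vector_space "cscale D" by (rule cvs)

lemma lact_lin:
  assumes "X \<in> Obj D" "Y \<in> Obj D"
  shows "f \<in> Hom D X Y \<Longrightarrow> lin_on (hscale H) UNIV (cscale D) (Hom D X Y) (\<lambda>h. lact D X Y h f)"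
    and "lin_on (cscale D) (Hom D X Y) (cscale D) (Hom D X Y) (lact D X Y h)"
    and "f \<in> Hom D X Y \<Longrightarrow> lact D X Y h f \<in> Hom D X Y"
    and "f \<in> Hom D X Y \<Longrightarrow> lact D X Y 1 f = f"
    and "f \<in> Hom D X Y \<Longrightarrow> lact D X Y (g * h) f = lact D X Y g (lact D X Y h f)"
proof -
  show *: "lin_on (cscale D) (Hom D X Y) (cscale D) (Hom D X Y) (lact D X Y h)" for h
    using lact_axiom[OF assms] by (simp add: bilin_on_def)
  show "f \<in> Hom D X Y \<Longrightarrow> lin_on (hscale H) UNIV (cscale D) (Hom D X Y) (\<lambda>h. lact D X Y h f)"
    "f \<in> Hom D X Y \<Longrightarrow> lact D X Y 1 f = f"
    "f \<in> Hom D X Y \<Longrightarrow> lact D X Y (g * h) f = lact D X Y g (lact D X Y h f)"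
    using lact_axiom[OF assms] by (simp_all add: bilin_on_def)
  show "f \<in> Hom D X Y \<Longrightarrow> lact D X Y h f \<in> Hom D X Y" by (rule lin_on_mem[OF *])
qed

lemma wordD:
  assumes "(xs, fs) \<in> cyclic_words D n"
  shows "length xs = Suc n" "length fs = Suc n" "set xs \<subseteq> Obj D"
    "i \<le> n \<Longrightarrow> fs ! i \<in> Hom D (src xs i) (tgt xs i)"
    "src xs i \<in> Obj D" "tgt xs i \<in> Obj D"
proof -
  show l: "length xs = Suc n" "length fs = Suc n" and o: "set xs \<subseteq> Obj D"
    and "i \<le> n \<Longrightarrow> fs ! i \<in> Hom D (src xs i) (tgt xs i)"
    using assms by (simp_all add: cyclic_words_def)
  show "src xs i \<in> Obj D" "tgt xs i \<in> Obj D"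
    using l by (auto simp: src_def tgt_def intro!: subsetD[OF o] nth_mem)
qed

definition wact :: "nat \<Rightarrow> 'o list \<Rightarrow> 'h list \<Rightarrow> 'a list \<Rightarrow> 'a list" where
  "wact n xs hs fs = map (\<lambda>i. lact D (src xs i) (tgt xs i) (hs ! i) (fs ! i)) [0..<Suc n]"

lemma length_wact [simp]: "length (wact n xs hs fs) = Suc n"
  by (simp add: wact_def)

lemma nth_wact [simp]: "i \<le> n \<Longrightarrow> wact n xs hs fs ! i = lact D (src xs i) (tgt xs i) (hs ! i) (fs ! i)"
  unfolding wact_def by (simp del: upt_Suc add: less_Suc_eq_le)

lemma wact_word:
  assumes "(xs, fs) \<in> cyclic_words D n"
  shows "(xs, wact n xs hs fs) \<in> cyclic_words D n"
proof -
  note w = wordD[OF assms]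
  show ?thesis
    unfolding cyclic_words_def using w(1,3) lact_lin(3)[OF w(5,6) w(4)] by simp
qed

text \<open>Functions of words that extend to linear maps on M \<otimes> CN_n. The list of objects
  is a parameter in which no linearity is asked, since it labels the direct summands.\<close>

definition mform :: "nat \<Rightarrow> ('k \<Rightarrow> 'u::ab_group_add \<Rightarrow> 'u) \<Rightarrow> 'u set \<Rightarrow> ('m \<Rightarrow> 'o list \<Rightarrow> 'a list \<Rightarrow> 'u) \<Rightarrow> bool" where
  "mform n s U F \<longleftrightarrow>
     (\<forall>(xs, fs)\<in>cyclic_words D n. lin_on (mscale M) UNIV s U (\<lambda>m. F m xs fs)) \<and>
     (\<forall>m. multilin_CN D n s U (\<lambda>(xs, fs). F m xs fs))"

lemma mformI:
  assumes "\<And>xs fs. (xs, fs) \<in> cyclic_words D n \<Longrightarrow> lin_on (mscale M) UNIV s U (\<lambda>m. F m xs fs)"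
    and "\<And>m xs fs i. (xs, fs) \<in> cyclic_words D n \<Longrightarrow> i \<le> n \<Longrightarrow>
      lin_on (cscale D) (Hom D (src xs i) (tgt xs i)) s U (\<lambda>g. F m xs (fs[i := g]))"
  shows "mform n s U F"
  using assms by (auto simp: mform_def multilin_CN_def)

lemma mformD:
  assumes "mform n s U F" "(xs, fs) \<in> cyclic_words D n"
  shows "lin_on (mscale M) UNIV s U (\<lambda>m. F m xs fs)"
    and "i \<le> n \<Longrightarrow> lin_on (cscale D) (Hom D (src xs i) (tgt xs i)) s U (\<lambda>g. F m xs (fs[i := g]))"
  using bspec[OF assms(1)[unfolded mform_def multilin_CN_def, THEN conjunct1] assms(2)]
    bspec[OF assms(1)[unfolded mform_def multilin_CN_def, THEN conjunct2, THEN spec] assms(2)] by simp_all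

abbreviation CNs :: "nat \<Rightarrow> ('o list \<times> 'a list, 'k) tensor set" where
  "CNs n \<equiv> tensor_space (CN D n)"

abbreviation MCNs :: "nat \<Rightarrow> ('k, 'm, 'o, 'a) chain set" where
  "MCNs n \<equiv> tensor_space (MCN M D n)"

lemma fst_CN: "fst (CN D n) = cyclic_words D n"
  by (simp add: CN_def)

lemma CNs_sub: "module.subspace fscale (CNs n)"
proof (rule subspace_tensor_space)
  fix c x assume "x \<in> fst (CN D n)"
  then obtain xs fs where x: "x = (xs, fs)" "(xs, fs) \<in> cyclic_words D n" by (cases x) (auto simp: CN_def)
  note w = wordD[OF x(2)]
  have "lin_on (cscale D) (Hom D (src xs 0) (tgt xs 0)) fscale UNIV (\<lambda>g. pure (CN D n) (xs, fs[0 := g]))"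
    using pure_CN_multilin[of D n] x(2) unfolding multilin_CN_def by blast
  from lin_on_scale[OF this w(4)[of 0], of c]
  have "pure (CN D n) (xs, fs[0 := cscale D c (fs ! 0)]) = fscale c (pure (CN D n) (xs, fs))" by simp
  moreover have "cscale D c (fs ! 0) \<in> Hom D (src xs 0) (tgt xs 0)"
    by (rule c.subspace_scale[OF Hom_sub[OF w(5,6)] w(4)]) simp
  ultimately show "\<exists>y\<in>fst (CN D n). fscale c (pure (CN D n) x) = pure (CN D n) y"
    using cyclic_words_update[OF x(2), of 0] x(1) by (auto simp: fst_CN intro!: bexI)
qed

lemma MCNs_sub: "module.subspace fscale (MCNs n)"
  unfolding MCN_def by (rule subspace_tensor_space_bi[OF mvs m.subspace_UNIV])

lemma CN_pure_mem: "(xs, fs) \<in> cyclic_words D n \<Longrightarrow> pure (CN D n) (xs, fs) \<in> CNs n"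
  by (rule pure_mem_tensor_space) (simp add: fst_CN)

lemma MCN_pure_mem: "c \<in> CNs n \<Longrightarrow> pure (MCN M D n) (m, c) \<in> MCNs n"
  by (rule pure_mem_tensor_space) (simp add: MCN_def fst_bi)

lemma mword_mem: "(xs, fs) \<in> cyclic_words D n \<Longrightarrow> mword M D n m xs fs \<in> MCNs n"
  unfolding mword_def by (intro MCN_pure_mem CN_pure_mem)

lemma pure_MCN_lin:
  shows "c \<in> CNs n \<Longrightarrow> lin_on (mscale M) UNIV fscale (MCNs n) (\<lambda>m. pure (MCN M D n) (m, c))"
    and "lin_on fscale (CNs n) fscale (MCNs n) (\<lambda>c. pure (MCN M D n) (m, c))"
  using pure_bi_bilin[of "mscale M" UNIV fscale "CNs n"] MCN_pure_mem
  by (simp_all add: bilin_on_def lin_on_def MCN_def)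

lemma pure_CN_lin:
  assumes "(xs, fs) \<in> cyclic_words D n" "i \<le> n"
  shows "lin_on (cscale D) (Hom D (src xs i) (tgt xs i)) fscale (CNs n) (\<lambda>g. pure (CN D n) (xs, fs[i := g]))"
proof -
  have "lin_on (cscale D) (Hom D (src xs i) (tgt xs i)) fscale UNIV (\<lambda>g. pure (CN D n) (xs, fs[i := g]))"
    using pure_CN_multilin[of D n] assms unfolding multilin_CN_def by blast
  then show ?thesis using CN_pure_mem[OF cyclic_words_update[OF assms]] by (simp add: lin_on_def)
qed

lemma mform_mword: "mform n fscale (MCNs n) (mword M D n)"
proof (rule mformI)
  fix xs fs assume w: "(xs, fs) \<in> cyclic_words D n"
  show "lin_on (mscale M) UNIV fscale (MCNs n) (\<lambda>m. mword M D n m xs fs)"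
    unfolding mword_def by (rule pure_MCN_lin(1)[OF CN_pure_mem[OF w]])
  show "lin_on (cscale D) (Hom D (src xs i) (tgt xs i)) fscale (MCNs n) (\<lambda>g. mword M D n m xs (fs[i := g]))"
    if "i \<le> n" for i m
    unfolding mword_def by (rule lin_on_comp[OF pure_CN_lin[OF w that] pure_MCN_lin(2)])
qed

lemma mform_comp:
  assumes "mform n s U F" "lin_on s U s2 W f"
  shows "mform n s2 W (\<lambda>m xs fs. f (F m xs fs))"
  by (rule mformI; rule lin_on_comp[OF _ assms(2)]; rule mformD[OF assms(1)])

lemma lin_eq_on_sums:
  assumes "lin_on fscale (tensor_space P) s U f" "lin_on fscale (tensor_space P) s U' g" "vector_space s"
    and sub: "module.subspace fscale (tensor_space P)"
    and "\<And>x. x \<in> fst P \<Longrightarrow> f (pure P x) = g (pure P x)" and t: "t \<in> tensor_space P"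
  shows "f t = g t"
proof -
  note r = rep[OF t]
  have "f t = (\<Sum>x\<leftarrow>rep P t. f (pure P x))" "g t = (\<Sum>x\<leftarrow>rep P t. g (pure P x))"
    by (subst r(2), rule lin_on_sum_list_gen[OF vector_space_fscale sub], rule assms, use r(1) in \<open>auto intro: pure_mem_tensor_space\<close>)+
  moreover have "map (\<lambda>x. f (pure P x)) (rep P t) = map (\<lambda>x. g (pure P x)) (rep P t)"
    using r(1) assms(5) by (intro map_cong) auto
  ultimately show ?thesis by simp
qed

lemma MCNs_ext:
  assumes f: "lin_on fscale (MCNs n) s U f" and g: "lin_on fscale (MCNs n) s U' g" and s: "vector_space s"
    and e: "\<And>m xs fs. (xs, fs) \<in> cyclic_words D n \<Longrightarrow> f (mword M D n m xs fs) = g (mword M D n m xs fs)"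
    and t: "t \<in> MCNs n"
  shows "f t = g t"
proof (rule lin_eq_on_sums[OF f g s MCNs_sub _ t])
  fix x assume "x \<in> fst (MCN M D n)"
  then obtain m c where x: "x = (m, c)" "c \<in> CNs n" by (cases x) (auto simp: MCN_def fst_bi)
  have "f (pure (MCN M D n) (m, c)) = g (pure (MCN M D n) (m, c))"
  proof (rule lin_eq_on_sums[OF lin_on_comp[OF pure_MCN_lin(2) f] lin_on_comp[OF pure_MCN_lin(2) g] s CNs_sub _ x(2)])
    fix y assume "y \<in> fst (CN D n)"
    then show "f (pure (MCN M D n) (m, pure (CN D n) y)) = g (pure (MCN M D n) (m, pure (CN D n) y))"
      using e[of "fst y" "snd y" m] by (simp add: fst_CN mword_def)
  qed
  then show "f (pure (MCN M D n) x) = g (pure (MCN M D n) x)" using x by simp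
qed

text \<open>The two nested lifts are treated one after the other: the inner one is linear on CN_n
  for fixed m, and together with linearity in m this makes the outer integrand bilinear.\<close>

lemma chain_lift:
  assumes F: "mform n s U F" and s: "vector_space s" and U: "module.subspace s U"
  shows chain_lift_lin: "lin_on fscale (MCNs n) s U (chain_lift M D n F)"
    and chain_lift_mword: "(xs, fs) \<in> cyclic_words D n \<Longrightarrow> chain_lift M D n F (mword M D n m xs fs) = F m xs fs"
proof -
  define G where "G m c = tensor_lift (CN D n) (\<lambda>(xs, fs). F m xs fs) c" for m c
  have Fm: "multilin_CN D n s U (\<lambda>(xs, fs). F m xs fs)" for m using F by (simp add: mform_def)
  have G1: "lin_on fscale (CNs n) s U (G m)" for m
    unfolding G_def by (rule tensor_lift_lin_CN[OF s U Fm cvs Hom_sub])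
  have G2: "lin_on (mscale M) UNIV s U (\<lambda>m. G m c)" if "c \<in> CNs n" for c
    unfolding G_def tensor_lift_rep
  proof (rule lin_on_sum_list_fun[OF s U])
    fix y assume "y \<in> set (rep (CN D n) c)"
    then have "y \<in> cyclic_words D n" using rep(1)[OF that] by (auto simp: fst_CN)
    then show "lin_on (mscale M) UNIV s U (\<lambda>m. case y of (xs, fs) \<Rightarrow> F m xs fs)"
      using mformD(1)[OF F] by (cases y) simp
  qed
  have G: "bilin_on (mscale M) UNIV fscale (CNs n) s U G" using G1 G2 by (simp add: bilin_on_def)
  have c: "chain_lift M D n F = tensor_lift (MCN M D n) (\<lambda>(m, c). G m c)"
    by (simp add: chain_lift_def G_def fun_eq_iff)
  show "lin_on fscale (MCNs n) s U (chain_lift M D n F)"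
    unfolding c MCN_def by (rule tensor_lift_lin_bi[OF s U G mvs m.subspace_UNIV])
  assume w: "(xs, fs) \<in> cyclic_words D n"
  have "chain_lift M D n F (mword M D n m xs fs) = G m (pure (CN D n) (xs, fs))"
    unfolding c mword_def MCN_def by (rule tensor_lift_pure_bi[OF s G UNIV_I CN_pure_mem[OF w]])
  also have "\<dots> = F m xs fs"
    unfolding G_def using tensor_lift_pure_CN[OF s Fm w] by simp
  finally show "chain_lift M D n F (mword M D n m xs fs) = F m xs fs" .
qed

end

lemma tensor_space_sum_list: "(\<And>x. x \<in> set xs \<Longrightarrow> q x \<in> tensor_space P) \<Longrightarrow> (\<Sum>x\<leftarrow>xs. q x) \<in> tensor_space P"
  by (induction xs) (auto simp: tensor_space_zero tensor_space_add)

lemma cs_mem: "(\<And>a b. f a b \<in> tensor_space P) \<Longrightarrow> cs H h f \<in> tensor_space P"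
  unfolding cs_sum by (rule tensor_space_sum_list)

lemma sweedler_mem: "(\<And>hs. f hs \<in> tensor_space P) \<Longrightarrow> sweedler H n h f \<in> tensor_space P"
  unfolding sweedler_sum by (rule tensor_space_sum_list)

lemma lin_on_cs_out:
  assumes "lin_on s1 V s2 W f" "vector_space s1" "module.subspace s1 V" "\<And>a b. g a b \<in> V"
  shows "f (cs H h g) = cs H h (\<lambda>a b. f (g a b))"
  unfolding cs_sum by (rule lin_on_sum_list_gen[OF assms(2,3,1,4)])

lemma lin_on_sweedler_out:
  assumes "lin_on s1 V s2 W f" "vector_space s1" "module.subspace s1 V" "\<And>hs. g hs \<in> V"
  shows "f (sweedler H n h g) = sweedler H n h (\<lambda>hs. f (g hs))"
  unfolding sweedler_sum by (rule lin_on_sum_list_gen[OF assms(2,3,1,4)])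

context hcat_loc
begin

lemma wact_update_hs:
  assumes "length hs = Suc n" "i \<le> n"
  shows "wact n xs (hs[i := a]) fs = (wact n xs hs fs)[i := lact D (src xs i) (tgt xs i) a (fs ! i)]"
  using assms by (intro nth_equalityI) (auto simp: nth_list_update less_Suc_eq_le)

lemma wact_update_fs:
  assumes "length fs = Suc n" "i \<le> n"
  shows "wact n xs hs (fs[i := g]) = (wact n xs hs fs)[i := lact D (src xs i) (tgt xs i) (hs ! i) g]"
  using assms by (intro nth_equalityI) (auto simp: nth_list_update less_Suc_eq_le)

lemma wact_mult:
  assumes "(xs, fs) \<in> cyclic_words D n" "length gs = Suc n" "length hs = Suc n"
  shows "wact n xs gs (wact n xs hs fs) = wact n xs (map2 (*) gs hs) fs"
  using assms(2,3) wordD[OF assms(1)]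
  by (intro nth_equalityI) (auto simp: less_Suc_eq_le lact_lin)

lemma wact_one:
  assumes "(xs, fs) \<in> cyclic_words D n"
  shows "wact n xs (replicate (Suc n) 1) fs = fs"
  using wordD[OF assms]
  by (intro nth_equalityI) (auto simp: less_Suc_eq_le lact_lin simp del: replicate_Suc)

lemma mlin_wact:
  assumes w: "(xs, fs) \<in> cyclic_words D n"
    and F: "\<And>gs i. (xs, gs) \<in> cyclic_words D n \<Longrightarrow> i \<le> n \<Longrightarrow>
      lin_on (cscale D) (Hom D (src xs i) (tgt xs i)) s U (\<lambda>g. F (gs[i := g]))"
  shows "mlin s (Suc n) (\<lambda>hs. F (wact n xs hs fs))"
  unfolding mlin_def
proof (intro allI impI)
  fix hs :: "'h list" and i assume hs: "length hs = Suc n" and "i < Suc n"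
  then have i: "i \<le> n" by simp
  note wd = wordD[OF w]
  have "lin_on (hscale H) UNIV s U (\<lambda>a. F ((wact n xs hs fs)[i := lact D (src xs i) (tgt xs i) a (fs ! i)]))"
    by (rule lin_on_comp[OF lact_lin(1)[OF wd(5,6) wd(4)[OF i]] F[OF wact_word[OF w] i]])
  then show "lin s (\<lambda>a. F (wact n xs (hs[i := a]) fs))"
    unfolding wact_update_hs[OF hs i] by (simp add: lin_on_def)
qed

lemma mform_mlin:
  assumes "mform n s U F" "(xs, fs) \<in> cyclic_words D n"
  shows "mlin s (Suc n) (\<lambda>hs. F m xs (wact n xs hs fs))"
  by (rule mlin_wact[OF assms(2) mformD(2)[OF assms(1)]])

lemma lin_on_wact:
  assumes s: "vector_space s" "module.subspace s U" and w: "(xs, fs) \<in> cyclic_words D n" and i: "i \<le> n"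
    and F: "\<And>gs i. (xs, gs) \<in> cyclic_words D n \<Longrightarrow> i \<le> n \<Longrightarrow>
      lin_on (cscale D) (Hom D (src xs i) (tgt xs i)) s U (\<lambda>g. F (gs[i := g]))"
  shows "lin_on (cscale D) (Hom D (src xs i) (tgt xs i)) s U (\<lambda>g. sweedler H n h (\<lambda>hs. F (wact n xs hs (fs[i := g]))))"
  unfolding sweedler_sum
proof (rule lin_on_sum_list_fun[OF s])
  fix hs
  show "lin_on (cscale D) (Hom D (src xs i) (tgt xs i)) s U (\<lambda>g. F (wact n xs hs (fs[i := g])))"
    unfolding wact_update_fs[OF wordD(2)[OF w] i]
    by (rule lin_on_comp[OF lact_lin(2)[OF wordD(5,6)[OF w]] F[OF wact_word[OF w] i]])
qed

lemma CN_act_eq: "CN_act H D n h = tensor_lift (CN D n) (\<lambda>(xs, fs). sweedler H n h (\<lambda>hs. pure (CN D n) (xs, wact n xs hs fs)))"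
  by (simp add: CN_act_def wact_def)

lemma CN_act_multilin: "multilin_CN D n fscale (CNs n) (\<lambda>(xs, fs). sweedler H n h (\<lambda>hs. pure (CN D n) (xs, wact n xs hs fs)))"
  unfolding multilin_CN_def
  using lin_on_wact[OF vector_space_fscale CNs_sub _ _ pure_CN_lin] by auto

lemma CN_act_lin: "lin_on fscale (CNs n) fscale (CNs n) (CN_act H D n h)"
  unfolding CN_act_eq by (rule tensor_lift_lin_CN[OF vector_space_fscale CNs_sub CN_act_multilin cvs Hom_sub])

lemma CN_act_pure:
  assumes "(xs, fs) \<in> cyclic_words D n"
  shows "CN_act H D n h (pure (CN D n) (xs, fs)) = sweedler H n h (\<lambda>hs. pure (CN D n) (xs, wact n xs hs fs))"
  unfolding CN_act_eq tensor_lift_pure_CN[OF vector_space_fscale CN_act_multilin assms] by simp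

lemma MCN_act_eq: "MCN_act H M D n t h = tensor_lift (MCN M D n) (\<lambda>(m, c). cs H h (\<lambda>a b.
     pure (MCN M D n) (ract M m a, CN_act H D n (antip H b) c))) t"
  by (simp add: MCN_act_def cs_def)

lemma MCN_act_bilin: "bilin_on (mscale M) UNIV fscale (CNs n) fscale (MCNs n)
    (\<lambda>m c. cs H h (\<lambda>a b. pure (MCN M D n) (ract M m a, CN_act H D n (antip H b) c)))"
  unfolding bilin_on_def
proof (intro conjI ballI)
  fix m
  show "lin_on fscale (CNs n) fscale (MCNs n) (\<lambda>c. cs H h (\<lambda>a b. pure (MCN M D n) (ract M m a, CN_act H D n (antip H b) c)))"
    unfolding cs_sum
    by (intro lin_on_sum_list_fun vector_space_fscale MCNs_sub lin_on_comp[OF CN_act_lin pure_MCN_lin(2)])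
next
  fix c assume "c \<in> CNs n"
  then have "CN_act H D n g c \<in> CNs n" for g by (rule lin_on_mem[OF CN_act_lin])
  then show "lin_on (mscale M) UNIV fscale (MCNs n) (\<lambda>m. cs H h (\<lambda>a b. pure (MCN M D n) (ract M m a, CN_act H D n (antip H b) c)))"
    unfolding cs_sum
    by (intro lin_on_sum_list_fun vector_space_fscale MCNs_sub lin_on_comp[OF ract_lin(1) pure_MCN_lin(1)])
qed

lemma MCN_act_lin: "lin_on fscale (MCNs n) fscale (MCNs n) (\<lambda>t. MCN_act H M D n t h)"
  unfolding MCN_act_eq unfolding MCN_def
  by (rule tensor_lift_lin_bi[OF vector_space_fscale MCNs_sub[unfolded MCN_def] MCN_act_bilin[unfolded MCN_def] mvs m.subspace_UNIV])

lemma MCN_act_mword: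
  assumes w: "(xs, fs) \<in> cyclic_words D n"
  shows "MCN_act H M D n (mword M D n m xs fs) h =
    cs H h (\<lambda>a b. sweedler H n (antip H b) (\<lambda>hs. mword M D n (ract M m a) xs (wact n xs hs fs)))"
proof -
  have "MCN_act H M D n (mword M D n m xs fs) h =
      cs H h (\<lambda>a b. pure (MCN M D n) (ract M m a, CN_act H D n (antip H b) (pure (CN D n) (xs, fs))))"
    unfolding MCN_act_eq mword_def unfolding MCN_def
    by (rule tensor_lift_pure_bi[OF vector_space_fscale MCN_act_bilin[unfolded MCN_def] UNIV_I CN_pure_mem[OF w]])
  also have "\<dots> = cs H h (\<lambda>a b. sweedler H n (antip H b) (\<lambda>hs. mword M D n (ract M m a) xs (wact n xs hs fs)))"
    unfolding CN_act_pure[OF w] mword_def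
    by (simp only: lin_on_sweedler_out[OF pure_MCN_lin(2) vector_space_fscale CNs_sub CN_pure_mem[OF wact_word[OF w]]])
  finally show ?thesis .
qed

lemma lin_MCN_act_mword:
  assumes f: "lin_on fscale (MCNs n) s U f" and w: "(xs, fs) \<in> cyclic_words D n"
  shows "f (MCN_act H M D n (mword M D n m xs fs) h) =
    cs H h (\<lambda>a b. sweedler H n (antip H b) (\<lambda>hs. f (mword M D n (ract M m a) xs (wact n xs hs fs))))"
  unfolding MCN_act_mword[OF w]
  by (simp only: lin_on_cs_out[OF f vector_space_fscale MCNs_sub sweedler_mem[OF mword_mem[OF wact_word[OF w]]]]
      lin_on_sweedler_out[OF f vector_space_fscale MCNs_sub mword_mem[OF wact_word[OF w]]])

text \<open>Multilinear forms with this property are those that factor through M \<otimes>_H CN_n.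
  Unlike the invariance condition in \<open>cochains\<close>, it involves neither the antipode nor
  the counit, which makes it easy to transport along operations on words.\<close>

definition bal :: "nat \<Rightarrow> ('m \<Rightarrow> 'o list \<Rightarrow> 'a list \<Rightarrow> 'k) \<Rightarrow> bool" where
  "bal n F \<longleftrightarrow> (\<forall>m h xs fs. (xs, fs) \<in> cyclic_words D n \<longrightarrow>
     F (ract M m h) xs fs = sweedler H n h (\<lambda>hs. F m xs (wact n xs hs fs)))"

definition cform :: "nat \<Rightarrow> ('m \<Rightarrow> 'o list \<Rightarrow> 'a list \<Rightarrow> 'k) \<Rightarrow> bool" where
  "cform n F \<longleftrightarrow> mform n (*) UNIV F \<and> bal n F"

lemma balD: "bal n F \<Longrightarrow> (xs, fs) \<in> cyclic_words D n \<Longrightarrow>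
    F (ract M m h) xs fs = sweedler H n h (\<lambda>hs. F m xs (wact n xs hs fs))"
  by (simp add: bal_def)

lemma sweedler_wact_mult:
  assumes F: "mform n (*) UNIV F" and w: "(xs, fs) \<in> cyclic_words D n"
  shows "sweedler H n g (\<lambda>gs. sweedler H n h (\<lambda>hs. F m xs (wact n xs gs (wact n xs hs fs)))) =
    sweedler H n (g * h) (\<lambda>hs. F m xs (wact n xs hs fs))"
proof -
  have "sweedler H n g (\<lambda>gs. sweedler H n h (\<lambda>hs. F m xs (wact n xs gs (wact n xs hs fs)))) =
    sweedler H n g (\<lambda>gs. sweedler H n h (\<lambda>hs. F m xs (wact n xs (map2 (*) gs hs) fs)))"
    by (intro sweedler_cong) (simp add: wact_mult[OF w])
  then show ?thesis unfolding sweedler_mult[OF vector_space_field mform_mlin[OF F w]] .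
qed

lemma sweedler_swap: "sweedler H n g (\<lambda>gs. sweedler H n' h (\<lambda>hs. f gs hs)) = sweedler H n' h (\<lambda>hs. sweedler H n g (\<lambda>gs. f gs hs))"
  for f :: "_ \<Rightarrow> _ \<Rightarrow> 'u::ab_group_add"
  unfolding sweedler_sum by (rule sum_list_swap)

lemma mform_ract_lin: "mform n (*) UNIV F \<Longrightarrow> (xs, fs) \<in> cyclic_words D n \<Longrightarrow> lin (*) (\<lambda>a. F (ract M m a) xs fs)"
  by (rule mlinear_comp[OF mformD(1) ract_lin(2)])

text \<open>A form is \<open>H\<close>-invariant if and only if \<open>F (mh, c) = F (m, hc)\<close>.\<close>

lemma bal_iff:
  assumes F: "mform n (*) UNIV F"
  shows "bal n F \<longleftrightarrow> (\<forall>m h xs fs. (xs, fs) \<in> cyclic_words D n \<longrightarrow>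
    cs H h (\<lambda>a b. sweedler H n (antip H b) (\<lambda>hs. F (ract M m a) xs (wact n xs hs fs))) = counit H h * F m xs fs)"
    (is "_ \<longleftrightarrow> ?I")
proof
  assume b: "bal n F"
  show ?I
  proof (intro allI impI)
    fix m h xs fs assume w: "(xs, fs) \<in> cyclic_words D n"
    \<comment> \<open>Balancing moves the leg \<open>a\<close> next to the antipode of
      \<open>b\<close>, and h_1 S(h_2) = eps(h).\<close>
    have "cs H h (\<lambda>a b. sweedler H n (antip H b) (\<lambda>hs. F (ract M m a) xs (wact n xs hs fs))) =
        cs H h (\<lambda>a b. sweedler H n (a * antip H b) (\<lambda>hs. F m xs (wact n xs hs fs)))"
      unfolding balD[OF b wact_word[OF w]]
      by (subst sweedler_swap) (simp only: sweedler_wact_mult[OF F w])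
    also have "\<dots> = counit H h * sweedler H n 1 (\<lambda>hs. F m xs (wact n xs hs fs))"
      by (rule cs_antip(2)[OF sweedler_lin[OF vector_space_field mform_mlin[OF F w]]])
    also have "sweedler H n 1 (\<lambda>hs. F m xs (wact n xs hs fs)) = F m xs fs"
      unfolding sweedler_one[OF vector_space_field mform_mlin[OF F w]] wact_one[OF w] ..
    finally show "cs H h (\<lambda>a b. sweedler H n (antip H b) (\<lambda>hs. F (ract M m a) xs (wact n xs hs fs))) = counit H h * F m xs fs" .
  qed
next
  assume I: ?I
  show "bal n F" unfolding bal_def
  proof (intro allI impI)
    fix m h xs fs assume w: "(xs, fs) \<in> cyclic_words D n"
    \<comment> \<open>Write F (m h, c) as F (m h_1, S(h_2) h_3 c), and apply the invariance of F
      under the pair h_1, h_2 to the word h_3 c.\<close>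
    let ?G = "\<lambda>a b c. sweedler H n (antip H b * c) (\<lambda>hs. F (ract M m a) xs (wact n xs hs fs))"
    have lG: "lin (*) (\<lambda>a. ?G a b c)" "lin (*) (\<lambda>b. ?G a b c)" "lin (*) (\<lambda>c. ?G a b c)" for a b c
    proof -
      show "lin (*) (\<lambda>a. ?G a b c)"
        by (rule sweedler_lin_fun[OF vector_space_field mform_ract_lin[OF F wact_word[OF w]]])
      have "lin (*) (\<lambda>h. sweedler H n h (\<lambda>hs. F (ract M m a) xs (wact n xs hs fs)))"
        by (rule sweedler_lin[OF vector_space_field mform_mlin[OF F w]])
      then show "lin (*) (\<lambda>b. ?G a b c)" "lin (*) (\<lambda>c. ?G a b c)"
        by (rule lin_comp, intro lin_intros)+
    qed
    have "cs H h (\<lambda>a r. cs H r (\<lambda>b c. ?G a b c)) = cs H h (\<lambda>a r. counit H r * F (ract M m a) xs fs)"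
      by (simp only: cs_antip(1)[OF sweedler_lin[OF vector_space_field mform_mlin[OF F w]]]
          sweedler_one[OF vector_space_field mform_mlin[OF F w]] wact_one[OF w])
    also have "\<dots> = F (ract M m h) xs fs"
      by (rule cs_counit(2)[OF mform_ract_lin[OF F w]])
    finally have "F (ract M m h) xs fs = cs H h (\<lambda>k c. cs H k (\<lambda>a b. ?G a b c))"
      using coassoc[OF vector_space_field lG, of h] by simp
    also have "\<dots> = cs H h (\<lambda>k c. cs H k (\<lambda>a b. sweedler H n c (\<lambda>hs. sweedler H n (antip H b) (\<lambda>gs. F (ract M m a) xs (wact n xs gs (wact n xs hs fs))))))"
      unfolding sweedler_wact_mult[OF F w, symmetric] by (subst sweedler_swap) (rule refl)
    also have "\<dots> = cs H h (\<lambda>k c. sweedler H n c (\<lambda>hs. counit H k * F m xs (wact n xs hs fs)))"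
      unfolding sweedler_cs_swap[symmetric] using I wact_word[OF w] by simp
    also have "\<dots> = cs H h (\<lambda>k c. counit H k * sweedler H n c (\<lambda>hs. F m xs (wact n xs hs fs)))"
      by (simp only: sweedler_scale[OF vector_space_field])
    also have "\<dots> = sweedler H n h (\<lambda>hs. F m xs (wact n xs hs fs))"
      by (rule cs_counit(1)[OF sweedler_lin[OF vector_space_field mform_mlin[OF F w]]])
    finally show "F (ract M m h) xs fs = sweedler H n h (\<lambda>hs. F m xs (wact n xs hs fs))" .
  qed
qed

text \<open>\<open>ev\<close> reads a cochain as a balanced form and \<open>ext\<close> turns a
  balanced form into a cochain. Cochains are compared through \<open>ev\<close>, and operators on
  cochains are analysed as \<open>ext\<close> of operations on forms.\<close>

definition ev :: "nat \<Rightarrow> (('k, 'm, 'o, 'a) chain \<Rightarrow> 'k) \<Rightarrow> 'm \<Rightarrow> 'o list \<Rightarrow> 'a list \<Rightarrow> 'k" where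
  "ev n \<phi> m xs fs = \<phi> (mword M D n m xs fs)"

definition ext :: "nat \<Rightarrow> ('m \<Rightarrow> 'o list \<Rightarrow> 'a list \<Rightarrow> 'k) \<Rightarrow> ('k, 'm, 'o, 'a) chain \<Rightarrow> 'k" where
  "ext n F = off_zero (MCNs n) (chain_lift M D n F)"

lemma cochainsD:
  assumes "\<phi> \<in> cochains H M D n"
  shows "lin_on fscale (MCNs n) (*) UNIV \<phi>" "t \<notin> MCNs n \<Longrightarrow> \<phi> t = 0"
    "t \<in> MCNs n \<Longrightarrow> \<phi> (MCN_act H M D n t h) = counit H h * \<phi> t"
  using assms by (simp_all add: cochains_def)

lemma cform_ev:
  assumes \<phi>: "\<phi> \<in> cochains H M D n"
  shows "cform n (ev n \<phi>)"
proof -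
  have m: "mform n (*) UNIV (ev n \<phi>)"
    using mform_comp[OF mform_mword cochainsD(1)[OF \<phi>]] by (simp add: ev_def[abs_def])
  then show ?thesis
    unfolding cform_def bal_iff[OF m] ev_def
    using lin_MCN_act_mword[OF cochainsD(1)[OF \<phi>], symmetric] cochainsD(3)[OF \<phi> mword_mem] by simp
qed

lemma cochains_eqI:
  assumes "\<phi> \<in> cochains H M D n" "\<psi> \<in> cochains H M D n"
    and "\<And>m xs fs. (xs, fs) \<in> cyclic_words D n \<Longrightarrow> ev n \<phi> m xs fs = ev n \<psi> m xs fs"
  shows "\<phi> = \<psi>"
proof
  fix t show "\<phi> t = \<psi> t"
  proof (cases "t \<in> MCNs n")
    case True
    show ?thesis
      by (rule MCNs_ext[OF cochainsD(1)[OF assms(1)] cochainsD(1)[OF assms(2)] vector_space_field assms(3)[unfolded ev_def] True])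
  next
    case False
    then show ?thesis using cochainsD(2)[OF assms(1)] cochainsD(2)[OF assms(2)] by simp
  qed
qed

lemma off_zero_lin:
  assumes "lin_on fscale (MCNs n) (*) UNIV f"
  shows "lin_on fscale (MCNs n) (*) UNIV (off_zero (MCNs n) f)"
proof -
  interpret F: vector_space "fscale :: 'k \<Rightarrow> ('k, 'm, 'o, 'a) chain \<Rightarrow> _" by (rule vector_space_fscale)
  show ?thesis
    using assms F.subspace_add[OF MCNs_sub] F.subspace_scale[OF MCNs_sub]
    unfolding lin_on_def off_zero_def by auto
qed

lemma off_zero_cochain:
  assumes f: "lin_on fscale (MCNs n) (*) UNIV f"
    and inv: "\<And>m xs fs h. (xs, fs) \<in> cyclic_words D n \<Longrightarrow>
      f (MCN_act H M D n (mword M D n m xs fs) h) = counit H h * f (mword M D n m xs fs)"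
  shows "off_zero (MCNs n) f \<in> cochains H M D n"
  unfolding cochains_def
proof (intro CollectI conjI allI impI ballI)
  show "lin_on fscale (MCNs n) (*) UNIV (off_zero (MCNs n) f)" by (rule off_zero_lin[OF f])
  show "t \<notin> MCNs n \<Longrightarrow> off_zero (MCNs n) f t = 0" for t by (simp add: off_zero_def)
  fix t h assume t: "t \<in> MCNs n"
  have "lin_on fscale (MCNs n) (*) UNIV (\<lambda>t. counit H h * f t)"
    using f by (simp add: lin_on_def algebra_simps)
  then have "f (MCN_act H M D n t h) = counit H h * f t"
    by (rule MCNs_ext[OF lin_on_comp[OF MCN_act_lin f] _ vector_space_field inv t])
  then show "off_zero (MCNs n) f (MCN_act H M D n t h) = counit H h * off_zero (MCNs n) f t"
    using t lin_on_mem[OF MCN_act_lin t] by (simp add: off_zero_def)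
qed

lemma ev_ext:
  assumes "mform n (*) UNIV F" "(xs, fs) \<in> cyclic_words D n"
  shows "ev n (ext n F) m xs fs = F m xs fs"
  using chain_lift_mword[OF assms(1) vector_space_field subspace_UNIV[OF vector_space_field] assms(2)] mword_mem[OF assms(2)]
  by (simp add: ev_def ext_def off_zero_def)

lemma ext_cochain:
  assumes F: "cform n F"
  shows "ext n F \<in> cochains H M D n"
  unfolding ext_def
proof (rule off_zero_cochain)
  have m: "mform n (*) UNIV F" and b: "bal n F" using F by (simp_all add: cform_def)
  note cl = chain_lift_lin[OF m vector_space_field subspace_UNIV[OF vector_space_field]]
    and ce = chain_lift_mword[OF m vector_space_field subspace_UNIV[OF vector_space_field]]
  show "lin_on fscale (MCNs n) (*) UNIV (chain_lift M D n F)" by (rule cl)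
  fix m' xs fs h assume w: "(xs, fs) \<in> cyclic_words D n"
  show "chain_lift M D n F (MCN_act H M D n (mword M D n m' xs fs) h) = counit H h * chain_lift M D n F (mword M D n m' xs fs)"
    unfolding lin_MCN_act_mword[OF cl w] ce[OF w] ce[OF wact_word[OF w]]
    using b[unfolded bal_iff[OF m]] w by blast
qed

lemma cochains_sub: "module.subspace fscale (cochains H M D n)"
proof -
  interpret F: vector_space "fscale :: 'k \<Rightarrow> (('k, 'm, 'o, 'a) chain \<Rightarrow> 'k) \<Rightarrow> _" by (rule vector_space_fscale)
  show ?thesis
    by (rule F.subspaceI) (auto simp: cochains_def lin_on_def fscale_def algebra_simps)
qed

text \<open>A common source of linear operators on cochains: cofaces, codegeneracies, the rotation
  and the junction insertions all arise from an operation \<open>T\<close> that preserves balanced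
  forms and is linear in the form.\<close>

lemma ext_lin:
  assumes "\<And>F. cform n F \<Longrightarrow> cform n' (T F)"
    and add: "\<And>F G m xs fs. (xs, fs) \<in> cyclic_words D n' \<Longrightarrow> T (\<lambda>m xs fs. F m xs fs + G m xs fs) m xs fs = T F m xs fs + T G m xs fs"
    and sc: "\<And>c F m xs fs. (xs, fs) \<in> cyclic_words D n' \<Longrightarrow> T (\<lambda>m xs fs. c * F m xs fs) m xs fs = c * T F m xs fs"
  shows "lin_on fscale (cochains H M D n) fscale (cochains H M D n') (\<lambda>\<phi>. ext n' (T (ev n \<phi>)))"
proof -
  interpret F: vector_space "fscale :: 'k \<Rightarrow> (('k, 'm, 'o, 'a) chain \<Rightarrow> 'k) \<Rightarrow> _" by (rule vector_space_fscale)
  have mem: "ext n' (T (ev n \<phi>)) \<in> cochains H M D n'" if "\<phi> \<in> cochains H M D n" for \<phi>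
    by (rule ext_cochain[OF assms(1)[OF cform_ev[OF that]]])
  have e: "ev n' (ext n' (T (ev n \<phi>))) m xs fs = T (ev n \<phi>) m xs fs"
    if "\<phi> \<in> cochains H M D n" "(xs, fs) \<in> cyclic_words D n'" for \<phi> m xs fs
    using ev_ext[of n' "T (ev n \<phi>)"] assms(1)[OF cform_ev[OF that(1)]] that(2) by (simp add: cform_def)
  have ev_add: "ev k (\<phi> + \<psi>) = (\<lambda>m xs fs. ev k \<phi> m xs fs + ev k \<psi> m xs fs)"
    and ev_scale: "ev k (fscale c \<phi>) = (\<lambda>m xs fs. c * ev k \<phi> m xs fs)" for k c \<phi> \<psi>
    by (simp_all add: ev_def fscale_def fun_eq_iff)
  show ?thesis unfolding lin_on_def
  proof (intro conjI ballI allI)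
    fix \<phi> c assume \<phi>: "\<phi> \<in> cochains H M D n"
    show "ext n' (T (ev n \<phi>)) \<in> cochains H M D n'" by (rule mem[OF \<phi>])
    have c\<phi>: "fscale c \<phi> \<in> cochains H M D n" by (rule F.subspace_scale[OF cochains_sub \<phi>])
    show "ext n' (T (ev n (fscale c \<phi>))) = fscale c (ext n' (T (ev n \<phi>)))"
    proof (rule cochains_eqI[OF mem[OF c\<phi>] F.subspace_scale[OF cochains_sub mem[OF \<phi>]]])
      fix m xs fs assume w: "(xs, fs) \<in> cyclic_words D n'"
      show "ev n' (ext n' (T (ev n (fscale c \<phi>)))) m xs fs = ev n' (fscale c (ext n' (T (ev n \<phi>)))) m xs fs"
        unfolding e[OF c\<phi> w] unfolding ev_scale e[OF \<phi> w] by (rule sc[OF w])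
    qed
    fix \<psi> assume \<psi>: "\<psi> \<in> cochains H M D n"
    have s: "\<phi> + \<psi> \<in> cochains H M D n" by (rule F.subspace_add[OF cochains_sub \<phi> \<psi>])
    show "ext n' (T (ev n (\<phi> + \<psi>))) = ext n' (T (ev n \<phi>)) + ext n' (T (ev n \<psi>))"
    proof (rule cochains_eqI[OF mem[OF s] F.subspace_add[OF cochains_sub mem[OF \<phi>] mem[OF \<psi>]]])
      fix m xs fs assume w: "(xs, fs) \<in> cyclic_words D n'"
      show "ev n' (ext n' (T (ev n (\<phi> + \<psi>)))) m xs fs = ev n' (ext n' (T (ev n \<phi>)) + ext n' (T (ev n \<psi>))) m xs fs"
        unfolding e[OF s w] unfolding ev_add e[OF \<phi> w] e[OF \<psi> w] by (rule add[OF w])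
    qed
  qed
qed

end

section \<open>Faces, degeneracies and rotations of words\<close>

lemma tgt_Suc: "tgt xs (Suc i) = src xs i"
  by (simp add: tgt_def src_def)

lemma tgt_nth: "i < length xs \<Longrightarrow> tgt xs i = xs ! i"
  by (simp add: tgt_def)

lemma src_nth: "Suc i < length xs \<Longrightarrow> src xs i = xs ! Suc i"
  by (simp add: src_def)

lemma src_last: "length xs = Suc n \<Longrightarrow> src xs n = xs ! 0"
  by (simp add: src_def)

text \<open>Removes the object X_(i+1) at which f^i and f^(i+1) are composed.\<close>

definition fX :: "nat \<Rightarrow> 'o list \<Rightarrow> 'o list" where
  "fX i xs = take (Suc i) xs @ drop (i + 2) xs"

text \<open>Doubles the source of f^i. For i = n that source is X_0, and the copy is appended at the
  end.\<close>

definition gX :: "nat \<Rightarrow> 'o list \<Rightarrow> 'o list" where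
  "gX i xs = take (Suc i) xs @ [src xs i] @ drop (Suc i) xs"

definition rX :: "nat \<Rightarrow> 'o list \<Rightarrow> 'o list" where
  "rX n xs = xs ! n # take n xs"

lemma fX_nth:
  assumes "length xs = Suc (Suc n)" "i \<le> n"
  shows length_fX: "length (fX i xs) = Suc n"
    and nth_fX: "k \<le> n \<Longrightarrow> fX i xs ! k = xs ! (if k \<le> i then k else Suc k)"
    and tgt_fX: "k \<le> Suc n \<Longrightarrow> tgt (fX i xs) k = tgt xs (if k \<le> i then k else Suc k)"
    and src_fX: "k \<le> n \<Longrightarrow> src (fX i xs) k = src xs (if k < i then k else Suc k)"
proof -
  show l: "length (fX i xs) = Suc n" using assms by (simp add: fX_def)
  show nth: "fX i xs ! k = xs ! (if k \<le> i then k else Suc k)" if "k \<le> n" for k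
    using assms that by (auto simp: fX_def nth_append min_def)
  show src: "src (fX i xs) k = src xs (if k < i then k else Suc k)" if "k \<le> n" for k
  proof (cases "k = n")
    case True
    then show ?thesis using assms by (simp add: src_last l nth)
  next
    case False
    then show ?thesis using assms that by (auto simp: src_nth l nth)
  qed
  show "tgt (fX i xs) k = tgt xs (if k \<le> i then k else Suc k)" if "k \<le> Suc n"
    using assms that by (cases "k = Suc n") (simp_all add: tgt_nth l nth tgt_Suc src)
qed

lemma gX_nth:
  assumes "length xs = Suc n" "i \<le> n"
  shows length_gX: "length (gX i xs) = Suc (Suc n)"
    and nth_gX: "k \<le> Suc n \<Longrightarrow> gX i xs ! k = tgt xs (if k \<le> Suc i then k else k - 1)"
    and tgt_gX: "k \<le> Suc (Suc n) \<Longrightarrow> tgt (gX i xs) k = tgt xs (if k \<le> Suc i then k else k - 1)"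
    and src_gX: "k \<le> Suc n \<Longrightarrow> src (gX i xs) k = src xs (if k \<le> i then k else k - 1)"
proof -
  show l: "length (gX i xs) = Suc (Suc n)" using assms by (simp add: gX_def)
  show nth: "gX i xs ! k = tgt xs (if k \<le> Suc i then k else k - 1)" if "k \<le> Suc n" for k
  proof -
    consider "k \<le> i" | "k = Suc i" | "Suc i < k" by linarith
    then show ?thesis
    proof cases
      case 1 then show ?thesis using assms by (simp add: gX_def nth_append tgt_nth)
    next
      case 2 then show ?thesis using assms by (simp add: gX_def nth_append min_def tgt_Suc)
    next
      case 3
      then obtain q where q: "k = Suc (Suc (i + q))" by (metis add_Suc less_imp_Suc_add)
      show ?thesis using assms that q by (simp add: gX_def nth_append min_def tgt_nth)
    qed
  qed
  show src: "src (gX i xs) k = src xs (if k \<le> i then k else k - 1)" if "k \<le> Suc n" for k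
  proof (cases "k = Suc n")
    case True
    then show ?thesis using assms by (simp add: src_last[OF l] nth src_last tgt_nth)
  next
    case False
    then have "src (gX i xs) k = tgt xs (if k \<le> i then Suc k else k)" using that by (simp add: src_nth l nth)
    then show ?thesis by (cases k) (auto simp: tgt_Suc)
  qed
  show "tgt (gX i xs) k = tgt xs (if k \<le> Suc i then k else k - 1)" if "k \<le> Suc (Suc n)"
    using assms that by (cases "k = Suc (Suc n)") (simp_all add: tgt_nth[of _ "gX i xs"] l nth tgt_Suc src)
qed

lemma rX_nth:
  assumes "length xs = Suc n"
  shows length_rX: "length (rX n xs) = Suc n"
    and nth_rX: "k \<le> n \<Longrightarrow> rX n xs ! k = xs ! (if k = 0 then n else k - 1)"
    and tgt_rX: "k \<le> Suc n \<Longrightarrow> tgt (rX n xs) k = tgt xs (if k = 0 then n else k - 1)"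
    and src_rX: "k \<le> n \<Longrightarrow> src (rX n xs) k = src xs (if k = 0 then n else k - 1)"
proof -
  show l: "length (rX n xs) = Suc n" using assms by (simp add: rX_def)
  show nth: "rX n xs ! k = xs ! (if k = 0 then n else k - 1)" if "k \<le> n" for k
    using assms that by (cases k) (auto simp: rX_def)
  show src: "src (rX n xs) k = src xs (if k = 0 then n else k - 1)" if "k \<le> n" for k
  proof (cases "k = n")
    case True
    then show ?thesis using assms src_last[OF l] nth[of 0] by (cases n) (auto simp: src_last src_nth)
  next
    case False
    then show ?thesis using assms that by (cases k) (auto simp: src_last src_nth l nth)
  qed
  show "tgt (rX n xs) k = tgt xs (if k = 0 then n else k - 1)" if "k \<le> Suc n"
  proof (cases "k = Suc n")
    case True
    then show ?thesis using assms by (simp add: tgt_Suc src_last[OF l] nth tgt_nth)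
  next
    case False
    then show ?thesis using assms that by (simp add: tgt_nth l nth)
  qed
qed

lemma fX_set: "set (fX i xs) \<subseteq> set xs"
  by (auto simp: fX_def dest: in_set_takeD in_set_dropD)

lemma gX_set: "xs \<noteq> [] \<Longrightarrow> set (gX i xs) \<subseteq> set xs"
  by (auto simp: gX_def src_def dest: in_set_takeD in_set_dropD)

lemma rX_set: "length xs = Suc n \<Longrightarrow> set (rX n xs) \<subseteq> set xs"
  by (auto simp: rX_def dest: in_set_takeD)

lemma fX_fX: "length xs = Suc (Suc (Suc n)) \<Longrightarrow> i \<le> j \<Longrightarrow> j \<le> n \<Longrightarrow> fX i (fX (Suc j) xs) = fX j (fX i xs)"
  by (rule nth_equalityI) (auto simp: length_fX[of _ "Suc n"] length_fX[of _ n] nth_fX[of _ n] nth_fX[of _ "Suc n"] less_Suc_eq_le)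

lemma gX_gX: "length xs = Suc n \<Longrightarrow> i \<le> j \<Longrightarrow> j \<le> n \<Longrightarrow> gX i (gX j xs) = gX (Suc j) (gX i xs)"
  by (rule nth_equalityI) (auto simp: length_gX[of _ "Suc n"] length_gX[of _ n] nth_gX[of _ "Suc n"] tgt_gX[of _ n] less_Suc_eq_le)

lemma fX_gX:
  assumes "length xs = Suc n"
  shows "i \<le> n \<Longrightarrow> fX i (gX i xs) = xs" "Suc i \<le> n \<Longrightarrow> fX (Suc i) (gX i xs) = xs"
  using assms
  by (auto intro!: nth_equalityI simp: length_gX[of _ n] length_fX[of _ n] nth_fX[of _ n] nth_gX[of _ n] less_Suc_eq_le tgt_nth)

lemma fX_gX_less: "length xs = Suc (Suc n) \<Longrightarrow> i \<le> j \<Longrightarrow> j \<le> n \<Longrightarrow> fX i (gX (Suc j) xs) = gX j (fX i xs)"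
  by (rule nth_equalityI)
    (auto simp: length_gX[of _ n] length_gX[of _ "Suc n"] length_fX[of _ n] length_fX[of _ "Suc n"]
      nth_fX[of _ "Suc n"] nth_gX[of _ n] nth_gX[of _ "Suc n"] tgt_fX[of _ n] less_Suc_eq_le)

lemma fX_gX_greater: "length xs = Suc (Suc n) \<Longrightarrow> j < i \<Longrightarrow> i \<le> n \<Longrightarrow> fX (Suc i) (gX j xs) = gX j (fX i xs)"
  by (rule nth_equalityI)
    (auto simp: length_gX[of _ n] length_gX[of _ "Suc n"] length_fX[of _ n] length_fX[of _ "Suc n"]
      nth_fX[of _ "Suc n"] nth_gX[of _ n] nth_gX[of _ "Suc n"] tgt_fX[of _ n] less_Suc_eq_le)

lemma fX_rX: "length xs = Suc (Suc n) \<Longrightarrow> Suc i \<le> n \<Longrightarrow> fX (Suc i) (rX (Suc n) xs) = rX n (fX i xs)"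
  by (rule nth_equalityI)
    (auto simp: length_rX[of _ n] length_rX[of _ "Suc n"] length_fX[of _ n] nth_fX[of _ n] nth_rX[of _ n] nth_rX[of _ "Suc n"] less_Suc_eq_le)

lemma gX_rX: "length xs = Suc n \<Longrightarrow> Suc i \<le> n \<Longrightarrow> gX (Suc i) (rX n xs) = rX (Suc n) (gX i xs)"
  by (rule nth_equalityI)
    (auto simp: length_rX[of _ n] length_rX[of _ "Suc n"] length_gX[of _ n] nth_gX[of _ n] tgt_rX[of _ n] nth_rX[of _ "Suc n"] less_Suc_eq_le)

lemma gX_rX_0:
  assumes "length xs = Suc n"
  shows "gX 0 (rX n xs) = rX (Suc n) (rX (Suc n) (gX n xs))"
proof (rule nth_equalityI)
  note simps = length_rX[of _ n] length_rX[of _ "Suc n"] length_gX[of _ n] nth_gX[of _ n] tgt_rX[of _ n]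
    nth_rX[of _ "Suc n"] tgt_Suc src_rX[of _ n] nth_rX[of _ n] less_Suc_eq_le
  show "length (gX 0 (rX n xs)) = length (rX (Suc n) (rX (Suc n) (gX n xs)))" using assms by (simp add: simps)
  fix k assume "k < length (gX 0 (rX n xs))"
  then have k: "k \<le> Suc n" using assms by (simp add: simps)
  consider "k = 0" | "k = 1" | "2 \<le> k" by linarith
  then show "gX 0 (rX n xs) ! k = rX (Suc n) (rX (Suc n) (gX n xs)) ! k"
  proof cases
    case 3
    then obtain q where "k = Suc (Suc q)" by (metis add_2_eq_Suc le_Suc_ex)
    then show ?thesis using assms k by (cases q) (simp_all add: simps tgt_nth src_last)
  qed (use assms in \<open>simp_all add: simps\<close>)
qed

context hcat_loc
begin

definition fF :: "nat \<Rightarrow> 'o list \<Rightarrow> 'a list \<Rightarrow> 'a list" where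
  "fF i xs fs = take i fs @ [cmp D (src xs (Suc i)) (src xs i) (tgt xs i) (fs ! i) (fs ! Suc i)] @ drop (i + 2) fs"

definition gF :: "nat \<Rightarrow> 'o list \<Rightarrow> 'a list \<Rightarrow> 'a list" where
  "gF i xs fs = take (Suc i) fs @ [ident D (src xs i)] @ drop (Suc i) fs"

text \<open>Rotation of the arrows for a fixed element \<open>a\<close> in the place of m_(-1). The
  sum over the coaction is taken afterwards, in \<open>cycF\<close>.\<close>

definition rF :: "nat \<Rightarrow> 'h \<Rightarrow> 'o list \<Rightarrow> 'a list \<Rightarrow> 'a list" where
  "rF n a xs fs = lact D (xs ! 0) (xs ! n) (S' a) (fs ! n) # take n fs"

lemma fF_nth:
  assumes "length fs = Suc (Suc n)" "i \<le> n"
  shows length_fF: "length (fF i xs fs) = Suc n"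
    and nth_fF: "k \<le> n \<Longrightarrow> fF i xs fs ! k = (if k < i then fs ! k else
      if k = i then cmp D (src xs (Suc i)) (src xs i) (tgt xs i) (fs ! i) (fs ! Suc i) else fs ! Suc k)"
proof -
  show "length (fF i xs fs) = Suc n" using assms by (simp add: fF_def)
  assume k: "k \<le> n"
  consider "k < i" | "k = i" | "i < k" by linarith
  then show "fF i xs fs ! k = (if k < i then fs ! k else
      if k = i then cmp D (src xs (Suc i)) (src xs i) (tgt xs i) (fs ! i) (fs ! Suc i) else fs ! Suc k)"
  proof cases
    case 3
    then obtain q where q: "k = Suc (i + q)" by (metis less_imp_Suc_add)
    show ?thesis using assms k q by (simp add: fF_def nth_append min_def)
  qed (use assms k in \<open>simp_all add: fF_def nth_append min_def\<close>)
qed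

lemma gF_nth:
  assumes "length fs = Suc n" "i \<le> n"
  shows length_gF: "length (gF i xs fs) = Suc (Suc n)"
    and nth_gF: "k \<le> Suc n \<Longrightarrow> gF i xs fs ! k = (if k \<le> i then fs ! k else
      if k = Suc i then ident D (src xs i) else fs ! (k - 1))"
proof -
  show "length (gF i xs fs) = Suc (Suc n)" using assms by (simp add: gF_def)
  assume k: "k \<le> Suc n"
  consider "k \<le> i" | "k = Suc i" | "Suc i < k" by linarith
  then show "gF i xs fs ! k = (if k \<le> i then fs ! k else
      if k = Suc i then ident D (src xs i) else fs ! (k - 1))"
  proof cases
    case 3
    then obtain q where q: "k = Suc (Suc (i + q))" by (metis add_Suc less_imp_Suc_add)
    show ?thesis using assms k q by (simp add: gF_def nth_append min_def)
  qed (use assms k in \<open>simp_all add: gF_def nth_append min_def\<close>)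
qed

lemma rF_nth:
  assumes "length fs = Suc n"
  shows length_rF: "length (rF n a xs fs) = Suc n"
    and nth_rF: "k \<le> n \<Longrightarrow> rF n a xs fs ! k = (if k = 0 then lact D (xs ! 0) (xs ! n) (S' a) (fs ! n) else fs ! (k - 1))"
  using assms by (auto simp: rF_def nth_Cons split: nat.split)

lemma wordI:
  assumes "length xs = Suc n" "length fs = Suc n" "set xs \<subseteq> Obj D"
    "\<And>i. i \<le> n \<Longrightarrow> fs ! i \<in> Hom D (src xs i) (tgt xs i)"
  shows "(xs, fs) \<in> cyclic_words D n"
  using assms by (simp add: cyclic_words_def)

lemma cmp_mem:
  assumes "X \<in> Obj D" "Y \<in> Obj D" "Z \<in> Obj D" "f \<in> Hom D X Y" "g \<in> Hom D Y Z"
  shows "cmp D X Y Z g f \<in> Hom D X Z"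
    and "lin_on (cscale D) (Hom D Y Z) (cscale D) (Hom D X Z) (\<lambda>g. cmp D X Y Z g f)"
    and "lin_on (cscale D) (Hom D X Y) (cscale D) (Hom D X Z) (cmp D X Y Z g)"
proof -
  show "lin_on (cscale D) (Hom D Y Z) (cscale D) (Hom D X Z) (\<lambda>g. cmp D X Y Z g f)"
    and l: "lin_on (cscale D) (Hom D X Y) (cscale D) (Hom D X Z) (cmp D X Y Z g)"
    using cmp_bilin[OF assms(1-3)] assms(4,5) unfolding bilin_on_def by blast+
  show "cmp D X Y Z g f \<in> Hom D X Z" by (rule lin_on_mem[OF l assms(4)])
qed

lemma fF_word:
  assumes w: "(xs, fs) \<in> cyclic_words D (Suc n)" and i: "i \<le> n"
  shows "(fX i xs, fF i xs fs) \<in> cyclic_words D n"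
proof (rule wordI)
  note wd = wordD[OF w]
  show "length (fX i xs) = Suc n" "length (fF i xs fs) = Suc n" "set (fX i xs) \<subseteq> Obj D"
    using wd(1-3) i fX_set[of i xs] by (auto simp: length_fX length_fF)
  have c: "cmp D (src xs (Suc i)) (src xs i) (tgt xs i) (fs ! i) (fs ! Suc i) \<in> Hom D (src xs (Suc i)) (tgt xs i)"
    using cmp_mem(1)[OF wd(5,5,6) wd(4)[of "Suc i", unfolded tgt_Suc] wd(4)[of i]] i by simp
  fix k assume "k \<le> n"
  then show "fF i xs fs ! k \<in> Hom D (src (fX i xs) k) (tgt (fX i xs) k)"
    using wd(1,2) i wd(4)[of k] wd(4)[of "Suc k"] c by (simp add: nth_fF src_fX tgt_fX)
qed

lemma gF_word:
  assumes w: "(xs, fs) \<in> cyclic_words D n" and i: "i \<le> n"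
  shows "(gX i xs, gF i xs fs) \<in> cyclic_words D (Suc n)"
proof (rule wordI)
  note wd = wordD[OF w]
  have "xs \<noteq> []" using wd(1) by auto
  then show "length (gX i xs) = Suc (Suc n)" "length (gF i xs fs) = Suc (Suc n)" "set (gX i xs) \<subseteq> Obj D"
    using wd(1-3) i gX_set[of xs i] by (auto simp: length_gX length_gF)
  fix k assume "k \<le> Suc n"
  then show "gF i xs fs ! k \<in> Hom D (src (gX i xs) k) (tgt (gX i xs) k)"
    using wd(1,2) i wd(4)[of k] wd(4)[of "k - 1"] ident_mem[OF wd(5)[of i]]
    by (auto simp: nth_gF src_gX tgt_gX tgt_Suc)
qed

lemma rF_word:
  assumes w: "(xs, fs) \<in> cyclic_words D n"
  shows "(rX n xs, rF n a xs fs) \<in> cyclic_words D n"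
proof (rule wordI)
  note wd = wordD[OF w]
  show "length (rX n xs) = Suc n" "length (rF n a xs fs) = Suc n" "set (rX n xs) \<subseteq> Obj D"
    using wd(1-3) rX_set[of xs n] by (auto simp: length_rX length_rF)
  have "lact D (src xs n) (tgt xs n) (S' a) (fs ! n) \<in> Hom D (src xs n) (tgt xs n)"
    by (rule lact_lin(3)[OF wd(5,6) wd(4)]) simp
  then have l: "lact D (xs ! 0) (xs ! n) (S' a) (fs ! n) \<in> Hom D (src xs n) (tgt xs n)"
    using wd(1) by (simp add: src_last tgt_nth)
  fix k assume "k \<le> n"
  then show "rF n a xs fs ! k \<in> Hom D (src (rX n xs) k) (tgt (rX n xs) k)"
    using wd(1,2) l wd(4)[of "k - 1"] by (simp add: nth_rF src_rX tgt_rX)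
qed

lemma fF_fF:
  assumes w: "(xs, fs) \<in> cyclic_words D (Suc (Suc n))" and ij: "i \<le> j" "j \<le> n"
  shows "fF i (fX (Suc j) xs) (fF (Suc j) xs fs) = fF j (fX i xs) (fF i xs fs)"
proof (rule nth_equalityI)
  note wd = wordD[OF w]
  note simps = length_fF[of _ "Suc n"] length_fF[of _ n] nth_fF[of _ n] nth_fF[of _ "Suc n"] less_Suc_eq_le
    src_fX[of _ "Suc n"] tgt_fX[of _ "Suc n"]
  show "length (fF i (fX (Suc j) xs) (fF (Suc j) xs fs)) = length (fF j (fX i xs) (fF i xs fs))"
    using wd(1,2) ij by (simp add: simps)
  fix k assume "k < length (fF i (fX (Suc j) xs) (fF (Suc j) xs fs))"
  then have k: "k \<le> n" using wd(1,2) ij by (simp add: simps)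
  show "fF i (fX (Suc j) xs) (fF (Suc j) xs fs) ! k = fF j (fX i xs) (fF i xs fs) ! k"
  \<comment> \<open>For i = j three arrows are composed into one and associativity is used. In all
    other places the two sides agree after matching indices.\<close>
  proof (cases "k = i \<and> i = j")
    case True
    have "cmp D (src xs (Suc (Suc i))) (src xs (Suc i)) (tgt xs i)
          (cmp D (src xs (Suc i)) (src xs i) (tgt xs i) (fs ! i) (fs ! Suc i)) (fs ! Suc (Suc i)) =
        cmp D (src xs (Suc (Suc i))) (src xs i) (tgt xs i) (fs ! i)
          (cmp D (src xs (Suc (Suc i))) (src xs (Suc i)) (src xs i) (fs ! Suc i) (fs ! Suc (Suc i)))"
      using ij True wd(4)[of i] wd(4)[of "Suc i"] wd(4)[of "Suc (Suc i)"]
      by (intro cmp_assoc) (simp_all add: tgt_Suc wd(5,6))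
    then show ?thesis using True wd(1,2) ij by (simp add: simps tgt_Suc)
  next
    case False
    then show ?thesis using wd(1,2) ij k by (auto simp: simps)
  qed
qed

lemma gF_gF:
  assumes w: "(xs, fs) \<in> cyclic_words D n" and ij: "i \<le> j" "j \<le> n"
  shows "gF i (gX j xs) (gF j xs fs) = gF (Suc j) (gX i xs) (gF i xs fs)"
  using wordD(1,2)[OF w] ij
  by (intro nth_equalityI)
    (auto simp: length_gF[of _ "Suc n"] length_gF[of _ n] nth_gF[of _ "Suc n"] nth_gF[of _ n] src_gX[of _ n] less_Suc_eq_le)

lemma fF_gF:
  assumes w: "(xs, fs) \<in> cyclic_words D n"
  shows "i \<le> n \<Longrightarrow> fF i (gX i xs) (gF i xs fs) = fs"
    and "Suc i \<le> n \<Longrightarrow> fF (Suc i) (gX i xs) (gF i xs fs) = fs"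
proof -
  note wd = wordD[OF w]
  note simps = length_gF[of _ n] length_fF[of _ n] nth_fF[of _ n] nth_gF[of _ n] src_gX[of _ n] tgt_gX[of _ n] less_Suc_eq_le
  have e: "cmp D (src xs k) (src xs k) (tgt xs k) (fs ! k) (ident D (src xs k)) = fs ! k"
    "cmp D (src xs k) (tgt xs k) (tgt xs k) (ident D (tgt xs k)) (fs ! k) = fs ! k" if "k \<le> n" for k
    using cmp_ident[OF wd(5,6) wd(4)[OF that]] by simp_all
  show "fF i (gX i xs) (gF i xs fs) = fs" if "i \<le> n"
    using that wd(1,2) e(1)[of i] by (intro nth_equalityI) (auto simp: simps)
  show "fF (Suc i) (gX i xs) (gF i xs fs) = fs" if "Suc i \<le> n"
    using that wd(1,2) e(2)[of "Suc i"] by (intro nth_equalityI) (auto simp: simps tgt_Suc)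
qed

lemma fF_gF_less:
  assumes w: "(xs, fs) \<in> cyclic_words D (Suc n)" and ij: "i \<le> j" "j \<le> n"
  shows "fF i (gX (Suc j) xs) (gF (Suc j) xs fs) = gF j (fX i xs) (fF i xs fs)"
  using wordD(1,2)[OF w] ij
  by (intro nth_equalityI)
    (auto simp: length_gF[of _ "Suc n"] length_gF[of _ n] length_fF[of _ "Suc n"] length_fF[of _ n]
      nth_fF[of _ n] nth_fF[of _ "Suc n"] nth_gF[of _ "Suc n"] nth_gF[of _ n] src_gX[of _ "Suc n"] tgt_gX[of _ "Suc n"]
      src_fX[of _ n] less_Suc_eq_le)

lemma fF_gF_greater:
  assumes w: "(xs, fs) \<in> cyclic_words D (Suc n)" and ij: "j < i" "i \<le> n"
  shows "fF (Suc i) (gX j xs) (gF j xs fs) = gF j (fX i xs) (fF i xs fs)"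
  using wordD(1,2)[OF w] ij
  by (intro nth_equalityI)
    (auto simp: length_gF[of _ "Suc n"] length_gF[of _ n] length_fF[of _ "Suc n"] length_fF[of _ n]
      nth_fF[of _ n] nth_fF[of _ "Suc n"] nth_gF[of _ "Suc n"] nth_gF[of _ n] src_gX[of _ "Suc n"] tgt_gX[of _ "Suc n"]
      src_fX[of _ n] less_Suc_eq_le)

lemma fF_rF:
  assumes w: "(xs, fs) \<in> cyclic_words D (Suc n)" and i: "Suc i \<le> n"
  shows "fF (Suc i) (rX (Suc n) xs) (rF (Suc n) a xs fs) = rF n a (fX i xs) (fF i xs fs)"
  using wordD(1,2)[OF w] i
  by (intro nth_equalityI)
    (auto simp: length_rF[of _ "Suc n"] length_rF[of _ n] length_fF[of _ n]
      nth_fF[of _ n] nth_rF[of _ "Suc n"] nth_rF[of _ n] src_rX[of _ "Suc n"] tgt_rX[of _ "Suc n"] nth_fX[of _ n]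
      less_Suc_eq_le)

lemma gF_rF:
  assumes w: "(xs, fs) \<in> cyclic_words D n" and i: "Suc i \<le> n"
  shows "gF (Suc i) (rX n xs) (rF n a xs fs) = rF (Suc n) a (gX i xs) (gF i xs fs)"
  using wordD(1,2)[OF w] i
  by (intro nth_equalityI)
    (auto simp: length_rF[of _ "Suc n"] length_rF[of _ n] length_gF[of _ n]
      nth_gF[of _ n] nth_rF[of _ "Suc n"] nth_rF[of _ n] src_rX[of _ n] nth_gX[of _ n] tgt_nth
      less_Suc_eq_le)

text \<open>The first rotation brings the appended identity to the front, where the twist by
  \<open>a\<close> becomes the scalar eps(a). The second one moves f^n in front of it. Apart from
  the scalar, this is the rotated word with an identity after its first arrow.\<close>

lemma rF_rF_gF:
  assumes w: "(xs, fs) \<in> cyclic_words D n"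
  shows "rF (Suc n) b (rX (Suc n) (gX n xs)) (rF (Suc n) a (gX n xs) (gF n xs fs)) =
    (gF 0 (rX n xs) (rF n b xs fs))[1 := cscale D (counit H a) (ident D (src xs n))]"
proof (rule nth_equalityI)
  note wd = wordD[OF w]
  note simps = length_rF[of _ "Suc n"] length_rF[of _ n] length_gF[of _ n] length_gX[of _ n]
      nth_gF[of _ n] nth_rF[of _ "Suc n"] nth_rF[of _ n] src_rX[of _ n] nth_gX[of _ n] nth_rX[of _ "Suc n"] less_Suc_eq_le
  show "length (rF (Suc n) b (rX (Suc n) (gX n xs)) (rF (Suc n) a (gX n xs) (gF n xs fs))) =
    length ((gF 0 (rX n xs) (rF n b xs fs))[1 := cscale D (counit H a) (ident D (src xs n))])"
    using wd(1,2) by (simp add: simps)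
  fix k assume "k < length (rF (Suc n) b (rX (Suc n) (gX n xs)) (rF (Suc n) a (gX n xs) (gF n xs fs)))"
  then have k: "k \<le> Suc n" using wd(1,2) by (simp add: simps)
  have i: "lact D (src xs n) (src xs n) (S' a) (ident D (src xs n)) = cscale D (counit H a) (ident D (src xs n))"
    using lact_ident[OF wd(5)] by (simp add: counit_S')
  consider "k = 0" | "k = 1" | "2 \<le> k" by linarith
  then show "rF (Suc n) b (rX (Suc n) (gX n xs)) (rF (Suc n) a (gX n xs) (gF n xs fs)) ! k =
    (gF 0 (rX n xs) (rF n b xs fs))[1 := cscale D (counit H a) (ident D (src xs n))] ! k"
  proof cases
    case 1 then show ?thesis using wd(1,2) by (simp add: simps tgt_nth tgt_Suc src_last)
  next
    case 2 then show ?thesis using wd(1,2) i by (simp add: simps tgt_Suc tgt_nth src_last)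
  next
    case 3
    then obtain q where "k = Suc (Suc q)" by (metis add_2_eq_Suc le_Suc_ex)
    then show ?thesis using wd(1,2) k by (simp add: simps)
  qed
qed

end

section \<open>The cocyclic module of a left $H$-category\<close>

context hcat_loc
begin

lemma fF_update:
  assumes "length fs = Suc (Suc n)" "i \<le> n" "j \<le> Suc n"
  shows "fF i xs (fs[j := g]) = (fF i xs fs)[(if j \<le> i then j else j - 1) :=
    (if j = i then cmp D (src xs (Suc i)) (src xs i) (tgt xs i) g (fs ! Suc i)
     else if j = Suc i then cmp D (src xs (Suc i)) (src xs i) (tgt xs i) (fs ! i) g else g)]"
  using assms
  by (intro nth_equalityI) (auto simp: length_fF[of _ n] nth_fF[of _ n] nth_list_update less_Suc_eq_le)

lemma gF_update:
  assumes "length fs = Suc n" "i \<le> n" "j \<le> n"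
  shows "gF i xs (fs[j := g]) = (gF i xs fs)[(if j \<le> i then j else Suc j) := g]"
  using assms
  by (intro nth_equalityI) (auto simp: length_gF[of _ n] nth_gF[of _ n] nth_list_update less_Suc_eq_le)

lemma rF_update:
  assumes "length fs = Suc n" "j \<le> n"
  shows "rF n a xs (fs[j := g]) = (rF n a xs fs)[(if j = n then 0 else Suc j) :=
    (if j = n then lact D (xs ! 0) (xs ! n) (S' a) g else g)]"
  using assms
  by (intro nth_equalityI) (auto simp: length_rF[of _ n] nth_rF[of _ n] nth_list_update less_Suc_eq_le)

text \<open>The pattern shared by cofaces, codegeneracies and rotations: changing one arrow of a
  word changes exactly one arrow of its image, through a linear map between the hom-spaces
  concerned.\<close>

lemma mform_subst:
  assumes F: "mform n s U F" and W: "\<And>xs fs. (xs, fs) \<in> cyclic_words D n' \<Longrightarrow> (X xs, Y xs fs) \<in> cyclic_words D n"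
    and Y: "\<And>xs fs j. (xs, fs) \<in> cyclic_words D n' \<Longrightarrow> j \<le> n' \<Longrightarrow> \<exists>p \<gamma>. p \<le> n \<and>
      lin_on (cscale D) (Hom D (src xs j) (tgt xs j)) (cscale D) (Hom D (src (X xs) p) (tgt (X xs) p)) \<gamma> \<and>
      (\<forall>g. Y xs (fs[j := g]) = (Y xs fs)[p := \<gamma> g])"
  shows "mform n' s U (\<lambda>m xs fs. F m (X xs) (Y xs fs))"
proof (rule mformI)
  fix xs fs assume w: "(xs, fs) \<in> cyclic_words D n'"
  show "lin_on (mscale M) UNIV s U (\<lambda>m. F m (X xs) (Y xs fs))" by (rule mformD(1)[OF F W[OF w]])
  fix m j assume "j \<le> n'"
  with Y[OF w] obtain p \<gamma> where p: "p \<le> n"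
    and \<gamma>: "lin_on (cscale D) (Hom D (src xs j) (tgt xs j)) (cscale D) (Hom D (src (X xs) p) (tgt (X xs) p)) \<gamma>"
    and e: "\<And>g. Y xs (fs[j := g]) = (Y xs fs)[p := \<gamma> g]" by blast
  show "lin_on (cscale D) (Hom D (src xs j) (tgt xs j)) s U (\<lambda>g. F m (X xs) (Y xs (fs[j := g])))"
    unfolding e by (rule lin_on_comp[OF \<gamma> mformD(2)[OF F W[OF w] p]])
qed

lemma mform_face:
  assumes F: "mform n s U F" and i: "i \<le> n"
  shows "mform (Suc n) s U (\<lambda>m xs fs. F m (fX i xs) (fF i xs fs))"
proof (rule mform_subst[OF F fF_word[OF _ i]])
  fix xs fs j assume w: "(xs, fs) \<in> cyclic_words D (Suc n)" and j: "j \<le> Suc n"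
  note wd = wordD[OF w]
  let ?p = "if j \<le> i then j else j - 1"
  let ?\<gamma> = "\<lambda>g. if j = i then cmp D (src xs (Suc i)) (src xs i) (tgt xs i) g (fs ! Suc i)
     else if j = Suc i then cmp D (src xs (Suc i)) (src xs i) (tgt xs i) (fs ! i) g else g"
  have "lin_on (cscale D) (Hom D (src xs j) (tgt xs j)) (cscale D) (Hom D (src (fX i xs) ?p) (tgt (fX i xs) ?p)) ?\<gamma>"
  proof -
    consider "j = i" | "j = Suc i" | "j < i" | "Suc i < j" by linarith
    then show ?thesis
    proof cases
      case 1
      then show ?thesis
        using cmp_mem(2)[OF wd(5,5,6) wd(4)[of "Suc i", unfolded tgt_Suc] wd(4)[of i]] i wd(1)
        by (simp add: src_fX tgt_fX)
    next
      case 2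
      then show ?thesis
        using cmp_mem(3)[OF wd(5,5,6) wd(4)[of "Suc i", unfolded tgt_Suc] wd(4)[of i]] i wd(1)
        by (simp add: src_fX tgt_fX tgt_Suc)
    next
      case 3
      then show ?thesis using i wd(1) by (simp add: src_fX tgt_fX) (simp add: lin_on_def)
    next
      case 4
      then obtain q where "j = Suc q" "i < q" by (cases j) auto
      then show ?thesis using i j wd(1) by (simp add: src_fX tgt_fX) (simp add: lin_on_def)
    qed
  qed
  moreover have "?p \<le> n" using i j by auto
  ultimately show "\<exists>p \<gamma>. p \<le> n \<and>
      lin_on (cscale D) (Hom D (src xs j) (tgt xs j)) (cscale D) (Hom D (src (fX i xs) p) (tgt (fX i xs) p)) \<gamma> \<and>
      (\<forall>g. fF i xs (fs[j := g]) = (fF i xs fs)[p := \<gamma> g])"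
    using fF_update[OF wd(2) i j] by blast
qed

lemma mform_degen:
  assumes F: "mform (Suc n) s U F" and i: "i \<le> n"
  shows "mform n s U (\<lambda>m xs fs. F m (gX i xs) (gF i xs fs))"
proof (rule mform_subst[OF F gF_word[OF _ i]])
  fix xs fs j assume w: "(xs, fs) \<in> cyclic_words D n" and j: "j \<le> n"
  note wd = wordD[OF w]
  let ?p = "if j \<le> i then j else Suc j"
  have "lin_on (cscale D) (Hom D (src xs j) (tgt xs j)) (cscale D) (Hom D (src (gX i xs) ?p) (tgt (gX i xs) ?p)) (\<lambda>g. g)"
    using i j wd(1) by (simp add: src_gX tgt_gX) (simp add: lin_on_def)
  moreover have "?p \<le> Suc n" using i j by auto
  ultimately show "\<exists>p \<gamma>. p \<le> Suc n \<and>
      lin_on (cscale D) (Hom D (src xs j) (tgt xs j)) (cscale D) (Hom D (src (gX i xs) p) (tgt (gX i xs) p)) \<gamma> \<and>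
      (\<forall>g. gF i xs (fs[j := g]) = (gF i xs fs)[p := \<gamma> g])"
    using gF_update[OF wd(2) i j] by blast
qed

lemma mform_rot:
  assumes F: "mform n s U F"
  shows "mform n s U (\<lambda>m xs fs. F m (rX n xs) (rF n a xs fs))"
proof (rule mform_subst[OF F rF_word])
  fix xs fs j assume w: "(xs, fs) \<in> cyclic_words D n" and j: "j \<le> n"
  note wd = wordD[OF w]
  let ?p = "if j = n then 0 else Suc j" and ?\<gamma> = "\<lambda>g. if j = n then lact D (xs ! 0) (xs ! n) (S' a) g else g"
  have "lin_on (cscale D) (Hom D (src xs j) (tgt xs j)) (cscale D) (Hom D (src (rX n xs) ?p) (tgt (rX n xs) ?p)) ?\<gamma>"
  proof (cases "j = n")
    case True
    have "lin_on (cscale D) (Hom D (src xs n) (tgt xs n)) (cscale D) (Hom D (src xs n) (tgt xs n)) (lact D (src xs n) (tgt xs n) (S' a))"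
      by (rule lact_lin(2)[OF wd(5,6)])
    then show ?thesis using True wd(1) by (simp add: src_rX tgt_rX) (simp add: src_last tgt_nth)
  next
    case False
    then show ?thesis using j wd(1) by (simp add: src_rX tgt_rX) (simp add: lin_on_def)
  qed
  moreover have "?p \<le> n" using j by auto
  ultimately show "\<exists>p \<gamma>. p \<le> n \<and>
      lin_on (cscale D) (Hom D (src xs j) (tgt xs j)) (cscale D) (Hom D (src (rX n xs) p) (tgt (rX n xs) p)) \<gamma> \<and>
      (\<forall>g. rF n a xs (fs[j := g]) = (rF n a xs fs)[p := \<gamma> g])"
    using rF_update[OF wd(2) j] by blast
qed

text \<open>Balance is inherited because h (g f) = (h_1 g) (h_2 f): the leg of h that acts on the
  composite is split over the two factors, as \<open>sweedler_split\<close> allows.\<close>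

lemma cform_face:
  assumes F: "cform n F" and i: "i \<le> n"
  shows "cform (Suc n) (\<lambda>m xs fs. F m (fX i xs) (fF i xs fs))"
  unfolding cform_def bal_def
proof (intro conjI allI impI)
  have m: "mform n (*) UNIV F" and b: "bal n F" using F by (simp_all add: cform_def)
  show m': "mform (Suc n) (*) UNIV (\<lambda>m xs fs. F m (fX i xs) (fF i xs fs))" by (rule mform_face[OF m i])
  fix m' h xs fs assume w: "(xs, fs) \<in> cyclic_words D (Suc n)"
  note wd = wordD[OF w] and fw = fF_word[OF w i]
  have l: "mlin (*) (n + 2) (\<lambda>hs. F m' (fX i xs) (fF i xs (wact (Suc n) xs hs fs)))"
    using mform_mlin[OF m' w] by simp
  have inner: "cs H (hs ! i) (\<lambda>a b. F m' (fX i xs) (fF i xs (wact (Suc n) xs (take i hs @ a # b # drop (Suc i) hs) fs))) =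
      F m' (fX i xs) (wact n (fX i xs) hs (fF i xs fs))" if hs: "length hs = Suc n" for hs
  proof -
    let ?W = "wact n (fX i xs) hs (fF i xs fs)"
    let ?c = "\<lambda>g f. cmp D (src xs (Suc i)) (src xs i) (tgt xs i) g f"
    have e: "fF i xs (wact (Suc n) xs (take i hs @ a # b # drop (Suc i) hs) fs) =
        ?W[i := ?c (lact D (src xs i) (tgt xs i) a (fs ! i)) (lact D (src xs (Suc i)) (src xs i) b (fs ! Suc i))]" for a b
    proof (rule nth_equalityI)
      fix k assume "k < length (fF i xs (wact (Suc n) xs (take i hs @ a # b # drop (Suc i) hs) fs))"
      then have k: "k \<le> n" using i by (simp add: length_fF)
      have d: "(take i hs @ a # b # drop (Suc i) hs) ! Suc k = hs ! k" if "i < k"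
      proof -
        obtain q where "k = Suc (i + q)" using \<open>i < k\<close> by (metis less_imp_Suc_add)
        then show ?thesis using hs i k by (simp add: nth_append min_def)
      qed
      show "fF i xs (wact (Suc n) xs (take i hs @ a # b # drop (Suc i) hs) fs) ! k =
        ?W[i := ?c (lact D (src xs i) (tgt xs i) a (fs ! i)) (lact D (src xs (Suc i)) (src xs i) b (fs ! Suc i))] ! k"
        using i k hs wd(1,2) d
        by (auto simp: nth_fF[of _ n] nth_list_update src_fX[of _ n] tgt_fX[of _ n] nth_append min_def tgt_Suc)
    qed (use i in \<open>simp add: length_fF\<close>)
    \<comment> \<open>Linearity in the slot of the composite carries the sum over the coproduct
      inside the word, where it becomes the action on the composite.\<close>
    have L: "lin_on (cscale D) (Hom D (src xs (Suc i)) (tgt xs i)) (*) UNIV (\<lambda>g. F m' (fX i xs) (?W[i := g]))"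
      using mformD(2)[OF m wact_word[OF fw] i] i wd(1) by (simp add: src_fX tgt_fX)
    have f: "fs ! i \<in> Hom D (src xs i) (tgt xs i)" "fs ! Suc i \<in> Hom D (src xs (Suc i)) (src xs i)"
      using wd(4)[of i] wd(4)[of "Suc i"] i by (simp_all add: tgt_Suc)
    have "cs H (hs ! i) (\<lambda>a b. F m' (fX i xs) (fF i xs (wact (Suc n) xs (take i hs @ a # b # drop (Suc i) hs) fs))) =
        F m' (fX i xs) (?W[i := cs H (hs ! i) (\<lambda>a b. ?c (lact D (src xs i) (tgt xs i) a (fs ! i)) (lact D (src xs (Suc i)) (src xs i) b (fs ! Suc i)))])"
      unfolding e by (rule lin_on_cs_out[OF L cvs Hom_sub[OF wd(5,6)], symmetric])
        (intro cmp_mem(1) wd lact_lin(3) f)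
    also have "cs H (hs ! i) (\<lambda>a b. ?c (lact D (src xs i) (tgt xs i) a (fs ! i)) (lact D (src xs (Suc i)) (src xs i) b (fs ! Suc i))) =
        lact D (src xs (Suc i)) (tgt xs i) (hs ! i) (?c (fs ! i) (fs ! Suc i))"
      unfolding lact_cmp_axiom[OF wd(5,5,6) f(2,1)] sweedler_1 by simp
    also have "?W[i := lact D (src xs (Suc i)) (tgt xs i) (hs ! i) (?c (fs ! i) (fs ! Suc i))] = ?W"
      using i wd(1,2) by (intro nth_equalityI) (auto simp: nth_list_update nth_fF src_fX tgt_fX)
    finally show ?thesis .
  qed
  show "F (ract M m' h) (fX i xs) (fF i xs fs) = sweedler H (Suc n) h (\<lambda>hs. F m' (fX i xs) (fF i xs (wact (Suc n) xs hs fs)))"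
    unfolding balD[OF b fw] sweedler_split[OF vector_space_field l i]
    by (rule sweedler_cong) (rule inner[symmetric])
qed

text \<open>Balance is inherited because h acts on the inserted identity through the counit, which
  deletes the corresponding leg of the coproduct.\<close>

lemma cform_degen:
  assumes F: "cform (Suc n) F" and i: "i \<le> n"
  shows "cform n (\<lambda>m xs fs. F m (gX i xs) (gF i xs fs))"
  unfolding cform_def bal_def
proof (intro conjI allI impI)
  have m: "mform (Suc n) (*) UNIV F" and b: "bal (Suc n) F" using F by (simp_all add: cform_def)
  show m': "mform n (*) UNIV (\<lambda>m xs fs. F m (gX i xs) (gF i xs fs))" by (rule mform_degen[OF m i])
  fix m' h xs fs assume w: "(xs, fs) \<in> cyclic_words D n"
  note wd = wordD[OF w] and gw = gF_word[OF w i]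
  have inner: "F m' (gX i xs) (wact (Suc n) (gX i xs) hs (gF i xs fs)) =
      counit H (hs ! Suc i) * F m' (gX i xs) (gF i xs (wact n xs (take (Suc i) hs @ drop (Suc (Suc i)) hs) fs))"
    if hs: "length hs = Suc (Suc n)" for hs
  proof -
    let ?W = "gF i xs (wact n xs (take (Suc i) hs @ drop (Suc (Suc i)) hs) fs)"
    have e: "wact (Suc n) (gX i xs) hs (gF i xs fs) = ?W[Suc i := cscale D (counit H (hs ! Suc i)) (ident D (src xs i))]"
    proof (rule nth_equalityI)
      fix k assume "k < length (wact (Suc n) (gX i xs) hs (gF i xs fs))"
      then have k: "k \<le> Suc n" by simp
      consider "k \<le> i" | "k = Suc i" | "Suc i < k" by linarith
      then show "wact (Suc n) (gX i xs) hs (gF i xs fs) ! k = ?W[Suc i := cscale D (counit H (hs ! Suc i)) (ident D (src xs i))] ! k"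
      proof cases
        case 1
        then show ?thesis using i k hs wd(1,2)
          by (simp add: nth_gF[of _ n] src_gX[of _ n] tgt_gX[of _ n] nth_append length_gF[of _ n] nth_list_update)
      next
        case 2
        then show ?thesis using i k hs wd(1,2) lact_ident[OF wd(5)]
          by (simp add: nth_gF[of _ n] src_gX[of _ n] tgt_gX[of _ n] length_gF[of _ n] nth_list_update tgt_Suc)
      next
        case 3
        then obtain q where "k = Suc (Suc (i + q))" by (metis add_Suc less_imp_Suc_add)
        then show ?thesis using i k hs wd(1,2)
          by (simp add: nth_gF[of _ n] src_gX[of _ n] tgt_gX[of _ n] nth_append length_gF[of _ n] nth_list_update min_def)
      qed
    qed (use i in \<open>simp add: length_gF\<close>)
    have gw': "(gX i xs, ?W) \<in> cyclic_words D (Suc n)" by (rule gF_word[OF wact_word[OF w] i])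
    have L: "lin_on (cscale D) (Hom D (src xs i) (src xs i)) (*) UNIV (\<lambda>g. F m' (gX i xs) (?W[Suc i := g]))"
      using mformD(2)[OF m gw', of "Suc i"] i wd(1) by (simp add: src_gX tgt_gX tgt_Suc)
    have "?W[Suc i := ident D (src xs i)] = ?W"
      using i by (intro nth_equalityI) (auto simp: nth_list_update nth_gF[of _ n] length_gF[of _ n])
    then show ?thesis unfolding e lin_on_scale[OF L ident_mem[OF wd(5)]] by simp
  qed
  show "F (ract M m' h) (gX i xs) (gF i xs fs) = sweedler H n h (\<lambda>hs. F m' (gX i xs) (gF i xs (wact n xs hs fs)))"
  proof -
    have "sweedler H (Suc n) h (\<lambda>hs. F m' (gX i xs) (wact (Suc n) (gX i xs) hs (gF i xs fs))) =
        sweedler H (Suc n) h (\<lambda>hs. counit H (hs ! Suc i) *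
          F m' (gX i xs) (gF i xs (wact n xs (take (Suc i) hs @ drop (Suc (Suc i)) hs) fs)))"
      by (rule sweedler_cong) (rule inner)
    also have "\<dots> = sweedler H n h (\<lambda>hs. F m' (gX i xs) (gF i xs (wact n xs hs fs)))"
      by (rule sweedler_counit[OF vector_space_field mform_mlin[OF m' w]]) (simp add: i)
    finally show ?thesis unfolding balD[OF b gw] .
  qed
qed

end

section \<open>The twisted rotation and its order\<close>

context hcat_loc
begin

definition cycF :: "nat \<Rightarrow> ('m \<Rightarrow> 'o list \<Rightarrow> 'a list \<Rightarrow> 'k) \<Rightarrow> 'm \<Rightarrow> 'o list \<Rightarrow> 'a list \<Rightarrow> 'k" where
  "cycF n F m xs fs = ca m (\<lambda>a x. F x (rX n xs) (rF n a xs fs))"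

text \<open>Brings twists and actions into one normal form, an action on the untwisted rotated word
  \<open>rF n 1\<close>. In both cases the twist ends up in the first entry, to the right or to the
  left of the acting element.\<close>

lemma wact_rot:
  assumes w: "(xs, fs) \<in> cyclic_words D n" and ks: "length ks = n"
  shows "wact n (rX n xs) (y # ks) (rF n a xs fs) = wact n (rX n xs) ((y * S' a) # ks) (rF n 1 xs fs)"
    and "rF n a xs (wact n xs (ks @ [z]) fs) = wact n (rX n xs) ((S' a * z) # ks) (rF n 1 xs fs)"
proof -
  note wd = wordD[OF w]
  have n: "lact D (xs ! 0) (xs ! n) g (fs ! n) = lact D (src xs n) (tgt xs n) g (fs ! n)" for g
    using wd(1) by (simp add: src_last tgt_nth)
  note l = lact_lin(4,5)[OF wd(5,6) wd(4)[OF order_refl], folded n]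
  show "wact n (rX n xs) (y # ks) (rF n a xs fs) = wact n (rX n xs) ((y * S' a) # ks) (rF n 1 xs fs)"
  proof (rule nth_equalityI)
    fix k assume "k < length (wact n (rX n xs) (y # ks) (rF n a xs fs))"
    then show "wact n (rX n xs) (y # ks) (rF n a xs fs) ! k = wact n (rX n xs) ((y * S' a) # ks) (rF n 1 xs fs) ! k"
      using wd(1,2) lact_lin(4,5)[OF wd(5,6) wd(4)[OF order_refl]]
      by (cases k) (simp_all add: nth_rF src_rX tgt_rX n S'_one)
  qed simp
  show "rF n a xs (wact n xs (ks @ [z]) fs) = wact n (rX n xs) ((S' a * z) # ks) (rF n 1 xs fs)"
  proof (rule nth_equalityI)
    fix k assume "k < length (rF n a xs (wact n xs (ks @ [z]) fs))"
    then have k: "k \<le> n" by (simp add: length_rF)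
    have nn: "(ks @ [z]) ! n = z" using ks by (metis nth_append_length)
    show "rF n a xs (wact n xs (ks @ [z]) fs) ! k = wact n (rX n xs) ((S' a * z) # ks) (rF n 1 xs fs) ! k"
    proof (cases k)
      case 0
      have "wact n xs (ks @ [z]) fs ! n = lact D (src xs n) (tgt xs n) z (fs ! n)" by (simp add: nn)
      then show ?thesis
        using wd(1,2) 0 k lact_lin(4,5)[OF wd(5,6) wd(4)[OF order_refl]]
        by (simp add: nth_rF src_rX tgt_rX S'_one) (simp add: src_last tgt_nth)
    next
      case (Suc q)
      then show ?thesis using wd(1,2) k ks by (simp add: nth_rF src_rX tgt_rX nth_append)
    qed
  qed (simp add: length_rF)
qed

lemma mform_cyc:
  assumes F: "mform n (*) UNIV F"
  shows "mform n (*) UNIV (cycF n F)"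
proof (rule mformI)
  fix xs fs assume w: "(xs, fs) \<in> cyclic_words D n"
  note wd = wordD[OF w] and rw = rF_word[OF w]
  show "mlinear (*) (\<lambda>m. cycF n F m xs fs)"
    unfolding cycF_def
  proof (rule ca_lin)
    fix x a
    show "mlinear (*) (\<lambda>x. F x (rX n xs) (rF n a xs fs))" by (rule mformD(1)[OF F rw])
    obtain W where W: "W = rF n 0 xs fs" by blast
    have e: "rF n a xs fs = W[0 := lact D (src xs n) (tgt xs n) (S' a) (fs ! n)]" for a
      using wd(1,2) by (simp add: W rF_def src_last tgt_nth)
    have "lin_on (hscale H) UNIV (cscale D) (Hom D (src xs n) (tgt xs n)) (\<lambda>a. lact D (src xs n) (tgt xs n) (S' a) (fs ! n))"
      by (rule lin_on_comp[OF S'_lin lact_lin(1)[OF wd(5,6) wd(4)]]) simp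
    moreover have "lin_on (cscale D) (Hom D (src xs n) (tgt xs n)) (*) UNIV (\<lambda>g. F x (rX n xs) (W[0 := g]))"
      using mformD(2)[OF F rw, of 0] wd(1) unfolding W by (simp add: src_rX tgt_rX)
    ultimately show "lin (*) (\<lambda>a. F x (rX n xs) (rF n a xs fs))" unfolding e by (rule lin_on_comp)
  qed
  fix m j assume "j \<le> n"
  then show "lin_on (cscale D) (Hom D (src xs j) (tgt xs j)) (*) UNIV (\<lambda>g. cycF n F m xs (fs[j := g]))"
    unfolding cycF_def by (intro ca_lin_fun mformD(2)[OF mform_rot[OF F] w])
qed

text \<open>The anti-Yetter-Drinfeld condition makes this work. It gives the coaction of m h as
  S(h_3) m_(-1) h_1 \<otimes> m_(0) h_2, whose twist is S^-1(h_1) S^-1(m_(-1)) h_3. Balancing moves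
  h_2 onto the rotated word; its first leg meets the twist, and h_2 S^-1(h_1) collapses to a counit.
  The remaining legs act on f^0, ..., f^(n-1) in order and the last one on f^n, as in the diagonal
  action.\<close>

lemma cform_cyc:
  assumes F: "cform n F"
  shows "cform n (cycF n F)"
  unfolding cform_def bal_def
proof (intro conjI allI impI)
  have m: "mform n (*) UNIV F" and b: "bal n F" using F by (simp_all add: cform_def)
  show m': "mform n (*) UNIV (cycF n F)" by (rule mform_cyc[OF m])
  fix m' h xs fs assume w: "(xs, fs) \<in> cyclic_words D n"
  note wd = wordD[OF w] and rw = rF_word[OF w]
  define A where "A x hs = F x (rX n xs) (wact n (rX n xs) hs (rF n 1 xs fs))" for x hs
  have lA: "mlin (*) (Suc n) (A x)" for x
    using mform_mlin[OF m rw] by (simp add: A_def[abs_def])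
  have lA1: "lin (*) (\<lambda>u. A x (u # ks))" if "length ks = n" for x ks
    by (rule mlin_hd[OF lA that])
  have a: "F x (rX n xs) (wact n (rX n xs) (y # ks) (rF n c xs fs)) = A x ((y * S' c) # ks)" if "length ks = n" for x y ks c
    unfolding A_def wact_rot(1)[OF w that, of y c] ..
  have z: "cycF n F m' xs (wact n xs (ks @ [z]) fs) = ca m' (\<lambda>a x. A x ((S' a * z) # ks))" if "length ks = n" for ks z
    unfolding cycF_def A_def wact_rot(2)[OF w that] ..
  \<comment> \<open>The value after balancing: \<open>y\<close> is the leg of h_2 that acts on the
    rotated arrow, \<open>ks\<close> are the legs that act on the others.\<close>
  define Q where "Q y h1 h3 ks = ca m' (\<lambda>a x. A x ((y * (S' h1 * (S' a * h3))) # ks))" for y h1 h3 ks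
  note Lin = ca_lin_fun lin_comp[OF lA1] lin_mult1 lin_mult2 lin_id S'_lin
  have lQ: "lin (*) (\<lambda>y. Q y h1 h3 ks)" "lin (*) (\<lambda>h1. Q y h1 h3 ks)" "lin (*) (\<lambda>h3. Q y h1 h3 ks)"
    if "length ks = n" for y h1 h3 ks
    unfolding Q_def by (intro Lin that)+
  have start: "cycF n F (ract M m' h) xs fs =
      cs H h (\<lambda>h1 r. cs H r (\<lambda>h2 h3. sweedler H n h2 (\<lambda>hs. Q (hd hs) h1 h3 (tl hs))))"
  proof -
    have "F (ract M x h2) (rX n xs) (rF n (antip H h3 * a * h1) xs fs) =
        sweedler H n h2 (\<lambda>hs. A x ((hd hs * (S' h1 * (S' a * h3))) # tl hs))" for x a h1 h2 h3
      unfolding balD[OF b rw]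
    proof (rule sweedler_cong)
      fix hs :: "'h list" assume "length hs = Suc n"
      then have "hs = hd hs # tl hs" "length (tl hs) = n" by (cases hs; simp)+
      moreover have "S' (antip H h3 * a * h1) = S' h1 * (S' a * h3)" by (simp add: S'_mult S'_antip)
      ultimately show "F x (rX n xs) (wact n (rX n xs) hs (rF n (antip H h3 * a * h1) xs fs)) =
          A x ((hd hs * (S' h1 * (S' a * h3))) # tl hs)"
        using a[of "tl hs" x "hd hs" "antip H h3 * a * h1"] by simp
    qed
    then have e: "ca m' (\<lambda>a x. F (ract M x h2) (rX n xs) (rF n (antip H h3 * a * h1) xs fs)) =
        sweedler H n h2 (\<lambda>hs. Q (hd hs) h1 h3 (tl hs))" for h1 h2 h3
      by (simp add: ca_sweedler_swap Q_def)
    have l1: "lin (*) (\<lambda>a. F x (rX n xs) (rF n a xs fs))" for x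
    proof -
      have "(\<lambda>a. F x (rX n xs) (rF n a xs fs)) = (\<lambda>a. A x (S' a # replicate n 1))"
        using a[of "replicate n 1" x 1] wact_one[OF rw] by (simp add: fun_eq_iff)
      then show ?thesis by (simp only:) (intro Lin length_replicate)
    qed
    show ?thesis
      unfolding cycF_def
      by (subst ca_ract) (rule l1, rule mformD(1)[OF m rw], simp only: e)
  qed
  show "cycF n F (ract M m' h) xs fs = sweedler H n h (\<lambda>hs. cycF n F m' xs (wact n xs hs fs))"
  proof (cases n)
    \<comment> \<open>With a single arrow h_2 has no legs left for other arrows, and the collapse is
      one use of coassociativity without an inner iterated coproduct.\<close>
    case 0
    have "cycF n F (ract M m' h) xs fs = cs H h (\<lambda>h1 r. cs H r (\<lambda>h2 h3. Q h2 h1 h3 []))"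
      unfolding start by (simp add: 0)
    also have "\<dots> = cs H h (\<lambda>k h3. cs H k (\<lambda>h1 h2. Q h2 h1 h3 []))"
      by (rule coassoc[OF vector_space_field, symmetric]) (intro lQ; simp add: 0)+
    also have "\<dots> = cs H h (\<lambda>k h3. counit H k * Q 1 1 h3 [])"
    proof -
      have "cs H k (\<lambda>h1 h2. Q h2 h1 h3 []) = counit H k * Q 1 1 h3 []" for k h3
        using cs_S'[of "(*)" "\<lambda>c. ca m' (\<lambda>a x. A x ((c * (S' a * h3)) # []))" k]
        by (simp add: Q_def mult.assoc S'_one 0 Lin)
      then show ?thesis by simp
    qed
    also have "\<dots> = Q 1 1 h []"
      by (rule cs_counit(1)) (rule lQ, simp add: 0)
    also have "\<dots> = cycF n F m' xs (wact n xs ([] @ [h]) fs)"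
      by (subst z) (simp_all add: 0 Q_def S'_one)
    finally show ?thesis by (simp add: 0)
  next
    case (Suc p)
    have lA2: "mlin (*) (Suc p) (\<lambda>ks. A x (u # ks))" for x u
      using mlin_Cons[OF lA] Suc by simp
    have mQ: "mlin (*) (Suc p) (\<lambda>ks. Q y h1 h3 ks)" for y h1 h3
      unfolding Q_def ca_sum by (rule mlin_sum_list[OF vector_space_field lA2])
    let ?f = "\<lambda>h1 y z h3. sweedler H p z (\<lambda>ks. Q y h1 h3 ks)"
    have lf: "lin (*) (\<lambda>h1. ?f h1 y z h3)" "lin (*) (\<lambda>y. ?f h1 y z h3)" "lin (*) (\<lambda>h3. ?f h1 y z h3)"
      "lin (*) (\<lambda>z. ?f h1 y z h3)" for h1 y z h3
      by (intro sweedler_lin_fun vector_space_field lQ sweedler_lin mQ; simp add: Suc)+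
    have "cycF n F (ract M m' h) xs fs = cs H h (\<lambda>h1 r. cs H r (\<lambda>h2 h3. cs H h2 (\<lambda>y z. ?f h1 y z h3)))"
      unfolding start by (simp add: Suc sweedler_Suc del: sweedler.simps)
    also have "\<dots> = cs H h (\<lambda>h1 r. cs H r (\<lambda>y r. cs H r (\<lambda>z h3. ?f h1 y z h3)))"
      by (subst coassoc[OF vector_space_field, of "\<lambda>y z h3. ?f _ y z h3"]) (rule lf refl)+
    also have "\<dots> = cs H h (\<lambda>k r. cs H k (\<lambda>h1 y. cs H r (\<lambda>z h3. ?f h1 y z h3)))"
      by (rule coassoc[OF vector_space_field, symmetric]) (intro lin_cs_fun lin_cs vector_space_field lf)+
    also have "\<dots> = cs H h (\<lambda>k r. counit H k * cs H r (\<lambda>z h3. ?f 1 1 z h3))"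
    proof -
      have "cs H k (\<lambda>h1 y. cs H r (\<lambda>z h3. ?f h1 y z h3)) = counit H k * cs H r (\<lambda>z h3. ?f 1 1 z h3)" for k r
      proof -
        have "lin (*) (\<lambda>c. cs H r (\<lambda>z h3. ?f 1 c z h3))" by (intro lin_cs_fun vector_space_field lf)
        from cs_S'[OF this, of k] show ?thesis by (simp add: Q_def mult.assoc S'_one)
      qed
      then show ?thesis by simp
    qed
    also have "\<dots> = cs H h (\<lambda>z h3. ?f 1 1 z h3)"
      by (rule cs_counit(1)) (intro lin_cs vector_space_field lf)
    also have "\<dots> = cs H h (\<lambda>a b. sweedler H p a (\<lambda>ks. cycF n F m' xs (wact n xs (ks @ [b]) fs)))"
    proof -
      have "?f 1 1 a b = sweedler H p a (\<lambda>ks. cycF n F m' xs (wact n xs (ks @ [b]) fs))" for a b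
      proof (rule sweedler_cong)
        fix ks :: "'h list" assume "length ks = Suc p"
        then have "length ks = n" using Suc by simp
        from z[OF this, of b] show "Q 1 1 b ks = cycF n F m' xs (wact n xs (ks @ [b]) fs)"
          by (simp only: Q_def S'_one mult_1_left)
      qed
      then show ?thesis by simp
    qed
    also have "\<dots> = sweedler H (Suc p) h (\<lambda>hs. cycF n F m' xs (wact n xs hs fs))"
      by (rule sweedler_snoc[OF vector_space_field, symmetric]) (use mform_mlin[OF m' w] Suc in simp)
    finally show ?thesis by (simp add: Suc)
  qed
qed

text \<open>The j-fold iterated coaction, as produced by j successive rotations. The list holds the
  coacting elements in the order of the rotations.\<close>

fun mca :: "nat \<Rightarrow> 'm \<Rightarrow> ('h list \<Rightarrow> 'm \<Rightarrow> 'k) \<Rightarrow> 'k" where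
  "mca 0 m f = f [] m"
| "mca (Suc j) m f = ca m (\<lambda>a x. mca j x (\<lambda>as. f (a # as)))"

lemma mca_cong: "(\<And>as x. length as = j \<Longrightarrow> f as x = g as x) \<Longrightarrow> mca j m f = mca j m g"
proof (induction j arbitrary: m f g)
  case (Suc j)
  have "mca j x (\<lambda>as. f (a # as)) = mca j x (\<lambda>as. g (a # as))" for a x
    by (rule Suc.IH) (rule Suc.prems, simp)
  then show ?case by (simp only: mca.simps)
next
  case 0
  then show ?case by simp
qed

text \<open>Comodule coassociativity: coacting repeatedly on the module part amounts to coacting
  once and comultiplying the Hopf part.\<close>

lemma mca_sweedler:
  assumes "\<And>x. mlin (*) (Suc n) (\<lambda>as. f as x)" "\<And>as. length as = Suc n \<Longrightarrow> mlinear (*) (f as)"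
  shows "mca (Suc n) m f = ca m (\<lambda>a x. sweedler H n a (\<lambda>as. f as x))"
  using assms
proof (induction n arbitrary: m f)
  case (Suc n)
  have F: "mlin (*) (Suc n) (\<lambda>as. f (a # as) x)" for a x by (rule mlin_Cons[OF Suc.prems(1)])
  have IH: "mca (Suc n) x (\<lambda>as. f (a # as)) = ca x (\<lambda>b y. sweedler H n b (\<lambda>as. f (a # as) y))" for a x
    by (rule Suc.IH[OF F]) (rule Suc.prems(2), simp)
  have "mca (Suc (Suc n)) m f = ca m (\<lambda>a x. ca x (\<lambda>b y. sweedler H n b (\<lambda>as. f (a # as) y)))"
    unfolding mca.simps(2)[of "Suc n"] IH ..
  also have "\<dots> = ca m (\<lambda>a x. cs H a (\<lambda>a1 a2. sweedler H n a2 (\<lambda>as. f (a1 # as) x)))"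
  proof (rule ca_coassoc[symmetric])
    show "lin (*) (\<lambda>a. sweedler H n b (\<lambda>as. f (a # as) x))" for b x
      by (rule sweedler_lin_fun[OF vector_space_field mlin_hd[OF Suc.prems(1)]])
    show "lin (*) (\<lambda>b. sweedler H n b (\<lambda>as. f (a # as) x))" for a x
      by (rule sweedler_lin[OF vector_space_field F])
    show "mlinear (*) (\<lambda>x. sweedler H n b (\<lambda>as. f (a # as) x))" for a b
      unfolding sweedler_sum
      by (rule lin_on_sum_list_fun[OF vector_space_field subspace_UNIV[OF vector_space_field] Suc.prems(2)]) (simp add: length_swl)
  qed
  finally show ?case by (simp add: sweedler_Suc del: sweedler.simps)
qed simp

definition xr :: "nat \<Rightarrow> nat \<Rightarrow> 'o list \<Rightarrow> 'o list" where
  "xr n j xs = drop (Suc n - j) xs @ take (Suc n - j) xs"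

text \<open>Closed form of j rotations of the arrows. The last j arrows come to the front in their
  old order, each twisted once. The last arrow is rotated first, so the arrow that ends in place k <
  j takes entry j - (k + 1) of the list.\<close>

definition fr :: "nat \<Rightarrow> nat \<Rightarrow> 'h list \<Rightarrow> 'o list \<Rightarrow> 'a list \<Rightarrow> 'a list" where
  "fr n j as xs fs = map (\<lambda>k. if k < j
     then lact D (src xs (Suc n - j + k)) (tgt xs (Suc n - j + k)) (S' (as ! (j - Suc k))) (fs ! (Suc n - j + k))
     else fs ! (k - j)) [0..<Suc n]"

lemma xr_rX:
  assumes "length xs = Suc n" "j \<le> n"
  shows "xr n j (rX n xs) = xr n (Suc j) xs"
proof -
  have "Suc n - j = Suc (n - j)" using assms by simp
  moreover have "drop (n - j) xs = drop (n - j) (take n xs) @ [xs ! n]"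
  proof -
    have "xs = take n xs @ [xs ! n]" using assms by (metis lessI take_Suc_conv_app_nth take_all_iff order_refl)
    then have "drop (n - j) xs = drop (n - j) (take n xs @ [xs ! n])" by simp
    then show ?thesis using assms by simp
  qed
  ultimately show ?thesis using assms by (simp add: xr_def rX_def)
qed

lemma fr_rF:
  assumes w: "(xs, fs) \<in> cyclic_words D n" and j: "j \<le> n" and as: "length as = j"
  shows "fr n j as (rX n xs) (rF n a xs fs) = fr n (Suc j) (a # as) xs fs"
proof (rule nth_equalityI)
  note wd = wordD[OF w]
  fix k assume "k < length (fr n j as (rX n xs) (rF n a xs fs))"
  then have k: "k \<le> n" by (simp add: fr_def)
  consider "k < j" | "k = j" | "j < k" by linarith
  then show "fr n j as (rX n xs) (rF n a xs fs) ! k = fr n (Suc j) (a # as) xs fs ! k"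
  proof cases
    case 1
    then have i: "Suc n - j + k = Suc (n - j + k)" "Suc n - Suc j + k = n - j + k" "n - j + k \<le> n" "Suc (n - j + k) \<le> n"
      "Suc j - Suc k = Suc (j - Suc k)" using j by auto
    show ?thesis using 1 k wd(1,2) i by (simp add: fr_def src_rX tgt_rX nth_rF del: upt_Suc)
  next
    case 2
    then show ?thesis using k wd(1,2) j by (simp add: fr_def nth_rF src_last tgt_nth del: upt_Suc)
  next
    case 3
    then show ?thesis using k wd(1,2) j by (simp add: fr_def nth_rF del: upt_Suc)
  qed
qed (simp add: fr_def)

lemma cycF_cong:
  assumes "\<And>m xs fs. (xs, fs) \<in> cyclic_words D n \<Longrightarrow> F m xs fs = G m xs fs" "(xs, fs) \<in> cyclic_words D n"
  shows "cycF n F m xs fs = cycF n G m xs fs"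
  unfolding cycF_def by (simp add: assms(1)[OF rF_word[OF assms(2)]])

lemma cycF_funpow:
  assumes "(xs, fs) \<in> cyclic_words D n" "j \<le> Suc n"
  shows "(cycF n ^^ j) F m xs fs = mca j m (\<lambda>as x. F x (xr n j xs) (fr n j as xs fs))"
  using assms
proof (induction j arbitrary: m xs fs)
  case 0
  note wd = wordD[OF 0(1)]
  have "fr n 0 [] xs fs = fs" using wd(2) unfolding fr_def by (simp del: upt_Suc) (metis map_nth)
  then show ?case using wd(1) by (simp add: xr_def)
next
  case (Suc j)
  have "(cycF n ^^ Suc j) F m xs fs = ca m (\<lambda>a x. (cycF n ^^ j) F x (rX n xs) (rF n a xs fs))"
    by (simp add: cycF_def)
  also have "\<dots> = ca m (\<lambda>a x. mca j x (\<lambda>as y. F y (xr n j (rX n xs)) (fr n j as (rX n xs) (rF n a xs fs))))"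
    using Suc.IH[OF rF_word[OF Suc.prems(1)]] Suc.prems(2) by simp
  finally have s: "(cycF n ^^ Suc j) F m xs fs = \<dots>" .
  have "mca j x (\<lambda>as y. F y (xr n j (rX n xs)) (fr n j as (rX n xs) (rF n a xs fs))) =
      mca j x (\<lambda>as y. F y (xr n (Suc j) xs) (fr n (Suc j) (a # as) xs fs))" for a x
    by (rule mca_cong) (use Suc.prems wordD(1)[OF Suc.prems(1)] in \<open>simp add: xr_rX fr_rF\<close>)
  then show ?case unfolding s by (simp only: mca.simps)
qed

text \<open>After n + 1 rotations every arrow is back in place and twisted once. The twists, in
  reversed order, are the legs of S^-1(m_(-1)), so together they act diagonally; balance moves this
  element to the module, and m_(0) S^-1(m_(-1)) = m.\<close>

lemma cycF_order:
  assumes F: "cform n F" and w: "(xs, fs) \<in> cyclic_words D n"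
  shows "(cycF n ^^ Suc n) F m xs fs = F m xs fs"
proof -
  have m: "mform n (*) UNIV F" and b: "bal n F" using F by (simp_all add: cform_def)
  have "fr n (Suc n) as xs fs = wact n xs (map S' (rev as)) fs" if "length as = Suc n" for as
    using that by (intro nth_equalityI) (simp_all add: fr_def rev_nth del: upt_Suc)
  then have "(cycF n ^^ Suc n) F m xs fs = mca (Suc n) m (\<lambda>as x. F x xs (wact n xs (map S' (rev as)) fs))"
    unfolding cycF_funpow[OF w order_refl] by (intro mca_cong) (simp add: xr_def)
  also have "\<dots> = ca m (\<lambda>a x. sweedler H n a (\<lambda>as. F x xs (wact n xs (map S' (rev as)) fs)))"
    by (rule mca_sweedler[OF mlin_map_rev[OF mform_mlin[OF m w] S'_lin] mformD(1)[OF m wact_word[OF w]]])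
  also have "\<dots> = ca m (\<lambda>a x. F (ract M x (S' a)) xs fs)"
    unfolding balD[OF b w] sweedler_S'[OF vector_space_field mform_mlin[OF m w]] ..
  also have "\<dots> = F m xs fs" by (rule ca_stable_S'[OF mformD(1)[OF m w]])
  finally show ?thesis .
qed

text \<open>A twist that falls on an arrow on which H acts by the counit leaves the scalar
  eps(m_(-1)), and the counit of the coaction removes it.\<close>

lemma ca_counit_slot:
  assumes m: "mform n (*) UNIV F" and w: "(xs, fs) \<in> cyclic_words D n" and i: "i \<le> n" and g: "g \<in> Hom D (src xs i) (tgt xs i)"
  shows "ca m (\<lambda>a x. F x xs (fs[i := cscale D (counit H a) g])) = F m xs (fs[i := g])"
proof -
  have "ca m (\<lambda>a x. F x xs (fs[i := cscale D (counit H a) g])) = ca m (\<lambda>a x. counit H a * F x xs (fs[i := g]))"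
    by (simp only: lin_on_scale[OF mformD(2)[OF m w i] g])
  also have "\<dots> = F m xs (fs[i := g])"
    by (rule ca_counit[OF mformD(1)[OF m cyclic_words_update[OF w i g]]])
  finally show ?thesis .
qed

lemma fX_rX_gX:
  assumes "length xs = Suc n"
  shows "fX 0 (rX (Suc n) (gX n xs)) = xs"
proof (rule nth_equalityI)
  note simps = length_fX[of _ n] length_rX[of _ "Suc n"] length_gX[of _ n] nth_fX[of _ n] nth_rX[of _ "Suc n"] nth_gX[of _ n]
  show "length (fX 0 (rX (Suc n) (gX n xs))) = length xs" using assms by (simp add: simps)
  fix k assume "k < length (fX 0 (rX (Suc n) (gX n xs)))"
  then have "k \<le> n" using assms by (simp add: simps)
  then show "fX 0 (rX (Suc n) (gX n xs)) ! k = xs ! k"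
    using assms by (cases k) (simp_all add: simps tgt_Suc src_last src_nth tgt_nth)
qed

text \<open>The word behind the last coface followed by the last codegeneracy: the appended identity
  is rotated to the front, becomes eps(a) times an identity under the twist, and is composed with
  f^0.\<close>

lemma fF_rF_gF:
  assumes w: "(xs, fs) \<in> cyclic_words D n"
  shows "fF 0 (rX (Suc n) (gX n xs)) (rF (Suc n) a (gX n xs) (gF n xs fs)) = fs[0 := cscale D (counit H a) (fs ! 0)]"
proof (rule nth_equalityI)
  note wd = wordD[OF w]
  note simps = length_fF[of _ n] length_rF[of _ "Suc n"] length_gF[of _ n] nth_fF[of _ n] nth_rF[of _ "Suc n"] nth_gF[of _ n]
    src_rX[of _ "Suc n"] tgt_rX[of _ "Suc n"] length_gX[of _ n] src_gX[of _ n] tgt_gX[of _ n] nth_gX[of _ n] less_Suc_eq_le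
  show "length (fF 0 (rX (Suc n) (gX n xs)) (rF (Suc n) a (gX n xs) (gF n xs fs))) = length (fs[0 := cscale D (counit H a) (fs ! 0)])"
    using wd(1,2) by (simp add: simps)
  fix k assume "k < length (fF 0 (rX (Suc n) (gX n xs)) (rF (Suc n) a (gX n xs) (gF n xs fs)))"
  then have k: "k \<le> n" using wd(1,2) by (simp add: simps)
  have t: "tgt xs 0 = src xs n" using wd(1) by (simp add: src_last tgt_nth)
  have f0: "fs ! 0 \<in> Hom D (src xs 0) (src xs n)" using wd(4)[of 0] t by simp
  have "cmp D (src xs 0) (src xs n) (src xs n) (cscale D (counit H a) (ident D (src xs n))) (fs ! 0) = cscale D (counit H a) (fs ! 0)"
    using lin_on_scale[OF cmp_mem(2)[OF wd(5,5,5) f0 ident_mem[OF wd(5)]] ident_mem[OF wd(5)]] cmp_ident[OF wd(5,5) f0] by simp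
  then show "fF 0 (rX (Suc n) (gX n xs)) (rF (Suc n) a (gX n xs) (gF n xs fs)) ! k = fs[0 := cscale D (counit H a) (fs ! 0)] ! k"
    using wd(1,2) k lact_ident[OF wd(5)] by (cases k) (simp_all add: simps tgt_Suc t counit_S')
qed

end

section \<open>Operators on cochains and the cocyclic identities\<close>

context hcat_loc
begin

lemma chain_lift_cong:
  assumes "\<And>m xs fs. (xs, fs) \<in> cyclic_words D n \<Longrightarrow> F m xs fs = G m xs fs" and t: "t \<in> MCNs n"
  shows "chain_lift M D n F t = chain_lift M D n G t"
    unfolding chain_lift_def tensor_lift_rep
  proof (rule arg_cong[where f = sum_list], rule map_cong[OF refl])
    fix p assume "p \<in> set (rep (MCN M D n) t)"
    then obtain m c where p: "p = (m, c)" "c \<in> CNs n" using rep(1)[OF t] by (cases p) (auto simp: MCN_def fst_bi)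
    have "(\<Sum>(xs, fs)\<leftarrow>rep (CN D n) c. F m xs fs) = (\<Sum>(xs, fs)\<leftarrow>rep (CN D n) c. G m xs fs)"
    proof (rule arg_cong[where f = sum_list], rule map_cong[OF refl])
      fix q assume "q \<in> set (rep (CN D n) c)"
      then have "q \<in> cyclic_words D n" using rep(1)[OF p(2)] by (auto simp: fst_CN)
      then show "(case q of (xs, fs) \<Rightarrow> F m xs fs) = (case q of (xs, fs) \<Rightarrow> G m xs fs)"
        using assms(1) by (cases q) simp
    qed
    then show "(case p of (m, c) \<Rightarrow> \<Sum>x\<leftarrow>rep (CN D n) c. case x of (xs, fs) \<Rightarrow> F m xs fs) =
        (case p of (m, c) \<Rightarrow> \<Sum>x\<leftarrow>rep (CN D n) c. case x of (xs, fs) \<Rightarrow> G m xs fs)"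
      unfolding p prod.case .
  qed

lemma ext_cong:
  assumes "\<And>m xs fs. (xs, fs) \<in> cyclic_words D n \<Longrightarrow> F m xs fs = G m xs fs"
  shows "ext n F = ext n G"
proof
  fix t
  show "ext n F t = ext n G t"
    using chain_lift_cong[of n F G, OF assms] by (simp add: ext_def off_zero_def)
qed

abbreviation faceF :: "nat \<Rightarrow> ('m \<Rightarrow> 'o list \<Rightarrow> 'a list \<Rightarrow> 'k) \<Rightarrow> 'm \<Rightarrow> 'o list \<Rightarrow> 'a list \<Rightarrow> 'k" where
  "faceF i F \<equiv> \<lambda>m xs fs. F m (fX i xs) (fF i xs fs)"

abbreviation degenF :: "nat \<Rightarrow> ('m \<Rightarrow> 'o list \<Rightarrow> 'a list \<Rightarrow> 'k) \<Rightarrow> 'm \<Rightarrow> 'o list \<Rightarrow> 'a list \<Rightarrow> 'k" where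
  "degenF i F \<equiv> \<lambda>m xs fs. F m (gX i xs) (gF i xs fs)"

lemma coface_ext: "i \<le> n \<Longrightarrow> coface H M D n i \<phi> = ext (Suc n) (faceF i (ev n \<phi>))"
  by (simp add: coface_def ext_def ev_def fX_def fF_def)

lemma codegen_ext: "codegen M D n i \<phi> = ext n (degenF i (ev (Suc n) \<phi>))"
  by (simp add: codegen_def ext_def ev_def gX_def gF_def)

lemma cocyc_ext: "cocyc H M D n \<phi> = ext n (cycF n (ev n \<phi>))"
  by (simp add: cocyc_def ext_def ev_def[abs_def] cycF_def[abs_def] rX_def rF_def ca_def)

text \<open>Merging (S^-1(m_(-1)) f^(n+1)) f^0 into one arrow is rotating and then composing the
  first two arrows. In this form the last coface fits the reduced list of axioms in
  \<open>cocyclic_moduleI\<close>.\<close>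

lemma coface_last_ext: "coface H M D n (Suc n) \<phi> = ext (Suc n) (cycF (Suc n) (faceF 0 (ev n \<phi>)))"
proof -
  have "coface H M D n (Suc n) \<phi> = ext (Suc n) (\<lambda>m xs fs. ca m (\<lambda>a x. ev n \<phi> x (xs ! Suc n # take n (tl xs))
        (cmp D (src xs 0) (xs ! 0) (xs ! Suc n)
           (lact D (xs ! 0) (xs ! Suc n) (S' a) (fs ! Suc n)) (fs ! 0) # take n (tl fs))))"
    by (simp add: coface_def ext_def ev_def ca_def)
  also have "\<dots> = ext (Suc n) (cycF (Suc n) (faceF 0 (ev n \<phi>)))"
  proof (rule ext_cong)
    fix m xs fs assume w: "(xs, fs) \<in> cyclic_words D (Suc n)"
    note wd = wordD[OF w]
    have "fX 0 (rX (Suc n) xs) = xs ! Suc n # take n (tl xs)"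
      using wd(1) by (simp add: fX_def rX_def drop_take drop_Suc)
    moreover have "fF 0 (rX (Suc n) xs) (rF (Suc n) a xs fs) = cmp D (src xs 0) (xs ! 0) (xs ! Suc n)
           (lact D (xs ! 0) (xs ! Suc n) (S' a) (fs ! Suc n)) (fs ! 0) # take n (tl fs)" for a
      using wd(1,2) by (simp add: fF_def nth_rF src_rX tgt_rX src_last tgt_nth) (simp add: rF_def drop_take drop_Suc)
    ultimately show "ca m (\<lambda>a x. ev n \<phi> x (xs ! Suc n # take n (tl xs))
        (cmp D (src xs 0) (xs ! 0) (xs ! Suc n)
           (lact D (xs ! 0) (xs ! Suc n) (S' a) (fs ! Suc n)) (fs ! 0) # take n (tl fs))) =
        cycF (Suc n) (faceF 0 (ev n \<phi>)) m xs fs"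
      by (simp add: cycF_def)
  qed
  finally show ?thesis .
qed

lemma ev_coface:
  assumes "\<phi> \<in> cochains H M D n" "i \<le> n" "(xs, fs) \<in> cyclic_words D (Suc n)"
  shows "ev (Suc n) (coface H M D n i \<phi>) m xs fs = ev n \<phi> m (fX i xs) (fF i xs fs)"
  unfolding coface_ext[OF assms(2)]
  by (rule ev_ext[OF _ assms(3)]) (use cform_face[OF cform_ev[OF assms(1)] assms(2)] in \<open>simp add: cform_def\<close>)

lemma ev_codegen:
  assumes "\<phi> \<in> cochains H M D (Suc n)" "i \<le> n" "(xs, fs) \<in> cyclic_words D n"
  shows "ev n (codegen M D n i \<phi>) m xs fs = ev (Suc n) \<phi> m (gX i xs) (gF i xs fs)"
  unfolding codegen_ext
  by (rule ev_ext[OF _ assms(3)]) (use cform_degen[OF cform_ev[OF assms(1)] assms(2)] in \<open>simp add: cform_def\<close>)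

lemma ev_cocyc:
  assumes "\<phi> \<in> cochains H M D n" "(xs, fs) \<in> cyclic_words D n"
  shows "ev n (cocyc H M D n \<phi>) m xs fs = cycF n (ev n \<phi>) m xs fs"
  unfolding cocyc_ext
  by (rule ev_ext[OF _ assms(2)]) (use cform_cyc[OF cform_ev[OF assms(1)]] in \<open>simp add: cform_def\<close>)

lemma coface_mem: "\<phi> \<in> cochains H M D n \<Longrightarrow> i \<le> n \<Longrightarrow> coface H M D n i \<phi> \<in> cochains H M D (Suc n)"
  by (simp add: coface_ext ext_cochain cform_face cform_ev)

lemma codegen_mem: "\<phi> \<in> cochains H M D (Suc n) \<Longrightarrow> i \<le> n \<Longrightarrow> codegen M D n i \<phi> \<in> cochains H M D n"
  by (simp add: codegen_ext ext_cochain cform_degen cform_ev)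

lemma cocyc_mem: "\<phi> \<in> cochains H M D n \<Longrightarrow> cocyc H M D n \<phi> \<in> cochains H M D n"
  by (simp add: cocyc_ext ext_cochain cform_cyc cform_ev)

lemma coface_last:
  assumes "\<phi> \<in> cochains H M D n"
  shows "coface H M D n (Suc n) \<phi> = cocyc H M D (Suc n) (coface H M D n 0 \<phi>)"
  unfolding coface_last_ext cocyc_ext
  by (rule ext_cong, rule cycF_cong) (simp_all add: ev_coface[OF assms])

lemma coface_lin: "i \<le> n \<Longrightarrow> lin_on fscale (cochains H M D n) fscale (cochains H M D (Suc n)) (coface H M D n i)"
proof -
  assume i: "i \<le> n"
  have "coface H M D n i = (\<lambda>\<phi>. ext (Suc n) (faceF i (ev n \<phi>)))" by (simp add: fun_eq_iff coface_ext i)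
  then show ?thesis using ext_lin[of n "Suc n" "faceF i", OF cform_face[OF _ i]] by simp
qed

lemma codegen_lin: "i \<le> n \<Longrightarrow> lin_on fscale (cochains H M D (Suc n)) fscale (cochains H M D n) (codegen M D n i)"
  using ext_lin[of "Suc n" n "degenF i", OF cform_degen] by (simp add: codegen_ext[abs_def])

lemma cocyc_lin: "lin_on fscale (cochains H M D n) fscale (cochains H M D n) (cocyc H M D n)"
  using ext_lin[of n n "cycF n", OF cform_cyc]
  by (simp add: cocyc_ext[abs_def] cycF_def ca_sum sum_list_addf sum_list_const_mult)

lemma ev_cocyc_funpow:
  assumes \<phi>: "\<phi> \<in> cochains H M D n" and "(xs, fs) \<in> cyclic_words D n"
  shows "ev n ((cocyc H M D n ^^ k) \<phi>) m xs fs = (cycF n ^^ k) (ev n \<phi>) m xs fs"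
  using assms(2)
proof (induction k arbitrary: m xs fs)
  case (Suc k)
  have "(cocyc H M D n ^^ k) \<phi> \<in> cochains H M D n" by (induction k) (simp_all add: \<phi> cocyc_mem)
  then show ?case
    using ev_cocyc[OF _ Suc.prems, of "(cocyc H M D n ^^ k) \<phi>" m] cycF_cong[OF Suc.IH Suc.prems] by simp
qed simp

theorem cocyclic_module_C_H: "cocyclic_module (C_H H M D)"
proof (rule cocyclic_moduleI; (simp only: C_H_def cocyclic.simps)?)
  show "vector_space (fscale :: 'k \<Rightarrow> (('k, 'm, 'o, 'a) chain \<Rightarrow> 'k) \<Rightarrow> _)" by (rule vector_space_fscale)
  fix n i j \<phi>
  show "module.subspace fscale (cochains H M D n)" by (rule cochains_sub)
  show "i \<le> n \<Longrightarrow> lin_on fscale (cochains H M D n) fscale (cochains H M D (Suc n)) (coface H M D n i)" by (rule coface_lin)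
  show "i \<le> n \<Longrightarrow> lin_on fscale (cochains H M D (Suc n)) fscale (cochains H M D n) (codegen M D n i)" by (rule codegen_lin)
  show "lin_on fscale (cochains H M D n) fscale (cochains H M D n) (cocyc H M D n)" by (rule cocyc_lin)
  show "\<phi> \<in> cochains H M D n \<Longrightarrow> coface H M D n (Suc n) \<phi> = cocyc H M D (Suc n) (coface H M D n 0 \<phi>)" by (rule coface_last)
  show "coface H M D (Suc n) j (coface H M D n i \<phi>) = coface H M D (Suc n) i (coface H M D n (j - 1) \<phi>)"
    if \<phi>: "\<phi> \<in> cochains H M D n" and ij: "j \<le> Suc n" "i < j"
  proof -
    obtain j' where j: "j = Suc j'" "i \<le> j'" "j' \<le> n" using ij by (cases j) auto
    show ?thesis unfolding j(1)
    proof (rule cochains_eqI)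
      fix m xs fs assume w: "(xs, fs) \<in> cyclic_words D (Suc (Suc n))"
      show "ev (Suc (Suc n)) (coface H M D (Suc n) (Suc j') (coface H M D n i \<phi>)) m xs fs =
          ev (Suc (Suc n)) (coface H M D (Suc n) i (coface H M D n (Suc j' - 1) \<phi>)) m xs fs"
        using \<phi> w j fF_word[OF w, of "Suc j'"] fF_word[OF w, of i] fX_fX[OF wordD(1)[OF w]] fF_fF[OF w]
        by (simp add: ev_coface coface_mem)
    qed (use \<phi> j in \<open>simp_all add: coface_mem\<close>)
  qed
  show "codegen M D n j (codegen M D (Suc n) i \<phi>) = codegen M D n i (codegen M D (Suc n) (Suc j) \<phi>)"
    if \<phi>: "\<phi> \<in> cochains H M D (n + 2)" and ij: "j \<le> n" "i \<le> j"
  proof (rule cochains_eqI)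
    fix m xs fs assume w: "(xs, fs) \<in> cyclic_words D n"
    show "ev n (codegen M D n j (codegen M D (Suc n) i \<phi>)) m xs fs =
        ev n (codegen M D n i (codegen M D (Suc n) (Suc j) \<phi>)) m xs fs"
      using \<phi> w ij gF_word[OF w, of j] gF_word[OF w, of i] gX_gX[OF wordD(1)[OF w]] gF_gF[OF w]
      by (simp add: ev_codegen codegen_mem)
  qed (use \<phi> ij in \<open>simp_all add: codegen_mem\<close>)
  show "codegen M D n j (coface H M D n j \<phi>) = \<phi>" if \<phi>: "\<phi> \<in> cochains H M D n" and ij: "j \<le> n"
  proof (rule cochains_eqI)
    fix m xs fs assume w: "(xs, fs) \<in> cyclic_words D n"
    show "ev n (codegen M D n j (coface H M D n j \<phi>)) m xs fs = ev n \<phi> m xs fs"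
      using \<phi> w ij gF_word[OF w, of j] fX_gX(1)[OF wordD(1)[OF w]] fF_gF(1)[OF w]
      by (simp add: ev_codegen ev_coface coface_mem)
  qed (use \<phi> ij in \<open>simp_all add: codegen_mem coface_mem\<close>)
  show "codegen M D n j (coface H M D n (Suc j) \<phi>) = \<phi>" if \<phi>: "\<phi> \<in> cochains H M D n" and ij: "j \<le> n"
  proof (rule cochains_eqI)
    show mem: "codegen M D n j (coface H M D n (Suc j) \<phi>) \<in> cochains H M D n"
      using \<phi> ij by (cases "j = n") (simp_all add: codegen_mem coface_mem cocyc_mem coface_last)
    fix m xs fs assume w: "(xs, fs) \<in> cyclic_words D n"
    show "ev n (codegen M D n j (coface H M D n (Suc j) \<phi>)) m xs fs = ev n \<phi> m xs fs"
    proof (cases "j = n")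
      case False
      then show ?thesis
        using \<phi> w ij gF_word[OF w, of j] fX_gX(2)[OF wordD(1)[OF w], of j] fF_gF(2)[OF w, of j]
        by (simp add: ev_codegen ev_coface coface_mem)
    next
      \<comment> \<open>The last coface meets the last codegeneracy. The composite is the identity
        up to eps(m_(-1)), which the coaction removes.\<close>
      case True
      note wd = wordD[OF w] and gw = gF_word[OF w order_refl]
      have m: "mform n (*) UNIV (ev n \<phi>)" using cform_ev[OF \<phi>] by (simp add: cform_def)
      have c: "coface H M D n 0 \<phi> \<in> cochains H M D (Suc n)" by (simp add: coface_mem \<phi>)
      have "ev n (codegen M D n j (coface H M D n (Suc j) \<phi>)) m xs fs =
          cycF (Suc n) (ev (Suc n) (coface H M D n 0 \<phi>)) m (gX n xs) (gF n xs fs)"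
        using True by (simp add: coface_last[OF \<phi>] ev_codegen[OF cocyc_mem[OF c] _ w] ev_cocyc[OF c gw])
      also have "\<dots> = ca m (\<lambda>a x. ev n \<phi> x xs (fs[0 := cscale D (counit H a) (fs ! 0)]))"
        unfolding cycF_def ev_coface[OF \<phi> le0 rF_word[OF gw]] fX_rX_gX[OF wd(1)] fF_rF_gF[OF w] ..
      also have "\<dots> = ev n \<phi> m xs (fs[0 := fs ! 0])"
        by (rule ca_counit_slot[OF m w le0 wd(4)]) simp
      finally show ?thesis by simp
    qed
  qed (rule \<phi>)
  show "codegen M D (Suc n) j (coface H M D (Suc n) i \<phi>) = coface H M D n i (codegen M D n (j - 1) \<phi>)"
    if \<phi>: "\<phi> \<in> cochains H M D (Suc n)" and ij: "j \<le> Suc n" "i < j"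
  proof -
    obtain j' where j: "j = Suc j'" "i \<le> j'" "j' \<le> n" using ij by (cases j) auto
    show ?thesis unfolding j(1)
    proof (rule cochains_eqI)
      fix m xs fs assume w: "(xs, fs) \<in> cyclic_words D (Suc n)"
      show "ev (Suc n) (codegen M D (Suc n) (Suc j') (coface H M D (Suc n) i \<phi>)) m xs fs =
          ev (Suc n) (coface H M D n i (codegen M D n (Suc j' - 1) \<phi>)) m xs fs"
        using \<phi> w j gF_word[OF w, of "Suc j'"] fF_word[OF w, of i] fX_gX_less[OF wordD(1)[OF w]] fF_gF_less[OF w]
        by (simp add: ev_coface coface_mem ev_codegen codegen_mem)
    qed (use \<phi> j in \<open>simp_all add: coface_mem codegen_mem\<close>)
  qed
  show "codegen M D (Suc n) j (coface H M D (Suc n) i \<phi>) = coface H M D n (i - 1) (codegen M D n j \<phi>)"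
    if \<phi>: "\<phi> \<in> cochains H M D (Suc n)" and ij: "i \<le> Suc n" "Suc j < i"
  proof -
    obtain i' where i: "i = Suc i'" "j < i'" "i' \<le> n" using ij by (cases i) auto
    show ?thesis unfolding i(1)
    proof (rule cochains_eqI)
      fix m xs fs assume w: "(xs, fs) \<in> cyclic_words D (Suc n)"
      show "ev (Suc n) (codegen M D (Suc n) j (coface H M D (Suc n) (Suc i') \<phi>)) m xs fs =
          ev (Suc n) (coface H M D n (Suc i' - 1) (codegen M D n j \<phi>)) m xs fs"
        using \<phi> w i gF_word[OF w, of j] fF_word[OF w, of i'] fX_gX_greater[OF wordD(1)[OF w]] fF_gF_greater[OF w]
        by (simp add: ev_coface coface_mem ev_codegen codegen_mem)
    qed (use \<phi> i in \<open>simp_all add: coface_mem codegen_mem\<close>)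
  qed
  show "cocyc H M D (Suc n) (coface H M D n i \<phi>) = coface H M D n (i - 1) (cocyc H M D n \<phi>)"
    if \<phi>: "\<phi> \<in> cochains H M D n" and ij: "1 \<le> i" "i \<le> n"
  proof -
    obtain i' where i: "i = Suc i'" "Suc i' \<le> n" using ij by (cases i) auto
    show ?thesis unfolding i(1)
    proof (rule cochains_eqI)
      fix m xs fs assume w: "(xs, fs) \<in> cyclic_words D (Suc n)"
      show "ev (Suc n) (cocyc H M D (Suc n) (coface H M D n (Suc i') \<phi>)) m xs fs =
          ev (Suc n) (coface H M D n (Suc i' - 1) (cocyc H M D n \<phi>)) m xs fs"
        using \<phi> w i fF_word[OF w, of i'] fX_rX[OF wordD(1)[OF w]] fF_rF[OF w] rF_word[OF w]
        by (simp add: ev_coface coface_mem ev_cocyc cocyc_mem cycF_def)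
    qed (use \<phi> i in \<open>simp_all add: coface_mem cocyc_mem\<close>)
  qed
  show "cocyc H M D n (codegen M D n i \<phi>) = codegen M D n (i - 1) (cocyc H M D (Suc n) \<phi>)"
    if \<phi>: "\<phi> \<in> cochains H M D (Suc n)" and ij: "1 \<le> i" "i \<le> n"
  proof -
    obtain i' where i: "i = Suc i'" "Suc i' \<le> n" using ij by (cases i) auto
    show ?thesis unfolding i(1)
    proof (rule cochains_eqI)
      fix m xs fs assume w: "(xs, fs) \<in> cyclic_words D n"
      show "ev n (cocyc H M D n (codegen M D n (Suc i') \<phi>)) m xs fs =
          ev n (codegen M D n (Suc i' - 1) (cocyc H M D (Suc n) \<phi>)) m xs fs"
        using \<phi> w i gF_word[OF w, of i'] gX_rX[OF wordD(1)[OF w]] gF_rF[OF w] rF_word[OF w]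
        by (simp add: ev_codegen codegen_mem ev_cocyc cocyc_mem cycF_def)
    qed (use \<phi> i in \<open>simp_all add: codegen_mem cocyc_mem\<close>)
  qed
  show "cocyc H M D n (codegen M D n 0 \<phi>) = codegen M D n n (cocyc H M D (Suc n) (cocyc H M D (Suc n) \<phi>))"
    if \<phi>: "\<phi> \<in> cochains H M D (Suc n)"
  proof (rule cochains_eqI)
    fix m xs fs assume w: "(xs, fs) \<in> cyclic_words D n"
    note wd = wordD[OF w] and gw = gF_word[OF w order_refl]
    have mf: "mform (Suc n) (*) UNIV (ev (Suc n) \<phi>)" using cform_ev[OF \<phi>] by (simp add: cform_def)
    have c: "cocyc H M D (Suc n) \<phi> \<in> cochains H M D (Suc n)" by (rule cocyc_mem[OF \<phi>])
    have "ev n (codegen M D n n (cocyc H M D (Suc n) (cocyc H M D (Suc n) \<phi>))) m xs fs =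
        cycF (Suc n) (ev (Suc n) (cocyc H M D (Suc n) \<phi>)) m (gX n xs) (gF n xs fs)"
      by (simp add: ev_codegen[OF cocyc_mem[OF c] order_refl w] ev_cocyc[OF c gw])
    \<comment> \<open>Two rotations give two nested coactions. The twist by the outer one falls on
      the inserted identity, so only its counit remains.\<close>
    also have "\<dots> = ca m (\<lambda>a x. ca x (\<lambda>b y. ev (Suc n) \<phi> y (gX 0 (rX n xs))
        ((gF 0 (rX n xs) (rF n b xs fs))[1 := cscale D (counit H a) (ident D (src xs n))])))"
      unfolding cycF_def[of _ "ev (Suc n) (cocyc H M D (Suc n) \<phi>)"] ev_cocyc[OF \<phi> rF_word[OF gw]]
      unfolding cycF_def rF_rF_gF[OF w] gX_rX_0[OF wd(1), symmetric] ..
    also have "\<dots> = ca m (\<lambda>a x. ca x (\<lambda>b y. counit H a * ev (Suc n) \<phi> y (gX 0 (rX n xs)) (gF 0 (rX n xs) (rF n b xs fs))))"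
    proof -
      have "ev (Suc n) \<phi> y (gX 0 (rX n xs)) ((gF 0 (rX n xs) (rF n b xs fs))[1 := cscale D (counit H a) (ident D (src xs n))]) =
          counit H a * ev (Suc n) \<phi> y (gX 0 (rX n xs)) (gF 0 (rX n xs) (rF n b xs fs))" for a b y
      proof -
        have rw: "(gX 0 (rX n xs), gF 0 (rX n xs) (rF n b xs fs)) \<in> cyclic_words D (Suc n)"
          by (rule gF_word[OF rF_word[OF w]]) simp
        have l: "length (rX n xs) = Suc n" "length (rF n b xs fs) = Suc n" using wd(1,2) by (simp_all add: length_rX length_rF)
        have L: "lin_on (cscale D) (Hom D (src xs n) (src xs n)) (*) UNIV
            (\<lambda>g. ev (Suc n) \<phi> y (gX 0 (rX n xs)) ((gF 0 (rX n xs) (rF n b xs fs))[1 := g]))"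
          using mformD(2)[OF mf rw, of 1] l wd(1) by (simp add: src_gX tgt_gX src_rX tgt_Suc)
        have "(gF 0 (rX n xs) (rF n b xs fs)) ! 1 = ident D (src xs n)"
          using l wd(1) by (simp add: nth_gF src_rX)
        then have "(gF 0 (rX n xs) (rF n b xs fs))[1 := ident D (src xs n)] = gF 0 (rX n xs) (rF n b xs fs)"
          by (metis list_update_id)
        then show ?thesis using lin_on_scale[OF L ident_mem[OF wd(5)], of "counit H a"] by simp
      qed
      then show ?thesis by simp
    qed
    \<comment> \<open>With eps(a) in front, the outer coaction collapses by the counit axiom and a
      single rotation is left.\<close>
    also have "\<dots> = ca m (\<lambda>a x. counit H a * cycF n (ev n (codegen M D n 0 \<phi>)) x xs fs)"
      by (simp add: cycF_def ev_codegen[OF \<phi> le0 rF_word[OF w]] ca_sum sum_list_const_mult)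
    also have "\<dots> = cycF n (ev n (codegen M D n 0 \<phi>)) m xs fs"
    proof (rule ca_counit)
      have "cform n (cycF n (ev n (codegen M D n 0 \<phi>)))"
        by (rule cform_cyc[OF cform_ev[OF codegen_mem[OF \<phi>]]]) simp
      then show "mlinear (*) (\<lambda>x. cycF n (ev n (codegen M D n 0 \<phi>)) x xs fs)"
        unfolding cform_def by (rule mformD(1)[OF conjunct1 w])
    qed
    finally show "ev n (cocyc H M D n (codegen M D n 0 \<phi>)) m xs fs =
        ev n (codegen M D n n (cocyc H M D (Suc n) (cocyc H M D (Suc n) \<phi>))) m xs fs"
      using \<phi> by (simp add: ev_cocyc[OF codegen_mem w])
  qed (use \<phi> in \<open>simp_all add: codegen_mem cocyc_mem\<close>)
  show "(cocyc H M D n ^^ Suc n) \<phi> = \<phi>" if \<phi>: "\<phi> \<in> cochains H M D n"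
  proof (rule cochains_eqI)
    show "(cocyc H M D n ^^ Suc n) \<phi> \<in> cochains H M D n"
    proof -
      have "(cocyc H M D n ^^ k) \<phi> \<in> cochains H M D n" for k by (induction k) (simp_all add: cocyc_mem \<phi>)
      then show ?thesis .
    qed
    fix m xs fs assume w: "(xs, fs) \<in> cyclic_words D n"
    show "ev n ((cocyc H M D n ^^ Suc n) \<phi>) m xs fs = ev n \<phi> m xs fs"
      unfolding ev_cocyc_funpow[OF \<phi> w] by (rule cycF_order[OF cform_ev[OF \<phi>] w])
  qed (rule \<phi>)
qed

end

section \<open>The left $H$-category of matrices\<close>

lemma lin_on_sum_fin:
  assumes "vector_space s1" "module.subspace s1 V" "lin_on s1 V s2 W f" "\<And>i. i \<in> I \<Longrightarrow> x i \<in> V"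
  shows "f (\<Sum>i\<in>I. x i) = (\<Sum>i\<in>I. f (x i))"
proof -
  interpret vector_space s1 by fact
  show ?thesis
    using assms(4)
  proof (induction I rule: infinite_finite_induct)
    case (insert i I)
    then show ?case
      using lin_on_add[OF assms(3), of "x i" "sum x I"] subspace_sum[OF assms(2), of I x] by simp
  qed (simp_all add: lin_on_zero[OF assms(1-3)])
qed

lemma lin_on_sum_fun:
  assumes "vector_space s2" "module.subspace s2 W" "\<And>i. i \<in> I \<Longrightarrow> lin_on s1 V s2 W (f i)"
  shows "lin_on s1 V s2 W (\<lambda>x. \<Sum>i\<in>I. f i x)"
proof -
  interpret vector_space s2 by fact
  show ?thesis
    unfolding lin_on_def
  proof (intro conjI ballI allI)
    fix x assume x: "x \<in> V"
    show "(\<Sum>i\<in>I. f i x) \<in> W" by (rule subspace_sum[OF assms(2)]) (rule lin_on_mem[OF assms(3) x])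
    show "(\<Sum>i\<in>I. f i (s1 c x)) = s2 c (\<Sum>i\<in>I. f i x)" for c
      by (simp add: scale_sum_right lin_on_scale[OF assms(3) x])
    fix y assume y: "y \<in> V"
    show "(\<Sum>i\<in>I. f i (x + y)) = (\<Sum>i\<in>I. f i x) + (\<Sum>i\<in>I. f i y)"
      by (simp add: sum.distrib lin_on_add[OF assms(3) x y])
  qed
qed

lemma cs_sum_fin: "cs H h (\<lambda>a b. \<Sum>i\<in>I. f i a b) = (\<Sum>i\<in>I. cs H h (f i))"
proof (induction I rule: infinite_finite_induct)
  case (insert i I)
  then show ?case by (simp add: cs_sum sum_list_addf)
qed (simp_all add: cs_sum)

lemma vector_space_mat_scale: "vector_space (mat_scale :: 'k::field \<Rightarrow> 'k ^ 'r ^ 'r \<Rightarrow> _)"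
  by unfold_locales (simp_all add: mat_scale_def vec_eq_iff algebra_simps)

lemma elem_mat_expand: "(\<Sum>p\<in>UNIV. \<Sum>q\<in>UNIV. mat_scale (B $ p $ q) (elem_mat p q)) = B"
  for B :: "'k::field ^ 'r::finite ^ 'r"
proof -
  have "(\<Sum>p\<in>UNIV. \<Sum>q\<in>UNIV. B $ p $ q * (if i = p \<and> j = q then 1 else 0)) = B $ i $ j" for i j
  proof -
    have "(\<Sum>q\<in>UNIV. B $ p $ q * (if i = p \<and> j = q then 1 else 0)) = (if i = p then B $ p $ j else 0)" for p
      by (simp add: if_distrib[of "\<lambda>x. _ * x"] sum.delta' cong: if_cong)
    then show ?thesis by (simp add: sum.delta)
  qed
  then show ?thesis by (simp add: vec_eq_iff mat_scale_def elem_mat_def)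
qed

context hcat_loc
begin

abbreviation HMs :: "'o \<Rightarrow> 'o \<Rightarrow> ('a \<times> ('k ^ 'r::finite ^ 'r), 'k) tensor set" where
  "HMs X Y \<equiv> tensor_space (HomMat D X Y)"

text \<open>The (p, q) entry, under the identification of the tensor product of Hom(X, Y) and M_r(k)
  with matrices of arrows from X to Y.\<close>

definition mcomp :: "'o \<Rightarrow> 'o \<Rightarrow> 'r::finite \<Rightarrow> 'r \<Rightarrow> ('a \<times> ('k ^ 'r ^ 'r), 'k) tensor \<Rightarrow> 'a" where
  "mcomp X Y p q t = tensor_lift (HomMat D X Y) (\<lambda>(f, B). cscale D (B $ p $ q) f) t"

context
  fixes X Y :: 'o
  assumes X: "X \<in> Obj D" and Y: "Y \<in> Obj D"
begin

lemma HMs_sub: "module.subspace fscale (HMs X Y :: ('a \<times> ('k ^ 'r::finite ^ 'r), 'k) tensor set)"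
  unfolding HomMat_def by (rule subspace_tensor_space_bi[OF cvs Hom_sub[OF X Y]])

lemma pure_HMs: "f \<in> Hom D X Y \<Longrightarrow> pure (HomMat D X Y) (f, B) \<in> HMs X Y"
  by (rule pure_mem_tensor_space) (simp add: HomMat_def fst_bi)

lemma pure_HMs_lin:
  fixes B :: "'k ^ 'r::finite ^ 'r"
  shows "lin_on (cscale D) (Hom D X Y) fscale (HMs X Y) (\<lambda>f. pure (HomMat D X Y) (f, B))"
    and "f \<in> Hom D X Y \<Longrightarrow> lin_on mat_scale UNIV fscale (HMs X Y) (\<lambda>B :: 'k ^ 'r ^ 'r. pure (HomMat D X Y) (f, B))"
proof -
  have p: "pure (HomMat D X Y) (f, B) \<in> HMs X Y" if "f \<in> Hom D X Y" for f and B :: "'k ^ 'r ^ 'r"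
    by (rule pure_HMs[OF that])
  note b = pure_bi_bilin[of "cscale D" "Hom D X Y" "mat_scale :: 'k \<Rightarrow> 'k ^ 'r ^ 'r \<Rightarrow> _" UNIV, folded HomMat_def]
  show "lin_on (cscale D) (Hom D X Y) fscale (HMs X Y) (\<lambda>f. pure (HomMat D X Y) (f, B))"
    using b p by (simp add: bilin_on_def lin_on_def)
  show "f \<in> Hom D X Y \<Longrightarrow> lin_on mat_scale UNIV fscale (HMs X Y) (\<lambda>B :: 'k ^ 'r ^ 'r. pure (HomMat D X Y) (f, B))"
    using b p by (simp add: bilin_on_def lin_on_def)
qed

lemma HMs_lift:
  assumes "vector_space s" "module.subspace s U"
    and "\<And>B. lin_on (cscale D) (Hom D X Y) s U (\<lambda>f. G f B)" "\<And>f. f \<in> Hom D X Y \<Longrightarrow> lin_on mat_scale UNIV s U (G f)"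
  shows HMs_lift_lin: "lin_on fscale (HMs X Y) s U (tensor_lift (HomMat D X Y) (\<lambda>(f, B). G f B))"
    and HMs_lift_pure: "f \<in> Hom D X Y \<Longrightarrow> tensor_lift (HomMat D X Y) (\<lambda>(f, B). G f B) (pure (HomMat D X Y) (f, B)) = G f B"
proof -
  have b: "bilin_on (cscale D) (Hom D X Y) mat_scale UNIV s U G" using assms(3,4) by (simp add: bilin_on_def)
  show "lin_on fscale (HMs X Y) s U (tensor_lift (HomMat D X Y) (\<lambda>(f, B). G f B))"
    unfolding HomMat_def by (rule tensor_lift_lin_bi[OF assms(1,2) b cvs Hom_sub[OF X Y]])
  show "f \<in> Hom D X Y \<Longrightarrow> tensor_lift (HomMat D X Y) (\<lambda>(f, B). G f B) (pure (HomMat D X Y) (f, B)) = G f B"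
    unfolding HomMat_def by (rule tensor_lift_pure_bi[OF assms(1) b]) simp_all
qed

lemma entry_lin:
  shows "lin_on (cscale D) (Hom D X Y) (cscale D) (Hom D X Y) (cscale D c)"
    and "f \<in> Hom D X Y \<Longrightarrow> lin_on mat_scale UNIV (cscale D) (Hom D X Y) (\<lambda>B. cscale D (B $ p $ q) f)"
  using c.subspace_scale[OF Hom_sub[OF X Y]]
  by (simp_all add: lin_on_def mat_scale_def c.scale_right_distrib c.scale_left_distrib mult.commute)

lemma mcomp_lin: "lin_on fscale (HMs X Y) (cscale D) (Hom D X Y) (mcomp X Y p q)"
  unfolding mcomp_def[abs_def] by (rule HMs_lift_lin[OF cvs Hom_sub[OF X Y] entry_lin])

lemma mcomp_pure: "f \<in> Hom D X Y \<Longrightarrow> mcomp X Y p q (pure (HomMat D X Y) (f, B)) = cscale D (B $ p $ q) f"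
  unfolding mcomp_def by (rule HMs_lift_pure[OF cvs Hom_sub[OF X Y] entry_lin])

lemma mcomp_mem: "t \<in> HMs X Y \<Longrightarrow> mcomp X Y p q t \<in> Hom D X Y"
  by (rule lin_on_mem[OF mcomp_lin])

lemma HMs_eq:
  assumes "lin_on fscale (HMs X Y) s U f" "lin_on fscale (HMs X Y) s U' g" "vector_space s"
    and "\<And>x B. x \<in> Hom D X Y \<Longrightarrow> f (pure (HomMat D X Y) (x, B)) = g (pure (HomMat D X Y) (x, B))" and "t \<in> HMs X Y"
  shows "f t = g t"
  by (rule lin_eq_on_sums[OF assms(1,2,3) HMs_sub _ assms(5)]) (auto simp: HomMat_def[of D X Y] fst_bi intro!: assms(4)[unfolded HomMat_def])

lemma mcomp_expand:
  assumes t: "t \<in> HMs X Y"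
  shows "(\<Sum>p\<in>UNIV. \<Sum>q\<in>UNIV. pure (HomMat D X Y) (mcomp X Y p q t, elem_mat p q)) = t"
proof (rule HMs_eq[OF _ _ vector_space_fscale _ t])
  show "lin_on fscale (HMs X Y) fscale (HMs X Y)
      (\<lambda>t. \<Sum>p\<in>UNIV. \<Sum>q\<in>UNIV. pure (HomMat D X Y) (mcomp X Y p q t, elem_mat p q))"
    by (intro lin_on_sum_fun vector_space_fscale HMs_sub lin_on_comp[OF mcomp_lin pure_HMs_lin(1)])
  show "lin_on fscale (HMs X Y) fscale (HMs X Y) (\<lambda>t. t)" by (simp add: lin_on_def)
  fix f and B :: "'k ^ 'r ^ 'r" assume f: "f \<in> Hom D X Y"
  note L = pure_HMs_lin(2)[OF f]
  have "(\<Sum>p\<in>UNIV. \<Sum>q\<in>UNIV. pure (HomMat D X Y) (mcomp X Y p q (pure (HomMat D X Y) (f, B)), elem_mat p q)) =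
      (\<Sum>p\<in>UNIV. \<Sum>q\<in>UNIV. pure (HomMat D X Y) (f, mat_scale (B $ p $ q) (elem_mat p q)))"
    by (simp add: mcomp_pure[OF f] lin_on_scale[OF pure_HMs_lin(1) f] lin_on_scale[OF L])
  also have "\<dots> = pure (HomMat D X Y) (f, \<Sum>p\<in>UNIV. \<Sum>q\<in>UNIV. mat_scale (B $ p $ q) (elem_mat p q))"
    by (simp add: lin_on_sum_fin[OF vector_space_mat_scale subspace_UNIV[OF vector_space_mat_scale] L])
  finally show "(\<Sum>p\<in>UNIV. \<Sum>q\<in>UNIV. pure (HomMat D X Y) (mcomp X Y p q (pure (HomMat D X Y) (f, B)), elem_mat p q)) =
      pure (HomMat D X Y) (f, B)" by (simp add: elem_mat_expand)
qed

text \<open>A matrix of arrows is determined by its entries. The axioms of the matrix category are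
  therefore verified entry by entry, where they are sums of identities in \<open>D\<close>.\<close>

lemma mcomp_eqI:
  assumes "t \<in> HMs X Y" "t' \<in> HMs X Y" "\<And>p q. mcomp X Y p q t = mcomp X Y p q t'"
  shows "t = t'"
proof -
  have "t = (\<Sum>p\<in>UNIV. \<Sum>q\<in>UNIV. pure (HomMat D X Y) (mcomp X Y p q t, elem_mat p q))"
    by (rule mcomp_expand[OF assms(1), symmetric])
  then show ?thesis unfolding assms(3) mcomp_expand[OF assms(2)] .
qed

definition mact :: "'h \<Rightarrow> ('a \<times> ('k ^ 'r::finite ^ 'r), 'k) tensor \<Rightarrow> ('a \<times> ('k ^ 'r ^ 'r), 'k) tensor" where
  "mact h = tensor_lift (HomMat D X Y) (\<lambda>(f, B). pure (HomMat D X Y) (lact D X Y h f, B))"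

lemma mact_lin: "lin_on fscale (HMs X Y) fscale (HMs X Y) (mact h)"
  unfolding mact_def
  by (rule HMs_lift_lin[OF vector_space_fscale HMs_sub lin_on_comp[OF lact_lin(2)[OF X Y] pure_HMs_lin(1)]
      pure_HMs_lin(2)[OF lact_lin(3)[OF X Y]]])

lemma mact_pure: "f \<in> Hom D X Y \<Longrightarrow> mact h (pure (HomMat D X Y) (f, B)) = pure (HomMat D X Y) (lact D X Y h f, B)"
  unfolding mact_def
  by (rule HMs_lift_pure[OF vector_space_fscale HMs_sub lin_on_comp[OF lact_lin(2)[OF X Y] pure_HMs_lin(1)]
      pure_HMs_lin(2)[OF lact_lin(3)[OF X Y]]])

lemma mact_mcomp:
  assumes t: "t \<in> HMs X Y"
  shows "mcomp X Y p q (mact h t) = lact D X Y h (mcomp X Y p q t)"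
  by (rule HMs_eq[OF lin_on_comp[OF mact_lin mcomp_lin] lin_on_comp[OF mcomp_lin lact_lin(2)[OF X Y]] cvs _ t])
    (simp add: mact_pure mcomp_pure lact_lin(3)[OF X Y] lin_on_scale[OF lact_lin(2)[OF X Y]])

lemma mact_lin_h:
  assumes t: "t \<in> HMs X Y"
  shows "lin_on (hscale H) UNIV fscale (HMs X Y) (\<lambda>h. mact h t)"
  unfolding mact_def tensor_lift_rep
proof (rule lin_on_sum_list_fun[OF vector_space_fscale HMs_sub])
  fix x assume "x \<in> set (rep (HomMat D X Y) t)"
  then obtain f B where x: "x = (f, B)" "f \<in> Hom D X Y" using rep(1)[OF t] by (cases x) (auto simp: HomMat_def fst_bi)
  show "lin_on (hscale H) UNIV fscale (HMs X Y) (\<lambda>h. case x of (f, B) \<Rightarrow> pure (HomMat D X Y) (lact D X Y h f, B))"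
    unfolding x prod.case by (rule lin_on_comp[OF lact_lin(1)[OF X Y x(2)] pure_HMs_lin(1)])
qed

end

section \<open>Composition of matrices of arrows\<close>

definition mmul :: "'o \<Rightarrow> 'o \<Rightarrow> 'o \<Rightarrow> ('a \<times> ('k ^ 'r::finite ^ 'r), 'k) tensor \<Rightarrow> ('a \<times> ('k ^ 'r ^ 'r), 'k) tensor \<Rightarrow>
    ('a \<times> ('k ^ 'r ^ 'r), 'k) tensor" where
  "mmul X Y Z s t = tensor_lift (HomMat D Y Z) (\<lambda>(g, B). tensor_lift (HomMat D X Y) (\<lambda>(f, C).
     pure (HomMat D X Z) (cmp D X Y Z g f, B ** C)) t) s"

lemma matrix_mul_lin: "lin_on mat_scale UNIV mat_scale UNIV (\<lambda>C. B ** C)" "lin_on mat_scale UNIV mat_scale UNIV (\<lambda>B. B ** C)"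
  for B C :: "'k ^ 'r::finite ^ 'r"
  by (auto simp: lin_on_def matrix_matrix_mult_def mat_scale_def vec_eq_iff sum.distrib sum_distrib_left algebra_simps)

context
  fixes X Y Z :: 'o
  assumes X: "X \<in> Obj D" and Y: "Y \<in> Obj D" and Z: "Z \<in> Obj D"
begin

lemma cmp_lin1: "f \<in> Hom D X Y \<Longrightarrow> lin_on (cscale D) (Hom D Y Z) (cscale D) (Hom D X Z) (\<lambda>g. cmp D X Y Z g f)"
  and cmp_lin2: "g \<in> Hom D Y Z \<Longrightarrow> lin_on (cscale D) (Hom D X Y) (cscale D) (Hom D X Z) (cmp D X Y Z g)"
  using cmp_bilin[OF X Y Z] unfolding bilin_on_def by blast+

lemma mmul_inner:
  assumes g: "g \<in> Hom D Y Z"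
  shows mmul_inner_lin: "lin_on fscale (HMs X Y) fscale (HMs X Z) (tensor_lift (HomMat D X Y) (\<lambda>(f, C). pure (HomMat D X Z) (cmp D X Y Z g f, B ** C)))"
    and mmul_inner_pure: "f \<in> Hom D X Y \<Longrightarrow> tensor_lift (HomMat D X Y) (\<lambda>(f, C). pure (HomMat D X Z) (cmp D X Y Z g f, B ** C))
       (pure (HomMat D X Y) (f, C)) = pure (HomMat D X Z) (cmp D X Y Z g f, B ** C)"
proof -
  have a: "lin_on (cscale D) (Hom D X Y) fscale (HMs X Z) (\<lambda>f. pure (HomMat D X Z) (cmp D X Y Z g f, B ** C))" for C
    by (rule lin_on_comp[OF cmp_lin2[OF g] pure_HMs_lin(1)[OF X Z]])
  have b: "lin_on mat_scale UNIV fscale (HMs X Z) (\<lambda>C. pure (HomMat D X Z) (cmp D X Y Z g f, B ** C))" if "f \<in> Hom D X Y" for f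
    by (rule lin_on_comp[OF matrix_mul_lin(1) pure_HMs_lin(2)[OF X Z cmp_mem(1)[OF X Y Z that g]]])
  show "lin_on fscale (HMs X Y) fscale (HMs X Z) (tensor_lift (HomMat D X Y) (\<lambda>(f, C). pure (HomMat D X Z) (cmp D X Y Z g f, B ** C)))"
    by (rule HMs_lift_lin[OF X Y vector_space_fscale HMs_sub[OF X Z] a b])
  show "f \<in> Hom D X Y \<Longrightarrow> tensor_lift (HomMat D X Y) (\<lambda>(f, C). pure (HomMat D X Z) (cmp D X Y Z g f, B ** C))
       (pure (HomMat D X Y) (f, C)) = pure (HomMat D X Z) (cmp D X Y Z g f, B ** C)"
    by (rule HMs_lift_pure[OF X Y vector_space_fscale HMs_sub[OF X Z] a b])
qed

lemma mmul_outer: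
  assumes t: "t \<in> HMs X Y"
  shows "lin_on (cscale D) (Hom D Y Z) fscale (HMs X Z) (\<lambda>g. tensor_lift (HomMat D X Y) (\<lambda>(f, C). pure (HomMat D X Z) (cmp D X Y Z g f, B ** C)) t)"
    and "g \<in> Hom D Y Z \<Longrightarrow> lin_on mat_scale UNIV fscale (HMs X Z) (\<lambda>B. tensor_lift (HomMat D X Y) (\<lambda>(f, C). pure (HomMat D X Z) (cmp D X Y Z g f, B ** C)) t)"
proof -
  have x: "\<exists>f C. x = (f, C) \<and> f \<in> Hom D X Y" if "x \<in> set (rep (HomMat D X Y) t)" for x
    using that rep(1)[OF t] by (cases x) (auto simp: HomMat_def fst_bi)
  show "lin_on (cscale D) (Hom D Y Z) fscale (HMs X Z) (\<lambda>g. tensor_lift (HomMat D X Y) (\<lambda>(f, C). pure (HomMat D X Z) (cmp D X Y Z g f, B ** C)) t)"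
    unfolding tensor_lift_rep
    by (rule lin_on_sum_list_fun[OF vector_space_fscale HMs_sub[OF X Z]])
      (use x lin_on_comp[OF cmp_lin1 pure_HMs_lin(1)[OF X Z]] in fastforce)
  show "lin_on mat_scale UNIV fscale (HMs X Z) (\<lambda>B. tensor_lift (HomMat D X Y) (\<lambda>(f, C). pure (HomMat D X Z) (cmp D X Y Z g f, B ** C)) t)"
    if g: "g \<in> Hom D Y Z"
    unfolding tensor_lift_rep
    by (rule lin_on_sum_list_fun[OF vector_space_fscale HMs_sub[OF X Z]])
      (use x lin_on_comp[OF matrix_mul_lin(2) pure_HMs_lin(2)[OF X Z cmp_mem(1)[OF X Y Z _ g]]] in fastforce)
qed

lemma mmul_lin1: "t \<in> HMs X Y \<Longrightarrow> lin_on fscale (HMs Y Z) fscale (HMs X Z) (\<lambda>s. mmul X Y Z s t)"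
  unfolding mmul_def by (rule HMs_lift_lin[OF Y Z vector_space_fscale HMs_sub[OF X Z] mmul_outer])

lemma mmul_pure1:
  "t \<in> HMs X Y \<Longrightarrow> g \<in> Hom D Y Z \<Longrightarrow> mmul X Y Z (pure (HomMat D Y Z) (g, B)) t =
    tensor_lift (HomMat D X Y) (\<lambda>(f, C). pure (HomMat D X Z) (cmp D X Y Z g f, B ** C)) t"
  unfolding mmul_def by (rule HMs_lift_pure[OF Y Z vector_space_fscale HMs_sub[OF X Z] mmul_outer])

lemma mmul_lin2:
  assumes "s \<in> HMs Y Z"
  shows "lin_on fscale (HMs X Y) fscale (HMs X Z) (mmul X Y Z s)"
proof -
  have "lin_on fscale (HMs X Y) fscale (HMs X Z) (\<lambda>t. \<Sum>x\<leftarrow>rep (HomMat D Y Z) s. case x of (g, B) \<Rightarrow>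
      tensor_lift (HomMat D X Y) (\<lambda>(f, C). pure (HomMat D X Z) (cmp D X Y Z g f, B ** C)) t)"
  proof (rule lin_on_sum_list_fun[OF vector_space_fscale HMs_sub[OF X Z]])
    fix x assume "x \<in> set (rep (HomMat D Y Z) s)"
    then obtain g B where "x = (g, B)" "g \<in> Hom D Y Z" using rep(1)[OF assms] by (cases x) (auto simp: HomMat_def fst_bi)
    then show "lin_on fscale (HMs X Y) fscale (HMs X Z) (\<lambda>t. case x of (g, B) \<Rightarrow>
        tensor_lift (HomMat D X Y) (\<lambda>(f, C). pure (HomMat D X Z) (cmp D X Y Z g f, B ** C)) t)"
      using mmul_inner_lin by simp
  qed
  then show ?thesis unfolding mmul_def[abs_def] tensor_lift_rep[of "HomMat D Y Z"] .
qed

lemma mmul_pure: "f \<in> Hom D X Y \<Longrightarrow> g \<in> Hom D Y Z \<Longrightarrow>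
    mmul X Y Z (pure (HomMat D Y Z) (g, B)) (pure (HomMat D X Y) (f, C)) = pure (HomMat D X Z) (cmp D X Y Z g f, B ** C)"
  by (simp add: mmul_pure1 pure_HMs[OF X Y] mmul_inner_pure)

text \<open>The matrix product with entries composed in \<open>D\<close>. Both sides are linear in
  each factor, so each is reduced to pure tensors in turn, where scalars pull out of the
  composition.\<close>

lemma mmul_mcomp:
  fixes s t :: "('a \<times> ('k ^ 'r::finite ^ 'r), 'k) tensor"
  assumes s: "s \<in> HMs Y Z" and t: "t \<in> HMs X Y"
  shows "mcomp X Z p q (mmul X Y Z s t) = (\<Sum>r\<in>UNIV. cmp D X Y Z (mcomp Y Z p r s) (mcomp X Y r q t))"
proof (rule HMs_eq[OF Y Z lin_on_comp[OF mmul_lin1[OF t] mcomp_lin[OF X Z]] _ cvs _ s])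
  show "lin_on fscale (HMs Y Z) (cscale D) (Hom D X Z) (\<lambda>s. \<Sum>r\<in>UNIV. cmp D X Y Z (mcomp Y Z p r s) (mcomp X Y r q t))"
    by (intro lin_on_sum_fun cvs Hom_sub X Z lin_on_comp[OF mcomp_lin[OF Y Z] cmp_lin1[OF mcomp_mem[OF X Y t]]])
  fix g and B :: "'k ^ 'r ^ 'r" assume g: "g \<in> Hom D Y Z"
  have pg: "pure (HomMat D Y Z) (g, B) \<in> HMs Y Z" by (rule pure_HMs[OF Y Z g])
  show "mcomp X Z p q (mmul X Y Z (pure (HomMat D Y Z) (g, B)) t) =
      (\<Sum>r\<in>UNIV. cmp D X Y Z (mcomp Y Z p r (pure (HomMat D Y Z) (g, B))) (mcomp X Y r q t))"
  proof (rule HMs_eq[OF X Y lin_on_comp[OF mmul_lin2[OF pg] mcomp_lin[OF X Z]] _ cvs _ t])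
    show "lin_on fscale (HMs X Y) (cscale D) (Hom D X Z)
        (\<lambda>t. \<Sum>r\<in>UNIV. cmp D X Y Z (mcomp Y Z p r (pure (HomMat D Y Z) (g, B))) (mcomp X Y r q t))"
      by (intro lin_on_sum_fun cvs Hom_sub X Z lin_on_comp[OF mcomp_lin[OF X Y] cmp_lin2[OF mcomp_mem[OF Y Z pg]]])
    fix f and C :: "'k ^ 'r ^ 'r" assume f: "f \<in> Hom D X Y"
    have "cmp D X Y Z (cscale D b g) (cscale D c f) = cscale D (b * c) (cmp D X Y Z g f)" for b c
      using lin_on_scale[OF cmp_lin1[OF c.subspace_scale[OF Hom_sub[OF X Y] f]] g] lin_on_scale[OF cmp_lin2[OF g] f] by simp
    then show "mcomp X Z p q (mmul X Y Z (pure (HomMat D Y Z) (g, B)) (pure (HomMat D X Y) (f, C))) =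
        (\<Sum>r\<in>UNIV. cmp D X Y Z (mcomp Y Z p r (pure (HomMat D Y Z) (g, B))) (mcomp X Y r q (pure (HomMat D X Y) (f, C))))"
      by (simp add: mmul_pure f g mcomp_pure X Y Z cmp_mem(1)[OF X Y Z f g] matrix_matrix_mult_def c.scale_sum_left)
  qed
qed

end

lemma mat_cat_simps:
  "Obj (mat_cat TYPE('r::finite) D) = Obj D"
  "Hom (mat_cat TYPE('r) D) X Y = HMs X Y"
  "cscale (mat_cat TYPE('r) D) = fscale"
  "cmp (mat_cat TYPE('r) D) X Y Z s t = mmul X Y Z s t"
  "ident (mat_cat TYPE('r) D) X = pure (HomMat D X X) (ident D X, mat 1)"
  "X \<in> Obj D \<Longrightarrow> Y \<in> Obj D \<Longrightarrow> lact (mat_cat TYPE('r) D) X Y h t = mact X Y h t"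
  by (simp_all add: mat_cat_def mmul_def mact_def)

lemma ident_HMs: "X \<in> Obj D \<Longrightarrow> pure (HomMat D X X) (ident D X, B) \<in> HMs X X"
  by (rule pure_HMs[OF _ _ ident_mem])

lemma mmul_mem: "X \<in> Obj D \<Longrightarrow> Y \<in> Obj D \<Longrightarrow> Z \<in> Obj D \<Longrightarrow> s \<in> HMs Y Z \<Longrightarrow> t \<in> HMs X Y \<Longrightarrow> mmul X Y Z s t \<in> HMs X Z"
  by (rule lin_on_mem[OF mmul_lin2])

lemma mact_mem: "X \<in> Obj D \<Longrightarrow> Y \<in> Obj D \<Longrightarrow> t \<in> HMs X Y \<Longrightarrow> mact X Y h t \<in> HMs X Y"
  by (rule lin_on_mem[OF mact_lin])

text \<open>Composing with id \<otimes> B multiplies by the scalar matrix B. The unit laws are the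
  case B = 1, and elementary matrices give the arrows that later split the identity.\<close>

lemma mmul_ident_left:
  assumes X: "X \<in> Obj D" "Y \<in> Obj D" and t: "t \<in> HMs X Y"
  shows "mcomp X Y p q (mmul X Y Y (pure (HomMat D Y Y) (ident D Y, B)) t) = (\<Sum>r\<in>UNIV. cscale D (B $ p $ r) (mcomp X Y r q t))"
proof -
  have "cmp D X Y Y (cscale D c (ident D Y)) f = cscale D c f" if "f \<in> Hom D X Y" for c f
    using lin_on_scale[OF cmp_lin1[OF X X(2) that] ident_mem[OF X(2)]] cmp_ident[OF X that] by simp
  then show ?thesis
    by (simp add: mmul_mcomp[OF X X(2) ident_HMs[OF X(2)] t] mcomp_pure[OF X(2,2) ident_mem[OF X(2)]] mcomp_mem[OF X t])
qed

lemma mmul_ident_right: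
  assumes X: "X \<in> Obj D" "Y \<in> Obj D" and t: "t \<in> HMs X Y"
  shows "mcomp X Y p q (mmul X X Y t (pure (HomMat D X X) (ident D X, B))) = (\<Sum>r\<in>UNIV. cscale D (B $ r $ q) (mcomp X Y p r t))"
proof -
  have "cmp D X X Y f (cscale D c (ident D X)) = cscale D c f" if "f \<in> Hom D X Y" for c f
    using lin_on_scale[OF cmp_lin2[OF X(1) X that] ident_mem[OF X(1)]] cmp_ident[OF X that] by simp
  then show ?thesis
    by (simp add: mmul_mcomp[OF X(1) X t ident_HMs[OF X(1)]] mcomp_pure[OF X(1,1) ident_mem[OF X(1)]] mcomp_mem[OF X t])
qed

lemma mact_ident:
  assumes "X \<in> Obj D"
  shows "mact X X h (pure (HomMat D X X) (ident D X, B)) = fscale (counit H h) (pure (HomMat D X X) (ident D X, B))"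
  using lin_on_scale[OF pure_HMs_lin(1)[OF assms assms] ident_mem[OF assms]]
  by (simp add: mact_pure[OF assms assms ident_mem[OF assms]] lact_ident[OF assms])

lemma mact_mmul:
  assumes X: "X \<in> Obj D" and Y: "Y \<in> Obj D" and Z: "Z \<in> Obj D" and s: "s \<in> HMs Y Z" and t: "t \<in> HMs X Y"
  shows "mact X Z h (mmul X Y Z s t) = cs H h (\<lambda>a b. mmul X Y Z (mact Y Z a s) (mact X Y b t))"
proof (rule mcomp_eqI[OF X Z])
  show "mact X Z h (mmul X Y Z s t) \<in> HMs X Z" by (intro mact_mem mmul_mem assms)
  have m: "mmul X Y Z (mact Y Z a s) (mact X Y b t) \<in> HMs X Z" for a b by (intro mact_mem mmul_mem assms)
  then show "cs H h (\<lambda>a b. mmul X Y Z (mact Y Z a s) (mact X Y b t)) \<in> HMs X Z" by (rule cs_mem)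
  fix p q
  have "mcomp X Z p q (cs H h (\<lambda>a b. mmul X Y Z (mact Y Z a s) (mact X Y b t))) =
      cs H h (\<lambda>a b. mcomp X Z p q (mmul X Y Z (mact Y Z a s) (mact X Y b t)))"
    by (rule lin_on_cs_out[OF mcomp_lin[OF X Z] vector_space_fscale HMs_sub[OF X Z] m])
  also have "\<dots> = (\<Sum>r\<in>UNIV. cs H h (\<lambda>a b. cmp D X Y Z (lact D Y Z a (mcomp Y Z p r s)) (lact D X Y b (mcomp X Y r q t))))"
    by (simp add: mmul_mcomp[OF X Y Z] mact_mem assms mact_mcomp[OF Y Z s] mact_mcomp[OF X Y t] cs_sum_fin)
  also have "\<dots> = (\<Sum>r\<in>UNIV. lact D X Z h (cmp D X Y Z (mcomp Y Z p r s) (mcomp X Y r q t)))"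
    by (simp add: lact_cmp_axiom[OF X Y Z mcomp_mem[OF X Y t] mcomp_mem[OF Y Z s]] sweedler_1[unfolded One_nat_def] del: sweedler.simps)
  also have "\<dots> = lact D X Z h (mcomp X Z p q (mmul X Y Z s t))"
    unfolding mmul_mcomp[OF X Y Z s t]
    by (rule lin_on_sum_fin[OF cvs Hom_sub[OF X Z] lact_lin(2)[OF X Z], symmetric])
      (rule cmp_mem(1)[OF X Y Z mcomp_mem[OF X Y t] mcomp_mem[OF Y Z s]])
  also have "\<dots> = mcomp X Z p q (mact X Z h (mmul X Y Z s t))"
    by (rule mact_mcomp[OF X Z mmul_mem[OF X Y Z s t], symmetric])
  finally show "mcomp X Z p q (mact X Z h (mmul X Y Z s t)) =
    mcomp X Z p q (cs H h (\<lambda>a b. mmul X Y Z (mact Y Z a s) (mact X Y b t)))" by simp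
qed

lemma mmul_assoc:
  assumes W: "W \<in> Obj D" and X: "X \<in> Obj D" and Y: "Y \<in> Obj D" and Z: "Z \<in> Obj D"
    and f: "f \<in> HMs W X" and g: "g \<in> HMs X Y" and k: "k \<in> HMs Y Z"
  shows "mmul W X Z (mmul X Y Z k g) f = mmul W Y Z k (mmul W X Y g f)"
proof (rule mcomp_eqI[OF W Z])
  show "mmul W X Z (mmul X Y Z k g) f \<in> HMs W Z" "mmul W Y Z k (mmul W X Y g f) \<in> HMs W Z" by (intro mmul_mem assms)+
  fix p q
  note fm = mcomp_mem[OF W X f] and gm = mcomp_mem[OF X Y g] and km = mcomp_mem[OF Y Z k]
  have "mcomp W Z p q (mmul W X Z (mmul X Y Z k g) f) =
      (\<Sum>r\<in>UNIV. cmp D W X Z (\<Sum>s\<in>UNIV. cmp D X Y Z (mcomp Y Z p s k) (mcomp X Y s r g)) (mcomp W X r q f))"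
    by (simp add: mmul_mcomp W X Y Z f g k mmul_mem)
  also have "\<dots> = (\<Sum>r\<in>UNIV. \<Sum>s\<in>UNIV. cmp D W X Z (cmp D X Y Z (mcomp Y Z p s k) (mcomp X Y s r g)) (mcomp W X r q f))"
    by (intro sum.cong refl lin_on_sum_fin[OF cvs Hom_sub[OF X Z] cmp_lin1[OF W X Z fm]] cmp_mem(1)[OF X Y Z gm km])
  also have "\<dots> = (\<Sum>r\<in>UNIV. \<Sum>s\<in>UNIV. cmp D W Y Z (mcomp Y Z p s k) (cmp D W X Y (mcomp X Y s r g) (mcomp W X r q f)))"
    by (simp add: cmp_assoc[OF W X Y Z fm gm km])
  also have "\<dots> = (\<Sum>s\<in>UNIV. \<Sum>r\<in>UNIV. cmp D W Y Z (mcomp Y Z p s k) (cmp D W X Y (mcomp X Y s r g) (mcomp W X r q f)))"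
    by (rule sum.swap)
  also have "\<dots> = (\<Sum>s\<in>UNIV. cmp D W Y Z (mcomp Y Z p s k) (\<Sum>r\<in>UNIV. cmp D W X Y (mcomp X Y s r g) (mcomp W X r q f)))"
    by (intro sum.cong refl lin_on_sum_fin[OF cvs Hom_sub[OF W Y] cmp_lin2[OF W Y Z km], symmetric] cmp_mem(1)[OF W X Y fm gm])
  also have "\<dots> = mcomp W Z p q (mmul W Y Z k (mmul W X Y g f))"
    by (simp add: mmul_mcomp W X Y Z f g k mmul_mem)
  finally show "mcomp W Z p q (mmul W X Z (mmul X Y Z k g) f) = mcomp W Z p q (mmul W Y Z k (mmul W X Y g f))" .
qed

lemma mat_one_sums:
  fixes g :: "'r::finite \<Rightarrow> 'a"
  shows "(\<Sum>r\<in>UNIV. cscale D ((mat 1 :: 'k ^ 'r ^ 'r) $ p $ r) (g r)) = g p"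
    and "(\<Sum>r\<in>UNIV. cscale D ((mat 1 :: 'k ^ 'r ^ 'r) $ r $ q) (g r)) = g q"
  by (simp_all add: mat_def if_distrib[of "\<lambda>c. cscale D c _"] sum.delta sum.delta' cong: if_cong)

theorem H_category_mat_cat: "H_category H (mat_cat TYPE('r::finite) D)"
  unfolding H_category_def
proof (intro conjI ballI allI; (simp only: mat_cat_simps(1-5))?)
  show "vector_space (fscale :: 'k \<Rightarrow> ('a \<times> ('k ^ 'r ^ 'r), 'k) tensor \<Rightarrow> _)" by (rule vector_space_fscale)
  fix X Y assume X: "X \<in> Obj D" and Y: "Y \<in> Obj D"
  show "module.subspace fscale (HMs X Y :: ('a \<times> ('k ^ 'r ^ 'r), 'k) tensor set)" by (rule HMs_sub[OF X Y])
  show "bilin_on (hscale H) UNIV fscale (HMs X Y) fscale (HMs X Y) (lact (mat_cat TYPE('r) D) X Y)"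
    unfolding bilin_on_def mat_cat_simps(6)[OF X Y] by (simp add: mat_cat_simps(6)[OF X Y, THEN HOL.ext] mact_lin[OF X Y] mact_lin_h[OF X Y])
  show "pure (HomMat D X X) (ident D X, mat 1 :: 'k ^ 'r ^ 'r) \<in> HMs X X" by (rule ident_HMs[OF X])
  fix f :: "('a \<times> ('k ^ 'r ^ 'r), 'k) tensor" assume f: "f \<in> HMs X Y"
  note iX = ident_HMs[OF X, of "mat 1 :: 'k ^ 'r ^ 'r"] and iY = ident_HMs[OF Y, of "mat 1 :: 'k ^ 'r ^ 'r"]
  show "mmul X X Y f (pure (HomMat D X X) (ident D X, mat 1)) = f"
    by (rule mcomp_eqI[OF X Y mmul_mem[OF X X Y f iX] f]) (simp add: mmul_ident_right[OF X Y f] mat_one_sums)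
  show "mmul X Y Y (pure (HomMat D Y Y) (ident D Y, mat 1)) f = f"
    by (rule mcomp_eqI[OF X Y mmul_mem[OF X Y Y iY f] f]) (simp add: mmul_ident_left[OF X Y f] mat_one_sums)
  show "lact (mat_cat TYPE('r) D) X Y 1 f = f"
    unfolding mat_cat_simps(6)[OF X Y]
    by (rule mcomp_eqI[OF X Y mact_mem[OF X Y f] f]) (simp add: mact_mcomp[OF X Y f] lact_lin(4)[OF X Y mcomp_mem[OF X Y f]])
  show "lact (mat_cat TYPE('r) D) X Y (g * h) f = lact (mat_cat TYPE('r) D) X Y g (lact (mat_cat TYPE('r) D) X Y h f)" for g h
    unfolding mat_cat_simps(6)[OF X Y]
    by (rule mcomp_eqI[OF X Y mact_mem[OF X Y f] mact_mem[OF X Y mact_mem[OF X Y f]]])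
      (simp add: mact_mcomp[OF X Y] mact_mem[OF X Y] f lact_lin(5)[OF X Y mcomp_mem[OF X Y f]])
next
  fix X h assume X: "X \<in> Obj D"
  show "lact (mat_cat TYPE('r) D) X X h (pure (HomMat D X X) (ident D X, mat 1)) =
      fscale (counit H h) (pure (HomMat D X X) (ident D X, mat 1))"
    unfolding mat_cat_simps(6)[OF X X] by (rule mact_ident[OF X])
next
  fix X Y Z assume X: "X \<in> Obj D" and Y: "Y \<in> Obj D" and Z: "Z \<in> Obj D"
  show "bilin_on fscale (HMs Y Z) fscale (HMs X Y) fscale (HMs X Z) (cmp (mat_cat TYPE('r) D) X Y Z)"
    by (simp add: bilin_on_def mat_cat_simps(4)[THEN HOL.ext] mmul_lin1[OF X Y Z] mmul_lin2[OF X Y Z] mat_cat_simps(4))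
  fix f g :: "('a \<times> ('k ^ 'r ^ 'r), 'k) tensor" and h
  assume f: "f \<in> HMs X Y" and g: "g \<in> HMs Y Z"
  show "lact (mat_cat TYPE('r) D) X Z h (mmul X Y Z g f) =
      sweedler H 1 h (\<lambda>hs. mmul X Y Z (lact (mat_cat TYPE('r) D) Y Z (hs ! 0) g) (lact (mat_cat TYPE('r) D) X Y (hs ! 1) f))"
    unfolding mat_cat_simps(6)[OF X Z] mat_cat_simps(6)[OF X Y] mat_cat_simps(6)[OF Y Z] sweedler_1
    using mact_mmul[OF X Y Z g f] by simp
qed (rule mmul_assoc; assumption)

end

section \<open>Chain maps given arrow by arrow\<close>

lemma sweedler_sum_fin: "sweedler H n h (\<lambda>hs. \<Sum>i\<in>I. f i hs) = (\<Sum>i\<in>I. sweedler H n h (f i))"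
proof (induction I rule: infinite_finite_induct)
  case (insert i I)
  then show ?case by (simp add: sweedler_sum sum_list_addf)
qed (simp_all add: sweedler_sum)

lemma right_H_homD:
  assumes "right_H_hom H M D D' n f"
  shows "lin_on fscale (tensor_space (MCN M D n)) fscale (tensor_space (MCN M D' n)) f"
    and "t \<in> tensor_space (MCN M D n) \<Longrightarrow> f (MCN_act H M D n t h) = MCN_act H M D' n (f t) h"
  using assms by (simp_all add: right_H_hom_def)

locale hcat_pair = s: hcat_loc H M D1 + t: hcat_loc H M D2
  for H :: "('k::field, 'h::ring_1) hopf" and M :: "('k, 'h, 'm::ab_group_add) hmodcomod"
    and D1 :: "('k, 'h, 'o, 'a::ab_group_add) hcat" and D2 :: "('k, 'h, 'o, 'b::ab_group_add) hcat"
begin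

lemma HomH_cochain:
  assumes f: "right_H_hom H M D1 D2 n f" and \<phi>: "\<phi> \<in> cochains H M D2 n"
  shows "HomH M D1 n f \<phi> \<in> cochains H M D1 n"
  unfolding HomH_def
proof (rule s.off_zero_cochain)
  note fD = right_H_homD[OF f]
  show "lin_on fscale (s.MCNs n) (*) UNIV (\<lambda>t. \<phi> (f t))" by (rule lin_on_comp[OF fD(1) t.cochainsD(1)[OF \<phi>]])
  fix m xs fs h assume "(xs, fs) \<in> cyclic_words D1 n"
  then have w: "mword M D1 n m xs fs \<in> s.MCNs n" by (rule s.mword_mem)
  show "\<phi> (f (MCN_act H M D1 n (mword M D1 n m xs fs) h)) = counit H h * \<phi> (f (mword M D1 n m xs fs))"
    unfolding fD(2)[OF w] by (rule t.cochainsD(3)[OF \<phi> lin_on_mem[OF fD(1) w]])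
qed

lemma ev_HomH: "(xs, fs) \<in> cyclic_words D1 n \<Longrightarrow> s.ev n (HomH M D1 n f \<phi>) m xs fs = \<phi> (f (mword M D1 n m xs fs))"
  by (simp add: s.ev_def HomH_def off_zero_def s.mword_mem)

lemma HomH_lin:
  assumes "right_H_hom H M D1 D2 n f"
  shows "lin_on fscale (cochains H M D2 n) fscale (cochains H M D1 n) (HomH M D1 n f)"
  using HomH_cochain[OF assms]
  by (simp add: lin_on_def) (simp add: HomH_def off_zero_def fscale_def fun_eq_iff)

text \<open>Allows a chain map to be replaced by one that agrees with it on chains. Off the tensor
  space the value of a lift is an arbitrary choice, so equality of functions is not to be
  expected.\<close>

lemma right_H_hom_cong:
  assumes f: "right_H_hom H M D1 D2 n f" and g: "\<And>t. t \<in> s.MCNs n \<Longrightarrow> g t = f t"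
  shows "right_H_hom H M D1 D2 n g"
proof -
  interpret F: vector_space "fscale :: 'k \<Rightarrow> ('k, 'm, 'o, 'a) chain \<Rightarrow> _" by (rule vector_space_fscale)
  show ?thesis
    using f lin_on_mem[OF s.MCN_act_lin] F.subspace_add[OF s.MCNs_sub] F.subspace_scale[OF s.MCNs_sub]
    unfolding right_H_hom_def lin_on_def[of fscale "s.MCNs n"] by (simp add: g)
qed

end

text \<open>The common form of the inclusion, the trace and the junction insertions: a sum over p in
  \<open>I\<close> of maps that act on each arrow separately by linear H-equivariant maps, which may
  depend on the position of the arrow. Balance and H-linearity are proved once for all of
  them.\<close>

locale slot_maps = hcat_pair H M D1 D2
  for H :: "('k::field, 'h::ring_1) hopf" and M :: "('k, 'h, 'm::ab_group_add) hmodcomod"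
    and D1 :: "('k, 'h, 'o, 'a::ab_group_add) hcat" and D2 :: "('k, 'h, 'o, 'b::ab_group_add) hcat" +
  fixes n :: nat and I :: "'i set" and G :: "'i \<Rightarrow> nat \<Rightarrow> 'o \<Rightarrow> 'o \<Rightarrow> 'a \<Rightarrow> 'b"
  assumes Obj_eq: "Obj D2 = Obj D1"
    and G_lin: "\<And>p i X Y. X \<in> Obj D1 \<Longrightarrow> Y \<in> Obj D1 \<Longrightarrow> lin_on (cscale D1) (Hom D1 X Y) (cscale D2) (Hom D2 X Y) (G p i X Y)"
    and G_lact: "\<And>p i X Y h f. X \<in> Obj D1 \<Longrightarrow> Y \<in> Obj D1 \<Longrightarrow> f \<in> Hom D1 X Y \<Longrightarrow>
      G p i X Y (lact D1 X Y h f) = lact D2 X Y h (G p i X Y f)"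
begin

definition slot :: "'i \<Rightarrow> 'o list \<Rightarrow> 'a list \<Rightarrow> 'b list" where
  "slot p xs fs = map (\<lambda>i. G p i (src xs i) (tgt xs i) (fs ! i)) [0..<Suc n]"

lemma length_slot: "length (slot p xs fs) = Suc n"
  by (simp add: slot_def)

lemma nth_slot: "i \<le> n \<Longrightarrow> slot p xs fs ! i = G p i (src xs i) (tgt xs i) (fs ! i)"
  unfolding slot_def by (simp del: upt_Suc add: less_Suc_eq_le)

lemma slot_word:
  assumes "(xs, fs) \<in> cyclic_words D1 n"
  shows "(xs, slot p xs fs) \<in> cyclic_words D2 n"
proof -
  note w = s.wordD[OF assms]
  show ?thesis
    by (rule t.wordI) (simp_all add: w(1,3) length_slot Obj_eq nth_slot lin_on_mem[OF G_lin[OF w(5,6)] w(4)])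
qed

lemma slot_update:
  assumes "length fs = Suc n" "i \<le> n"
  shows "slot p xs (fs[i := g]) = (slot p xs fs)[i := G p i (src xs i) (tgt xs i) g]"
  using assms by (intro nth_equalityI) (auto simp: length_slot nth_slot nth_list_update less_Suc_eq_le)

lemma slot_wact:
  assumes "(xs, fs) \<in> cyclic_words D1 n"
  shows "slot p xs (s.wact n xs hs fs) = t.wact n xs hs (slot p xs fs)"
  using s.wordD[OF assms] by (intro nth_equalityI) (auto simp: length_slot nth_slot less_Suc_eq_le G_lact)

lemma slot_mform:
  assumes F: "t.mform n s U F" and s: "vector_space s" and U: "module.subspace s U"
  shows "s.mform n s U (\<lambda>m xs fs. \<Sum>p\<in>I. F m xs (slot p xs fs))"
proof (rule s.mformI)
  fix xs fs assume w: "(xs, fs) \<in> cyclic_words D1 n"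
  show "lin_on (mscale M) UNIV s U (\<lambda>m. \<Sum>p\<in>I. F m xs (slot p xs fs))"
    by (rule lin_on_sum_fun[OF s U t.mformD(1)[OF F slot_word[OF w]]])
  fix m i assume i: "i \<le> n"
  show "lin_on (cscale D1) (Hom D1 (src xs i) (tgt xs i)) s U (\<lambda>g. \<Sum>p\<in>I. F m xs (slot p xs (fs[i := g])))"
    unfolding slot_update[OF s.wordD(2)[OF w] i]
    by (rule lin_on_sum_fun[OF s U lin_on_comp[OF G_lin[OF s.wordD(5,6)[OF w]] t.mformD(2)[OF F slot_word[OF w] i]]])
qed

lemma slot_cform:
  assumes F: "t.cform n F"
  shows "s.cform n (\<lambda>m xs fs. \<Sum>p\<in>I. F m xs (slot p xs fs))"
  unfolding s.cform_def s.bal_def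
proof (intro conjI allI impI)
  have m: "t.mform n (*) UNIV F" and b: "t.bal n F" using F by (simp_all add: t.cform_def)
  show "s.mform n (*) UNIV (\<lambda>m xs fs. \<Sum>p\<in>I. F m xs (slot p xs fs))"
    by (rule slot_mform[OF m vector_space_field subspace_UNIV[OF vector_space_field]])
  fix m h xs fs assume w: "(xs, fs) \<in> cyclic_words D1 n"
  show "(\<Sum>p\<in>I. F (ract M m h) xs (slot p xs fs)) = sweedler H n h (\<lambda>hs. \<Sum>p\<in>I. F m xs (slot p xs (s.wact n xs hs fs)))"
    unfolding t.balD[OF b slot_word[OF w]] slot_wact[OF w] sweedler_sum_fin ..
qed

definition pb :: "('k, 'm, 'o, 'a) chain \<Rightarrow> ('k, 'm, 'o, 'b) chain" where
  "pb = chain_lift M D1 n (\<lambda>m xs fs. \<Sum>p\<in>I. mword M D2 n m xs (slot p xs fs))"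

lemma pb_lin: "lin_on fscale (s.MCNs n) fscale (t.MCNs n) pb"
  and pb_mword: "(xs, fs) \<in> cyclic_words D1 n \<Longrightarrow> pb (mword M D1 n m xs fs) = (\<Sum>p\<in>I. mword M D2 n m xs (slot p xs fs))"
  unfolding pb_def
  by (rule s.chain_lift_lin s.chain_lift_mword, rule slot_mform[OF t.mform_mword vector_space_fscale t.MCNs_sub],
      rule vector_space_fscale, rule t.MCNs_sub, assumption?)+

lemma pb_hom: "right_H_hom H M D1 D2 n pb"
  unfolding right_H_hom_def
proof (intro conjI ballI allI)
  show "lin_on fscale (s.MCNs n) fscale (t.MCNs n) pb" by (rule pb_lin)
  fix t h assume t: "t \<in> s.MCNs n"
  show "pb (MCN_act H M D1 n t h) = MCN_act H M D2 n (pb t) h"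
  proof (rule s.MCNs_ext[OF lin_on_comp[OF s.MCN_act_lin pb_lin] lin_on_comp[OF pb_lin t.MCN_act_lin] vector_space_fscale _ t])
    fix m xs fs assume w: "(xs, fs) \<in> cyclic_words D1 n"
    have "pb (MCN_act H M D1 n (mword M D1 n m xs fs) h) =
        (\<Sum>p\<in>I. cs H h (\<lambda>a b. sweedler H n (antip H b) (\<lambda>hs. mword M D2 n (ract M m a) xs (t.wact n xs hs (slot p xs fs)))))"
      unfolding s.lin_MCN_act_mword[OF pb_lin w] pb_mword[OF s.wact_word[OF w]] slot_wact[OF w]
        sweedler_sum_fin cs_sum_fin ..
    also have "\<dots> = (\<Sum>p\<in>I. MCN_act H M D2 n (mword M D2 n m xs (slot p xs fs)) h)"
      unfolding t.MCN_act_mword[OF slot_word[OF w]] ..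
    also have "\<dots> = MCN_act H M D2 n (pb (mword M D1 n m xs fs)) h"
      unfolding pb_mword[OF w]
      by (rule lin_on_sum_fin[OF vector_space_fscale t.MCNs_sub t.MCN_act_lin t.mword_mem[OF slot_word[OF w]], symmetric])
    finally show "pb (MCN_act H M D1 n (mword M D1 n m xs fs) h) = MCN_act H M D2 n (pb (mword M D1 n m xs fs)) h" .
  qed
qed

lemma ev_pb:
  assumes \<phi>: "\<phi> \<in> cochains H M D2 n" and w: "(xs, fs) \<in> cyclic_words D1 n"
  shows "\<phi> (pb (mword M D1 n m xs fs)) = (\<Sum>p\<in>I. t.ev n \<phi> m xs (slot p xs fs))"
  unfolding pb_mword[OF w] t.ev_def
  by (rule lin_on_sum_fin[OF vector_space_fscale t.MCNs_sub t.cochainsD(1)[OF \<phi>] t.mword_mem[OF slot_word[OF w]]])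

end

section \<open>Splitting the identity at a junction\<close>

text \<open>Singles out the index in one position of an index word, such as the inner index of a
  matrix product.\<close>

lemma sum_lists_insert:
  fixes f :: "'q::finite list \<Rightarrow> 'z::comm_monoid_add"
  assumes "i \<le> n"
  shows "(\<Sum>rs | length rs = Suc n. f rs) = (\<Sum>rs | length rs = n. \<Sum>r\<in>UNIV. f (take i rs @ r # drop i rs))"
  unfolding sum.cartesian_product
proof (rule sum.reindex_bij_witness[of _ "\<lambda>(rs, r). take i rs @ r # drop i rs" "\<lambda>rs. (take i rs @ drop (Suc i) rs, rs ! i)"])
  fix rs :: "'q list" assume "rs \<in> {rs. length rs = Suc n}"
  then have rs: "length rs = Suc n" by simp
  show "(case (take i rs @ drop (Suc i) rs, rs ! i) of (rs, r) \<Rightarrow> take i rs @ r # drop i rs) = rs"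
    using rs assms by (simp add: Cons_nth_drop_Suc)
  then show "(case (take i rs @ drop (Suc i) rs, rs ! i) of (rs, r) \<Rightarrow> f (take i rs @ r # drop i rs)) = f rs"
    by simp
qed (use assms in \<open>auto simp: min_def nth_append\<close>)

lemma sum_lists_snoc:
  fixes f :: "'q::finite list \<Rightarrow> 'z::comm_monoid_add"
  shows "(\<Sum>ps | length ps = Suc j. f ps) = (\<Sum>ps | length ps = j. \<Sum>p\<in>UNIV. f (ps @ [p]))"
  by (simp add: sum_lists_insert[OF order_refl])

context hcat_loc
begin

lemma ca_sum_fin: "ca m (\<lambda>a x. \<Sum>i\<in>I. f i a x) = (\<Sum>i\<in>I. ca m (f i))"
proof (induction I rule: infinite_finite_induct)
  case (insert i I)
  then show ?case by (simp add: ca_sum sum_list_addf)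
qed (simp_all add: ca_sum)

text \<open>Operators \<open>Q\<^sub>j\<close> on cochains that replace \<open>\<dots>, f\<^sup>j\<^sup>-\<^sup>1, f\<^sup>j, \<dots>\<close> by
  \<open>\<Sum>\<^sub>p \<dots>, f\<^sup>j\<^sup>-\<^sup>1 u\<^sub>p, v\<^sub>p f\<^sup>j, \<dots>\<close>, for invariant endomorphisms with \<open>\<Sum>\<^sub>p u\<^sub>p v\<^sub>p = id\<close>.\<close>

context
  fixes u v :: "'o \<Rightarrow> 'i::finite \<Rightarrow> 'a"
  assumes u: "\<And>X p. X \<in> Obj D \<Longrightarrow> u X p \<in> Hom D X X" and v: "\<And>X p. X \<in> Obj D \<Longrightarrow> v X p \<in> Hom D X X"
    and lu: "\<And>X p h. X \<in> Obj D \<Longrightarrow> lact D X X h (u X p) = cscale D (counit H h) (u X p)"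
    and lv: "\<And>X p h. X \<in> Obj D \<Longrightarrow> lact D X X h (v X p) = cscale D (counit H h) (v X p)"
    and uv: "\<And>X. X \<in> Obj D \<Longrightarrow> (\<Sum>p\<in>UNIV. cmp D X X X (u X p) (v X p)) = ident D X"
begin

definition rmul :: "'i \<Rightarrow> 'o \<Rightarrow> 'o \<Rightarrow> 'a \<Rightarrow> 'a" where
  "rmul p X Y f = cmp D X X Y f (u X p)"

definition lmul :: "'i \<Rightarrow> 'o \<Rightarrow> 'o \<Rightarrow> 'a \<Rightarrow> 'a" where
  "lmul p X Y f = cmp D X Y Y (v Y p) f"

text \<open>Junction j lies between f^(j-1) and f^j, and junction 0 between f^n and f^0. In degree 0
  these are the same arrow, which then receives both factors; hence the two tests are nested rather
  than alternatives.\<close>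

definition jmap :: "nat \<Rightarrow> nat \<Rightarrow> 'i \<Rightarrow> nat \<Rightarrow> 'o \<Rightarrow> 'o \<Rightarrow> 'a \<Rightarrow> 'a" where
  "jmap n j p i X Y f =
     (let g = (if i = (if j = 0 then n else j - 1) then rmul p X Y f else f) in if i = j then lmul p X Y g else g)"

lemma rmul_lin: "X \<in> Obj D \<Longrightarrow> Y \<in> Obj D \<Longrightarrow> lin_on (cscale D) (Hom D X Y) (cscale D) (Hom D X Y) (rmul p X Y)"
  unfolding rmul_def[abs_def] by (rule cmp_lin1[OF _ _ _ u])

lemma lmul_lin: "X \<in> Obj D \<Longrightarrow> Y \<in> Obj D \<Longrightarrow> lin_on (cscale D) (Hom D X Y) (cscale D) (Hom D X Y) (lmul p X Y)"
  unfolding lmul_def[abs_def] by (rule cmp_lin2[OF _ _ _ v])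

lemma rmul_mem: "X \<in> Obj D \<Longrightarrow> Y \<in> Obj D \<Longrightarrow> f \<in> Hom D X Y \<Longrightarrow> rmul p X Y f \<in> Hom D X Y"
  by (rule lin_on_mem[OF rmul_lin])

text \<open>H acts on \<open>u\<close> by the counit, so in h (f u) = (h_1 f) (h_2 u) the second leg
  is deleted.\<close>

lemma lact_rmul:
  assumes X: "X \<in> Obj D" "Y \<in> Obj D" and f: "f \<in> Hom D X Y"
  shows "rmul p X Y (lact D X Y h f) = lact D X Y h (rmul p X Y f)"
proof -
  have "lact D X Y h (rmul p X Y f) = cs H h (\<lambda>a b. cscale D (counit H b) (cmp D X X Y (lact D X Y a f) (u X p)))"
    unfolding rmul_def lact_cmp_axiom[OF X(1) X u[OF X(1)] f] sweedler_1
    by (simp add: lu[OF X(1)] lin_on_scale[OF cmp_lin2[OF X(1) X lact_lin(3)[OF X f]] u[OF X(1)]])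
  also have "\<dots> = cmp D X X Y (lact D X Y h f) (u X p)"
  proof (rule cs_counit(2))
    have "lin_on (hscale H) UNIV (cscale D) (Hom D X Y) (\<lambda>a. cmp D X X Y (lact D X Y a f) (u X p))"
      by (rule lin_on_comp[OF lact_lin(1)[OF X f] cmp_lin1[OF X(1) X u[OF X(1)]]])
    then show "lin (cscale D) (\<lambda>a. cmp D X X Y (lact D X Y a f) (u X p))" by (simp add: lin_on_def)
  qed
  finally show ?thesis by (simp add: rmul_def)
qed

lemma lact_lmul:
  assumes X: "X \<in> Obj D" "Y \<in> Obj D" and f: "f \<in> Hom D X Y"
  shows "lmul p X Y (lact D X Y h f) = lact D X Y h (lmul p X Y f)"
proof -
  have "lact D X Y h (lmul p X Y f) = cs H h (\<lambda>a b. cscale D (counit H a) (cmp D X Y Y (v Y p) (lact D X Y b f)))"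
    unfolding lmul_def lact_cmp_axiom[OF X X(2) f v[OF X(2)]] sweedler_1
    by (simp add: lv[OF X(2)] lin_on_scale[OF cmp_lin1[OF X X(2) lact_lin(3)[OF X f]] v[OF X(2)]])
  also have "\<dots> = cmp D X Y Y (v Y p) (lact D X Y h f)"
  proof (rule cs_counit(1))
    have "lin_on (hscale H) UNIV (cscale D) (Hom D X Y) (\<lambda>a. cmp D X Y Y (v Y p) (lact D X Y a f))"
      by (rule lin_on_comp[OF lact_lin(1)[OF X f] cmp_lin2[OF X X(2) v[OF X(2)]]])
    then show "lin (cscale D) (\<lambda>a. cmp D X Y Y (v Y p) (lact D X Y a f))" by (simp add: lin_on_def)
  qed
  finally show ?thesis by (simp add: lmul_def)
qed

lemma jmap_lin:
  assumes X: "X \<in> Obj D" "Y \<in> Obj D"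
  shows "lin_on (cscale D) (Hom D X Y) (cscale D) (Hom D X Y) (jmap n j p i X Y)"
proof -
  have r: "lin_on (cscale D) (Hom D X Y) (cscale D) (Hom D X Y) (\<lambda>f. if b then rmul p X Y f else f)" for b
    using rmul_lin[OF X] by (cases b) (simp_all, simp add: lin_on_def)
  then have "lin_on (cscale D) (Hom D X Y) (cscale D) (Hom D X Y) (\<lambda>f. lmul p X Y (if b then rmul p X Y f else f))" for b
    by (rule lin_on_comp[OF _ lmul_lin[OF X]])
  with r show ?thesis unfolding jmap_def[abs_def] Let_def by (cases "i = j") simp_all
qed

lemma jmap_lact:
  assumes X: "X \<in> Obj D" "Y \<in> Obj D" and f: "f \<in> Hom D X Y"
  shows "jmap n j p i X Y (lact D X Y h f) = lact D X Y h (jmap n j p i X Y f)"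
  using X f by (simp add: jmap_def Let_def lact_rmul lact_lmul rmul_mem)

lemma jslot: "slot_maps H M D D (jmap n j)"
  by unfold_locales (simp_all add: jmap_lin jmap_lact)

abbreviation jslot_list :: "nat \<Rightarrow> nat \<Rightarrow> 'i \<Rightarrow> 'o list \<Rightarrow> 'a list \<Rightarrow> 'a list" where
  "jslot_list n j \<equiv> slot_maps.slot n (jmap n j)"

lemmas length_jslot = slot_maps.length_slot[OF jslot]
lemmas nth_jslot = slot_maps.nth_slot[OF jslot]
lemmas jslot_word = slot_maps.slot_word[OF jslot]

text \<open>An insertion away from the composed junction can still touch the composed arrow:
  \<open>v\<close> from the left if j = i, \<open>u\<close> from the right if j = i + 2.
  Associativity moves it outside the composite. At the composed junction itself u_p and v_p meet and
  form one endomorphism.\<close>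

lemma jslot_face:
  assumes w: "(xs, fs) \<in> cyclic_words D (Suc n)" and i: "i \<le> n"
  shows "1 \<le> j \<Longrightarrow> j \<le> i \<Longrightarrow> fF i xs (jslot_list (Suc n) j p xs fs) = jslot_list n j p (fX i xs) (fF i xs fs)"
    and "i + 2 \<le> j \<Longrightarrow> j \<le> Suc n \<Longrightarrow> fF i xs (jslot_list (Suc n) j p xs fs) = jslot_list n (j - 1) p (fX i xs) (fF i xs fs)"
    and "fF i xs (jslot_list (Suc n) (Suc i) p xs fs) = (fF i xs fs)[i :=
      cmp D (src xs (Suc i)) (src xs i) (tgt xs i)
        (cmp D (src xs i) (src xs i) (tgt xs i) (fs ! i) (cmp D (src xs i) (src xs i) (src xs i) (u (src xs i) p) (v (src xs i) p)))
        (fs ! Suc i)]"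
proof -
  note wd = wordD[OF w]
  have f: "fs ! i \<in> Hom D (src xs i) (tgt xs i)" "fs ! Suc i \<in> Hom D (src xs (Suc i)) (src xs i)"
    using wd(4)[of i] wd(4)[of "Suc i"] i by (simp_all add: tgt_Suc)
  note simps = length_fF[of _ n] nth_fF[of _ n] length_jslot nth_jslot src_fX[of _ n] tgt_fX[of _ n] less_Suc_eq_le
  have A1: "cmp D (src xs (Suc i)) (src xs i) (tgt xs i) (lmul p (src xs i) (tgt xs i) (fs ! i)) (fs ! Suc i) =
      lmul p (src xs (Suc i)) (tgt xs i) (cmp D (src xs (Suc i)) (src xs i) (tgt xs i) (fs ! i) (fs ! Suc i))"
    unfolding lmul_def by (rule cmp_assoc[OF wd(5,5,6,6) f(2,1) v[OF wd(6)]])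
  have A2: "cmp D (src xs (Suc i)) (src xs i) (tgt xs i) (fs ! i) (rmul p (src xs (Suc i)) (src xs i) (fs ! Suc i)) =
      rmul p (src xs (Suc i)) (tgt xs i) (cmp D (src xs (Suc i)) (src xs i) (tgt xs i) (fs ! i) (fs ! Suc i))"
    unfolding rmul_def by (rule cmp_assoc[OF wd(5,5,5,6) u[OF wd(5)] f(2,1), symmetric])
  have A3: "cmp D (src xs (Suc i)) (src xs i) (tgt xs i) (rmul p (src xs i) (tgt xs i) (fs ! i)) (lmul p (src xs (Suc i)) (src xs i) (fs ! Suc i)) =
      cmp D (src xs (Suc i)) (src xs i) (tgt xs i)
        (cmp D (src xs i) (src xs i) (tgt xs i) (fs ! i) (cmp D (src xs i) (src xs i) (src xs i) (u (src xs i) p) (v (src xs i) p)))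
        (fs ! Suc i)"
    unfolding rmul_def lmul_def
    by (simp add: cmp_assoc[OF wd(5,5,5,6), symmetric] cmp_assoc[OF wd(5,5,5,6) f(2) v[OF wd(5)] cmp_mem(1)[OF wd(5,5,6) u[OF wd(5)] f(1)], symmetric]
        cmp_assoc[OF wd(5,5,5,6) v[OF wd(5)] u[OF wd(5)] f(1)])
  show "fF i xs (jslot_list (Suc n) j p xs fs) = jslot_list n j p (fX i xs) (fF i xs fs)" if "1 \<le> j" "j \<le> i"
  proof (rule nth_equalityI)
    fix k assume "k < length (fF i xs (jslot_list (Suc n) j p xs fs))"
    then have k: "k \<le> n" using i by (simp add: simps)
    then show "fF i xs (jslot_list (Suc n) j p xs fs) ! k = jslot_list n j p (fX i xs) (fF i xs fs) ! k"
      using that i wd(1,2) A1 by (auto simp: simps jmap_def Let_def tgt_Suc)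
  qed (use i in \<open>simp add: simps\<close>)
  show "fF i xs (jslot_list (Suc n) j p xs fs) = jslot_list n (j - 1) p (fX i xs) (fF i xs fs)" if "i + 2 \<le> j" "j \<le> Suc n"
  proof (rule nth_equalityI)
    obtain q where j: "j = Suc (Suc (i + q))" using \<open>i + 2 \<le> j\<close> by (metis add_2_eq_Suc' add_Suc le_iff_add)
    fix k assume "k < length (fF i xs (jslot_list (Suc n) j p xs fs))"
    then have k: "k \<le> n" using i by (simp add: simps)
    then show "fF i xs (jslot_list (Suc n) j p xs fs) ! k = jslot_list n (j - 1) p (fX i xs) (fF i xs fs) ! k"
      using that i wd(1,2) A2 by (auto simp: simps jmap_def Let_def tgt_Suc j)
  qed (use i in \<open>simp add: simps\<close>)
  show "fF i xs (jslot_list (Suc n) (Suc i) p xs fs) = (fF i xs fs)[i :=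
      cmp D (src xs (Suc i)) (src xs i) (tgt xs i)
        (cmp D (src xs i) (src xs i) (tgt xs i) (fs ! i) (cmp D (src xs i) (src xs i) (src xs i) (u (src xs i) p) (v (src xs i) p)))
        (fs ! Suc i)]"
  proof (rule nth_equalityI)
    fix k assume "k < length (fF i xs (jslot_list (Suc n) (Suc i) p xs fs))"
    then have k: "k \<le> n" using i by (simp add: simps)
    then show "fF i xs (jslot_list (Suc n) (Suc i) p xs fs) ! k = (fF i xs fs)[i :=
      cmp D (src xs (Suc i)) (src xs i) (tgt xs i)
        (cmp D (src xs i) (src xs i) (tgt xs i) (fs ! i) (cmp D (src xs i) (src xs i) (src xs i) (u (src xs i) p) (v (src xs i) p)))
        (fs ! Suc i)] ! k"
      using i wd(1,2) A3 by (auto simp: simps jmap_def Let_def tgt_Suc nth_list_update)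
  qed (use i wd(2) in \<open>simp add: simps\<close>)
qed

text \<open>The last coface makes f^(n+1) f^0 the new first arrow and keeps the positions of f^1,
  ..., f^n, so junctions 1 to n keep their numbers. Only for j = 1 does a factor touch the
  composite, namely \<open>u\<close> from the right.\<close>

lemma jslot_last:
  assumes w: "(xs, fs) \<in> cyclic_words D (Suc n)" and j: "1 \<le> j" "j \<le> n"
  shows "fF 0 (rX (Suc n) xs) (rF (Suc n) a xs (jslot_list (Suc n) j p xs fs)) =
    jslot_list n j p (fX 0 (rX (Suc n) xs)) (fF 0 (rX (Suc n) xs) (rF (Suc n) a xs fs))"
proof (rule nth_equalityI)
  note wd = wordD[OF w]
  note simps = length_fF[of _ n] nth_fF[of _ n] length_rF[of _ "Suc n"] nth_rF[of _ "Suc n"] length_jslot nth_jslot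
    length_rX[of _ "Suc n"] src_fX[of _ n] tgt_fX[of _ n] src_rX[of _ "Suc n"] tgt_rX[of _ "Suc n"] less_Suc_eq_le
  show "length (fF 0 (rX (Suc n) xs) (rF (Suc n) a xs (jslot_list (Suc n) j p xs fs))) =
    length (jslot_list n j p (fX 0 (rX (Suc n) xs)) (fF 0 (rX (Suc n) xs) (rF (Suc n) a xs fs)))"
    using wd(1,2) by (simp add: simps)
  fix k assume "k < length (fF 0 (rX (Suc n) xs) (rF (Suc n) a xs (jslot_list (Suc n) j p xs fs)))"
  then have k: "k \<le> n" using wd(1,2) by (simp add: simps)
  have f0: "fs ! 0 \<in> Hom D (src xs 0) (src xs (Suc n))" using wd(4)[of 0] wd(1) by (simp add: tgt_nth src_last)
  have fn: "lact D (src xs (Suc n)) (tgt xs (Suc n)) (S' a) (fs ! Suc n) \<in> Hom D (src xs (Suc n)) (tgt xs (Suc n))"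
    by (rule lact_lin(3)[OF wd(5,6) wd(4)]) simp
  have A: "cmp D (src xs 0) (src xs (Suc n)) (tgt xs (Suc n)) (lact D (src xs (Suc n)) (tgt xs (Suc n)) (S' a) (fs ! Suc n))
        (rmul p (src xs 0) (src xs (Suc n)) (fs ! 0)) =
      rmul p (src xs 0) (tgt xs (Suc n)) (cmp D (src xs 0) (src xs (Suc n)) (tgt xs (Suc n))
        (lact D (src xs (Suc n)) (tgt xs (Suc n)) (S' a) (fs ! Suc n)) (fs ! 0))"
    unfolding rmul_def by (rule cmp_assoc[OF wd(5,5,5,6) u[OF wd(5)] f0 fn, symmetric])
  have e: "xs ! 0 = src xs (Suc n)" "xs ! Suc n = tgt xs (Suc n)" "tgt xs 0 = src xs (Suc n)"
    using wd(1) by (simp_all add: src_last tgt_nth)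
  show "fF 0 (rX (Suc n) xs) (rF (Suc n) a xs (jslot_list (Suc n) j p xs fs)) ! k =
    jslot_list n j p (fX 0 (rX (Suc n) xs)) (fF 0 (rX (Suc n) xs) (rF (Suc n) a xs fs)) ! k"
  proof (cases k)
    case 0
    have "Suc n \<noteq> j - Suc 0" using j by simp
    with 0 show ?thesis using wd(1,2) j A by (simp add: simps e jmap_def Let_def)
  next
    case (Suc q)
    then show ?thesis using wd(1,2) j k by (simp add: simps e jmap_def)
  qed
qed

text \<open>Inserting at junction n + 1 of the word with an appended identity multiplies f^n by
  \<open>u\<close> and turns the identity into \<open>v\<close>. The last coface carries this
  \<open>v\<close> to the front, where its twist is eps(a), and composes it with f^0. The result is
  an insertion at junction 0.\<close>

lemma jslot_wrap:
  assumes w: "(xs, fs) \<in> cyclic_words D n"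
  shows "fF 0 (rX (Suc n) (gX n xs)) (rF (Suc n) a (gX n xs) (jslot_list (Suc n) (Suc n) p (gX n xs) (gF n xs fs))) =
    (jslot_list n 0 p xs fs)[0 := cscale D (counit H a) (jslot_list n 0 p xs fs ! 0)]"
proof (rule nth_equalityI)
  note wd = wordD[OF w]
  note simps = length_fF[of _ n] nth_fF[of _ n] length_rF[of _ "Suc n"] nth_rF[of _ "Suc n"] length_jslot nth_jslot
    length_gF[of _ n] nth_gF[of _ n] length_gX[of _ n] nth_gX[of _ n] src_gX[of _ n] tgt_gX[of _ n]
    length_rX[of _ "Suc n"] src_rX[of _ "Suc n"] tgt_rX[of _ "Suc n"] less_Suc_eq_le
  show "length (fF 0 (rX (Suc n) (gX n xs)) (rF (Suc n) a (gX n xs) (jslot_list (Suc n) (Suc n) p (gX n xs) (gF n xs fs)))) =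
    length ((jslot_list n 0 p xs fs)[0 := cscale D (counit H a) (jslot_list n 0 p xs fs ! 0)])"
    using wd(1,2) by (simp add: simps)
  fix k assume "k < length (fF 0 (rX (Suc n) (gX n xs)) (rF (Suc n) a (gX n xs) (jslot_list (Suc n) (Suc n) p (gX n xs) (gF n xs fs))))"
  then have k: "k \<le> n" using wd(1,2) by (simp add: simps)
  have t: "tgt xs 0 = src xs n" using wd(1) by (simp add: src_last tgt_nth)
  have f0: "fs ! 0 \<in> Hom D (src xs 0) (src xs n)" using wd(4)[of 0] t by simp
  have vi: "lmul p (src xs n) (src xs n) (ident D (src xs n)) = v (src xs n) p"
    unfolding lmul_def using cmp_ident[OF wd(5,5) v[OF wd(5)]] by simp
  have V: "cmp D (src xs 0) (src xs n) (src xs n) (cscale D (counit H a) (v (src xs n) p)) f =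
      cscale D (counit H a) (lmul p (src xs 0) (src xs n) f)" if "f \<in> Hom D (src xs 0) (src xs n)" for f
    unfolding lmul_def by (rule lin_on_scale[OF cmp_lin1[OF wd(5,5,5) that] v[OF wd(5)]])
  show "fF 0 (rX (Suc n) (gX n xs)) (rF (Suc n) a (gX n xs) (jslot_list (Suc n) (Suc n) p (gX n xs) (gF n xs fs))) ! k =
    (jslot_list n 0 p xs fs)[0 := cscale D (counit H a) (jslot_list n 0 p xs fs ! 0)] ! k"
  proof (cases k)
    case 0
    \<comment> \<open>In degree 0 the arrow that \<open>v\<close> is composed with is the one
      already multiplied by \<open>u\<close>.\<close>
    have "(if n = 0 then rmul p (src xs 0) (src xs n) (fs ! 0) else fs ! 0) \<in> Hom D (src xs 0) (src xs n)"
      using f0 rmul_mem[OF wd(5,5) f0] by (split if_split) blast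
    from V[OF this] show ?thesis using wd(1,2) 0 vi t lv[OF wd(5)]
      by (simp add: simps jmap_def Let_def tgt_Suc counit_S' eq_commute[of 0 n])
  next
    case (Suc q)
    then show ?thesis using wd(1,2) k by (simp add: simps jmap_def)
  qed
qed

definition Qop :: "nat \<Rightarrow> nat \<Rightarrow> (('k, 'm, 'o, 'a) chain \<Rightarrow> 'k) \<Rightarrow> ('k, 'm, 'o, 'a) chain \<Rightarrow> 'k" where
  "Qop n j \<phi> = ext n (\<lambda>m xs fs. \<Sum>p\<in>UNIV. ev n \<phi> m xs (jslot_list n j p xs fs))"

lemmas cform_Q = slot_maps.slot_cform[OF jslot, where I = UNIV]

lemma Qop_mem: "\<phi> \<in> cochains H M D n \<Longrightarrow> Qop n j \<phi> \<in> cochains H M D n"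
  unfolding Qop_def by (intro ext_cochain cform_Q cform_ev)

lemma ev_Qop:
  assumes "\<phi> \<in> cochains H M D n" "(xs, fs) \<in> cyclic_words D n"
  shows "ev n (Qop n j \<phi>) m xs fs = (\<Sum>p\<in>UNIV. ev n \<phi> m xs (jslot_list n j p xs fs))"
  unfolding Qop_def by (rule ev_ext[OF _ assms(2)]) (use cform_Q[OF cform_ev[OF assms(1)]] in \<open>simp add: cform_def\<close>)

lemma Qop_lin: "lin_on fscale (cochains H M D n) fscale (cochains H M D n) (Qop n j)"
  using ext_lin[of n n "\<lambda>F m xs fs. \<Sum>p\<in>UNIV. F m xs (jslot_list n j p xs fs)", OF cform_Q]
  by (simp add: Qop_def[abs_def] sum.distrib sum_distrib_left)

lemma ev_coface_last:
  assumes \<phi>: "\<phi> \<in> cochains H M D n" and w: "(xs, fs) \<in> cyclic_words D (Suc n)"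
  shows "ev (Suc n) (coface H M D n (Suc n) \<phi>) m xs fs =
    ca m (\<lambda>a x. ev n \<phi> x (fX 0 (rX (Suc n) xs)) (fF 0 (rX (Suc n) xs) (rF (Suc n) a xs fs)))"
  unfolding coface_last[OF \<phi>] ev_cocyc[OF coface_mem[OF \<phi> le0] w] cycF_def ev_coface[OF \<phi> le0 rF_word[OF w]] ..

lemma coface_mem': "\<phi> \<in> cochains H M D n \<Longrightarrow> i \<le> Suc n \<Longrightarrow> coface H M D n i \<phi> \<in> cochains H M D (Suc n)"
  by (cases "i = Suc n") (simp_all add: coface_mem coface_last cocyc_mem)

lemma Q_inner:
  assumes \<phi>: "\<phi> \<in> cochains H M D n" and i: "i \<le> n" and ij: "1 \<le> j \<and> j \<le> i \<and> j' = j \<or> i + 2 \<le> j \<and> j \<le> Suc n \<and> j' = j - 1"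
  shows "Qop (Suc n) j (coface H M D n i \<phi>) = coface H M D n i (Qop n j' \<phi>)"
proof (rule cochains_eqI)
  fix m xs fs assume w: "(xs, fs) \<in> cyclic_words D (Suc n)"
  have "fF i xs (jslot_list (Suc n) j p xs fs) = jslot_list n j' p (fX i xs) (fF i xs fs)" for p
    using jslot_face(1,2)[OF w i, of j p] ij by auto
  then show "ev (Suc n) (Qop (Suc n) j (coface H M D n i \<phi>)) m xs fs = ev (Suc n) (coface H M D n i (Qop n j' \<phi>)) m xs fs"
    by (simp add: ev_Qop[OF coface_mem[OF \<phi> i] w] ev_coface[OF \<phi> i jslot_word[OF w]]
        ev_coface[OF Qop_mem[OF \<phi>] i w] ev_Qop[OF \<phi> fF_word[OF w i]])
qed (use \<phi> i in \<open>simp_all add: Qop_mem coface_mem\<close>)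

text \<open>The inserted factors meet as f^i u_p v_p f^(i+1). As the form is linear in this slot,
  the sum over p can be taken inside, where it is the identity.\<close>

lemma Q_merge:
  assumes \<phi>: "\<phi> \<in> cochains H M D n" and i: "i \<le> n"
  shows "Qop (Suc n) (Suc i) (coface H M D n i \<phi>) = coface H M D n i \<phi>"
proof (rule cochains_eqI)
  fix m xs fs assume w: "(xs, fs) \<in> cyclic_words D (Suc n)"
  note wd = wordD[OF w] and fw = fF_word[OF w i]
  let ?X = "src xs i"
  have f: "fs ! i \<in> Hom D ?X (tgt xs i)" "fs ! Suc i \<in> Hom D (src xs (Suc i)) ?X"
    using wd(4)[of i] wd(4)[of "Suc i"] i by (simp_all add: tgt_Suc)
  let ?uv = "\<lambda>p. cmp D ?X ?X ?X (u ?X p) (v ?X p)"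
  let ?L = "\<lambda>g. ev n \<phi> m (fX i xs) ((fF i xs fs)[i := cmp D (src xs (Suc i)) ?X (tgt xs i) (cmp D ?X ?X (tgt xs i) (fs ! i) g) (fs ! Suc i)])"
  have m: "mform n (*) UNIV (ev n \<phi>)" using cform_ev[OF \<phi>] by (simp add: cform_def)
  have "lin_on (cscale D) (Hom D (src xs (Suc i)) (tgt xs i)) (*) UNIV (\<lambda>g. ev n \<phi> m (fX i xs) ((fF i xs fs)[i := g]))"
    using mformD(2)[OF m fw i] i wd(1) by (simp add: src_fX tgt_fX)
  from lin_on_comp[OF lin_on_comp[OF cmp_lin2[OF wd(5,5,6) f(1)] cmp_lin1[OF wd(5,5,6) f(2)]] this]
  have L: "lin_on (cscale D) (Hom D ?X ?X) (*) UNIV ?L" .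
  have "ev (Suc n) (Qop (Suc n) (Suc i) (coface H M D n i \<phi>)) m xs fs = (\<Sum>p\<in>UNIV. ?L (?uv p))"
    by (simp add: ev_Qop[OF coface_mem[OF \<phi> i] w] ev_coface[OF \<phi> i jslot_word[OF w]] jslot_face(3)[OF w i])
  also have "\<dots> = ?L (\<Sum>p\<in>UNIV. ?uv p)"
    by (rule lin_on_sum_fin[OF cvs Hom_sub[OF wd(5,5)] L, symmetric]) (rule cmp_mem(1)[OF wd(5,5,5) v[OF wd(5)] u[OF wd(5)]])
  also have "(\<Sum>p\<in>UNIV. ?uv p) = ident D ?X" by (rule uv[OF wd(5)])
  also have "cmp D ?X ?X (tgt xs i) (fs ! i) (ident D ?X) = fs ! i" using cmp_ident[OF wd(5,6) f(1)] by simp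
  also have "(fF i xs fs)[i := cmp D (src xs (Suc i)) ?X (tgt xs i) (fs ! i) (fs ! Suc i)] = fF i xs fs"
    using wd(2) i by (intro nth_equalityI) (auto simp: length_fF nth_fF nth_list_update less_Suc_eq_le)
  also have "ev n \<phi> m (fX i xs) (fF i xs fs) = ev (Suc n) (coface H M D n i \<phi>) m xs fs" by (rule ev_coface[OF \<phi> i w, symmetric])
  finally show "ev (Suc n) (Qop (Suc n) (Suc i) (coface H M D n i \<phi>)) m xs fs = ev (Suc n) (coface H M D n i \<phi>) m xs fs" .
qed (use \<phi> i in \<open>simp_all add: Qop_mem coface_mem\<close>)

lemma Q_last:
  assumes \<phi>: "\<phi> \<in> cochains H M D n" and j: "1 \<le> j" "j \<le> n"
  shows "Qop (Suc n) j (coface H M D n (Suc n) \<phi>) = coface H M D n (Suc n) (Qop n j \<phi>)"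
proof (rule cochains_eqI)
  fix m xs fs assume w: "(xs, fs) \<in> cyclic_words D (Suc n)"
  show "ev (Suc n) (Qop (Suc n) j (coface H M D n (Suc n) \<phi>)) m xs fs = ev (Suc n) (coface H M D n (Suc n) (Qop n j \<phi>)) m xs fs"
    unfolding ev_Qop[OF coface_mem'[OF \<phi> order_refl] w] ev_coface_last[OF \<phi> jslot_word[OF w]] ev_coface_last[OF Qop_mem[OF \<phi>] w]
      ev_Qop[OF \<phi> fF_word[OF rF_word[OF w] le0]] ca_sum_fin jslot_last[OF w j] ..
qed (use \<phi> in \<open>simp_all add: Qop_mem coface_mem'\<close>)

lemma Q_wrap:
  assumes \<phi>: "\<phi> \<in> cochains H M D n"
  shows "codegen M D n n (Qop (Suc n) (Suc n) (coface H M D n (Suc n) \<phi>)) = Qop n 0 \<phi>"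
proof (rule cochains_eqI)
  have c: "coface H M D n (Suc n) \<phi> \<in> cochains H M D (Suc n)" by (rule coface_mem'[OF \<phi> order_refl])
  show "codegen M D n n (Qop (Suc n) (Suc n) (coface H M D n (Suc n) \<phi>)) \<in> cochains H M D n"
    by (rule codegen_mem[OF Qop_mem[OF c] order_refl])
  fix m xs fs assume w: "(xs, fs) \<in> cyclic_words D n"
  note wd = wordD[OF w] and gw = gF_word[OF w order_refl]
  have m: "mform n (*) UNIV (ev n \<phi>)" using cform_ev[OF \<phi>] by (simp add: cform_def)
  have "ca m (\<lambda>a x. ev n \<phi> x xs ((jslot_list n 0 p xs fs)[0 := cscale D (counit H a) (jslot_list n 0 p xs fs ! 0)])) =
      ev n \<phi> m xs (jslot_list n 0 p xs fs)" for p
    using ca_counit_slot[OF m jslot_word[OF w] le0 wordD(4)[OF jslot_word[OF w] le0]] by simp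
  then show "ev n (codegen M D n n (Qop (Suc n) (Suc n) (coface H M D n (Suc n) \<phi>))) m xs fs = ev n (Qop n 0 \<phi>) m xs fs"
    unfolding ev_codegen[OF Qop_mem[OF c] order_refl w] ev_Qop[OF c gw] ev_coface_last[OF \<phi> jslot_word[OF gw]]
      fX_rX_gX[OF wd(1)] jslot_wrap[OF w] ev_Qop[OF \<phi> w] by simp
qed (rule Qop_mem[OF \<phi>])

text \<open>Simultaneous insertion at all junctions. Index i of \<open>rs\<close> belongs to the
  junction after f^i, so f^i gets \<open>u\<close> with index i and \<open>v\<close> with the index
  before it; for i = 0 that index is the last one.\<close>

definition split_all :: "nat \<Rightarrow> 'i list \<Rightarrow> 'o list \<Rightarrow> 'a list \<Rightarrow> 'a list" where
  "split_all n rs xs fs = map (\<lambda>i. lmul (rs ! (if i = 0 then n else i - 1)) (src xs i) (tgt xs i)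
     (rmul (rs ! i) (src xs i) (tgt xs i) (fs ! i))) [0..<Suc n]"

text \<open>The words met when Q_j ... Q_1 is evaluated. Evaluation reverses the order: the operator
  applied last to the cochain modifies the word first, so junction j is treated before the lower
  ones.\<close>

fun isplit :: "nat \<Rightarrow> nat \<Rightarrow> 'i list \<Rightarrow> 'o list \<Rightarrow> 'a list \<Rightarrow> 'a list" where
  "isplit n 0 ps xs fs = fs"
| "isplit n (Suc j) ps xs fs = isplit n j ps xs (jslot_list n (Suc j) (ps ! j) xs fs)"

lemma isplit_nth:
  assumes "(xs, fs) \<in> cyclic_words D n" "j \<le> n"
  shows "length (isplit n j ps xs fs) = Suc n"
    and "i \<le> n \<Longrightarrow> isplit n j ps xs fs ! i = (let g = (if i < j then rmul (ps ! i) (src xs i) (tgt xs i) (fs ! i) else fs ! i) in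
      if 1 \<le> i \<and> i \<le> j then lmul (ps ! (i - 1)) (src xs i) (tgt xs i) g else g)"
proof -
  have "length (isplit n j ps xs fs) = Suc n \<and> (\<forall>i\<le>n. isplit n j ps xs fs ! i =
      (let g = (if i < j then rmul (ps ! i) (src xs i) (tgt xs i) (fs ! i) else fs ! i) in
      if 1 \<le> i \<and> i \<le> j then lmul (ps ! (i - 1)) (src xs i) (tgt xs i) g else g))"
    using assms
  proof (induction j arbitrary: fs)
    case 0
    then show ?case by (simp add: wordD Let_def)
  next
    case (Suc j)
    note w = Suc.prems(1)
    have IH: "length (isplit n (Suc j) ps xs fs) = Suc n"
      "\<And>i. i \<le> n \<Longrightarrow> isplit n (Suc j) ps xs fs ! i =
      (let g = (if i < j then rmul (ps ! i) (src xs i) (tgt xs i) (jslot_list n (Suc j) (ps ! j) xs fs ! i) else jslot_list n (Suc j) (ps ! j) xs fs ! i) in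
      if 1 \<le> i \<and> i \<le> j then lmul (ps ! (i - 1)) (src xs i) (tgt xs i) g else g)"
      using Suc.IH[OF jslot_word[OF w]] Suc.prems(2) by simp_all
    show ?case
    proof (intro conjI allI impI IH(1))
      fix i assume i: "i \<le> n"
      consider "i < j" | "i = j" | "i = Suc j" | "Suc j < i" by linarith
      then show "isplit n (Suc j) ps xs fs ! i = (let g = (if i < Suc j then rmul (ps ! i) (src xs i) (tgt xs i) (fs ! i) else fs ! i) in
        if 1 \<le> i \<and> i \<le> Suc j then lmul (ps ! (i - 1)) (src xs i) (tgt xs i) g else g)"
        by cases (unfold IH(2)[OF i] nth_jslot[OF i] jmap_def Let_def, simp_all)
    qed
  qed
  then show "length (isplit n j ps xs fs) = Suc n"
    "i \<le> n \<Longrightarrow> isplit n j ps xs fs ! i = (let g = (if i < j then rmul (ps ! i) (src xs i) (tgt xs i) (fs ! i) else fs ! i) in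
      if 1 \<le> i \<and> i \<le> j then lmul (ps ! (i - 1)) (src xs i) (tgt xs i) g else g)" by blast+
qed

lemma isplit_cong: "take j ps = take j ps' \<Longrightarrow> j \<le> length ps \<Longrightarrow> j \<le> length ps' \<Longrightarrow> isplit n j ps xs fs = isplit n j ps' xs fs"
proof (induction j arbitrary: fs)
  case (Suc j)
  have "ps ! j = ps' ! j" using Suc.prems by (metis lessI nth_take)
  moreover have "take j ps = take j ps'" using Suc.prems(1) by (metis take_take min.absorb1 le_SucI order_refl)
  ultimately show ?case using Suc by simp
qed simp

lemma split_all_isplit:
  assumes w: "(xs, fs) \<in> cyclic_words D n" and ps: "length ps = n"
  shows "isplit n n ps xs (jslot_list n 0 p xs fs) = split_all n (ps @ [p]) xs fs"
proof (rule nth_equalityI)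
  note wd = wordD[OF w]
  have len: "length (isplit n n ps xs (jslot_list n 0 p xs fs)) = Suc n"
    by (rule isplit_nth(1)[OF jslot_word[OF w] order_refl])
  show "length (isplit n n ps xs (jslot_list n 0 p xs fs)) = length (split_all n (ps @ [p]) xs fs)"
    by (simp add: len split_all_def)
  fix i assume "i < length (isplit n n ps xs (jslot_list n 0 p xs fs))"
  then have i: "i \<le> n" using len by simp
  have np: "(ps @ [p]) ! n = p" using ps by (metis nth_append_length)
  \<comment> \<open>The insertion at junction 0 comes first and attaches \<open>v\<close> to f^0
    before \<open>u\<close> arrives from junction 1, whereas \<open>split_all\<close> attaches
    \<open>u\<close> first. For 0 < n the two orders have to be reconciled by associativity.\<close>
  have comm: "rmul q (src xs i) (tgt xs i) (lmul p (src xs i) (tgt xs i) (fs ! i)) =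
      lmul p (src xs i) (tgt xs i) (rmul q (src xs i) (tgt xs i) (fs ! i))" for q
    unfolding rmul_def lmul_def by (rule cmp_assoc[OF wd(5,5,6,6) u[OF wd(5)] wd(4)[OF i] v[OF wd(6)]])
  note e = isplit_nth(2)[OF jslot_word[OF w] order_refl i] nth_jslot[OF i] jmap_def Let_def
  have e2: "split_all n (ps @ [p]) xs fs ! i = lmul ((ps @ [p]) ! (if i = 0 then n else i - 1)) (src xs i) (tgt xs i)
     (rmul ((ps @ [p]) ! i) (src xs i) (tgt xs i) (fs ! i))" using i by (simp add: split_all_def del: upt_Suc)
  have np': "(ps @ [p]) ! k = ps ! k" if "k < n" for k using that ps by (simp add: nth_append)
  consider "i = 0" "i = n" | "i = 0" "i < n" | "0 < i" "i < n" | "0 < i" "i = n" using i by linarith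
  then show "isplit n n ps xs (jslot_list n 0 p xs fs) ! i = split_all n (ps @ [p]) xs fs ! i"
    by cases (unfold e e2, use np np' comm in simp_all)
qed

text \<open>The form in which the junction homotopy is applied: a cochain whose value at a word is
  the value of z summed over all splittings of that word is cohomologous to z. Such a cochain is
  identified with Q_0 Q_n ... Q_1 z by evaluating both on words.\<close>

lemma split_all_homotopy:
  assumes z: "z \<in> cocycles (hoc (C_H H M D)) n" and \<phi>: "\<phi> \<in> cochains H M D n"
    and ev_\<phi>: "\<And>m xs fs. (xs, fs) \<in> cyclic_words D n \<Longrightarrow>
      ev n \<phi> m xs fs = (\<Sum>rs | length rs = Suc n. ev n z m xs (split_all n rs xs fs))"
  shows "z - \<phi> \<in> coboundaries (hoc (C_H H M D)) n"
proof -
  interpret C: cocyclic_loc "C_H H M D" by (rule cocyclic_loc.intro[OF cocyclic_module_C_H])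
  have sel: "Cob (C_H H M D) = cochains H M D" "scl (C_H H M D) = fscale" "cface (C_H H M D) = coface H M D"
    "cdegen (C_H H M D) = codegen M D" by (simp_all add: C_H_def)
  have zc: "z \<in> cochains H M D n" using z by (simp add: cocycles_def hoc_def sel)
  have J0: "C.jfold Qop k 0 x = x" and J_Suc: "C.jfold Qop k (Suc j) x = Qop k (Suc j) (C.jfold Qop k j x)" for k j x
    by (rule C.jfold_simps[of Qop]; simp only: sel; rule Qop_lin Q_inner Q_merge Q_last Q_wrap; simp)+
  let ?J = "C.jfold Qop"
  have J: "?J n j z \<in> cochains H M D n" for j
    by (induction j) (simp_all add: J0 J_Suc Qop_mem zc)
  have ev_J: "(xs, fs) \<in> cyclic_words D n \<Longrightarrow> ev n (?J n j z) m xs fs = (\<Sum>ps | length ps = j. ev n z m xs (isplit n j ps xs fs))"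
    for m j xs fs
  proof (induction j arbitrary: fs)
    case 0
    then show ?case by (simp add: J0)
  next
    case (Suc j)
    have e: "isplit n (Suc j) (ps @ [p]) xs fs = isplit n j ps xs (jslot_list n (Suc j) p xs fs)" if "length ps = j" for ps p
      using that isplit_cong[of j "ps @ [p]" ps] by (simp add: nth_append)
    show ?case
      unfolding J_Suc ev_Qop[OF J Suc.prems] Suc.IH[OF jslot_word[OF Suc.prems]] sum_lists_snoc
      by (subst sum.swap) (simp add: e del: isplit.simps)
  qed
  have "z - Qop n 0 (?J n n z) \<in> coboundaries (hoc (C_H H M D)) n"
    by (rule C.junction_homotopy[of Qop, OF _ _ _ _ _ _ z]; simp only: sel; rule Qop_lin Q_inner Q_merge Q_last Q_wrap; simp)
  also have "Qop n 0 (?J n n z) = \<phi>"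
  proof (rule cochains_eqI[OF Qop_mem[OF J] \<phi>])
    fix m xs fs assume w: "(xs, fs) \<in> cyclic_words D n"
    show "ev n (Qop n 0 (?J n n z)) m xs fs = ev n \<phi> m xs fs"
      unfolding ev_Qop[OF J w] ev_J[OF jslot_word[OF w]] ev_\<phi>[OF w] sum_lists_snoc
      by (subst sum.swap) (simp add: split_all_isplit[OF w])
  qed
  finally show ?thesis .
qed

end

end

section \<open>The inclusion and the trace\<close>

lemma sum_lists_rotate:
  fixes f :: "'q::finite list \<Rightarrow> 'z::comm_monoid_add"
  shows "(\<Sum>rs | length rs = Suc n. f (rX n rs)) = (\<Sum>rs | length rs = Suc n. f rs)"
proof (rule sum.reindex_bij_witness[of _ "\<lambda>rs. tl rs @ [hd rs]" "rX n"])
  fix rs :: "'q list" assume "rs \<in> {rs. length rs = Suc n}"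
  then have rs: "length rs = Suc n" by simp
  show "tl (rX n rs) @ [hd (rX n rs)] = rs"
    using rs by (simp add: rX_def take_Suc_conv_app_nth[symmetric])
  show "rX n (tl rs @ [hd rs]) = rs" using rs by (cases rs) (simp_all add: rX_def nth_append)
qed (auto simp: rX_def)

lemma sum_list_sum: "(\<Sum>x\<leftarrow>xs. \<Sum>r\<in>R. g r x) = (\<Sum>r\<in>R. \<Sum>x\<leftarrow>xs. g r x)"
  by (induction xs) (simp_all add: sum.distrib)

lemma tensor_lifts_sum: "tensor_lifts Ps (\<lambda>ps. \<Sum>r\<in>R. F r ps) ts = (\<Sum>r\<in>R. tensor_lifts Ps (F r) ts)"
proof (induction Ps arbitrary: F ts)
  case (Cons P Ps)
  then show ?case by (cases ts) (simp_all add: tensor_lift_rep sum_list_sum)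
qed simp

lemma elem_mat_nth: "elem_mat p q $ i $ j = (if i = p \<and> j = q then 1 else 0)"
  by (simp add: elem_mat_def)

lemma elem_mat_mult: "elem_mat p q ** elem_mat q s = (elem_mat p s :: 'k::field ^ 'r::finite ^ 'r)"
  by (simp add: elem_mat_def matrix_matrix_mult_def vec_eq_iff if_distrib[of "\<lambda>x. x * _"] if_distrib[of "\<lambda>x. _ * x"] cong: if_cong)

lemma elem_mat_sum: "(\<Sum>p\<in>UNIV. elem_mat p p) = (mat 1 :: 'k::field ^ 'r::finite ^ 'r)"
  by (auto simp: elem_mat_def mat_def vec_eq_iff intro!: sum.neutral)

context slot_maps
begin

lemma ev_HomH_pb:
  assumes "\<phi> \<in> cochains H M D2 n" "(xs, fs) \<in> cyclic_words D1 n" and "\<And>t. t \<in> s.MCNs n \<Longrightarrow> g t = pb t"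
  shows "s.ev n (HomH M D1 n g \<phi>) m xs fs = (\<Sum>p\<in>I. t.ev n \<phi> m xs (slot p xs fs))"
  unfolding ev_HomH[OF assms(2)] assms(3)[OF s.mword_mem[OF assms(2)]] by (rule ev_pb[OF assms(1,2)])

end

context hcat_loc
begin

lemma mform_zero_slot:
  assumes m: "mform n (*) UNIV F" and w: "(xs, fs) \<in> cyclic_words D n" and i: "i \<le> n" and z: "fs ! i = 0"
  shows "F m xs fs = 0"
  using lin_on_zero[OF cvs Hom_sub[OF wordD(5,6)[OF w]] mformD(2)[OF m w i]] z
  by (metis list_update_id)

end

locale mat_loc = hcat_loc H M D
  for H :: "('k::field, 'h::ring_1) hopf" and M :: "('k, 'h, 'm::ab_group_add) hmodcomod"
    and D :: "('k, 'h, 'o, 'a::ab_group_add) hcat" +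
  fixes DM :: "('k, 'h, 'o, ('a \<times> ('k ^ 'r::finite ^ 'r), 'k) tensor) hcat" and e :: 'r
  assumes DM: "DM = mat_cat TYPE('r) D"
begin

sublocale d: hcat_loc H M DM
  by unfold_locales (simp add: DM H_category_mat_cat)

lemmas DM_simps = mat_cat_simps[where 'r = 'r, folded DM]

lemma mcomp_cmp:
  assumes "X \<in> Obj D" "Y \<in> Obj D" "Z \<in> Obj D" "s \<in> Hom DM Y Z" "t \<in> Hom DM X Y"
  shows "mcomp X Z p q (cmp DM X Y Z s t) = (\<Sum>r\<in>UNIV. cmp D X Y Z (mcomp Y Z p r s) (mcomp X Y r q t))"
  using mmul_mcomp[OF assms(1-3)] assms(4,5) by (simp add: DM_simps)

lemma mcomp_lact:
  assumes "X \<in> Obj D" "Y \<in> Obj D" "t \<in> Hom DM X Y"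
  shows "mcomp X Y p q (lact DM X Y h t) = lact D X Y h (mcomp X Y p q t)"
  using mact_mcomp[OF assms(1,2)] assms by (simp add: DM_simps)

lemma mcomp_ident: "X \<in> Obj D \<Longrightarrow> mcomp X X p q (ident DM X) = (if p = q then ident D X else 0)"
  by (simp add: DM_simps mcomp_pure ident_mem mat_def)

definition incG :: "unit \<Rightarrow> nat \<Rightarrow> 'o \<Rightarrow> 'o \<Rightarrow> 'a \<Rightarrow> ('a \<times> ('k ^ 'r ^ 'r), 'k) tensor" where
  "incG _ _ X Y f = pure (HomMat D X Y) (f, elem_mat e e)"

text \<open>Arrow i contributes the entry with row index i - 1 and column index i of the index word.
  Prepending the last index gives arrow 0 its row index and closes the path, as a trace
  requires.\<close>

definition trG :: "nat \<Rightarrow> 'r list \<Rightarrow> nat \<Rightarrow> 'o \<Rightarrow> 'o \<Rightarrow> ('a \<times> ('k ^ 'r ^ 'r), 'k) tensor \<Rightarrow> 'a" where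
  "trG n rs i X Y t = mcomp X Y ((rs ! n # rs) ! i) (rs ! i) t"

sublocale inc: slot_maps H M D DM n "{()}" incG for n
  by unfold_locales (simp_all add: DM_simps incG_def[abs_def] pure_HMs_lin mact_pure)

sublocale tr: slot_maps H M DM D n "{rs. length rs = Suc n}" "trG n" for n
  by unfold_locales (simp_all add: DM_simps trG_def[abs_def] mcomp_lin mact_mcomp)

abbreviation inc_list :: "nat \<Rightarrow> 'o list \<Rightarrow> 'a list \<Rightarrow> ('a \<times> ('k ^ 'r ^ 'r), 'k) tensor list" where
  "inc_list n \<equiv> inc.slot n ()"

abbreviation tr_list :: "nat \<Rightarrow> 'r list \<Rightarrow> 'o list \<Rightarrow> ('a \<times> ('k ^ 'r ^ 'r), 'k) tensor list \<Rightarrow> 'a list" where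
  "tr_list n \<equiv> tr.slot n"

lemma inc_chain_eq: "inc_chain M D e n = inc.pb n"
  unfolding inc_chain_def inc.pb_def inc.slot_def incG_def DM[symmetric] by simp

lemma ev_inc:
  assumes "\<phi> \<in> cochains H M DM n" "(xs, fs) \<in> cyclic_words D n"
  shows "ev n (inc_cochain M D e n \<phi>) m xs fs = d.ev n \<phi> m xs (inc_list n xs fs)"
  unfolding inc_cochain_def by (subst inc.ev_HomH_pb[OF assms]) (simp_all add: inc_chain_eq)

lemma inc_hom: "right_H_hom H M D DM n (inc_chain M D e n)"
  unfolding inc_chain_eq by (rule inc.pb_hom)

lemma inc_mem: "\<phi> \<in> cochains H M DM n \<Longrightarrow> inc_cochain M D e n \<phi> \<in> cochains H M D n"
  unfolding inc_cochain_def by (rule inc.HomH_cochain[OF inc_hom])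

text \<open>Composition is preserved because E_ee is idempotent.\<close>

lemma inc_face:
  assumes w: "(xs, fs) \<in> cyclic_words D (Suc n)" and i: "i \<le> n"
  shows "d.fF i xs (inc_list (Suc n) xs fs) = inc_list n (fX i xs) (fF i xs fs)"
proof (rule nth_equalityI)
  note wd = wordD[OF w]
  note simps = length_fF[of _ n] nth_fF[of _ n] d.length_fF[of _ n] d.nth_fF[of _ n] inc.length_slot inc.nth_slot
    src_fX[of _ n] tgt_fX[of _ n] less_Suc_eq_le
  have f: "fs ! i \<in> Hom D (src xs i) (tgt xs i)" "fs ! Suc i \<in> Hom D (src xs (Suc i)) (src xs i)"
    using wd(4)[of i] wd(4)[of "Suc i"] i by (simp_all add: tgt_Suc)
  fix k assume "k < length (d.fF i xs (inc_list (Suc n) xs fs))"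
  then have k: "k \<le> n" using i by (simp add: simps)
  then show "d.fF i xs (inc_list (Suc n) xs fs) ! k = inc_list n (fX i xs) (fF i xs fs) ! k"
    using i wd(1,2) f by (auto simp: simps incG_def tgt_Suc DM_simps mmul_pure[OF wd(5,5,6)] elem_mat_mult)
qed (use i in \<open>simp add: d.length_fF[of _ n] inc.length_slot\<close>)

lemma inc_rot:
  assumes w: "(xs, fs) \<in> cyclic_words D n"
  shows "d.rF n a xs (inc_list n xs fs) = inc_list n (rX n xs) (rF n a xs fs)"
proof (rule nth_equalityI)
  note wd = wordD[OF w]
  note simps = length_rF[of _ n] nth_rF[of _ n] d.length_rF[of _ n] d.nth_rF[of _ n] inc.length_slot inc.nth_slot
    src_rX[of _ n] tgt_rX[of _ n] less_Suc_eq_le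
  have e: "xs ! 0 = src xs n" "xs ! n = tgt xs n" using wd(1) by (simp_all add: src_last tgt_nth)
  fix k assume "k < length (d.rF n a xs (inc_list n xs fs))"
  then have k: "k \<le> n" by (simp add: simps)
  then show "d.rF n a xs (inc_list n xs fs) ! k = inc_list n (rX n xs) (rF n a xs fs) ! k"
    using wd(1,2) wd(4)[of n] wd(5,6) by (simp add: simps incG_def e DM_simps mact_pure)
qed (simp add: d.length_rF[of _ n] inc.length_slot)

theorem precocyclic_inc: "precocyclic_morphism (C_H H M DM) (C_H H M D) (inc_cochain M D e)"
  unfolding precocyclic_morphism_def
proof (intro conjI allI ballI impI; (simp only: C_H_def cocyclic.simps)?)
  show "lin_on fscale (cochains H M DM n) fscale (cochains H M D n) (inc_cochain M D e n)" for n
    unfolding inc_cochain_def[abs_def] by (rule inc.HomH_lin[OF inc_hom])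
  fix n \<phi> assume \<phi>: "\<phi> \<in> cochains H M DM n"
  show "inc_cochain M D e (Suc n) (coface H M DM n i \<phi>) = coface H M D n i (inc_cochain M D e n \<phi>)" if i: "i \<le> n" for i
  proof (rule cochains_eqI[OF inc_mem[OF d.coface_mem[OF \<phi> i]] coface_mem[OF inc_mem[OF \<phi>] i]])
    fix m xs fs assume w: "(xs, fs) \<in> cyclic_words D (Suc n)"
    show "ev (Suc n) (inc_cochain M D e (Suc n) (coface H M DM n i \<phi>)) m xs fs = ev (Suc n) (coface H M D n i (inc_cochain M D e n \<phi>)) m xs fs"
      unfolding ev_inc[OF d.coface_mem[OF \<phi> i] w] ev_coface[OF inc_mem[OF \<phi>] i w] d.ev_coface[OF \<phi> i inc.slot_word[OF w]]
        ev_inc[OF \<phi> fF_word[OF w i]] inc_face[OF w i] ..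
  qed
  show "inc_cochain M D e n (cocyc H M DM n \<phi>) = cocyc H M D n (inc_cochain M D e n \<phi>)"
  proof (rule cochains_eqI[OF inc_mem[OF d.cocyc_mem[OF \<phi>]] cocyc_mem[OF inc_mem[OF \<phi>]]])
    fix m xs fs assume w: "(xs, fs) \<in> cyclic_words D n"
    show "ev n (inc_cochain M D e n (cocyc H M DM n \<phi>)) m xs fs = ev n (cocyc H M D n (inc_cochain M D e n \<phi>)) m xs fs"
      unfolding ev_inc[OF d.cocyc_mem[OF \<phi>] w] ev_cocyc[OF inc_mem[OF \<phi>] w] d.ev_cocyc[OF \<phi> inc.slot_word[OF w]]
        cycF_def d.cycF_def ev_inc[OF \<phi> rF_word[OF w]] inc_rot[OF w] ..
  qed
qed (rule cocyclic_module_C_H[unfolded C_H_def] d.cocyclic_module_C_H[unfolded C_H_def])+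

text \<open>Expands the (p, q) entry of B^0 ... B^n A over index paths starting at p. By linearity
  each scalar entry is absorbed into its arrow, which makes the arrow an entry \<open>mcomp\<close>.
  The empty product is A, and \<open>W\<close> is arbitrary so that the induction can absorb the
  leading arrow into it.\<close>

lemma tensor_lifts_entries:
  fixes A :: "'k ^ 'r ^ 'r"
  assumes W: "\<And>us i. length us = length L \<Longrightarrow> (\<And>j. j < length L \<Longrightarrow> us ! j \<in> Hom D (fst (L ! j)) (snd (L ! j))) \<Longrightarrow> i < length L \<Longrightarrow>
      lin_on (cscale D) (Hom D (fst (L ! i)) (snd (L ! i))) fscale UNIV (\<lambda>g. W (us[i := g]))"
    and L: "set L \<subseteq> Obj D \<times> Obj D" and ts: "length ts = length L"
      "\<And>j. j < length L \<Longrightarrow> ts ! j \<in> HMs (fst (L ! j)) (snd (L ! j))"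
  shows "tensor_lifts (map (\<lambda>(X, Y). HomMat D X Y) L) (\<lambda>ps. fscale (foldr (**) (map snd ps) A $ p $ q) (W (map fst ps))) ts =
    (\<Sum>rs | length rs = length L. fscale (A $ last (p # rs) $ q)
       (W (map (\<lambda>i. mcomp (fst (L ! i)) (snd (L ! i)) ((p # rs) ! i) (rs ! i) (ts ! i)) [0..<length L]) :: 'z \<Rightarrow> 'k))"
    (is "_ = ?S L p W ts")
  using assms
proof (induction L arbitrary: p W ts)
  case Nil
  then show ?case by simp
next
  case (Cons XY L)
  obtain X Y where XY: "XY = (X, Y)" by (cases XY)
  obtain t ts' where ts: "ts = t # ts'" using Cons.prems(3) by (cases ts) auto
  have X: "X \<in> Obj D" "Y \<in> Obj D" and L: "set L \<subseteq> Obj D \<times> Obj D" using Cons.prems(2) XY by auto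
  have t: "t \<in> HMs X Y" using Cons.prems(4)[of 0] ts XY by simp
  have ts': "length ts' = length L" "\<And>j. j < length L \<Longrightarrow> ts' ! j \<in> HMs (fst (L ! j)) (snd (L ! j))"
    using Cons.prems(3) Cons.prems(4)[of "Suc _"] ts by auto
  let ?M = "\<lambda>r rs. map (\<lambda>i. mcomp (fst (L ! i)) (snd (L ! i)) ((r # rs) ! i) (rs ! i) (ts' ! i)) [0..<length L]"
  interpret F: vector_space "fscale :: 'k \<Rightarrow> ('z \<Rightarrow> 'k) \<Rightarrow> _" by (rule vector_space_fscale)
  have W1: "lin_on (cscale D) (Hom D X Y) fscale UNIV (\<lambda>g. W (g # us))"
    if us: "length us = length L" "\<And>j. j < length L \<Longrightarrow> us ! j \<in> Hom D (fst (L ! j)) (snd (L ! j))" for us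
  proof -
    have "(0 # us) ! j \<in> Hom D (fst ((XY # L) ! j)) (snd ((XY # L) ! j))" if "j < length (XY # L)" for j
      using that us(2) XY c.subspace_0[OF Hom_sub[OF X]] by (cases j) auto
    from Cons.prems(1)[of "0 # us" 0, OF _ this] us(1) XY show ?thesis by simp
  qed
  \<comment> \<open>The leading arrow and its matrix entry \<open>c\<close> become part of the
    function to which the induction hypothesis is applied, and the path of the tail starts at the
    column index \<open>r\<close> of the leading matrix.\<close>
  have IH: "tensor_lifts (map (\<lambda>(X, Y). HomMat D X Y) L) (\<lambda>ps. fscale (foldr (**) (map snd ps) A $ r $ q) (fscale c (W (f # map fst ps)))) ts' =
      (\<Sum>rs | length rs = length L. fscale (A $ last (r # rs) $ q) (fscale c (W (f # ?M r rs))))" if f: "f \<in> Hom D X Y" for f r c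
  proof (rule Cons.IH[OF _ L ts', of "\<lambda>us. fscale c (W (f # us))"])
    fix us i assume us: "length us = length L" "\<And>j. j < length L \<Longrightarrow> us ! j \<in> Hom D (fst (L ! j)) (snd (L ! j))" and i: "i < length L"
    show "lin_on (cscale D) (Hom D (fst (L ! i)) (snd (L ! i))) fscale UNIV (\<lambda>g. fscale c (W (f # us[i := g])))"
    proof -
      have "(f # us) ! j \<in> Hom D (fst ((XY # L) ! j)) (snd ((XY # L) ! j))" if "j < length (XY # L)" for j
        using that us(2) f XY by (cases j) auto
      from Cons.prems(1)[of "f # us" "Suc i", OF _ this] us(1) i
      have "lin_on (cscale D) (Hom D (fst (L ! i)) (snd (L ! i))) fscale UNIV (\<lambda>g. W (f # us[i := g]))" by simp
      then show ?thesis by (simp add: lin_on_def F.scale_right_distrib F.scale_left_commute)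
    qed
  qed
  have Mw: "length (?M r rs) = length L" "\<And>j. j < length L \<Longrightarrow> ?M r rs ! j \<in> Hom D (fst (L ! j)) (snd (L ! j))" for r rs
  proof -
    show "?M r rs ! j \<in> Hom D (fst (L ! j)) (snd (L ! j))" if "j < length L" for j
      using subsetD[OF L nth_mem[OF that]] ts'(2)[OF that] that by (simp add: mcomp_mem mem_Times_iff)
  qed simp
  note rt = rep[OF t]
  have rf: "f \<in> Hom D X Y" if "(f, B) \<in> set (rep (HomMat D X Y) t)" for f B
    using rt(1) that by (auto simp: HomMat_def fst_bi)
  have E: "fscale ((B ** C) $ p $ q) w = (\<Sum>r\<in>UNIV. fscale (C $ r $ q) (fscale (B $ p $ r) w))"
    for B C :: "'k ^ 'r ^ 'r" and w :: "'z \<Rightarrow> 'k"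
    by (simp add: matrix_matrix_mult_def F.scale_sum_left mult.commute)
  have SL: "fscale c (\<Sum>x\<leftarrow>xs. g x) = (\<Sum>x\<leftarrow>xs. fscale c (g x))" for c and xs :: "'y list" and g :: "'y \<Rightarrow> 'z \<Rightarrow> 'k"
    by (induction xs) (simp_all add: fscale_def fun_eq_iff distrib_left)
  let ?S = "\<lambda>r rs f B. fscale (A $ last (r # rs) $ q) (W (cscale D (B $ p $ r) f # ?M r rs))"
  have "tensor_lifts (map (\<lambda>(X, Y). HomMat D X Y) L) (\<lambda>ps. fscale ((B ** foldr (**) (map snd ps) A) $ p $ q) (W (f # map fst ps))) ts' =
      (\<Sum>r\<in>UNIV. \<Sum>rs | length rs = length L. ?S r rs f B)" if f: "f \<in> Hom D X Y" for f B
  proof -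
    have "W (cscale D c f # ?M r rs) = fscale c (W (f # ?M r rs))" for c r rs
      by (rule lin_on_scale[OF W1[OF Mw] f])
    then show ?thesis unfolding E tensor_lifts_sum IH[OF f] by simp
  qed
  then have "tensor_lifts (map (\<lambda>(X, Y). HomMat D X Y) (XY # L)) (\<lambda>ps. fscale (foldr (**) (map snd ps) A $ p $ q) (W (map fst ps))) ts =
      (\<Sum>x\<leftarrow>rep (HomMat D X Y) t. \<Sum>r\<in>UNIV. \<Sum>rs | length rs = length L. ?S r rs (fst x) (snd x))"
    using rf by (simp add: XY ts tensor_lift_rep, intro arg_cong[of _ _ sum_list]) auto
  also have "\<dots> = (\<Sum>rs | length rs = length L. \<Sum>r\<in>UNIV. fscale (A $ last (r # rs) $ q) (\<Sum>x\<leftarrow>rep (HomMat D X Y) t. W (cscale D (snd x $ p $ r) (fst x) # ?M r rs)))"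
    unfolding sum_list_sum by (subst sum.swap) (simp add: SL)
  also have "\<dots> = (\<Sum>rs | length rs = length L. \<Sum>r\<in>UNIV. fscale (A $ last (r # rs) $ q) (W (mcomp X Y p r t # ?M r rs)))"
  proof -
    have "W (mcomp X Y p r t # us) = (\<Sum>x\<leftarrow>rep (HomMat D X Y) t. W (cscale D (snd x $ p $ r) (fst x) # us))"
      if us: "length us = length L" "\<And>j. j < length L \<Longrightarrow> us ! j \<in> Hom D (fst (L ! j)) (snd (L ! j))" for r us
      unfolding mcomp_def tensor_lift_rep split_def
      by (rule lin_on_sum_list_gen[OF cvs Hom_sub[OF X] W1[OF us]]) (auto intro!: c.subspace_scale[OF Hom_sub[OF X]] intro: rf)
    from this[OF Mw] show ?thesis by simp
  qed
  also have "\<dots> = (\<Sum>rs | length rs = length (XY # L). fscale (A $ last (p # rs) $ q)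
      (W (map (\<lambda>i. mcomp (fst ((XY # L) ! i)) (snd ((XY # L) ! i)) ((p # rs) ! i) (rs ! i) (ts ! i)) [0..<length (XY # L)])))"
    by (simp add: sum_lists_insert[of 0] map_upt_Suc ts XY del: upt_Suc)
  finally show ?case .
qed

text \<open>With A = 1 and p = q only paths that end at p contribute, so summing over p leaves one
  term for each index word. This exhibits the trace as a sum of slot maps, from which its
  H-linearity follows.\<close>

lemma tr_chain_eq:
  assumes t: "t \<in> d.MCNs n"
  shows "tr_chain M D n t = tr.pb n t"
  unfolding tr_chain_def tr.pb_def DM[symmetric]
proof (rule d.chain_lift_cong[OF _ t])
  fix m xs ts assume w: "(xs, ts) \<in> cyclic_words DM n"
  note wd = d.wordD[OF w, unfolded DM_simps]
  let ?L = "map (\<lambda>i. (src xs i, tgt xs i)) [0..<Suc n]"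
  let ?T = "\<lambda>p. tensor_lifts (map (\<lambda>(X, Y). HomMat D X Y) ?L) (\<lambda>ps. fscale (foldr (**) (map snd ps) (mat 1) $ p $ p) (mword M D n m xs (map fst ps))) ts"
  have nth: "?L ! j = (src xs j, tgt xs j)" if "j < Suc n" for j using that by (simp del: upt_Suc)
  interpret F: vector_space "fscale :: 'k \<Rightarrow> ('k, 'm, 'o, 'a) chain \<Rightarrow> _" by (rule vector_space_fscale)
  have Lw: "lin_on (cscale D) (Hom D (src xs i) (tgt xs i)) fscale UNIV (\<lambda>g. mword M D n m xs (us[i := g]))"
    if us: "length us = Suc n" "\<And>j. j < Suc n \<Longrightarrow> us ! j \<in> Hom D (src xs j) (tgt xs j)" and i: "i < Suc n" for us i
  proof -
    have "(xs, us) \<in> cyclic_words D n" by (rule wordI) (use wd(1,3) us in auto)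
    from mformD(2)[OF mform_mword this] i show ?thesis by (simp add: lin_on_def)
  qed
  have "?T p = (\<Sum>rs | length rs = Suc n. fscale (mat 1 $ last (p # rs) $ p)
       (mword M D n m xs (map (\<lambda>i. mcomp (src xs i) (tgt xs i) ((p # rs) ! i) (rs ! i) (ts ! i)) [0..<Suc n])))" for p
  proof -
    have len: "length ?L = Suc n" by simp
    have mc: "map (\<lambda>i. mcomp (fst (?L ! i)) (snd (?L ! i)) ((p # rs) ! i) (rs ! i) (ts ! i)) [0..<Suc n] =
        map (\<lambda>i. mcomp (src xs i) (tgt xs i) ((p # rs) ! i) (rs ! i) (ts ! i)) [0..<Suc n]" for rs
      by (rule map_cong[OF refl]) (simp add: nth del: upt_Suc)
    have "?T p = (\<Sum>rs | length rs = length ?L. fscale (mat 1 $ last (p # rs) $ p)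
       (mword M D n m xs (map (\<lambda>i. mcomp (fst (?L ! i)) (snd (?L ! i)) ((p # rs) ! i) (rs ! i) (ts ! i)) [0..<length ?L])))"
    proof (rule tensor_lifts_entries; (unfold len)?)
      show "set ?L \<subseteq> Obj D \<times> Obj D" using wd(5,6) by auto
      show "ts ! j \<in> HMs (fst (?L ! j)) (snd (?L ! j))" if "j < Suc n" for j
        using wd(4)[of j] that unfolding nth[OF that] by simp
      fix us i assume "length us = Suc n" "\<And>j. j < Suc n \<Longrightarrow> us ! j \<in> Hom D (fst (?L ! j)) (snd (?L ! j))" and i: "i < Suc n"
      then show "lin_on (cscale D) (Hom D (fst (?L ! i)) (snd (?L ! i))) fscale UNIV (\<lambda>g. mword M D n m xs (us[i := g]))"
        unfolding nth[OF i] fst_conv snd_conv by (intro Lw) (simp_all add: nth del: upt_Suc)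
    qed (rule wd(2))
    then show ?thesis unfolding len mc .
  qed
  then have "(\<Sum>p\<in>UNIV. ?T p) = (\<Sum>rs | length rs = Suc n. \<Sum>p\<in>UNIV. fscale (mat 1 $ last (p # rs) $ p)
       (mword M D n m xs (map (\<lambda>i. mcomp (src xs i) (tgt xs i) ((p # rs) ! i) (rs ! i) (ts ! i)) [0..<Suc n])))"
    by (subst sum.swap) simp
  also have "\<dots> = (\<Sum>rs | length rs = Suc n. mword M D n m xs (tr_list n rs xs ts))"
  proof (rule sum.cong[OF refl])
    fix rs :: "'r list" assume "rs \<in> {rs. length rs = Suc n}"
    \<comment> \<open>The entry of the identity matrix vanishes unless p is the last index of the
      path, which removes the sum over p.\<close>
    then have "last (p # rs) = rs ! n" for p by (cases rs) (auto simp: last_conv_nth)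
    then show "(\<Sum>p\<in>UNIV. fscale (mat 1 $ last (p # rs) $ p)
       (mword M D n m xs (map (\<lambda>i. mcomp (src xs i) (tgt xs i) ((p # rs) ! i) (rs ! i) (ts ! i)) [0..<Suc n]))) = mword M D n m xs (tr_list n rs xs ts)"
      by (simp add: mat_def if_distrib[of "\<lambda>c. fscale c _"] tr.slot_def trG_def del: upt_Suc cong: if_cong)
  qed
  finally show "tensor_lifts (map (\<lambda>i. HomMat D (src xs i) (tgt xs i)) [0..<Suc n])
      (\<lambda>ps. fscale (trace (foldr (**) (map snd ps) (mat 1))) (mword M D n m xs (map fst ps))) ts =
    (\<Sum>rs | length rs = Suc n. mword M D n m xs (tr_list n rs xs ts))"
    by (simp add: trace_def F.scale_sum_left tensor_lifts_sum o_def del: upt_Suc)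
qed

lemma ev_tr:
  assumes "\<phi> \<in> cochains H M D n" "(xs, ts) \<in> cyclic_words DM n"
  shows "d.ev n (tr_cochain M D n \<phi>) m xs ts = (\<Sum>rs | length rs = Suc n. ev n \<phi> m xs (tr_list n rs xs ts))"
  unfolding tr_cochain_def DM[symmetric] by (rule tr.ev_HomH_pb[OF assms tr_chain_eq])

lemma tr_hom: "right_H_hom H M DM D n (tr_chain M D n)"
  by (rule tr.right_H_hom_cong[OF tr.pb_hom tr_chain_eq])

lemma tr_mem: "\<phi> \<in> cochains H M D n \<Longrightarrow> tr_cochain M D n \<phi> \<in> cochains H M DM n"
  unfolding tr_cochain_def DM[symmetric] by (rule tr.HomH_cochain[OF tr_hom])

lemma tr_lin: "lin_on fscale (cochains H M D n) fscale (cochains H M DM n) (tr_cochain M D n)"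
  unfolding tr_cochain_def[abs_def] DM[symmetric] by (rule tr.HomH_lin[OF tr_hom])

text \<open>Inserting r in position i of an index word gives arrow i the column index r and arrow i
  + 1 the row index r. So r is the inner index that is summed when these two matrices are
  multiplied.\<close>

lemma tr_list_face:
  assumes w: "(xs, ts) \<in> cyclic_words DM (Suc n)" and i: "i \<le> n" and rs: "length rs = Suc n"
  shows "fF i xs (tr_list (Suc n) (take i rs @ r # drop i rs) xs ts) =
      (tr_list n rs (fX i xs) (d.fF i xs ts))[i := cmp D (src xs (Suc i)) (src xs i) (tgt xs i)
        (mcomp (src xs i) (tgt xs i) ((rs ! n # rs) ! i) r (ts ! i)) (mcomp (src xs (Suc i)) (src xs i) r (rs ! i) (ts ! Suc i))]"
    (is "?l = ?r")
proof (rule nth_equalityI)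
  note wd = d.wordD[OF w]
  note simps = length_fF[of _ n] nth_fF[of _ n] d.length_fF[of _ n] d.nth_fF[of _ n] tr.length_slot tr.nth_slot
    src_fX[of _ n] tgt_fX[of _ n] less_Suc_eq_le
  fix k assume "k < length ?l"
  then have k: "k \<le> n" using i by (simp add: simps)
  then show "?l ! k = ?r ! k"
    using i wd(1,2) rs by (auto simp: simps trG_def tgt_Suc nth_list_update nth_append nth_Cons' min_def not_less)
qed (use i wordD in \<open>simp add: length_fF[of _ n] tr.length_slot\<close>)

lemma tr_face:
  assumes \<phi>: "\<phi> \<in> cochains H M D n" and i: "i \<le> n"
  shows "tr_cochain M D (Suc n) (coface H M D n i \<phi>) = coface H M DM n i (tr_cochain M D n \<phi>)"
proof (rule d.cochains_eqI[OF tr_mem[OF coface_mem[OF \<phi> i]] d.coface_mem[OF tr_mem[OF \<phi>] i]])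
  fix m xs ts assume w: "(xs, ts) \<in> cyclic_words DM (Suc n)"
  note wd = d.wordD[OF w, unfolded DM_simps(1)] and fw = tr.slot_word[OF d.fF_word[OF w i]]
  have t: "ts ! i \<in> Hom DM (src xs i) (tgt xs i)" "ts ! Suc i \<in> Hom DM (src xs (Suc i)) (src xs i)"
    using wd(4)[of i] wd(4)[of "Suc i"] i by (simp_all add: tgt_Suc)
  have m: "mform n (*) UNIV (ev n \<phi>)" using cform_ev[OF \<phi>] by (simp add: cform_def)
  let ?c = "\<lambda>rs r. cmp D (src xs (Suc i)) (src xs i) (tgt xs i)
      (mcomp (src xs i) (tgt xs i) ((rs ! n # rs) ! i) r (ts ! i)) (mcomp (src xs (Suc i)) (src xs i) r (rs ! i) (ts ! Suc i))"
  have s: "(\<Sum>r\<in>UNIV. ev n \<phi> m (fX i xs) ((tr_list n rs (fX i xs) (d.fF i xs ts))[i := ?c rs r])) =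
      ev n \<phi> m (fX i xs) (tr_list n rs (fX i xs) (d.fF i xs ts))" for rs
  proof -
    have "(\<Sum>r\<in>UNIV. ?c rs r) = tr_list n rs (fX i xs) (d.fF i xs ts) ! i"
      using i wd(1,2) by (simp add: tr.nth_slot d.nth_fF[of _ n] src_fX[of _ n] tgt_fX[of _ n] trG_def mcomp_cmp[OF wd(5,5,6) t])
    moreover have "?c rs r \<in> Hom D (src (fX i xs) i) (tgt (fX i xs) i)" for r
      using cmp_mem(1)[OF wd(5,5,6) mcomp_mem mcomp_mem, OF wd(5,5) _ wd(5,6)] t i wd(1)
      by (simp add: src_fX[of _ n] tgt_fX[of _ n] DM_simps)
    ultimately show ?thesis
      using lin_on_sum_fin[OF cvs Hom_sub mformD(2)[OF m fw[of rs] i, of m], of UNIV "?c rs"] wordD(5,6)[OF fw] by simp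
  qed
  show "d.ev (Suc n) (tr_cochain M D (Suc n) (coface H M D n i \<phi>)) m xs ts = d.ev (Suc n) (coface H M DM n i (tr_cochain M D n \<phi>)) m xs ts"
    unfolding ev_tr[OF coface_mem[OF \<phi> i] w] d.ev_coface[OF tr_mem[OF \<phi>] i w] ev_tr[OF \<phi> d.fF_word[OF w i]]
      ev_coface[OF \<phi> i tr.slot_word[OF w]] sum_lists_insert[OF le_SucI[OF i]]
    by (rule sum.cong[OF refl]) (simp add: tr_list_face[OF w i] s)
qed

lemma tr_list_degen:
  assumes w: "(xs, ts) \<in> cyclic_words DM n" and i: "i \<le> n" and rs: "length rs = Suc n"
  shows "tr_list (Suc n) (take (Suc i) rs @ rs ! i # drop (Suc i) rs) (gX i xs) (d.gF i xs ts) = gF i xs (tr_list n rs xs ts)"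
    (is "?l = ?r")
proof (rule nth_equalityI)
  note wd = d.wordD[OF w, unfolded DM_simps(1)]
  note simps = length_gF[of _ n] nth_gF[of _ n] d.nth_gF[of _ n] tr.length_slot tr.nth_slot
    src_gX[of _ n] tgt_gX[of _ n] less_Suc_eq_le
  fix k assume "k < length ?l"
  then have k: "k \<le> Suc n" by (simp add: simps)
  consider "k \<le> i" | "k = Suc i" | q where "k = Suc (Suc q)" "i \<le> q"
    by (metis Suc_le_D Suc_le_mono le_SucE not_less_eq_eq)
  then show "?l ! k = ?r ! k"
  proof cases
    case 1
    then show ?thesis using k i wd(1,2) rs mcomp_ident[OF wd(5)]
      by (auto simp: simps trG_def tgt_Suc nth_append nth_Cons' min_def not_less not_le Suc_le_eq)
  next
    case 2
    then show ?thesis using i wd(1,2) rs mcomp_ident[OF wd(5)]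
      by (simp add: simps trG_def tgt_Suc nth_append)
  next
    case 3
    then show ?thesis using k i wd(1,2) rs
      by (cases "q = i") (auto simp: simps trG_def nth_append nth_Cons' min_def Suc_diff_le)
  qed
qed (use i in \<open>simp add: length_gF[of _ n] tr.length_slot\<close>)

text \<open>The entries of the inserted identity vanish off the diagonal, so of all values of the
  new index only the one equal to its predecessor contributes.\<close>

lemma tr_degen:
  assumes \<phi>: "\<phi> \<in> cochains H M D (Suc n)" and i: "i \<le> n"
  shows "tr_cochain M D n (codegen M D n i \<phi>) = codegen M DM n i (tr_cochain M D (Suc n) \<phi>)"
proof (rule d.cochains_eqI[OF tr_mem[OF codegen_mem[OF \<phi> i]] d.codegen_mem[OF tr_mem[OF \<phi>] i]])
  fix m xs ts assume w: "(xs, ts) \<in> cyclic_words DM n"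
  note wd = d.wordD[OF w, unfolded DM_simps(1)] and gw = d.gF_word[OF w i]
  have m: "mform (Suc n) (*) UNIV (ev (Suc n) \<phi>)" using cform_ev[OF \<phi>] by (simp add: cform_def)
  have z: "ev (Suc n) \<phi> m (gX i xs) (tr_list (Suc n) (take (Suc i) rs @ r # drop (Suc i) rs) (gX i xs) (d.gF i xs ts)) = 0"
    if "length rs = Suc n" "r \<noteq> rs ! i" for rs r
  proof (rule mform_zero_slot[OF m tr.slot_word[OF gw], of "Suc i"])
    show "tr_list (Suc n) (take (Suc i) rs @ r # drop (Suc i) rs) (gX i xs) (d.gF i xs ts) ! Suc i = 0"
      using that i wd(1,2) mcomp_ident[OF wd(5)]
      by (simp add: tr.nth_slot d.nth_gF[of _ n] src_gX[of _ n] tgt_gX[of _ n] trG_def tgt_Suc nth_append)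
  qed (use i in simp)
  have "(\<Sum>r\<in>UNIV. ev (Suc n) \<phi> m (gX i xs) (tr_list (Suc n) (take (Suc i) rs @ r # drop (Suc i) rs) (gX i xs) (d.gF i xs ts))) =
      ev (Suc n) \<phi> m (gX i xs) (gF i xs (tr_list n rs xs ts))" if rs: "length rs = Suc n" for rs
    using sum.mono_neutral_right[of UNIV "{rs ! i}", OF _ _ ballI[OF z[OF rs]]] by (simp add: tr_list_degen[OF w i rs])
  then show "d.ev n (tr_cochain M D n (codegen M D n i \<phi>)) m xs ts = d.ev n (codegen M DM n i (tr_cochain M D (Suc n) \<phi>)) m xs ts"
    unfolding ev_tr[OF codegen_mem[OF \<phi> i] w] d.ev_codegen[OF tr_mem[OF \<phi>] i w] ev_tr[OF \<phi> gw]
      ev_codegen[OF \<phi> i tr.slot_word[OF w]] sum_lists_insert[OF Suc_le_mono[THEN iffD2, OF i]]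
    by (intro sum.cong[OF refl]) simp
qed

lemma tr_list_rot:
  assumes w: "(xs, ts) \<in> cyclic_words DM n" and rs: "length rs = Suc n"
  shows "tr_list n (rX n rs) (rX n xs) (d.rF n a xs ts) = rF n a xs (tr_list n rs xs ts)" (is "?l = ?r")
proof (rule nth_equalityI)
  note wd = d.wordD[OF w, unfolded DM_simps(1)]
  note simps = length_rF[of _ n] nth_rF[of _ n] d.nth_rF[of _ n] tr.length_slot tr.nth_slot
    src_rX[of _ n] tgt_rX[of _ n] nth_rX[of _ n] less_Suc_eq_le
  have e: "xs ! 0 = src xs n" "xs ! n = tgt xs n" using wd(1) by (simp_all add: src_last tgt_nth)
  fix k assume "k < length ?l"
  then have k: "k \<le> n" by (simp add: simps)
  then show "?l ! k = ?r ! k"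
    using wd(1,2) rs wd(4)[of n] wd(5,6) by (simp add: simps trG_def e mcomp_lact nth_Cons')
qed (simp add: length_rF[of _ n] tr.length_slot)

text \<open>Rotating the word rotates the index words along with it, and summing over all index
  words is insensitive to that. This is the cyclic invariance of the trace.\<close>

lemma tr_cyc:
  assumes \<phi>: "\<phi> \<in> cochains H M D n"
  shows "tr_cochain M D n (cocyc H M D n \<phi>) = cocyc H M DM n (tr_cochain M D n \<phi>)"
proof (rule d.cochains_eqI[OF tr_mem[OF cocyc_mem[OF \<phi>]] d.cocyc_mem[OF tr_mem[OF \<phi>]]])
  fix m xs ts assume w: "(xs, ts) \<in> cyclic_words DM n"
  have "(\<Sum>rs | length rs = Suc n. ev n \<phi> x (rX n xs) (tr_list n rs (rX n xs) (d.rF n a xs ts))) =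
      (\<Sum>rs | length rs = Suc n. ev n \<phi> x (rX n xs) (rF n a xs (tr_list n rs xs ts)))" for a x
    by (subst sum_lists_rotate[symmetric]) (simp add: tr_list_rot[OF w])
  then show "d.ev n (tr_cochain M D n (cocyc H M D n \<phi>)) m xs ts = d.ev n (cocyc H M DM n (tr_cochain M D n \<phi>)) m xs ts"
    unfolding ev_tr[OF cocyc_mem[OF \<phi>] w] d.ev_cocyc[OF tr_mem[OF \<phi>] w] ev_cocyc[OF \<phi> tr.slot_word[OF w]]
      cycF_def d.cycF_def ev_tr[OF \<phi> d.rF_word[OF w]] ca_sum_fin[symmetric] by simp
qed

theorem precocyclic_tr: "precocyclic_morphism (C_H H M D) (C_H H M DM) (tr_cochain M D)"
  unfolding precocyclic_morphism_def
  by (intro conjI allI ballI impI; (simp only: C_H_def cocyclic.simps)?;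
      (rule cocyclic_module_C_H[unfolded C_H_def] d.cocyclic_module_C_H[unfolded C_H_def] tr_lin tr_face tr_cyc; assumption?))

theorem cocyclic_morphism_tr: "cocyclic_morphism (C_H H M D) (C_H H M DM) (tr_cochain M D)"
proof -
  interpret T: precocyclic_morphism_loc "C_H H M D" "C_H H M DM" "tr_cochain M D" by unfold_locales (rule precocyclic_tr)
  have "\<phi> \<in> Cob (C_H H M D) (Suc n) \<Longrightarrow> i \<le> n \<Longrightarrow>
      tr_cochain M D n (cdegen (C_H H M D) n i \<phi>) = cdegen (C_H H M DM) n i (tr_cochain M D (Suc n) \<phi>)" for n i \<phi>
    by (simp add: C_H_def tr_degen)
  then show ?thesis
    unfolding cocyclic_morphism_def using T.source T.target T.mor_lin T.mor_face T.mor_cyc by blast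
qed

end

section \<open>The two composites of inclusion and trace\<close>

context mat_loc
begin

text \<open>Each included arrow f \<otimes> E_ee has a single nonzero entry. An index word with some
  entry other than \<open>e\<close> puts 0 into a slot of a multilinear form, so only the constant
  word \<open>e\<close> contributes, and it returns the original arrows.\<close>

lemma inc_tr:
  assumes \<phi>: "\<phi> \<in> cochains H M D n"
  shows "inc_cochain M D e n (tr_cochain M D n \<phi>) = \<phi>"
proof (rule cochains_eqI[OF inc_mem[OF tr_mem[OF \<phi>]] \<phi>])
  fix m xs fs assume w: "(xs, fs) \<in> cyclic_words D n"
  note wd = wordD[OF w] and iw = inc.slot_word[OF w]
  have m: "mform n (*) UNIV (ev n \<phi>)" using cform_ev[OF \<phi>] by (simp add: cform_def)
  have nth: "tr_list n rs xs (inc_list n xs fs) ! i = (if (rs ! n # rs) ! i = e \<and> rs ! i = e then fs ! i else 0)" if "i \<le> n" for rs i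
    using that wd(4)[OF that] by (simp add: tr.nth_slot inc.nth_slot trG_def incG_def mcomp_pure[OF wd(5,6)] elem_mat_nth)
  have z: "ev n \<phi> m xs (tr_list n rs xs (inc_list n xs fs)) = 0" if rs: "length rs = Suc n" "rs \<noteq> replicate (Suc n) e" for rs
  proof -
    obtain i where "i \<le> n" "rs ! i \<noteq> e"
      using rs by (metis length_replicate less_Suc_eq_le nth_equalityI nth_replicate)
    then show ?thesis using mform_zero_slot[OF m tr.slot_word[OF iw], of i] by (simp add: nth)
  qed
  have "(\<Sum>rs | length rs = Suc n. ev n \<phi> m xs (tr_list n rs xs (inc_list n xs fs))) =
      (\<Sum>rs\<in>{replicate (Suc n) e}. ev n \<phi> m xs (tr_list n rs xs (inc_list n xs fs)))"
    using z finite_lists_length_eq[of "UNIV :: 'r set" "Suc n"] by (intro sum.mono_neutral_right) auto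
  also have "\<dots> = ev n \<phi> m xs (tr_list n (replicate (Suc n) e) xs (inc_list n xs fs))" by simp
  also have "tr_list n (replicate (Suc n) e) xs (inc_list n xs fs) = fs"
    using wd(2) by (intro nth_equalityI) (auto simp: tr.length_slot nth nth_Cons' less_Suc_eq_le simp del: replicate_Suc)
  finally show "ev n (inc_cochain M D e n (tr_cochain M D n \<phi>)) m xs fs = ev n \<phi> m xs fs"
    unfolding ev_inc[OF tr_mem[OF \<phi>] w] ev_tr[OF \<phi> iw] .
qed

text \<open>\<open>\<Sum>\<^sub>p E\<^sub>p\<^sub>e E\<^sub>e\<^sub>p = 1\<close>, and \<open>E\<^sub>e\<^sub>p B E\<^sub>q\<^sub>e = B\<^sub>p\<^sub>q E\<^sub>e\<^sub>e\<close>: splitting the identity of each object in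
  this way replaces a word by the sum of terms that defines the trace.\<close>

definition col :: "'o \<Rightarrow> 'r \<Rightarrow> ('a \<times> ('k ^ 'r ^ 'r), 'k) tensor" where
  "col X p = pure (HomMat D X X) (ident D X, elem_mat p e)"

definition row :: "'o \<Rightarrow> 'r \<Rightarrow> ('a \<times> ('k ^ 'r ^ 'r), 'k) tensor" where
  "row X p = pure (HomMat D X X) (ident D X, elem_mat e p)"

lemma col_row:
  shows col: "X \<in> Obj DM \<Longrightarrow> col X p \<in> Hom DM X X" and row: "X \<in> Obj DM \<Longrightarrow> row X p \<in> Hom DM X X"
    and lact_col: "X \<in> Obj DM \<Longrightarrow> lact DM X X h (col X p) = cscale DM (counit H h) (col X p)"
    and lact_row: "X \<in> Obj DM \<Longrightarrow> lact DM X X h (row X p) = cscale DM (counit H h) (row X p)"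
  by (simp_all add: DM_simps col_def row_def ident_HMs mact_ident)

lemma sum_col_row:
  assumes "X \<in> Obj DM"
  shows "(\<Sum>p\<in>UNIV. cmp DM X X X (col X p) (row X p)) = ident DM X"
proof -
  have X: "X \<in> Obj D" using assms by (simp add: DM_simps)
  have "(\<Sum>p\<in>UNIV. cmp DM X X X (col X p) (row X p)) = (\<Sum>p\<in>UNIV. pure (HomMat D X X) (ident D X, elem_mat p p))"
    using cmp_ident[OF X X ident_mem[OF X]]
    by (simp add: DM_simps col_def row_def mmul_pure[OF X X X ident_mem[OF X] ident_mem[OF X]] elem_mat_mult)
  also have "\<dots> = pure (HomMat D X X) (ident D X, \<Sum>p\<in>UNIV. elem_mat p p)"
    by (rule lin_on_sum_fin[OF vector_space_mat_scale _ pure_HMs_lin(2)[OF X X ident_mem[OF X]], symmetric])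
      (simp_all add: subspace_UNIV[OF vector_space_mat_scale])
  finally show ?thesis by (simp add: elem_mat_sum DM_simps)
qed

lemmas colrow = col row lact_col lact_row sum_col_row

lemma split_defs:
  "d.rmul col p X Y f = cmp DM X X Y f (col X p)"
  "d.lmul row p X Y f = cmp DM X Y Y (row Y p) f"
  "d.split_all col row n rs xs fs = map (\<lambda>i. d.lmul row (rs ! (if i = 0 then n else i - 1)) (src xs i) (tgt xs i)
     (d.rmul col (rs ! i) (src xs i) (tgt xs i) (fs ! i))) [0..<Suc n]"
  by (rule d.rmul_def d.lmul_def d.split_all_def; erule colrow)+

lemma row_col_mult:
  assumes X: "X \<in> Obj D" "Y \<in> Obj D" and t: "t \<in> Hom DM X Y"
  shows "d.lmul row p X Y (d.rmul col q X Y t) = pure (HomMat D X Y) (mcomp X Y p q t, elem_mat e e)"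
proof -
  have t': "t \<in> HMs X Y" using t by (simp add: DM_simps)
  have r: "mmul X X Y t (pure (HomMat D X X) (ident D X, elem_mat q e)) \<in> HMs X Y"
    by (rule mmul_mem[OF X(1,1,2) t' ident_HMs[OF X(1)]])
  have "mmul X Y Y (pure (HomMat D Y Y) (ident D Y, elem_mat e p)) (mmul X X Y t (pure (HomMat D X X) (ident D X, elem_mat q e))) =
      pure (HomMat D X Y) (mcomp X Y p q t, elem_mat e e)"
  proof (rule mcomp_eqI[OF X mmul_mem[OF X(1,2,2) ident_HMs[OF X(2)] r] pure_HMs[OF X mcomp_mem[OF X t']]])
    fix a b
    show "mcomp X Y a b (mmul X Y Y (pure (HomMat D Y Y) (ident D Y, elem_mat e p)) (mmul X X Y t (pure (HomMat D X X) (ident D X, elem_mat q e)))) =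
        mcomp X Y a b (pure (HomMat D X Y) (mcomp X Y p q t, elem_mat e e))"
      unfolding mmul_ident_left[OF X r] mmul_ident_right[OF X t'] mcomp_pure[OF X mcomp_mem[OF X t']] elem_mat_nth
      by (cases "a = e"; cases "b = e")
        (simp_all add: if_distrib[of "\<lambda>c. cscale D c _"] sum.delta sum.delta' cong: if_cong)
  qed
  then show ?thesis by (simp add: split_defs DM_simps col_def row_def)
qed

text \<open>The terms of tr o inc at a word have arrows t_pq \<otimes> E_ee with p, q consecutive
  indices. By \<open>row_col_mult\<close> these are the arrows \<open>row\<close> t
  \<open>col\<close>, that is, the word split at every junction.\<close>

lemma tr_inc_homotopy:
  assumes z: "z \<in> cocycles (hoc (C_H H M DM)) n"
  shows "z - tr_cochain M D n (inc_cochain M D e n z) \<in> coboundaries (hoc (C_H H M DM)) n"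
proof (rule d.split_all_homotopy[where u = col and v = row, OF _ _ _ _ _ z])
  have zc: "z \<in> cochains H M DM n" using z by (simp add: cocycles_def hoc_def C_H_def)
  show "tr_cochain M D n (inc_cochain M D e n z) \<in> cochains H M DM n" by (rule tr_mem[OF inc_mem[OF zc]])
  fix m xs ts assume w: "(xs, ts) \<in> cyclic_words DM n"
  note wd = d.wordD[OF w, unfolded DM_simps(1)]
  have "inc_list n xs (tr_list n rs xs ts) = d.split_all col row n rs xs ts" for rs
    unfolding split_defs(3)
  proof (rule nth_equalityI)
    fix i assume "i < length (inc_list n xs (tr_list n rs xs ts))"
    then have i: "i \<le> n" by (simp add: inc.length_slot)
    then show "inc_list n xs (tr_list n rs xs ts) ! i = map (\<lambda>i. d.lmul row (rs ! (if i = 0 then n else i - 1)) (src xs i) (tgt xs i)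
        (d.rmul col (rs ! i) (src xs i) (tgt xs i) (ts ! i))) [0..<Suc n] ! i"
      by (simp add: inc.nth_slot tr.nth_slot incG_def trG_def row_col_mult[OF wd(5,6) wd(4)[OF i]] nth_Cons' less_Suc_eq_le del: upt_Suc)
  qed (simp add: inc.length_slot)
  then show "d.ev n (tr_cochain M D n (inc_cochain M D e n z)) m xs ts =
      (\<Sum>rs | length rs = Suc n. d.ev n z m xs (d.split_all col row n rs xs ts))"
    unfolding ev_tr[OF inc_mem[OF zc] w] ev_inc[OF zc tr.slot_word[OF w]] by simp
qed (fact colrow)+

end

lemma coh_isos_of_retract:
  assumes f: "complex_morphism K L f" and g: "complex_morphism L K g"
    and fg: "\<And>y. y \<in> cob L n \<Longrightarrow> f n (g n y) = y"
    and gf: "\<And>z. z \<in> cocycles K n \<Longrightarrow> z - g n (f n z) \<in> coboundaries K n"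
  shows "inverse_coh_isos K L n (coh_map L f n) (coh_map K g n)"
    and "inverse_coh_isos L K n (coh_map K g n) (coh_map L f n)"
proof -
  note K = complex_morphismD(1)[OF f] and L = complex_morphismD(1)[OF g]
  interpret K: vector_space "cpscl K" by (rule cochain_complex_vs[OF K])
  interpret L: vector_space "cpscl L" by (rule cochain_complex_vs[OF L])
  have a: "g n (f n z) - z \<in> coboundaries K n" if "z \<in> cocycles K n" for z
    using K.subspace_neg[OF subspace_coboundaries[OF K] gf[OF that]] by simp
  have b: "f n (g n z) - z \<in> coboundaries L n" if "z \<in> cocycles L n" for z
    using that fg[of z] L.subspace_0[OF subspace_coboundaries[OF L]] by (simp add: cocycles_def)
  show "inverse_coh_isos K L n (coh_map L f n) (coh_map K g n)" by (rule inverse_coh_isosI[OF f g a b])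
  show "inverse_coh_isos L K n (coh_map K g n) (coh_map L f n)" by (rule inverse_coh_isosI[OF g f b a])
qed

section \<open>The isomorphisms on Hochschild and cyclic cohomology\<close>

context mat_loc
begin

interpretation I: precocyclic_morphism_loc "C_H H M DM" "C_H H M D" "inc_cochain M D e" by unfold_locales (rule precocyclic_inc)
interpretation T: precocyclic_morphism_loc "C_H H M D" "C_H H M DM" "tr_cochain M D" by unfold_locales (rule precocyclic_tr)

lemmas inc_morphisms = I.complex_morphism_hoc I.bicomplex_morphism_cy

lemma cob_hoc: "cob (hoc (C_H H M D)) n = cochains H M D n"
  by (simp add: hoc_def C_H_def)

theorem hochschild_isos: "inverse_coh_isos (hoc (C_H H M DM)) (hoc (C_H H M D)) n
    (coh_map (hoc (C_H H M D)) (inc_cochain M D e) n) (coh_map (hoc (C_H H M DM)) (tr_cochain M D) n)"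
  by (rule coh_isos_of_retract(1)[OF I.complex_morphism_hoc T.complex_morphism_hoc])
    (simp_all add: cob_hoc inc_tr tr_inc_homotopy)

theorem cyclic_isos: "inverse_coh_isos (tot (cy (C_H H M D))) (tot (cy (C_H H M DM))) n
    (coh_map (tot (cy (C_H H M DM))) (tot_map (\<lambda>p q. tr_cochain M D q)) n)
    (coh_map (tot (cy (C_H H M D))) (tot_map (\<lambda>p q. inc_cochain M D e q)) n)"
proof (rule coh_isos_of_retract(2)[OF complex_morphism_tot[OF I.bicomplex_morphism_cy] complex_morphism_tot[OF T.bicomplex_morphism_cy]])
  fix y assume "y \<in> cob (tot (cy (C_H H M D))) n"
  then have "\<And>p. p \<le> n \<Longrightarrow> y p \<in> cochains H M D (n - p)" "\<And>p. n < p \<Longrightarrow> y p = 0"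
    by (simp_all add: tot_def cy_def C_H_def)
  then show "tot_map (\<lambda>p q. inc_cochain M D e q) n (tot_map (\<lambda>p q. tr_cochain M D q) n y) = y"
    by (auto simp: tot_map_def inc_tr fun_eq_iff)
next
  fix z assume z: "z \<in> cocycles (tot (cy (C_H H M DM))) n"
  have "z - tot_map (\<lambda>p q. \<lambda>x. tr_cochain M D q (inc_cochain M D e q x)) n z \<in> coboundaries (tot (cy (C_H H M DM))) n"
  proof (rule cyclic_of_hochschild[OF precocyclic_morphism_comp[OF precocyclic_inc precocyclic_tr] _ tr_inc_homotopy z])
    \<comment> \<open>tr o inc is a projector because inc o tr is the identity.\<close>
    show "tr_cochain M D k (inc_cochain M D e k (tr_cochain M D k (inc_cochain M D e k x))) = tr_cochain M D k (inc_cochain M D e k x)"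
      if "x \<in> Cob (C_H H M DM) k" for k x
      using that by (simp add: inc_tr inc_mem C_H_def)
  qed
  also have "tot_map (\<lambda>p q. \<lambda>x. tr_cochain M D q (inc_cochain M D e q x)) n z =
      tot_map (\<lambda>p q. tr_cochain M D q) n (tot_map (\<lambda>p q. inc_cochain M D e q) n z)"
    by (simp add: tot_map_def fun_eq_iff)
  finally show "z - tot_map (\<lambda>p q. tr_cochain M D q) n (tot_map (\<lambda>p q. inc_cochain M D e q) n z) \<in> coboundaries (tot (cy (C_H H M DM))) n" .
qed

end

theorem proposition6p6:
  fixes H :: "('k::field_char_0, 'h::ring_1) hopf"
    and M :: "('k, 'h, 'm::ab_group_add) hmodcomod"
    and D :: "('k, 'h, 'o, 'a::ab_group_add) hcat"
    and DM :: "('k, 'h, 'o, ('a \<times> ('k ^ 'r::finite ^ 'r), 'k) tensor) hcat"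
    and e :: 'r
  assumes "hopf_algebra H" and "SAYD_module H M" and "H_category H D"
    and DM: "DM = mat_cat TYPE('r) D"
  shows "\<comment> \<open>(1)\<close>
     (\<forall>n. right_H_hom H M D DM n (inc_chain M D e n)) \<and>
     complex_morphism (hoc (C_H H M DM)) (hoc (C_H H M D)) (inc_cochain M D e) \<and>
     bicomplex_morphism (cy (C_H H M DM)) (cy (C_H H M D)) (\<lambda>p q. inc_cochain M D e q) \<and>
     \<comment> \<open>(2)\<close>
     (\<forall>n. right_H_hom H M DM D n (tr_chain M D n)) \<and>
     cocyclic_morphism (C_H H M D) (C_H H M DM) (tr_cochain M D) \<and>
     \<comment> \<open>(3)\<close>
     (\<forall>n. inverse_coh_isos (hoc (C_H H M DM)) (hoc (C_H H M D)) n
        (coh_map (hoc (C_H H M D)) (inc_cochain M D e) n)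
        (coh_map (hoc (C_H H M DM)) (tr_cochain M D) n)) \<and>
     \<comment> \<open>(4)\<close>
     (\<forall>n. inverse_coh_isos (tot (cy (C_H H M D))) (tot (cy (C_H H M DM))) n
        (coh_map (tot (cy (C_H H M DM))) (tot_map (\<lambda>p q. tr_cochain M D q)) n)
        (coh_map (tot (cy (C_H H M D))) (tot_map (\<lambda>p q. inc_cochain M D e q)) n))"
proof -
  interpret mat_loc H M D DM e by unfold_locales fact+
  show ?thesis using inc_hom inc_morphisms tr_hom cocyclic_morphism_tr hochschild_isos cyclic_isos by blast
qed

end
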